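(* Let $Q$ be a consistent (equivalently, thin) dimer model in a disk with $n$ boundary vertices and decorated permutation $\pi$, and let $k$ be the number of noninversions of $\pi$. The boundary algebra $B_Q$ is isomorphic to $B^\pi_\circ:=\mathbb C Q_\circ^\pi/I_\circ^\pi$, where $Q_\circ^\pi$ is the circle quiver on $[n]$ together with one arrow $\alpha_p:t(p)\to h(p)$ for each nonadjacent arrow-defining path $p$ of $Q$ up to path-equivalence, and $I_\circ^\pi$ is the cancellative closure of the ideal of $\mathbb C Q_\circ^\pi$ generated by $$xy-yx,\qquad x^k-y^{n-k},\qquad \sum_{p\in\mathrm{NBP}(Q)}\Big(y_{t(p)-1}^{\mathrm{reach}_y(p)}-\alpha_p(xy)^{Y(p)}\Big).$$
   Context: **Dimer models.** A dimer model is a finite quiver with faces $Q=(Q_0,Q_1,Q_2)$: $(Q_0,Q_1)$ is a finite quiver and $Q_2=Q_2^{cc}\sqcup Q_2^{cl}$ is a set of oriented cycles (up to cyclic equivalence), called faces, such that: there are no loops; each arrow lies in exactly one face (a boundary arrow) or exactly two faces (an internal arrow); each internal arrow lies in one face of $Q_2^{cc}$ and one face of $Q_2^{cl}$; and for each vertex $i$ the incidence graph (vertices: arrows incident to $i$; an edge $\alpha\to\beta$ for each path $\xrightarrow{\alpha}i\xrightarrow{\beta}$ occurring in a face) is connected. Gluing polygons along arrows gives an oriented surface with boundary in which $Q$ is embedded, the faces in $Q_2^{cc}$ (resp. $Q_2^{cl}$) being oriented counter-clockwise (resp. clockwise), with the boundary running along boundary arrows. This surface is always assumed to be a disk. Boundary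 vertices are those on the boundary of the disk; a boundary path is a path starting and ending at boundary vertices. **Paths and algebras.** Paths are composed left to right: $t(p),h(p)$ are the start and end of $p$, and $pq$ is defined when $h(p)=t(q)$. A cycle is a nonconstant path with $t=h$; a path is cycleless if no subpath is a cycle. For an internal arrow $\alpha$, $R_\alpha^{cc}$ (resp. $R_\alpha^{cl}$) is the path from $h(\alpha)$ to $t(\alpha)$ such that $\alpha R_\alpha^{cc}$ (resp. $\alpha R_\alpha^{cl}$) goes once around the face of $Q_2^{cc}$ (resp. $Q_2^{cl}$) containing $\alpha$. The dimer algebra $A_Q$ is $\mathbb C Q$ modulo the ideal generated by $R_\alpha^{cc}-R_\alpha^{cl}$ for internal arrows $\alpha$. Write $[p]$ for the class of $p$; $p,q$ are path-equivalent if $[p]=[q]$ in $A_Q$. The boundary algebra is $B_Q=eA_Qe$, where $e$ is the sum of the idempotents $e_v$ over all boundary vertices $v$. A face-path at $v$ is a cycle from $v$ going once around a face; all face-paths at $v$ are equivalent; let $f=\sum_v f_v$ with $f_v$ a face-path at $v$; $[f]$ is central. A path $p$ is minimal if $[p]\ne[qf^m]$ for all paths $q$ and $m\ge1$. $Q$ is thin (consistent) if for all vertices $v_1,v_2$ there is a minimal path $r$ from $v_1$ to $v_2$ such that any path $p$ from $v_1$ to $v_2$ satisfies $[p]=[rf^{C(p)}]$ for a unique integer $C(p)\ge0$ (the c-value). **Boundary paths $x_i,y_i$ in $Q$.** Number boundary vertices $1,\dots,n$ clockwise, indices modulo $n$. Let $\alpha_i$ be the boundary arrow on the boundary segment between $i$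 and $i+1$ and $R_{\alpha_i}$ the path from $h(\alpha_i)$ to $t(\alpha_i)$ completing $\alpha_i$ to a face-path of the unique face containing it. If $\alpha_i:i\to i+1$ put $x_i=\alpha_i$, $y_i=R_{\alpha_i}$; if $\alpha_i:i+1\to i$ put $y_i=\alpha_i$, $x_i=R_{\alpha_i}$. **Arrow-defining paths and relation numbers.** A cycleless boundary path is direct if it passes through no boundary vertices other than its start and end, and arrow-defining if every path in its equivalence class is direct. An arrow-defining path is nonadjacent if its start and end are distinct boundary vertices that are not cyclically adjacent; $\mathrm{NBP}(Q)$ is the set of nonadjacent arrow-defining paths of $Q$ up to path-equivalence (at most one class for each pair of start and end). $\mathrm{reach}_y(p)\in\{0,\dots,n-1\}$ is congruent modulo $n$ to $t(p)-h(p)$. Put $y_i^m=y_iy_{i-1}\cdots y_{i-m+1}$ and $Y(p)=C(y_{t(p)-1}^{\mathrm{reach}_y(p)})-C(p)$. **Permutation.** Let $v_\alpha$ be the midpoint of the arrow $\alpha$. Whenever $\beta$ immediately follows $\alpha$ in a face, draw a segment from $v_\alpha$ to $v_\beta$ inside that face. These concatenate into oriented strands (passing at each internal arrow from one incident face to the other), which start and end at midpoints of boundary arrows. The midpoint of $\alpha_i$ is strand-vertex $i$, and $\pi(j)$ is the end of the strand starting at strand-vertex $j$ (for thin $Q$ there are no fixed points). A noninversion of $\pi$ is an $i\in[n]$ with $\pi(i)\ge i$. **Circle quiver and closure.** The circle quiver $Q_{k,n}$ has vertex set $[n]$ and, for each $i$ (modulo $n$), arrows $x_i:i\to i+1$ and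 $y_i:i+1\to i$ (abusing notation). In $\mathbb C Q_\circ^\pi$ put $x=\sum_i x_i$, $y=\sum_i y_i$, $y_i^m=y_iy_{i-1}\cdots y_{i-m+1}$. An ideal $I$ of a path algebra $\mathbb C\Gamma$ is cancellative if for all $m\ge1$, paths $a,b,p_1,\dots,p_m$ with $h(a)=t(p_i)$, $h(p_i)=t(b)$ and scalars $c_i\in\mathbb C$: $a(\sum c_ip_i)b\in I\iff\sum c_ip_i\in I$. The cancellative closure of a subset is the intersection of all cancellative ideals containing it. *)

theory Defs
  imports
    "HOL-Analysis.Analysis"
    "HOL-Algebra.QuotRing"
    "HOL-Algebra.Module"
    "Graph_Theory.Arc_Walk"
begin

section \<open>Path algebras\<close>

text \<open>
  A path is a start vertex together with a list of arrows, read from left to right;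
  \<open>(u, [])\<close> is the constant path at \<open>u\<close>.
\<close>

type_synonym ('v, 'a) qpath = "'v \<times> 'a list"

definition paths :: "('v, 'a) pre_digraph \<Rightarrow> ('v, 'a) qpath set" where
  "paths G = {(u, as). \<exists>v. pre_digraph.awalk G u as v}"

definition path_start :: "('v, 'a) qpath \<Rightarrow> 'v" where
  "path_start p = fst p"

definition path_end :: "('v, 'a) pre_digraph \<Rightarrow> ('v, 'a) qpath \<Rightarrow> 'v" where
  "path_end G p = pre_digraph.awlast G (fst p) (snd p)"

definition paths_between :: "('v, 'a) pre_digraph \<Rightarrow> 'v \<Rightarrow> 'v \<Rightarrow> ('v, 'a) qpath set" where
  "paths_between G u v = {p \<in> paths G. path_start p = u \<and> path_end G p = v}"

text \<open>
  An element of the path algebra is the coefficient function of a finite linear combination of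
  paths. The product sums over all ways of cutting a path in two.
\<close>

definition path_algebra ::
    "('v, 'a) pre_digraph \<Rightarrow> (complex, ('v, 'a) qpath \<Rightarrow> complex) module" where
  "path_algebra G =
    \<lparr>carrier = {f. finite {p. f p \<noteq> 0} \<and> {p. f p \<noteq> 0} \<subseteq> paths G},
     mult = (\<lambda>f g (u, as). \<Sum>k\<le>length as.
       f (u, take k as) * g (pre_digraph.awlast G u (take k as), drop k as)),
     one = (\<lambda>(u, as). if u \<in> verts G \<and> as = [] then 1 else 0),
     zero = (\<lambda>p. 0),
     add = (\<lambda>f g p. f p + g p),
     smult = (\<lambda>c f p. c * f p)\<rparr>"

definition single :: "('v, 'a) qpath \<Rightarrow> ('v, 'a) qpath \<Rightarrow> complex" where
  "single p = (\<lambda>q. if q = p then 1 else 0)"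

definition quot_algebra :: "('k, 'b) module \<Rightarrow> 'b set \<Rightarrow> ('k, 'b set) module" where
  "quot_algebra M I =
    \<lparr>carrier = carrier (M Quot I), mult = mult (M Quot I), one = one (M Quot I),
     zero = zero (M Quot I), add = add (M Quot I),
     smult = (\<lambda>c X. \<Union>x\<in>X. I +>\<^bsub>M\<^esub> (c \<odot>\<^bsub>M\<^esub> x))\<rparr>"

text \<open>For an idempotent \<open>e\<close> of \<open>M\<close>, this is the algebra \<open>eMe\<close>, whose unit is \<open>e\<close>.\<close>

definition corner_algebra :: "('k, 'b) module \<Rightarrow> 'b \<Rightarrow> ('k, 'b) module" where
  "corner_algebra M e =
    M\<lparr>carrier := {e \<otimes>\<^bsub>M\<^esub> x \<otimes>\<^bsub>M\<^esub> e | x. x \<in> carrier M}, one := e\<rparr>"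

definition algebra_isomorphic :: "('k, 'b) module \<Rightarrow> ('k, 'c) module \<Rightarrow> bool" where
  "algebra_isomorphic M N \<longleftrightarrow>
    (\<exists>\<phi> \<in> ring_iso M N. \<forall>c. \<forall>x \<in> carrier M. \<phi> (c \<odot>\<^bsub>M\<^esub> x) = c \<odot>\<^bsub>N\<^esub> \<phi> x)"

definition cancellative_ideal ::
    "('v, 'a) pre_digraph \<Rightarrow> (('v, 'a) qpath \<Rightarrow> complex) set \<Rightarrow> bool" where
  "cancellative_ideal G I \<longleftrightarrow> ideal I (path_algebra G) \<and>
    (\<forall>m \<ge> 1. \<forall>a \<in> paths G. \<forall>b \<in> paths G.
      \<forall>(p :: nat \<Rightarrow> ('v, 'a) qpath) (c :: nat \<Rightarrow> complex).
        (\<forall>l \<in> {1..m}. p l \<in> paths_between G (path_end G a) (path_start b)) \<longrightarrow>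
        (let z = (\<Oplus>\<^bsub>path_algebra G\<^esub>l \<in> {1..m}. c l \<odot>\<^bsub>path_algebra G\<^esub> single (p l))
         in single a \<otimes>\<^bsub>path_algebra G\<^esub> z \<otimes>\<^bsub>path_algebra G\<^esub> single b \<in> I \<longleftrightarrow> z \<in> I))"

definition cancellative_closure ::
    "('v, 'a) pre_digraph \<Rightarrow> (('v, 'a) qpath \<Rightarrow> complex) set \<Rightarrow> (('v, 'a) qpath \<Rightarrow> complex) set" where
  "cancellative_closure G S = \<Inter>{I. cancellative_ideal G I \<and> S \<subseteq> I}"


section \<open>Dimer models in a disk\<close>

text \<open>
  Each face is stored as one list of arrows representing its class up to cyclic rotation;
  \<open>cc_faces\<close> are the counter-clockwise faces, \<open>cl_faces\<close> the clockwise ones.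
\<close>

record ('v, 'a) dimer =
  quiver :: "('v, 'a) pre_digraph"
  cc_faces :: "'a list set"
  cl_faces :: "'a list set"

definition faces :: "('v, 'a) dimer \<Rightarrow> 'a list set" where
  "faces Q = cc_faces Q \<union> cl_faces Q"

definition boundary_arrows :: "('v, 'a) dimer \<Rightarrow> 'a set" where
  "boundary_arrows Q = {a \<in> arcs (quiver Q). card {c \<in> faces Q. a \<in> set c} = 1}"

definition internal_arrows :: "('v, 'a) dimer \<Rightarrow> 'a set" where
  "internal_arrows Q = {a \<in> arcs (quiver Q). card {c \<in> faces Q. a \<in> set c} = 2}"

definition boundary_verts :: "('v, 'a) dimer \<Rightarrow> 'v set" where
  "boundary_verts Q = tail (quiver Q) ` boundary_arrows Q \<union> head (quiver Q) ` boundary_arrows Q"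

definition follows_in :: "'a list \<Rightarrow> 'a \<Rightarrow> 'a \<Rightarrow> bool" where
  "follows_in c a a' \<longleftrightarrow> (\<exists>l < length c. c ! l = a \<and> c ! (Suc l mod length c) = a')"

definition incidence_edges :: "('v, 'a) dimer \<Rightarrow> 'v \<Rightarrow> ('a \<times> 'a) set" where
  "incidence_edges Q v =
    {(a, a'). head (quiver Q) a = v \<and> tail (quiver Q) a' = v \<and> (\<exists>c \<in> faces Q. follows_in c a a')}"

text \<open>
  The polygon of a face \<open>c\<close> is a copy of the closed unit disk whose boundary circle is divided into
  \<open>length c\<close> arcs, the \<open>l\<close>-th of which is the arrow \<open>c ! l\<close>, parametrised from tail to head. (This
  also makes sense for faces of length 2.) The surface is the quotient of the disjoint union of
  all polygons that identifies the sides carrying the same arrow.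
\<close>

definition side_point :: "'a list \<Rightarrow> nat \<Rightarrow> real \<Rightarrow> complex" where
  "side_point c l s = cis (2 * pi * (real l + s) / real (length c))"

definition polygons :: "('v, 'a) dimer \<Rightarrow> ('a list \<times> complex) topology" where
  "polygons Q = prod_topology (discrete_topology (faces Q)) (top_of_set (cball 0 1))"

definition glueing :: "('v, 'a) dimer \<Rightarrow> (('a list \<times> complex) \<times> ('a list \<times> complex)) set" where
  "glueing Q =
    {((c, side_point c l s), (d, side_point d m s)) | c d l m s.
      c \<in> faces Q \<and> d \<in> faces Q \<and> l < length c \<and> m < length d \<and> c ! l = d ! m \<and> 0 \<le> s \<and> s \<le> 1}"

definition surface_is_disk :: "('v, 'a) dimer \<Rightarrow> bool" where
  "surface_is_disk Q \<longleftrightarrow>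
    (\<exists>g. quotient_map (polygons Q) (top_of_set (cball (0 :: complex) 1)) g \<and>
      (\<forall>p \<in> topspace (polygons Q). \<forall>q \<in> topspace (polygons Q).
        g p = g q \<longleftrightarrow> (p, q) \<in> (glueing Q)\<^sup>*))"

text \<open>
  Arrows are counted with multiplicity in the faces they lie in, so no face runs twice through the
  same arrow.
\<close>

locale dimer_model_in_disk =
  fixes Q :: "('v, 'a) dimer"
  assumes finite_quiver: "fin_digraph (quiver Q)"
    and no_loops: "loopfree_digraph (quiver Q)"
    and face_cycle: "c \<in> faces Q \<Longrightarrow> c \<noteq> [] \<and> (\<exists>v. pre_digraph.awalk (quiver Q) v c v)"
    and face_distinct: "c \<in> faces Q \<Longrightarrow> distinct c"
    and face_representative: "c \<in> faces Q \<Longrightarrow> rotate m c \<in> faces Q \<Longrightarrow> rotate m c = c"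
    and faces_disjoint: "cc_faces Q \<inter> cl_faces Q = {}"
    and boundary_or_internal: "arcs (quiver Q) = boundary_arrows Q \<union> internal_arrows Q"
    and internal_faces: "a \<in> internal_arrows Q \<Longrightarrow>
      (\<exists>c \<in> cc_faces Q. a \<in> set c) \<and> (\<exists>c \<in> cl_faces Q. a \<in> set c)"
    and incidence_connected:
      "\<lbrakk>v \<in> verts (quiver Q); a \<in> arcs (quiver Q); a' \<in> arcs (quiver Q);
        tail (quiver Q) a = v \<or> head (quiver Q) a = v; tail (quiver Q) a' = v \<or> head (quiver Q) a' = v\<rbrakk>
       \<Longrightarrow> (a, a') \<in> (incidence_edges Q v \<union> (incidence_edges Q v)\<inverse>)\<^sup>*"
    and disk: "surface_is_disk Q"


section \<open>Dimer algebra and boundary algebra\<close>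

text \<open>The path from the head of \<open>a\<close> to its tail that completes \<open>a\<close> to a full turn around the face \<open>c\<close>.\<close>

definition face_return :: "'a list \<Rightarrow> 'a \<Rightarrow> 'a list" where
  "face_return c a = (THE r. \<exists>l. rotate l c = a # r)"

definition R_cc :: "('v, 'a) dimer \<Rightarrow> 'a \<Rightarrow> ('v, 'a) qpath" where
  "R_cc Q a = (head (quiver Q) a, face_return (THE c. c \<in> cc_faces Q \<and> a \<in> set c) a)"

definition R_cl :: "('v, 'a) dimer \<Rightarrow> 'a \<Rightarrow> ('v, 'a) qpath" where
  "R_cl Q a = (head (quiver Q) a, face_return (THE c. c \<in> cl_faces Q \<and> a \<in> set c) a)"

definition dimer_ideal :: "('v, 'a) dimer \<Rightarrow> (('v, 'a) qpath \<Rightarrow> complex) set" where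
  "dimer_ideal Q = Idl\<^bsub>path_algebra (quiver Q)\<^esub>
    {single (R_cc Q a) \<ominus>\<^bsub>path_algebra (quiver Q)\<^esub> single (R_cl Q a) | a. a \<in> internal_arrows Q}"

definition dimer_algebra :: "('v, 'a) dimer \<Rightarrow> (complex, (('v, 'a) qpath \<Rightarrow> complex) set) module" where
  "dimer_algebra Q = quot_algebra (path_algebra (quiver Q)) (dimer_ideal Q)"

definition dimer_class ::
    "('v, 'a) dimer \<Rightarrow> (('v, 'a) qpath \<Rightarrow> complex) \<Rightarrow> (('v, 'a) qpath \<Rightarrow> complex) set" where
  "dimer_class Q z = dimer_ideal Q +>\<^bsub>path_algebra (quiver Q)\<^esub> z"

definition boundary_algebra :: "('v, 'a) dimer \<Rightarrow> (complex, (('v, 'a) qpath \<Rightarrow> complex) set) module" where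
  "boundary_algebra Q = corner_algebra (dimer_algebra Q)
    (dimer_class Q (\<Oplus>\<^bsub>path_algebra (quiver Q)\<^esub>v \<in> boundary_verts Q. single (v, [])))"

definition path_equivalent :: "('v, 'a) dimer \<Rightarrow> ('v, 'a) qpath \<Rightarrow> ('v, 'a) qpath \<Rightarrow> bool" where
  "path_equivalent Q p q \<longleftrightarrow> dimer_class Q (single p) = dimer_class Q (single q)"

definition path_class :: "('v, 'a) dimer \<Rightarrow> ('v, 'a) qpath \<Rightarrow> ('v, 'a) qpath set" where
  "path_class Q p = {q \<in> paths (quiver Q). path_equivalent Q p q}"


section \<open>Thinness and c-values\<close>

definition face_paths_at :: "('v, 'a) dimer \<Rightarrow> 'v \<Rightarrow> 'a list set" where
  "face_paths_at Q v =
    {rotate m c | m c. c \<in> faces Q \<and> pre_digraph.awalk (quiver Q) v (rotate m c) v}"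

definition face_element :: "('v, 'a) dimer \<Rightarrow> ('v, 'a) qpath \<Rightarrow> complex" where
  "face_element Q = (\<Oplus>\<^bsub>path_algebra (quiver Q)\<^esub>v \<in> verts (quiver Q).
    single (v, SOME c. c \<in> face_paths_at Q v))"

text \<open>The class of \<open>q f\<^sup>m\<close>.\<close>

definition class_times_f :: "('v, 'a) dimer \<Rightarrow> ('v, 'a) qpath \<Rightarrow> nat \<Rightarrow> (('v, 'a) qpath \<Rightarrow> complex) set" where
  "class_times_f Q q m = dimer_class Q
    (single q \<otimes>\<^bsub>path_algebra (quiver Q)\<^esub> (face_element Q [^]\<^bsub>path_algebra (quiver Q)\<^esub> m))"

definition minimal_path :: "('v, 'a) dimer \<Rightarrow> ('v, 'a) qpath \<Rightarrow> bool" where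
  "minimal_path Q p \<longleftrightarrow> p \<in> paths (quiver Q) \<and>
    (\<forall>q \<in> paths (quiver Q). \<forall>m \<ge> 1. dimer_class Q (single p) \<noteq> class_times_f Q q m)"

definition thin :: "('v, 'a) dimer \<Rightarrow> bool" where
  "thin Q \<longleftrightarrow> (\<forall>u \<in> verts (quiver Q). \<forall>v \<in> verts (quiver Q).
    \<exists>r \<in> paths_between (quiver Q) u v. minimal_path Q r \<and>
      (\<forall>p \<in> paths_between (quiver Q) u v. \<exists>!m. dimer_class Q (single p) = class_times_f Q r m))"

text \<open>
  In a thin dimer model any two minimal paths from \<open>u\<close> to \<open>v\<close> are equivalent, so the c-value does
  not depend on \<open>r\<close>.
\<close>

definition c_value :: "('v, 'a) dimer \<Rightarrow> ('v, 'a) qpath \<Rightarrow> nat" where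
  "c_value Q p = (THE m. \<exists>r \<in> paths_between (quiver Q) (path_start p) (path_end (quiver Q) p).
    minimal_path Q r \<and> dimer_class Q (single p) = class_times_f Q r m)"


section \<open>The boundary\<close>

text \<open>The representative of \<open>j\<close> modulo \<open>n\<close> in \<open>{1..n}\<close>.\<close>

definition cyc :: "nat \<Rightarrow> int \<Rightarrow> nat" where
  "cyc n j = nat ((j - 1) mod int n) + 1"

text \<open>
  \<open>b i\<close> is boundary vertex \<open>i\<close>, and \<open>\<alpha> i\<close> is the arrow on the boundary segment between
  \<open>b i\<close> and \<open>b (i + 1)\<close>. The clockwise direction is read off from the faces: a boundary arrow of a
  clockwise face has the disk on its right, so it runs clockwise along the boundary, and a boundary
  arrow of a counter-clockwise face runs counter-clockwise.
\<close>

definition clockwise_numbering :: "('v, 'a) dimer \<Rightarrow> nat \<Rightarrow> (nat \<Rightarrow> 'v) \<Rightarrow> (nat \<Rightarrow> 'a) \<Rightarrow> bool" where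
  "clockwise_numbering Q n b \<alpha> \<longleftrightarrow>
    bij_betw b {1..n} (boundary_verts Q) \<and> bij_betw \<alpha> {1..n} (boundary_arrows Q) \<and>
    (\<forall>i \<in> {1..n}. \<forall>c \<in> faces Q. \<alpha> i \<in> set c \<longrightarrow>
      (c \<in> cl_faces Q \<longrightarrow>
        tail (quiver Q) (\<alpha> i) = b i \<and> head (quiver Q) (\<alpha> i) = b (cyc n (int i + 1))) \<and>
      (c \<in> cc_faces Q \<longrightarrow>
        tail (quiver Q) (\<alpha> i) = b (cyc n (int i + 1)) \<and> head (quiver Q) (\<alpha> i) = b i))"

definition vertex_label :: "nat \<Rightarrow> (nat \<Rightarrow> 'v) \<Rightarrow> 'v \<Rightarrow> nat" where
  "vertex_label n b v = inv_into {1..n} b v"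

definition boundary_face :: "('v, 'a) dimer \<Rightarrow> 'a \<Rightarrow> 'a list" where
  "boundary_face Q a = (THE c. c \<in> faces Q \<and> a \<in> set c)"

text \<open>
  The arrow lists of \<open>x\<^sub>i\<close> and \<open>y\<^sub>i\<close>; \<open>\<alpha> i\<close> goes from \<open>b i\<close> to \<open>b (i + 1)\<close> precisely when its face is
  clockwise. Testing the face also distinguishes the two directions when there are only two
  boundary vertices.
\<close>

definition x_arrows :: "('v, 'a) dimer \<Rightarrow> (nat \<Rightarrow> 'a) \<Rightarrow> nat \<Rightarrow> 'a list" where
  "x_arrows Q \<alpha> i = (if boundary_face Q (\<alpha> i) \<in> cl_faces Q then [\<alpha> i]
    else face_return (boundary_face Q (\<alpha> i)) (\<alpha> i))"

definition y_arrows :: "('v, 'a) dimer \<Rightarrow> (nat \<Rightarrow> 'a) \<Rightarrow> nat \<Rightarrow> 'a list" where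
  "y_arrows Q \<alpha> i = (if boundary_face Q (\<alpha> i) \<in> cl_faces Q
    then face_return (boundary_face Q (\<alpha> i)) (\<alpha> i) else [\<alpha> i])"

text \<open>The arrow list of \<open>y\<^sub>i y\<^sub>i\<^sub>-\<^sub>1 \<dots> y\<^sub>i\<^sub>-\<^sub>m\<^sub>+\<^sub>1\<close> for given lists \<open>y\<close>.\<close>

definition descending :: "nat \<Rightarrow> (nat \<Rightarrow> 'a list) \<Rightarrow> int \<Rightarrow> nat \<Rightarrow> 'a list" where
  "descending n y i m = concat (map (\<lambda>l. y (cyc n (i - int l))) [0..<m])"

definition cycleless :: "('v, 'a) dimer \<Rightarrow> ('v, 'a) qpath \<Rightarrow> bool" where
  "cycleless Q p \<longleftrightarrow>
    \<not> (\<exists>as bs cs v. snd p = as @ bs @ cs \<and> bs \<noteq> [] \<and> pre_digraph.awalk (quiver Q) v bs v)"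

definition direct_path :: "('v, 'a) dimer \<Rightarrow> ('v, 'a) qpath \<Rightarrow> bool" where
  "direct_path Q p \<longleftrightarrow> p \<in> paths (quiver Q) \<and>
    path_start p \<in> boundary_verts Q \<and> path_end (quiver Q) p \<in> boundary_verts Q \<and> cycleless Q p \<and>
    set (pre_digraph.awalk_verts (quiver Q) (fst p) (snd p)) \<inter> boundary_verts Q
      \<subseteq> {path_start p, path_end (quiver Q) p}"

definition arrow_defining :: "('v, 'a) dimer \<Rightarrow> ('v, 'a) qpath \<Rightarrow> bool" where
  "arrow_defining Q p \<longleftrightarrow> direct_path Q p \<and> (\<forall>q \<in> path_class Q p. direct_path Q q)"

definition t_label :: "nat \<Rightarrow> (nat \<Rightarrow> 'v) \<Rightarrow> ('v, 'a) qpath \<Rightarrow> nat" where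
  "t_label n b p = vertex_label n b (path_start p)"

definition h_label :: "('v, 'a) dimer \<Rightarrow> nat \<Rightarrow> (nat \<Rightarrow> 'v) \<Rightarrow> ('v, 'a) qpath \<Rightarrow> nat" where
  "h_label Q n b p = vertex_label n b (path_end (quiver Q) p)"

definition nonadjacent :: "('v, 'a) dimer \<Rightarrow> nat \<Rightarrow> (nat \<Rightarrow> 'v) \<Rightarrow> ('v, 'a) qpath \<Rightarrow> bool" where
  "nonadjacent Q n b p \<longleftrightarrow> h_label Q n b p \<notin>
    {t_label n b p, cyc n (int (t_label n b p) + 1), cyc n (int (t_label n b p) - 1)}"

definition NBP :: "('v, 'a) dimer \<Rightarrow> nat \<Rightarrow> (nat \<Rightarrow> 'v) \<Rightarrow> ('v, 'a) qpath set set" where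
  "NBP Q n b = {path_class Q p | p. arrow_defining Q p \<and> nonadjacent Q n b p}"

definition reach_y :: "('v, 'a) dimer \<Rightarrow> nat \<Rightarrow> (nat \<Rightarrow> 'v) \<Rightarrow> ('v, 'a) qpath \<Rightarrow> nat" where
  "reach_y Q n b p = nat ((int (t_label n b p) - int (h_label Q n b p)) mod int n)"

definition Y_number ::
    "('v, 'a) dimer \<Rightarrow> nat \<Rightarrow> (nat \<Rightarrow> 'v) \<Rightarrow> (nat \<Rightarrow> 'a) \<Rightarrow> ('v, 'a) qpath \<Rightarrow> int" where
  "Y_number Q n b \<alpha> p =
    int (c_value Q (path_start p,
      descending n (y_arrows Q \<alpha>) (int (t_label n b p) - 1) (reach_y Q n b p)))
    - int (c_value Q p)"


section \<open>Strands\<close>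

text \<open>
  A strand is given by the arrows \<open>as\<close> whose midpoints it passes and by the faces \<open>fs\<close> containing its
  segments; at each intermediate arrow it changes to the other face.
\<close>

definition is_strand :: "('v, 'a) dimer \<Rightarrow> 'a list \<Rightarrow> 'a list list \<Rightarrow> bool" where
  "is_strand Q as fs \<longleftrightarrow> fs \<noteq> [] \<and> length as = Suc (length fs) \<and>
    (\<forall>l < length fs. fs ! l \<in> faces Q \<and> follows_in (fs ! l) (as ! l) (as ! Suc l)) \<and>
    (\<forall>l. Suc l < length fs \<longrightarrow> fs ! Suc l \<noteq> fs ! l) \<and>
    hd as \<in> boundary_arrows Q \<and> last as \<in> boundary_arrows Q"

definition strand_perm :: "('v, 'a) dimer \<Rightarrow> nat \<Rightarrow> (nat \<Rightarrow> 'a) \<Rightarrow> nat \<Rightarrow> nat" where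
  "strand_perm Q n \<alpha> j = (THE k. k \<in> {1..n} \<and>
    (\<exists>as fs. is_strand Q as fs \<and> hd as = \<alpha> j \<and> last as = \<alpha> k))"

definition noninversions :: "nat \<Rightarrow> (nat \<Rightarrow> nat) \<Rightarrow> nat set" where
  "noninversions n \<pi> = {i \<in> {1..n}. \<pi> i \<ge> i}"


section \<open>The circle quiver with the arrow-defining paths added\<close>

datatype 'p circ_arrow = X_arrow nat | Y_arrow nat | P_arrow 'p

text \<open>
  The additional arrows are indexed by path classes; all members of a class share their end points,
  relation number and \<open>reach_y\<close>, so these are computed from an arbitrary member.
\<close>

definition representative :: "('v, 'a) qpath set \<Rightarrow> ('v, 'a) qpath" where
  "representative P = (SOME p. p \<in> P)"

definition circ_quiver ::
    "('v, 'a) dimer \<Rightarrow> nat \<Rightarrow> (nat \<Rightarrow> 'v) \<Rightarrow> (nat, ('v, 'a) qpath set circ_arrow) pre_digraph" where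
  "circ_quiver Q n b =
    \<lparr>verts = {1..n},
     arcs = X_arrow ` {1..n} \<union> Y_arrow ` {1..n} \<union> P_arrow ` NBP Q n b,
     tail = (\<lambda>a. case a of X_arrow i \<Rightarrow> i | Y_arrow i \<Rightarrow> cyc n (int i + 1)
       | P_arrow P \<Rightarrow> t_label n b (representative P)),
     head = (\<lambda>a. case a of X_arrow i \<Rightarrow> cyc n (int i + 1) | Y_arrow i \<Rightarrow> i
       | P_arrow P \<Rightarrow> h_label Q n b (representative P))\<rparr>"

definition circ_x ::
    "('v, 'a) dimer \<Rightarrow> nat \<Rightarrow> (nat \<Rightarrow> 'v) \<Rightarrow> (nat, ('v, 'a) qpath set circ_arrow) qpath \<Rightarrow> complex" where
  "circ_x Q n b = (\<Oplus>\<^bsub>path_algebra (circ_quiver Q n b)\<^esub>i \<in> {1..n}. single (i, [X_arrow i]))"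

definition circ_y ::
    "('v, 'a) dimer \<Rightarrow> nat \<Rightarrow> (nat \<Rightarrow> 'v) \<Rightarrow> (nat, ('v, 'a) qpath set circ_arrow) qpath \<Rightarrow> complex" where
  "circ_y Q n b =
    (\<Oplus>\<^bsub>path_algebra (circ_quiver Q n b)\<^esub>i \<in> {1..n}. single (cyc n (int i + 1), [Y_arrow i]))"

definition circ_y_reach ::
    "('v, 'a) dimer \<Rightarrow> nat \<Rightarrow> (nat \<Rightarrow> 'v) \<Rightarrow> ('v, 'a) qpath
      \<Rightarrow> (nat, ('v, 'a) qpath set circ_arrow) qpath" where
  "circ_y_reach Q n b p = (t_label n b p,
    descending n (\<lambda>i. [Y_arrow i]) (int (t_label n b p) - 1) (reach_y Q n b p))"

text \<open>
  Relation numbers are nonnegative because arrow-defining paths are minimal in a thin dimer model,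
  so \<open>nat\<close> loses nothing.
\<close>

definition circ_ideal ::
    "('v, 'a) dimer \<Rightarrow> nat \<Rightarrow> (nat \<Rightarrow> 'v) \<Rightarrow> (nat \<Rightarrow> 'a) \<Rightarrow> nat
      \<Rightarrow> ((nat, ('v, 'a) qpath set circ_arrow) qpath \<Rightarrow> complex) set" where
  "circ_ideal Q n b \<alpha> k =
    (let A = path_algebra (circ_quiver Q n b); x = circ_x Q n b; y = circ_y Q n b
     in cancellative_closure (circ_quiver Q n b) (Idl\<^bsub>A\<^esub>
       {x \<otimes>\<^bsub>A\<^esub> y \<ominus>\<^bsub>A\<^esub> y \<otimes>\<^bsub>A\<^esub> x,
        x [^]\<^bsub>A\<^esub> k \<ominus>\<^bsub>A\<^esub> y [^]\<^bsub>A\<^esub> (n - k),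
        \<Oplus>\<^bsub>A\<^esub>P \<in> NBP Q n b. (let p = representative P in
          single (circ_y_reach Q n b p)
          \<ominus>\<^bsub>A\<^esub> single (t_label n b p, [P_arrow P]) \<otimes>\<^bsub>A\<^esub>
             ((x \<otimes>\<^bsub>A\<^esub> y) [^]\<^bsub>A\<^esub> nat (Y_number Q n b \<alpha> p)))}))"

definition circ_algebra ::
    "('v, 'a) dimer \<Rightarrow> nat \<Rightarrow> (nat \<Rightarrow> 'v) \<Rightarrow> (nat \<Rightarrow> 'a) \<Rightarrow> nat
      \<Rightarrow> (complex, ((nat, ('v, 'a) qpath set circ_arrow) qpath \<Rightarrow> complex) set) module" where
  "circ_algebra Q n b \<alpha> k =
    quot_algebra (path_algebra (circ_quiver Q n b)) (circ_ideal Q n b \<alpha> k)"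

end

theory Submission
  imports Defs
begin

text \<open>
  Fix a vertex \<open>v\<close>. Appending an arrow \<open>a\<close> to a minimal path from \<open>v\<close> to \<open>tail a\<close> gives a path of
  c-value 0 or 1, called \<open>M v a\<close>; each face has exactly one arrow with \<open>M v a = 1\<close>, and two parallel
  paths are equivalent iff they have the same \<open>M v\<close>-weight. Hence the dimer ideal consists of the
  combinations whose coefficients sum to 0 over all parallel paths of a given weight, and since every
  boundary path is equivalent to a product of paths \<open>x\<^sub>i\<close>, \<open>y\<^sub>i\<close> and nonadjacent arrow-defining paths,
  the boundary algebra is the path algebra of the extended circle quiver modulo the analogous ideal
  for the induced weight. This ideal is cancellative.

  It contains \<open>x\<^sup>k - y\<^sup>n\<^sup>-\<^sup>k\<close> because, for \<open>v\<close> the first boundary vertex, the weights of the \<open>y\<^sub>j\<close>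
  add up to the number of noninversions: for a boundary arrow \<open>\<beta>\<close>, the weights \<open>M (tail \<beta>)\<close> and
  \<open>M (head \<beta>)\<close> differ on precisely two boundary arrows, the end points of the strand ending at \<open>\<beta>\<close>.
  To see this, one follows the strand backwards; a count of vertices, arrows and faces shows that the
  arrows of weight 0 into a vertex form a tree whose edges are the internal arrows of weight 1 out of
  it, which forces the two matchings to alternate along the strand.

  Conversely, modulo the relations every path becomes \<open>x\<^sup>a (xy)\<^sup>s\<close> with \<open>a < n\<close> after multiplication by
  a power of the central element \<open>xy\<close>, so paths of equal weight are identified by cancellation.
\<close>

section \<open>Path algebras\<close>

text \<open>c-values do not add up under concatenation. For a fixed \<open>v\<close> the
  \<open>M v\<close>-weight does, and on paths with given ends it differs from the c-value by a
  constant. Stating all ideals through labels of paths reduces each equality of ideals to comparing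
  pairs of paths.

  The delicate point is that the matchings of the two ends of a boundary arrow differ exactly along
  one strand. Alternation gives one inclusion. For the other, the difference of the matchings is the
  coboundary of a 0/1 function \<open>N\<close> on the vertices, and suitable minimal paths never
  cross the resulting cut. The Euler count behind alternation is linear algebra: a gradient that is
  also a combination of face boundaries is orthogonal to itself.

  The threshold \<open>\<pi> j \<ge> j\<close> records the base point 1: seen from
  \<open>b i\<close>, the weight of \<open>y\<^sub>j\<close> is 1 precisely for \<open>i\<close> on
  the cyclic interval from \<open>\<pi> j + 1\<close> to \<open>j\<close>, and this interval
  contains 1 iff \<open>\<pi> j \<ge> j\<close>.\<close>

context wf_digraph
begin

lemma awlast_conv: "awlast u as = (if as = [] then u else head G (last as))"
  by (simp add: awalk_verts_conv)

lemma awlast_append': "awlast u (as @ bs) = awlast (awlast u as) bs"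
  by (simp add: awlast_conv)

lemma mem_paths_iff: "(u, as) \<in> paths G \<longleftrightarrow> awalk u as (awlast u as)"
  unfolding paths_def by (auto dest: awalk_ends)

lemma mem_pathsI: "awalk u as v \<Longrightarrow> (u, as) \<in> paths G"
  unfolding paths_def by auto

lemma paths_between_iff: "(u, as) \<in> paths_between G v w \<longleftrightarrow> u = v \<and> awalk v as w"
  unfolding paths_between_def path_start_def path_end_def
  by (auto simp: mem_paths_iff dest: awalk_ends)

lemma paths_append_iff:
  "(u, as @ bs) \<in> paths G \<longleftrightarrow> (u, as) \<in> paths G \<and> (awlast u as, bs) \<in> paths G"
  by (simp add: mem_paths_iff awlast_append')

lemma path_end_conv: "path_end G (u, as) = awlast u as"
  by (simp add: path_end_def)

end

lemma path_algebra_simps: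
  "\<zero>\<^bsub>path_algebra G\<^esub> = (\<lambda>p. 0)"
  "\<one>\<^bsub>path_algebra G\<^esub> = (\<lambda>p. if fst p \<in> verts G \<and> snd p = [] then 1 else 0)"
  "f \<oplus>\<^bsub>path_algebra G\<^esub> g = (\<lambda>p. f p + g p)"
  "c \<odot>\<^bsub>path_algebra G\<^esub> f = (\<lambda>p. c * f p)"
  "(f \<otimes>\<^bsub>path_algebra G\<^esub> g) (u, as) = (\<Sum>k\<le>length as.
       f (u, take k as) * g (pre_digraph.awlast G u (take k as), drop k as))"
  "f \<in> carrier (path_algebra G) \<longleftrightarrow> finite {p. f p \<noteq> 0} \<and> {p. f p \<noteq> 0} \<subseteq> paths G"
  by (auto simp: path_algebra_def split: prod.splits)

context fin_digraph
begin

abbreviation "PA \<equiv> path_algebra G"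

text \<open>Both sides sum over all cuts of the path into three consecutive pieces. The triangular
  reindexing passes from an outer cut at \<open>k\<close> and an inner cut at \<open>j\<close> to
  the lengths \<open>j\<close> and \<open>i\<close> of the first two pieces.\<close>

lemma PA_mult_assoc: "(f \<otimes>\<^bsub>PA\<^esub> g) \<otimes>\<^bsub>PA\<^esub> h = f \<otimes>\<^bsub>PA\<^esub> (g \<otimes>\<^bsub>PA\<^esub> h)"
proof
  fix p :: "'a \<times> 'b list"
  obtain u as where p: "p = (u, as)" by (cases p)
  define F where "F j i = f (u, take j as) *
    (g (awlast u (take j as), take i (drop j as)) *
     h (awlast u (take (j + i) as), drop (j + i) as))" for j i
  have "((f \<otimes>\<^bsub>PA\<^esub> g) \<otimes>\<^bsub>PA\<^esub> h) p = (\<Sum>k\<le>length as. \<Sum>j\<le>k. F j (k - j))"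
    unfolding p path_algebra_simps F_def
    by (auto simp: sum_distrib_right min_def take_drop mult.assoc intro!: sum.cong)
  also have "\<dots> = (\<Sum>(j, i) \<in> {(j, i). j + i \<le> length as}. F j i)"
    by (rule sum.triangle_reindex_eq [symmetric])
  also have "{(j, i). j + i \<le> length as} = Sigma {..length as} (\<lambda>j. {..length as - j})"
    by auto
  also have "(\<Sum>(j, i) \<in> Sigma {..length as} (\<lambda>j. {..length as - j}). F j i) =
      (\<Sum>j\<le>length as. \<Sum>i\<le>length as - j. F j i)"
    by (subst sum.Sigma) auto
  also have "\<dots> = (f \<otimes>\<^bsub>PA\<^esub> (g \<otimes>\<^bsub>PA\<^esub> h)) p"
    unfolding p path_algebra_simps F_def
    by (auto simp: sum_distrib_left take_add awlast_append' add.commute intro!: sum.cong)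
  finally show "((f \<otimes>\<^bsub>PA\<^esub> g) \<otimes>\<^bsub>PA\<^esub> h) p = (f \<otimes>\<^bsub>PA\<^esub> (g \<otimes>\<^bsub>PA\<^esub> h)) p" .
qed

lemma PA_mult_closed:
  assumes "f \<in> carrier PA" "g \<in> carrier PA"
  shows "f \<otimes>\<^bsub>PA\<^esub> g \<in> carrier PA"
proof -
  let ?S = "{p. f p \<noteq> 0}" and ?T = "{p. g p \<noteq> 0}"
  have fin: "finite ?S" "?S \<subseteq> paths G" "finite ?T" "?T \<subseteq> paths G"
    using assms by (auto simp: path_algebra_simps)
  \<comment> \<open>A nonzero coefficient of the product comes from some cut, so the path is the
    concatenation of one path from each support. This gives finiteness, and the end condition makes
    the concatenation a path of \<open>G\<close>.\<close>
  have sub: "{p. (f \<otimes>\<^bsub>PA\<^esub> g) p \<noteq> 0} \<subseteq>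
      (\<lambda>(a, c). (fst a, snd a @ snd c)) ` {(a, c) \<in> ?S \<times> ?T. fst c = awlast (fst a) (snd a)}"
  proof
    fix p assume "p \<in> {p. (f \<otimes>\<^bsub>PA\<^esub> g) p \<noteq> 0}"
    moreover obtain u as where p: "p = (u, as)" by (cases p)
    ultimately obtain k where
      "f (u, take k as) * g (awlast u (take k as), drop k as) \<noteq> 0"
      by (auto simp: path_algebra_simps elim: sum.not_neutral_contains_not_neutral)
    then show "p \<in> (\<lambda>(a, c). (fst a, snd a @ snd c)) `
        {(a, c) \<in> ?S \<times> ?T. fst c = awlast (fst a) (snd a)}"
      unfolding p
      by (intro image_eqI [of _ _ "((u, take k as), (awlast u (take k as), drop k as))"]) auto
  qed
  have "finite {(a, c) \<in> ?S \<times> ?T. fst c = awlast (fst a) (snd a)}"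
    by (rule finite_subset [of _ "?S \<times> ?T"]) (use fin in auto)
  then have "finite {p. (f \<otimes>\<^bsub>PA\<^esub> g) p \<noteq> 0}"
    using sub finite_subset by blast
  moreover have "{p. (f \<otimes>\<^bsub>PA\<^esub> g) p \<noteq> 0} \<subseteq> paths G"
    using sub fin(2,4) by (fastforce simp: paths_append_iff)
  ultimately show ?thesis
    by (auto simp: path_algebra_simps(6))
qed

lemma PA_one_mult:
  assumes "f \<in> carrier PA"
  shows "\<one>\<^bsub>PA\<^esub> \<otimes>\<^bsub>PA\<^esub> f = f" "f \<otimes>\<^bsub>PA\<^esub> \<one>\<^bsub>PA\<^esub> = f"
proof -
  \<comment> \<open>A nonzero coefficient forces a genuine path, whose two ends are vertices; only
    there does the unit take the value 1 on constant paths.\<close>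
  have u: "u \<in> verts G \<and> awlast u as \<in> verts G" if "f (u, as) \<noteq> 0" for u as
    using assms that by (auto simp: path_algebra_simps(6) mem_paths_iff subset_iff)
  show "\<one>\<^bsub>PA\<^esub> \<otimes>\<^bsub>PA\<^esub> f = f"
  proof
    fix p :: "'a \<times> 'b list"
    obtain u as where p: "p = (u, as)" by (cases p)
    have "(\<one>\<^bsub>PA\<^esub> \<otimes>\<^bsub>PA\<^esub> f) p = (\<Sum>k\<le>length as. if k = 0 then f (u, as) else 0)"
      unfolding p path_algebra_simps(2,5)
    proof (rule sum.cong [OF refl])
      fix k assume "k \<in> {..length as}"
      then show "(if fst (u, take k as) \<in> verts G \<and> snd (u, take k as) = [] then 1 else 0) *
          f (awlast u (take k as), drop k as) = (if k = 0 then f (u, as) else 0)"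
        using u [of u as] by (cases "k = 0"; cases "as = []"; cases "f (u, as) = 0") simp_all
    qed
    then show "(\<one>\<^bsub>PA\<^esub> \<otimes>\<^bsub>PA\<^esub> f) p = f p" by (simp add: p)
  qed
  show "f \<otimes>\<^bsub>PA\<^esub> \<one>\<^bsub>PA\<^esub> = f"
  proof
    fix p :: "'a \<times> 'b list"
    obtain u as where p: "p = (u, as)" by (cases p)
    have "(f \<otimes>\<^bsub>PA\<^esub> \<one>\<^bsub>PA\<^esub>) p = (\<Sum>k\<le>length as. if k = length as then f (u, as) else 0)"
      unfolding p path_algebra_simps(2,5)
    proof (rule sum.cong [OF refl])
      fix k assume "k \<in> {..length as}"
      then show "f (u, take k as) * (if fst (awlast u (take k as), drop k as) \<in> verts G \<and>
          snd (awlast u (take k as), drop k as) = [] then 1 else 0) =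
          (if k = length as then f (u, as) else 0)"
        using u [of u as] by (cases "k = length as"; cases "f (u, as) = 0") simp_all
    qed
    then show "(f \<otimes>\<^bsub>PA\<^esub> \<one>\<^bsub>PA\<^esub>) p = f p" by (simp add: p)
  qed
qed

lemma PA_ring: "ring PA"
proof (intro ringI abelian_groupI monoid.intro)
  fix f g h
  assume f: "f \<in> carrier PA" and g: "g \<in> carrier PA"
  have "{p. f p + g p \<noteq> 0} \<subseteq> {p. f p \<noteq> 0} \<union> {p. g p \<noteq> 0}" by auto
  then show "f \<oplus>\<^bsub>PA\<^esub> g \<in> carrier PA"
    using f g unfolding path_algebra_simps by (meson finite_UnI le_sup_iff order_trans rev_finite_subset)
  show "f \<otimes>\<^bsub>PA\<^esub> g \<in> carrier PA" using f g by (rule PA_mult_closed)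
next
  fix f assume "f \<in> carrier PA"
  then show "\<exists>g\<in>carrier PA. g \<oplus>\<^bsub>PA\<^esub> f = \<zero>\<^bsub>PA\<^esub>"
    by (intro bexI [of _ "\<lambda>p. - f p"]) (auto simp: path_algebra_simps)
next
  have "{p. \<one>\<^bsub>PA\<^esub> p \<noteq> 0} \<subseteq> (\<lambda>v. (v, [])) ` verts G"
    by (auto simp: path_algebra_simps split: if_splits)
  moreover have "(\<lambda>v. (v, [])) ` verts G \<subseteq> paths G"
    by (auto simp: mem_paths_iff awalk_Nil_iff)
  ultimately show "\<one>\<^bsub>PA\<^esub> \<in> carrier PA"
    unfolding path_algebra_simps(6) by (meson finite_imageI finite_subset finite_verts order_trans)
next
  fix f g h
  show "(f \<oplus>\<^bsub>PA\<^esub> g) \<otimes>\<^bsub>PA\<^esub> h = f \<otimes>\<^bsub>PA\<^esub> h \<oplus>\<^bsub>PA\<^esub> g \<otimes>\<^bsub>PA\<^esub> h"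
    "h \<otimes>\<^bsub>PA\<^esub> (f \<oplus>\<^bsub>PA\<^esub> g) = h \<otimes>\<^bsub>PA\<^esub> f \<oplus>\<^bsub>PA\<^esub> h \<otimes>\<^bsub>PA\<^esub> g"
    by (auto simp: fun_eq_iff path_algebra_simps(3,5) distrib_left distrib_right sum.distrib)
  show "(f \<oplus>\<^bsub>PA\<^esub> g) \<oplus>\<^bsub>PA\<^esub> h = f \<oplus>\<^bsub>PA\<^esub> (g \<oplus>\<^bsub>PA\<^esub> h)"
    "f \<oplus>\<^bsub>PA\<^esub> g = g \<oplus>\<^bsub>PA\<^esub> f" "\<zero>\<^bsub>PA\<^esub> \<oplus>\<^bsub>PA\<^esub> f = f"
    by (simp_all add: fun_eq_iff path_algebra_simps(1,3) add_ac)
  show "\<zero>\<^bsub>PA\<^esub> \<in> carrier PA" by (simp add: path_algebra_simps(1,6))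
qed (simp_all add: PA_one_mult PA_mult_assoc)

end

sublocale fin_digraph \<subseteq> PA: ring "path_algebra G"
  by (rule PA_ring)

section \<open>Scalars, finite sums and products in terms of single paths\<close>

context fin_digraph
begin

lemma PA_uminus:
  assumes g: "g \<in> carrier PA"
  shows "\<ominus>\<^bsub>PA\<^esub> g = (\<lambda>p. - g p)"
proof -
  have "(\<lambda>p. - g p) \<in> carrier PA" using g by (auto simp: path_algebra_simps)
  moreover have "(\<lambda>p. - g p) \<oplus>\<^bsub>PA\<^esub> g = \<zero>\<^bsub>PA\<^esub>" by (auto simp: path_algebra_simps)
  ultimately show "\<ominus>\<^bsub>PA\<^esub> g = (\<lambda>p. - g p)"
    using g by (intro PA.minus_equality)
qed

lemma PA_minus: "g \<in> carrier PA \<Longrightarrow> f \<ominus>\<^bsub>PA\<^esub> g = (\<lambda>p. f p - g p)"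
  by (simp add: a_minus_def PA_uminus path_algebra_simps(3))

lemma PA_smult_closed:
  assumes "f \<in> carrier PA"
  shows "c \<odot>\<^bsub>PA\<^esub> f \<in> carrier PA"
proof -
  have "{p. c * f p \<noteq> 0} \<subseteq> {p. f p \<noteq> 0}" by auto
  then show ?thesis
    using assms unfolding path_algebra_simps(4,6) by (meson order_trans rev_finite_subset)
qed

lemma PA_smult_mult:
  "c \<odot>\<^bsub>PA\<^esub> f \<otimes>\<^bsub>PA\<^esub> g = c \<odot>\<^bsub>PA\<^esub> (f \<otimes>\<^bsub>PA\<^esub> g)"
  "f \<otimes>\<^bsub>PA\<^esub> (c \<odot>\<^bsub>PA\<^esub> g) = c \<odot>\<^bsub>PA\<^esub> (f \<otimes>\<^bsub>PA\<^esub> g)"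
  by (auto simp: fun_eq_iff path_algebra_simps(4,5) sum_distrib_left mult_ac)

lemma finsum_apply:
  assumes "finite A" "\<And>x. x \<in> A \<Longrightarrow> F x \<in> carrier PA"
  shows "(\<Oplus>\<^bsub>PA\<^esub>x\<in>A. F x) p = (\<Sum>x\<in>A. F x p)"
  using assms
proof (induction A rule: finite_induct)
  case empty then show ?case by (simp add: path_algebra_simps)
next
  case (insert x A)
  then have "(\<Oplus>\<^bsub>PA\<^esub>x\<in>insert x A. F x) = F x \<oplus>\<^bsub>PA\<^esub> (\<Oplus>\<^bsub>PA\<^esub>x\<in>A. F x)"
    by (intro PA.finsum_insert) auto
  then show ?case using insert by (simp add: path_algebra_simps(3))
qed

lemma single_closed [simp, intro]: "p \<in> paths G \<Longrightarrow> single p \<in> carrier PA"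
  by (simp add: path_algebra_simps(6) single_def)

lemma single_mult_single:
  "single (u, as) \<otimes>\<^bsub>PA\<^esub> single (v, bs) =
    (if v = awlast u as then single (u, as @ bs) else (\<lambda>_. 0))"
proof
  fix p :: "'a \<times> 'b list"
  obtain w cs where p: "p = (w, cs)" by (cases p)
  have "(single (u, as) \<otimes>\<^bsub>PA\<^esub> single (v, bs)) p = (\<Sum>k\<le>length cs. if k = length as then
     (if v = awlast u as \<and> w = u \<and> cs = as @ bs then 1 else 0) else 0)"
    unfolding p path_algebra_simps(5)
  proof (rule sum.cong [OF refl])
    fix k assume k: "k \<in> {..length cs}"
    show "single (u, as) (w, take k cs) * single (v, bs) (awlast w (take k cs), drop k cs) =
        (if k = length as then if v = awlast u as \<and> w = u \<and> cs = as @ bs then 1 else 0 else 0)"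
    proof (cases "take k cs = as \<and> drop k cs = bs")
      case True
      then have "cs = as @ bs" "k = length as" using k by auto
      then show ?thesis by (auto simp: single_def)
    next
      case False
      then have "\<not> (k = length as \<and> cs = as @ bs)" by auto
      then show ?thesis using False by (cases "take k cs = as") (auto simp: single_def)
    qed
  qed
  then show "(single (u, as) \<otimes>\<^bsub>PA\<^esub> single (v, bs)) p =
      (if v = awlast u as then single (u, as @ bs) else (\<lambda>_. 0)) p"
    by (auto simp: p single_def)
qed

lemma single_decomp:
  assumes "finite S" "{p. f p \<noteq> 0} \<subseteq> S"
  shows "f = (\<lambda>p. \<Sum>a\<in>S. f a * single a p)"
proof
  fix p
  have "(\<Sum>a\<in>S. f a * single a p) = (\<Sum>a\<in>S. if a = p then f p else 0)"
    by (rule sum.cong) (simp_all add: single_def)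
  also have "\<dots> = (if p \<in> S then f p else 0)"
    using assms(1) by (rule sum.delta)
  also have "\<dots> = f p" using assms(2) by auto
  finally show "f p = (\<Sum>a\<in>S. f a * single a p)" by (rule sym)
qed

lemma mult_decomp:
  assumes "finite S" "{p. f p \<noteq> 0} \<subseteq> S" "finite T" "{p. g p \<noteq> 0} \<subseteq> T"
  shows "(f \<otimes>\<^bsub>PA\<^esub> g) r = (\<Sum>a\<in>S. \<Sum>c\<in>T. f a * g c * (single a \<otimes>\<^bsub>PA\<^esub> single c) r)"
proof -
  obtain u as where r: "r = (u, as)" by (cases r)
  have f: "f = (\<lambda>p. \<Sum>a\<in>S. f a * single a p)" and g: "g = (\<lambda>p. \<Sum>a\<in>T. g a * single a p)"
    by (rule single_decomp [OF assms(1,2)], rule single_decomp [OF assms(3,4)])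
  have "(f \<otimes>\<^bsub>PA\<^esub> g) r = ((\<lambda>p. \<Sum>a\<in>S. f a * single a p) \<otimes>\<^bsub>PA\<^esub> (\<lambda>p. \<Sum>a\<in>T. g a * single a p)) r"
    by (rule arg_cong [where f = "\<lambda>h. h r"], rule arg_cong2 [OF f g])
  also have "\<dots> = (\<Sum>k\<le>length as. \<Sum>a\<in>S. \<Sum>c\<in>T. (f a * single a (u, take k as)) *
      (g c * single c (awlast u (take k as), drop k as)))"
    unfolding r path_algebra_simps(5) by (simp add: sum_product)
  also have "\<dots> = (\<Sum>a\<in>S. \<Sum>k\<le>length as. \<Sum>c\<in>T. (f a * single a (u, take k as)) *
      (g c * single c (awlast u (take k as), drop k as)))"
    by (rule sum.swap)
  also have "\<dots> = (\<Sum>a\<in>S. \<Sum>c\<in>T. \<Sum>k\<le>length as. (f a * single a (u, take k as)) *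
      (g c * single c (awlast u (take k as), drop k as)))"
    by (intro sum.cong refl sum.swap)
  also have "\<dots> = (\<Sum>a\<in>S. \<Sum>c\<in>T. f a * g c * (single a \<otimes>\<^bsub>PA\<^esub> single c) r)"
    unfolding r path_algebra_simps(5) by (simp add: sum_distrib_left mult_ac)
  finally show ?thesis .
qed

text \<open>A scalar acts as multiplication by \<open>c\<close> times the unit, so ideals of the
  underlying ring are automatically subspaces.\<close>

lemma ideal_smult_closed:
  assumes "ideal J PA" "f \<in> J"
  shows "c \<odot>\<^bsub>PA\<^esub> f \<in> J"
proof -
  interpret J: ideal J PA by fact
  have f: "f \<in> carrier PA" using assms(2) J.a_subset by blast
  have "c \<odot>\<^bsub>PA\<^esub> f = (c \<odot>\<^bsub>PA\<^esub> \<one>\<^bsub>PA\<^esub>) \<otimes>\<^bsub>PA\<^esub> f"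
    using f by (simp add: PA_smult_mult PA_one_mult)
  then show ?thesis using J.I_l_closed assms(2) PA_smult_closed by simp
qed

end

section \<open>Ideals given by labels of paths\<close>

text \<open>A label names the class of a path under a congruence: equal labels force equal ends and
  survive composition on either side. It is instantiated with flip classes and with weights. Two
  labellings that separate the same paths give the same ideal, which is how the dimer ideal becomes
  a weight ideal.\<close>

locale path_labelling = fin_digraph G for G :: "('v, 'a) pre_digraph" +
  fixes \<kappa> :: "('v, 'a) qpath \<Rightarrow> 'k"
  assumes label_ends: "\<lbrakk>(u, as) \<in> paths G; (v, bs) \<in> paths G; \<kappa> (u, as) = \<kappa> (v, bs)\<rbrakk> \<Longrightarrow>
      u = v \<and> awlast u as = awlast v bs"
    and label_left: "\<lbrakk>(u, as) \<in> paths G; (u, bs) \<in> paths G; \<kappa> (u, as) = \<kappa> (u, bs);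
      (w, cs) \<in> paths G; awlast w cs = u\<rbrakk> \<Longrightarrow> \<kappa> (w, cs @ as) = \<kappa> (w, cs @ bs)"
    and label_right: "\<lbrakk>(u, as) \<in> paths G; (u, bs) \<in> paths G; \<kappa> (u, as) = \<kappa> (u, bs);
      (awlast u as, cs) \<in> paths G\<rbrakk> \<Longrightarrow> \<kappa> (u, as @ cs) = \<kappa> (u, bs @ cs)"
begin

definition label_sum :: "(('v, 'a) qpath \<Rightarrow> complex) \<Rightarrow> 'k \<Rightarrow> complex" where
  "label_sum z l = (\<Sum>q\<in>{q. z q \<noteq> 0}. if \<kappa> q = l then z q else 0)"

text \<open>The kernel of the linear map from the path algebra to the vector space spanned by the
  labels.\<close>

definition label_ideal :: "(('v, 'a) qpath \<Rightarrow> complex) set" where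
  "label_ideal = {z \<in> carrier PA. \<forall>l. label_sum z l = 0}"

lemma label_sum_superset:
  assumes "finite S" "{q. z q \<noteq> 0} \<subseteq> S"
  shows "label_sum z l = (\<Sum>q\<in>S. if \<kappa> q = l then z q else 0)"
  unfolding label_sum_def by (rule sum.mono_neutral_left) (use assms in auto)

lemma label_sum_add:
  assumes "y \<in> carrier PA" "z \<in> carrier PA"
  shows "label_sum (\<lambda>p. c * y p + d * z p) l = c * label_sum y l + d * label_sum z l"
proof -
  let ?S = "{q. y q \<noteq> 0} \<union> {q. z q \<noteq> 0}"
  have fin: "finite ?S" using assms by (auto simp: path_algebra_simps)
  have "label_sum y l = (\<Sum>q\<in>?S. if \<kappa> q = l then y q else 0)"
    "label_sum z l = (\<Sum>q\<in>?S. if \<kappa> q = l then z q else 0)"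
    "label_sum (\<lambda>p. c * y p + d * z p) l = (\<Sum>q\<in>?S. if \<kappa> q = l then c * y q + d * z q else 0)"
    using fin by (auto intro!: label_sum_superset)
  then show ?thesis
    by (auto simp: sum_distrib_left simp flip: sum.distrib intro!: sum.cong)
qed

lemma label_sum_single: "label_sum (single p) l = (if \<kappa> p = l then 1 else 0)"
proof -
  have "label_sum (single p) l = (\<Sum>q\<in>{p}. if \<kappa> q = l then single p q else 0)"
    by (rule label_sum_superset) (auto simp: single_def)
  then show ?thesis by (simp add: single_def)
qed

text \<open>A property that depends on the label alone cuts the support into full label classes, on
  each of which the coefficients cancel. It will be used with \<open>D q\<close> saying that
  \<open>q\<close> composed with a fixed path has a given label.\<close>

lemma label_ideal_invariant_sum:
  assumes z: "z \<in> label_ideal"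
    and D: "\<And>p q. \<lbrakk>p \<in> paths G; q \<in> paths G; \<kappa> p = \<kappa> q; D p\<rbrakk> \<Longrightarrow> D q"
  shows "(\<Sum>q\<in>{q. z q \<noteq> 0}. if D q then z q else 0) = 0"
proof -
  let ?S = "{q. z q \<noteq> 0}"
  have S: "finite ?S" "?S \<subseteq> paths G"
    using z by (auto simp: label_ideal_def path_algebra_simps)
  have "(\<Sum>q\<in>?S. if D q then z q else 0) = (\<Sum>q\<in>{q \<in> ?S. D q}. z q)"
    by (rule sum.inter_filter [OF S(1), symmetric])
  also have "\<dots> = (\<Sum>l\<in>\<kappa> ` {q \<in> ?S. D q}. \<Sum>q\<in>{q \<in> {q \<in> ?S. D q}. \<kappa> q = l}. z q)"
    using S(1) by (intro sum.group [symmetric]) simp_all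
  also have "\<dots> = (\<Sum>l\<in>\<kappa> ` {q \<in> ?S. D q}. label_sum z l)"
  proof (rule sum.cong)
    fix l assume "l \<in> \<kappa> ` {q \<in> ?S. D q}"
    then obtain p where p: "p \<in> ?S" "D p" "\<kappa> p = l" by blast
    have "D q" if "q \<in> ?S" "\<kappa> q = l" for q
    proof (rule D [OF _ _ _ p(2)])
      show "p \<in> paths G" using S(2) p(1) by (rule subsetD)
      show "q \<in> paths G" using S(2) that(1) by (rule subsetD)
      show "\<kappa> p = \<kappa> q" using p(3) that(2) by simp
    qed
    then have "{q \<in> {q \<in> ?S. D q}. \<kappa> q = l} = {q \<in> ?S. \<kappa> q = l}"
      by blast
    then show "(\<Sum>q\<in>{q \<in> {q \<in> ?S. D q}. \<kappa> q = l}. z q) = label_sum z l"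
      using sum.inter_filter [OF S(1), of z "\<lambda>q. \<kappa> q = l"] by (simp only: label_sum_def)
  qed simp
  also have "\<dots> = 0" using z by (simp add: label_ideal_def)
  finally show ?thesis .
qed

lemma label_sum_mult:
  assumes y: "y \<in> carrier PA" and z: "z \<in> carrier PA"
  shows "label_sum (y \<otimes>\<^bsub>PA\<^esub> z) l = (\<Sum>a\<in>{a. y a \<noteq> 0}. \<Sum>c\<in>{c. z c \<noteq> 0}.
    if fst c = awlast (fst a) (snd a) \<and> \<kappa> (fst a, snd a @ snd c) = l then y a * z c else 0)"
proof -
  let ?S = "{a. y a \<noteq> 0}" and ?T = "{c. z c \<noteq> 0}"
  \<comment> \<open>\<open>R\<close> contains the support of the product and all concatenations of
    pairs, so for each pair the only path to which it can contribute is an index and the sums may be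
    exchanged.\<close>
  define R where "R = {r. (y \<otimes>\<^bsub>PA\<^esub> z) r \<noteq> 0} \<union> (\<lambda>(a, c). (fst a, snd a @ snd c)) ` (?S \<times> ?T)"
  have fin: "finite ?S" "finite ?T" using y z by (auto simp: path_algebra_simps)
  have "finite {r. (y \<otimes>\<^bsub>PA\<^esub> z) r \<noteq> 0}"
    using PA_mult_closed [OF y z] by (auto simp: path_algebra_simps(6))
  then have R: "finite R" using fin by (auto simp: R_def)
  have "label_sum (y \<otimes>\<^bsub>PA\<^esub> z) l = (\<Sum>r\<in>R. if \<kappa> r = l then (y \<otimes>\<^bsub>PA\<^esub> z) r else 0)"
    by (rule label_sum_superset [OF R]) (simp add: R_def)
  also have "\<dots> = (\<Sum>r\<in>R. \<Sum>a\<in>?S. \<Sum>c\<in>?T. if \<kappa> r = l then y a * z c * (single a \<otimes>\<^bsub>PA\<^esub> single c) r else 0)"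
    by (rule sum.cong [OF refl]) (simp add: mult_decomp [OF fin(1) subset_refl fin(2) subset_refl])
  also have "\<dots> = (\<Sum>a\<in>?S. \<Sum>r\<in>R. \<Sum>c\<in>?T. if \<kappa> r = l then y a * z c * (single a \<otimes>\<^bsub>PA\<^esub> single c) r else 0)"
    by (rule sum.swap)
  also have "\<dots> = (\<Sum>a\<in>?S. \<Sum>c\<in>?T. \<Sum>r\<in>R. if \<kappa> r = l then y a * z c * (single a \<otimes>\<^bsub>PA\<^esub> single c) r else 0)"
    by (intro sum.cong refl sum.swap)
  also have "\<dots> = (\<Sum>a\<in>?S. \<Sum>c\<in>?T.
    if fst c = awlast (fst a) (snd a) \<and> \<kappa> (fst a, snd a @ snd c) = l then y a * z c else 0)"
  proof (rule sum.cong [OF refl], rule sum.cong [OF refl])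
    fix a c assume ac: "a \<in> ?S" "c \<in> ?T"
    let ?r = "(fst a, snd a @ snd c)"
    have r: "?r \<in> R" using ac by (auto simp: R_def)
    have eq: "(single a \<otimes>\<^bsub>PA\<^esub> single c) = (if fst c = awlast (fst a) (snd a) then single ?r else (\<lambda>_. 0))"
      using single_mult_single [of "fst a" "snd a" "fst c" "snd c"] by simp
    have "(\<Sum>r\<in>R. if \<kappa> r = l then y a * z c * (single a \<otimes>\<^bsub>PA\<^esub> single c) r else 0) =
      (\<Sum>r\<in>R. if r = ?r then (if fst c = awlast (fst a) (snd a) \<and> \<kappa> ?r = l then y a * z c else 0) else 0)"
      unfolding eq by (rule sum.cong [OF refl]) (simp add: single_def)
    then show "(\<Sum>r\<in>R. if \<kappa> r = l then y a * z c * (single a \<otimes>\<^bsub>PA\<^esub> single c) r else 0) =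
      (if fst c = awlast (fst a) (snd a) \<and> \<kappa> ?r = l then y a * z c else 0)"
      using R r by simp
  qed
  finally show ?thesis .
qed

lemma label_ideal_ideal: "ideal label_ideal PA"
proof (rule idealI)
  show "ring PA" by (rule PA_ring)
  show "subgroup label_ideal (add_monoid PA)"
  proof (rule PA.add.subgroupI)
    show "label_ideal \<subseteq> carrier PA" by (auto simp: label_ideal_def)
    have "\<zero>\<^bsub>PA\<^esub> \<in> label_ideal"
      unfolding label_ideal_def using PA.zero_closed by (auto simp: path_algebra_simps(1) label_sum_def)
    then show "label_ideal \<noteq> {}" by auto
    fix y assume y: "y \<in> label_ideal"
    then have yc: "y \<in> carrier PA" by (auto simp: label_ideal_def)
    have "label_sum (\<ominus>\<^bsub>PA\<^esub> y) l = 0" for l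
      using y label_sum_add [OF yc yc, of "-1" 0 l]
      by (simp add: label_ideal_def PA_uminus [OF yc])
    then show "\<ominus>\<^bsub>PA\<^esub> y \<in> label_ideal"
      using PA.a_inv_closed [OF yc] by (simp add: label_ideal_def)
    fix z assume z: "z \<in> label_ideal"
    then have zc: "z \<in> carrier PA" by (auto simp: label_ideal_def)
    have "label_sum (y \<oplus>\<^bsub>PA\<^esub> z) l = 0" for l
      using y z label_sum_add [OF yc zc, of 1 1 l]
      by (simp add: label_ideal_def path_algebra_simps(3))
    then show "y \<oplus>\<^bsub>PA\<^esub> z \<in> label_ideal"
      using PA.a_closed [OF yc zc] by (simp add: label_ideal_def)
  qed
  fix z y assume z: "z \<in> label_ideal" and y: "y \<in> carrier PA"
  have zc: "z \<in> carrier PA" using z by (auto simp: label_ideal_def)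
  have zp: "c \<in> paths G" if "z c \<noteq> 0" for c using zc that by (auto simp: path_algebra_simps)
  have yp: "c \<in> paths G" if "y c \<noteq> 0" for c using y that by (auto simp: path_algebra_simps)
  \<comment> \<open>With the path \<open>a\<close> of one factor fixed, the label of a composite
    depends only on the label of the other path, by \<open>label_left\<close>; so the inner sum is
    one of the invariant sums that vanish.\<close>
  have "label_sum (y \<otimes>\<^bsub>PA\<^esub> z) l = 0" for l
    unfolding label_sum_mult [OF y zc]
  proof (rule sum.neutral, rule ballI)
    fix a assume a: "a \<in> {a. y a \<noteq> 0}"
    let ?D = "\<lambda>c. fst c = awlast (fst a) (snd a) \<and> \<kappa> (fst a, snd a @ snd c) = l"
    have "(\<Sum>c\<in>{c. z c \<noteq> 0}. if ?D c then y a * z c else 0) =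
        y a * (\<Sum>c\<in>{c. z c \<noteq> 0}. if ?D c then z c else 0)"
      by (auto simp: sum_distrib_left intro!: sum.cong)
    also have "(\<Sum>c\<in>{c. z c \<noteq> 0}. if ?D c then z c else 0) = 0"
    proof (rule label_ideal_invariant_sum [OF z])
      fix p q assume *: "p \<in> paths G" "q \<in> paths G" "\<kappa> p = \<kappa> q" "?D p"
      obtain u as v bs w cs where eqs: "p = (u, as)" "q = (v, bs)" "a = (w, cs)"
        by (cases p, cases q, cases a) blast
      have uv: "v = u" using label_ends *(1-3) unfolding eqs by metis
      have "\<kappa> (w, cs @ as) = \<kappa> (w, cs @ bs)"
        using label_left [of u as bs w cs] * yp [of a] a unfolding eqs uv by simp
      then show "?D q" using *(4) unfolding eqs uv by simp
    qed
    finally show "(\<Sum>c\<in>{c. z c \<noteq> 0}. if ?D c then y a * z c else 0) = 0" by simp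
  qed
  then show "y \<otimes>\<^bsub>PA\<^esub> z \<in> label_ideal"
    using PA_mult_closed [OF y zc] by (simp add: label_ideal_def)
  have "label_sum (z \<otimes>\<^bsub>PA\<^esub> y) l = 0" for l
    unfolding label_sum_mult [OF zc y]
  proof (subst sum.swap, rule sum.neutral, rule ballI)
    fix a assume a: "a \<in> {a. y a \<noteq> 0}"
    let ?D = "\<lambda>c. fst a = awlast (fst c) (snd c) \<and> \<kappa> (fst c, snd c @ snd a) = l"
    have "(\<Sum>c\<in>{c. z c \<noteq> 0}. if ?D c then z c * y a else 0) =
        y a * (\<Sum>c\<in>{c. z c \<noteq> 0}. if ?D c then z c else 0)"
      by (auto simp: sum_distrib_left intro!: sum.cong)
    also have "(\<Sum>c\<in>{c. z c \<noteq> 0}. if ?D c then z c else 0) = 0"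
    proof (rule label_ideal_invariant_sum [OF z])
      fix p q assume *: "p \<in> paths G" "q \<in> paths G" "\<kappa> p = \<kappa> q" "?D p"
      obtain u as v bs w cs where eqs: "p = (u, as)" "q = (v, bs)" "a = (w, cs)"
        by (cases p, cases q, cases a) blast
      have uv: "v = u" and e: "awlast v bs = awlast u as"
        using label_ends *(1-3) unfolding eqs by metis+
      have "\<kappa> (u, as @ cs) = \<kappa> (u, bs @ cs)"
        using label_right [of u as bs cs] * yp [of a] a unfolding eqs uv by simp
      then show "?D q" using *(4) e unfolding eqs uv by simp
    qed
    finally show "(\<Sum>c\<in>{c. z c \<noteq> 0}. if ?D c then z c * y a else 0) = 0" by simp
  qed
  then show "z \<otimes>\<^bsub>PA\<^esub> y \<in> label_ideal"
    using PA_mult_closed [OF zc y] by (simp add: label_ideal_def)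
qed

lemma single_diff_label_ideal:
  assumes "p \<in> paths G" "q \<in> paths G"
  shows "single p \<ominus>\<^bsub>PA\<^esub> single q \<in> label_ideal \<longleftrightarrow> \<kappa> p = \<kappa> q"
proof -
  have "single p \<ominus>\<^bsub>PA\<^esub> single q = (\<lambda>r. 1 * single p r + (-1) * single q r)"
    unfolding PA_minus [OF single_closed [OF assms(2)]] by (simp add: fun_eq_iff)
  moreover have "single p \<ominus>\<^bsub>PA\<^esub> single q \<in> carrier PA" using assms by simp
  moreover have "label_sum (\<lambda>r. 1 * single p r + (-1) * single q r) l =
      (if \<kappa> p = l then 1 else 0) - (if \<kappa> q = l then 1 else 0)" for l
    using label_sum_add [of "single p" "single q" 1 "-1" l] assms by (simp add: label_sum_single)
  ultimately have *: "single p \<ominus>\<^bsub>PA\<^esub> single q \<in> label_ideal \<longleftrightarrow>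
      (\<forall>l. (if \<kappa> p = l then 1 else 0) - (if \<kappa> q = l then 1 else 0) = (0 :: complex))"
    unfolding label_ideal_def by simp
  show ?thesis
  proof
    assume "single p \<ominus>\<^bsub>PA\<^esub> single q \<in> label_ideal"
    then have "(if \<kappa> p = \<kappa> p then 1 else 0) - (if \<kappa> q = \<kappa> p then 1 else 0) = (0 :: complex)"
      using * by blast
    then show "\<kappa> p = \<kappa> q" by (simp split: if_splits)
  next
    assume "\<kappa> p = \<kappa> q"
    then show "single p \<ominus>\<^bsub>PA\<^esub> single q \<in> label_ideal" unfolding * by simp
  qed
qed

text \<open>Induction on the size of the support. A path in the support cannot be alone in its label
  class, since the coefficients there sum to 0; subtracting a multiple of the difference of two
  equally labelled paths removes it.\<close>

lemma label_ideal_subset: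
  assumes J: "ideal J PA"
    and sing: "\<And>p q. \<lbrakk>p \<in> paths G; q \<in> paths G; \<kappa> p = \<kappa> q\<rbrakk> \<Longrightarrow> single p \<ominus>\<^bsub>PA\<^esub> single q \<in> J"
  shows "label_ideal \<subseteq> J"
proof
  interpret J: ideal J PA by fact
  interpret I: ideal label_ideal PA by (rule label_ideal_ideal)
  fix z assume "z \<in> label_ideal"
  then show "z \<in> J"
  proof (induction "card {q. z q \<noteq> 0}" arbitrary: z rule: less_induct)
    case less
    have zc: "z \<in> carrier PA" using less.prems unfolding label_ideal_def by blast
    have fin: "finite {q. z q \<noteq> 0}" and sub: "{q. z q \<noteq> 0} \<subseteq> paths G"
      using zc unfolding path_algebra_simps(6) by blast+
    show ?case
    proof (cases "{q. z q \<noteq> 0} = {}")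
      case True
      have "z q = 0" for q using equals0D [OF True, of q] by simp
      then have "z = \<zero>\<^bsub>PA\<^esub>" unfolding path_algebra_simps(1) by (rule ext)
      then show ?thesis by simp
    next
      case False
      then obtain p where p: "z p \<noteq> 0" by blast
      have "\<exists>q. q \<noteq> p \<and> z q \<noteq> 0 \<and> \<kappa> q = \<kappa> p"
      proof (rule ccontr)
        assume neg: "\<not> ?thesis"
        have "label_sum z (\<kappa> p) = (\<Sum>q\<in>{q. z q \<noteq> 0}. if q = p then z p else 0)"
          unfolding label_sum_def
        proof (rule sum.cong [OF refl])
          fix q assume q: "q \<in> {q. z q \<noteq> 0}"
          show "(if \<kappa> q = \<kappa> p then z q else 0) = (if q = p then z p else 0)"
          proof (cases "q = p")
            case False
            then have "\<kappa> q \<noteq> \<kappa> p" using neg q by blast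
            then show ?thesis using False by simp
          qed simp
        qed
        also have "\<dots> = (if p \<in> {q. z q \<noteq> 0} then z p else 0)"
          by (rule sum.delta [OF fin])
        finally have "label_sum z (\<kappa> p) \<noteq> 0" using p by simp
        then show False using less.prems unfolding label_ideal_def by blast
      qed
      then obtain q where q: "q \<noteq> p" "z q \<noteq> 0" "\<kappa> q = \<kappa> p" by blast
      have pq: "p \<in> paths G" "q \<in> paths G" using p q sub by blast+
      define d where "d = z p \<odot>\<^bsub>PA\<^esub> (single p \<ominus>\<^bsub>PA\<^esub> single q)"
      have dI: "d \<in> label_ideal"
        unfolding d_def
        by (rule ideal_smult_closed [OF label_ideal_ideal single_diff_label_ideal [OF pq, THEN iffD2, OF q(3) [symmetric]]])
      have dJ: "d \<in> J"
        unfolding d_def by (rule ideal_smult_closed [OF J sing [OF pq q(3) [symmetric]]])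
      have dc: "d \<in> carrier PA" using dJ J.a_subset by blast
      have deq: "d r = z p * (single p r - single q r)" for r
        unfolding d_def by (simp add: PA_minus [OF single_closed [OF pq(2)]] path_algebra_simps(4))
      have zd: "z \<ominus>\<^bsub>PA\<^esub> d = (\<lambda>r. z r - d r)" using zc dc by (simp add: PA_minus)
      have "{r. (z \<ominus>\<^bsub>PA\<^esub> d) r \<noteq> 0} \<subseteq> {r. z r \<noteq> 0} - {p}"
      proof
        fix r assume "r \<in> {r. (z \<ominus>\<^bsub>PA\<^esub> d) r \<noteq> 0}"
        then have "z r \<noteq> z p * (single p r - single q r)" by (simp add: zd deq)
        then show "r \<in> {r. z r \<noteq> 0} - {p}"
          using q by (cases "r = p"; cases "r = q") (simp_all add: single_def)
      qed
      moreover have "p \<in> {r. z r \<noteq> 0}" using p by simp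
      ultimately have "{r. (z \<ominus>\<^bsub>PA\<^esub> d) r \<noteq> 0} \<subset> {r. z r \<noteq> 0}" by blast
      then have "card {r. (z \<ominus>\<^bsub>PA\<^esub> d) r \<noteq> 0} < card {r. z r \<noteq> 0}"
        by (rule psubset_card_mono [OF fin])
      moreover have "z \<ominus>\<^bsub>PA\<^esub> d \<in> label_ideal"
        unfolding a_minus_def using less.prems dI by (intro I.a_closed I.a_inv_closed)
      ultimately have "z \<ominus>\<^bsub>PA\<^esub> d \<in> J" by (rule less.hyps)
      then have "(z \<ominus>\<^bsub>PA\<^esub> d) \<oplus>\<^bsub>PA\<^esub> d \<in> J" using dJ by (rule J.a_closed)
      moreover have "(z \<ominus>\<^bsub>PA\<^esub> d) \<oplus>\<^bsub>PA\<^esub> d = z"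
        unfolding zd path_algebra_simps(3) by simp
      ultimately show ?thesis by (simp only:)
    qed
  qed
qed

end

section \<open>Weighted quivers\<close>

text \<open>Indexed by a set with a map \<open>F\<close> that need not be injective: mapping a
  combination along a map of paths may identify paths, and their coefficients then add up.\<close>

definition lin_comb ::
    "'i set \<Rightarrow> ('i \<Rightarrow> complex) \<Rightarrow> ('i \<Rightarrow> ('v, 'a) qpath) \<Rightarrow> ('v, 'a) qpath \<Rightarrow> complex" where
  "lin_comb S c F = (\<lambda>q. \<Sum>a\<in>S. c a * single (F a) q)"

lemma lin_comb_insert:
  "finite S \<Longrightarrow> a \<notin> S \<Longrightarrow> lin_comb (insert a S) c F = (\<lambda>q. c a * single (F a) q + 1 * lin_comb S c F q)"
  by (simp add: lin_comb_def)

context fin_digraph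
begin

lemma lin_comb_closed:
  assumes "finite S" "\<And>a. a \<in> S \<Longrightarrow> F a \<in> paths G"
  shows "lin_comb S c F \<in> carrier PA"
  using assms
proof (induction S rule: finite_induct)
  case empty
  then show ?case by (simp add: lin_comb_def path_algebra_simps(6))
next
  case (insert a S)
  have "c a \<odot>\<^bsub>PA\<^esub> single (F a) \<oplus>\<^bsub>PA\<^esub> lin_comb S c F \<in> carrier PA"
    using insert by (intro PA.a_closed PA_smult_closed single_closed) simp_all
  then show ?case unfolding lin_comb_insert [OF insert.hyps] by (simp add: path_algebra_simps(3,4))
qed

lemma carrier_support:
  assumes "z \<in> carrier PA"
  shows "finite {p. z p \<noteq> 0}" "z p \<noteq> 0 \<Longrightarrow> p \<in> paths G"
proof -
  have sub: "{p. z p \<noteq> 0} \<subseteq> paths G" and fin: "finite {p. z p \<noteq> 0}"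
    using assms unfolding path_algebra_simps(6) by simp_all
  show "finite {p. z p \<noteq> 0}" by (rule fin)
  show "p \<in> paths G" if "z p \<noteq> 0" by (rule subsetD [OF sub]) (rule CollectI, rule that)
qed

lemma lin_comb_mult:
  "(lin_comb S c F \<otimes>\<^bsub>PA\<^esub> lin_comb T d K) r =
    (\<Sum>a\<in>S. \<Sum>e\<in>T. c a * d e * (single (F a) \<otimes>\<^bsub>PA\<^esub> single (K e)) r)"
proof -
  obtain u as where r: "r = (u, as)" by (cases r)
  have "(lin_comb S c F \<otimes>\<^bsub>PA\<^esub> lin_comb T d K) r =
      (\<Sum>k\<le>length as. \<Sum>a\<in>S. \<Sum>e\<in>T. (c a * single (F a) (u, take k as)) *
        (d e * single (K e) (awlast u (take k as), drop k as)))"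
    unfolding r path_algebra_simps(5) lin_comb_def by (simp add: sum_product)
  also have "\<dots> = (\<Sum>a\<in>S. \<Sum>k\<le>length as. \<Sum>e\<in>T. (c a * single (F a) (u, take k as)) *
        (d e * single (K e) (awlast u (take k as), drop k as)))"
    by (rule sum.swap)
  also have "\<dots> = (\<Sum>a\<in>S. \<Sum>e\<in>T. \<Sum>k\<le>length as. (c a * single (F a) (u, take k as)) *
        (d e * single (K e) (awlast u (take k as), drop k as)))"
    by (intro sum.cong refl sum.swap)
  also have "\<dots> = (\<Sum>a\<in>S. \<Sum>e\<in>T. c a * d e * (single (F a) \<otimes>\<^bsub>PA\<^esub> single (K e)) r)"
    unfolding r path_algebra_simps(5) by (simp add: sum_distrib_left mult_ac)
  finally show ?thesis .
qed

text \<open>Scalar multiplication on the quotient is a union over all representatives. The cosets in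
  this union coincide, since two representatives differ by an element of the ideal and the ideal is
  closed under scalars.\<close>

lemma quot_smult:
  assumes I: "ideal I PA" and g: "g \<in> carrier PA"
  shows "c \<odot>\<^bsub>quot_algebra PA I\<^esub> (I +>\<^bsub>PA\<^esub> g) = I +>\<^bsub>PA\<^esub> (c \<odot>\<^bsub>PA\<^esub> g)"
proof -
  interpret I: ideal I PA by (rule I)
  have eq: "I +>\<^bsub>PA\<^esub> (c \<odot>\<^bsub>PA\<^esub> x) = I +>\<^bsub>PA\<^esub> (c \<odot>\<^bsub>PA\<^esub> g)" if "x \<in> I +>\<^bsub>PA\<^esub> g" for x
  proof -
    obtain i where i: "i \<in> I" "x = i \<oplus>\<^bsub>PA\<^esub> g" using \<open>x \<in> I +>\<^bsub>PA\<^esub> g\<close> by (auto simp: a_r_coset_def')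
    have ic: "i \<in> carrier PA" using i(1) I.a_subset by blast
    then have x: "x \<in> carrier PA" using i g by simp
    have "(c \<odot>\<^bsub>PA\<^esub> x) \<ominus>\<^bsub>PA\<^esub> (c \<odot>\<^bsub>PA\<^esub> g) = c \<odot>\<^bsub>PA\<^esub> i"
      unfolding PA_minus [OF PA_smult_closed [OF g]]
      unfolding i(2) path_algebra_simps(3,4) by (simp add: algebra_simps)
    then have "(c \<odot>\<^bsub>PA\<^esub> x) \<ominus>\<^bsub>PA\<^esub> (c \<odot>\<^bsub>PA\<^esub> g) \<in> I" using ideal_smult_closed [OF I i(1)] by simp
    then show ?thesis
      using PA.quotient_eq_iff_same_a_r_cos [OF I PA_smult_closed [OF x] PA_smult_closed [OF g]] by simp
  qed
  have mem: "g \<in> I +>\<^bsub>PA\<^esub> g" using I.a_rcos_self g by simp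
  have "(\<Union>x\<in>I +>\<^bsub>PA\<^esub> g. I +>\<^bsub>PA\<^esub> (c \<odot>\<^bsub>PA\<^esub> x)) = I +>\<^bsub>PA\<^esub> (c \<odot>\<^bsub>PA\<^esub> g)"
    by (rule UN_constant_eq [OF mem ballI [OF eq]])
  then show ?thesis unfolding quot_algebra_def by simp
qed

end

lemma (in path_labelling) label_idealD: "z \<in> label_ideal \<Longrightarrow> label_sum z l = 0"
  by (simp add: label_ideal_def)

lemma (in path_labelling) label_idealI:
  "z \<in> carrier PA \<Longrightarrow> (\<And>l. label_sum z l = 0) \<Longrightarrow> z \<in> label_ideal"
  by (simp add: label_ideal_def)

lemma (in path_labelling) label_sum_lin_comb:
  assumes "finite S" "\<And>a. a \<in> S \<Longrightarrow> F a \<in> paths G"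
  shows "label_sum (lin_comb S c F) l = (\<Sum>a\<in>S. if \<kappa> (F a) = l then c a else 0)"
  using assms
proof (induction S rule: finite_induct)
  case empty
  then show ?case by (simp add: lin_comb_def label_sum_def)
next
  case (insert a S)
  have "label_sum (lin_comb (insert a S) c F) l =
      c a * label_sum (single (F a)) l + 1 * label_sum (lin_comb S c F) l"
    unfolding lin_comb_insert [OF insert.hyps]
    by (rule label_sum_add) (use insert in \<open>auto intro: lin_comb_closed\<close>)
  then show ?case using insert by (simp add: label_sum_single)
qed

locale weighted_quiver = fin_digraph G for G :: "('v, 'a) pre_digraph" +
  fixes \<omega> :: "'a \<Rightarrow> nat"
begin

definition weight :: "'a list \<Rightarrow> nat" where
  "weight as = (\<Sum>a\<leftarrow>as. \<omega> a)"

lemma weight_simps [simp]: "weight [] = 0" "weight (a # as) = \<omega> a + weight as"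
    "weight (as @ bs) = weight as + weight bs"
  by (simp_all add: weight_def)

definition wlabel :: "('v, 'a) qpath \<Rightarrow> 'v \<times> 'v \<times> nat" where
  "wlabel p = (fst p, awlast (fst p) (snd p), weight (snd p))"

sublocale path_labelling G wlabel
  by unfold_locales (simp_all add: wlabel_def awlast_append')

end

text \<open>Arrows of \<open>H\<close> are sent to paths of \<open>G\<close>, and the vertices of
  \<open>H\<close> to distinct vertices of \<open>G\<close>. \<open>lift\<close> is surjectivity up
  to weight: each path of \<open>G\<close> between such vertices has the weight of some path of
  \<open>H\<close> between their preimages. It makes the induced map onto the corner of the quotient
  surjective.\<close>

locale quiver_map = G: weighted_quiver G \<omega> + H: weighted_quiver H \<omega>'
  for G :: "('v, 'a) pre_digraph" and \<omega> :: "'a \<Rightarrow> nat"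
    and H :: "('w, 'c) pre_digraph" and \<omega>' :: "'c \<Rightarrow> nat" +
  fixes b :: "'w \<Rightarrow> 'v" and arr :: "'c \<Rightarrow> 'a list"
  assumes b_inj: "inj_on b (verts H)"
    and b_verts: "b ` verts H \<subseteq> verts G"
    and arr_walk: "e \<in> arcs H \<Longrightarrow> G.awalk (b (tail H e)) (arr e) (b (head H e))"
    and arr_weight: "e \<in> arcs H \<Longrightarrow> G.weight (arr e) = \<omega>' e"
    and lift: "\<lbrakk>i \<in> verts H; j \<in> verts H; G.awalk (b i) p (b j)\<rbrakk> \<Longrightarrow>
      \<exists>q. H.awalk i q j \<and> H.weight q = G.weight p"
begin

definition pmap :: "('w, 'c) qpath \<Rightarrow> ('v, 'a) qpath" where
  "pmap p = (b (fst p), concat (map arr (snd p)))"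

lemma pmap_walk: "H.awalk i q j \<Longrightarrow> G.awalk (b i) (concat (map arr q)) (b j)"
proof (induction q arbitrary: i)
  case Nil
  then show ?case using b_verts by (auto simp: H.awalk_Nil_iff G.awalk_Nil_iff)
next
  case (Cons e q)
  then have e: "e \<in> arcs H" "i = tail H e" "H.awalk (head H e) q j" by (simp_all add: H.awalk_Cons_iff)
  have "G.awalk (b i) (arr e @ concat (map arr q)) (b j)"
    unfolding e(2) by (rule G.awalk_appendI [OF arr_walk [OF e(1)] Cons.IH [OF e(3)]])
  then show ?case by simp
qed

lemma pmap_weight: "H.awalk i q j \<Longrightarrow> G.weight (concat (map arr q)) = H.weight q"
  by (induction q arbitrary: i) (auto simp: H.awalk_Cons_iff arr_weight)

lemma path_walk: "p \<in> paths H \<Longrightarrow> H.awalk (fst p) (snd p) (H.awlast (fst p) (snd p))"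
  using H.mem_paths_iff [of "fst p" "snd p"] by simp

lemma pmap_path:
  assumes p: "p \<in> paths H"
  shows "pmap p \<in> paths G" "G.awlast (fst (pmap p)) (snd (pmap p)) = b (H.awlast (fst p) (snd p))"
    "G.weight (snd (pmap p)) = H.weight (snd p)"
proof -
  have w: "G.awalk (fst (pmap p)) (snd (pmap p)) (b (H.awlast (fst p) (snd p)))"
    unfolding pmap_def using pmap_walk [OF path_walk [OF p]] by simp
  show "pmap p \<in> paths G" using G.mem_pathsI [OF w] by simp
  show "G.awlast (fst (pmap p)) (snd (pmap p)) = b (H.awlast (fst p) (snd p))"
    using w by simp
  show "G.weight (snd (pmap p)) = H.weight (snd p)"
    unfolding pmap_def using pmap_weight [OF path_walk [OF p]] by simp
qed

lemma path_ends_verts: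
  assumes p: "p \<in> paths H"
  shows "fst p \<in> verts H" "H.awlast (fst p) (snd p) \<in> verts H"
  using path_walk [OF p] H.awalk_hd_in_verts H.awalk_last_in_verts by blast+

lemma pmap_label_iff:
  assumes "p \<in> paths H" "q \<in> paths H"
  shows "G.wlabel (pmap p) = G.wlabel (pmap q) \<longleftrightarrow> H.wlabel p = H.wlabel q"
proof -
  have "fst (pmap r) = b (fst r)" for r by (simp add: pmap_def)
  then show ?thesis
    using pmap_path(2,3) [OF assms(1)] pmap_path(2,3) [OF assms(2)]
      inj_on_eq_iff [OF b_inj path_ends_verts(1) [OF assms(1)] path_ends_verts(1) [OF assms(2)]]
      inj_on_eq_iff [OF b_inj path_ends_verts(2) [OF assms(1)] path_ends_verts(2) [OF assms(2)]]
    unfolding G.wlabel_def H.wlabel_def by simp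
qed

definition push :: "(('w, 'c) qpath \<Rightarrow> complex) \<Rightarrow> ('v, 'a) qpath \<Rightarrow> complex" where
  "push g = lin_comb {p. g p \<noteq> 0} g pmap"

lemma push_superset:
  assumes "finite S" "{p. g p \<noteq> 0} \<subseteq> S"
  shows "push g = lin_comb S g pmap"
  unfolding push_def lin_comb_def
  by (rule ext, rule sum.mono_neutral_left [OF assms]) simp

lemma push_lin_comb:
  assumes S: "finite S"
  shows "push (lin_comb S c F) = lin_comb S c (\<lambda>a. pmap (F a))"
proof
  fix q
  have sub: "{p. lin_comb S c F p \<noteq> 0} \<subseteq> F ` S"
  proof
    fix p assume "p \<in> {p. lin_comb S c F p \<noteq> 0}"
    then have "(\<Sum>a\<in>S. c a * single (F a) p) \<noteq> 0" by (simp add: lin_comb_def)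
    then obtain a where "a \<in> S" "c a * single (F a) p \<noteq> 0" by (rule sum.not_neutral_contains_not_neutral)
    then show "p \<in> F ` S" by (auto simp: single_def split: if_splits)
  qed
  then have "push (lin_comb S c F) q = (\<Sum>p\<in>F ` S. lin_comb S c F p * single (pmap p) q)"
    unfolding push_superset [OF finite_imageI [OF S] sub] by (simp only: lin_comb_def [of "F ` S"])
  also have "\<dots> = (\<Sum>p\<in>F ` S. \<Sum>a\<in>S. c a * single (F a) p * single (pmap p) q)"
    by (simp add: lin_comb_def sum_distrib_right)
  also have "\<dots> = (\<Sum>a\<in>S. \<Sum>p\<in>F ` S. c a * single (F a) p * single (pmap p) q)"
    by (rule sum.swap)
  also have "\<dots> = (\<Sum>a\<in>S. c a * single (pmap (F a)) q)"
  proof (rule sum.cong [OF refl])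
    fix a assume a: "a \<in> S"
    have "(\<Sum>p\<in>F ` S. c a * single (F a) p * single (pmap p) q) =
        (\<Sum>p\<in>F ` S. if p = F a then c a * single (pmap (F a)) q else 0)"
      by (rule sum.cong [OF refl]) (simp add: single_def)
    also have "\<dots> = (if F a \<in> F ` S then c a * single (pmap (F a)) q else 0)"
      by (rule sum.delta [OF finite_imageI [OF S]])
    finally show "(\<Sum>p\<in>F ` S. c a * single (F a) p * single (pmap p) q) = c a * single (pmap (F a)) q"
      using a by simp
  qed
  finally show "push (lin_comb S c F) q = lin_comb S c (\<lambda>a. pmap (F a)) q"
    by (simp add: lin_comb_def)
qed

lemma push_closed:
  assumes "g \<in> carrier H.PA"
  shows "push g \<in> carrier G.PA"
  unfolding push_def
  by (rule G.lin_comb_closed) (use H.carrier_support [OF assms] pmap_path(1) in auto)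

lemma push_add:
  assumes g: "g \<in> carrier H.PA" and h: "h \<in> carrier H.PA"
  shows "push (g \<oplus>\<^bsub>H.PA\<^esub> h) = push g \<oplus>\<^bsub>G.PA\<^esub> push h"
proof -
  let ?S = "{p. g p \<noteq> 0} \<union> {p. h p \<noteq> 0}"
  have S: "finite ?S" using H.carrier_support(1) g h by simp
  have "{p. (g \<oplus>\<^bsub>H.PA\<^esub> h) p \<noteq> 0} \<subseteq> ?S"
    unfolding path_algebra_simps(3) by auto
  then have "push (g \<oplus>\<^bsub>H.PA\<^esub> h) = lin_comb ?S (g \<oplus>\<^bsub>H.PA\<^esub> h) pmap"
    by (rule push_superset [OF S])
  moreover have "push g = lin_comb ?S g pmap" "push h = lin_comb ?S h pmap"
    by (rule push_superset [OF S], simp)+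
  ultimately show ?thesis
    unfolding path_algebra_simps(3) lin_comb_def by (simp add: fun_eq_iff distrib_right sum.distrib)
qed

lemma push_smult:
  assumes g: "g \<in> carrier H.PA"
  shows "push (c \<odot>\<^bsub>H.PA\<^esub> g) = c \<odot>\<^bsub>G.PA\<^esub> push g"
proof -
  let ?S = "{p. g p \<noteq> 0}"
  have S: "finite ?S" using H.carrier_support(1) g by simp
  have "{p. (c \<odot>\<^bsub>H.PA\<^esub> g) p \<noteq> 0} \<subseteq> ?S" unfolding path_algebra_simps(4) by auto
  then have "push (c \<odot>\<^bsub>H.PA\<^esub> g) = lin_comb ?S (c \<odot>\<^bsub>H.PA\<^esub> g) pmap"
    by (rule push_superset [OF S])
  then show ?thesis
    unfolding path_algebra_simps(4) push_def lin_comb_def by (simp add: fun_eq_iff sum_distrib_left mult.assoc)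
qed

lemma push_mult:
  assumes g: "g \<in> carrier H.PA" and h: "h \<in> carrier H.PA"
  shows "push (g \<otimes>\<^bsub>H.PA\<^esub> h) = push g \<otimes>\<^bsub>G.PA\<^esub> push h"
proof -
  let ?S = "{p. g p \<noteq> 0}" and ?T = "{p. h p \<noteq> 0}"
  have fin: "finite ?S" "finite ?T" using H.carrier_support(1) g h by simp_all
  \<comment> \<open>The pairs that compose. Since \<open>b\<close> is injective on vertices,
    \<open>pmap\<close> sends composable pairs to composable pairs and all others to pairs whose
    product vanishes, so both products are indexed by \<open>U\<close>.\<close>
  define U where "U = {ac \<in> ?S \<times> ?T. fst (snd ac) = H.awlast (fst (fst ac)) (snd (fst ac))}"
  have U: "finite U" unfolding U_def using fin by simp
  define k where "k = (\<lambda>ac. g (fst ac) * h (snd ac))"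
  define J where "J = (\<lambda>ac :: ('w, 'c) qpath \<times> ('w, 'c) qpath. (fst (fst ac), snd (fst ac) @ snd (snd ac)))"
  have U_sum: "(\<Sum>a\<in>?S. \<Sum>c\<in>?T. g a * h c * (if fst c = H.awlast (fst a) (snd a) then f (J (a, c)) else 0)) =
      (\<Sum>ac\<in>U. k ac * f (J ac))" for f :: "('w, 'c) qpath \<Rightarrow> complex"
  proof -
    have "(\<Sum>a\<in>?S. \<Sum>c\<in>?T. g a * h c * (if fst c = H.awlast (fst a) (snd a) then f (J (a, c)) else 0)) =
        (\<Sum>ac\<in>?S \<times> ?T. g (fst ac) * h (snd ac) * (if fst (snd ac) = H.awlast (fst (fst ac)) (snd (fst ac)) then f (J ac) else 0))"
      by (simp only: sum.cartesian_product case_prod_unfold prod.collapse)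
    also have "\<dots> = (\<Sum>ac\<in>?S \<times> ?T. if fst (snd ac) = H.awlast (fst (fst ac)) (snd (fst ac)) then k ac * f (J ac) else 0)"
      by (rule sum.cong [OF refl]) (simp add: k_def)
    also have "\<dots> = (\<Sum>ac\<in>U. k ac * f (J ac))"
      unfolding U_def by (rule sum.inter_filter [symmetric]) (use fin in simp)
    finally show ?thesis .
  qed
  have mult: "g \<otimes>\<^bsub>H.PA\<^esub> h = lin_comb U k J"
  proof
    fix r
    have "(g \<otimes>\<^bsub>H.PA\<^esub> h) r = (\<Sum>a\<in>?S. \<Sum>c\<in>?T. g a * h c * (single a \<otimes>\<^bsub>H.PA\<^esub> single c) r)"
      by (rule H.mult_decomp [OF fin(1) subset_refl fin(2) subset_refl])
    also have "\<dots> = (\<Sum>a\<in>?S. \<Sum>c\<in>?T. g a * h c * (if fst c = H.awlast (fst a) (snd a) then single (J (a, c)) r else 0))"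
    proof (intro sum.cong refl)
      fix a c
      show "g a * h c * (single a \<otimes>\<^bsub>H.PA\<^esub> single c) r =
        g a * h c * (if fst c = H.awlast (fst a) (snd a) then single (J (a, c)) r else 0)"
        using H.single_mult_single [of "fst a" "snd a" "fst c" "snd c"] by (simp add: J_def)
    qed
    also have "\<dots> = (\<Sum>ac\<in>U. k ac * single (J ac) r)" by (rule U_sum)
    finally show "(g \<otimes>\<^bsub>H.PA\<^esub> h) r = lin_comb U k J r" by (simp add: lin_comb_def)
  qed
  have "push (g \<otimes>\<^bsub>H.PA\<^esub> h) = lin_comb U k (\<lambda>a. pmap (J a))"
    unfolding mult by (rule push_lin_comb [OF U])
  also have "\<dots> = push g \<otimes>\<^bsub>G.PA\<^esub> push h"
  proof
    fix r
    have "(push g \<otimes>\<^bsub>G.PA\<^esub> push h) r = (\<Sum>a\<in>?S. \<Sum>c\<in>?T. g a * h c * (single (pmap a) \<otimes>\<^bsub>G.PA\<^esub> single (pmap c)) r)"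
      unfolding push_def by (rule G.lin_comb_mult)
    also have "\<dots> = (\<Sum>a\<in>?S. \<Sum>c\<in>?T. g a * h c * (if fst c = H.awlast (fst a) (snd a) then single (pmap (J (a, c))) r else 0))"
    proof (rule sum.cong [OF refl], rule sum.cong [OF refl])
      fix a c assume ac: "a \<in> ?S" "c \<in> ?T"
      have a: "a \<in> paths H" and c: "c \<in> paths H" using ac H.carrier_support(2) g h by simp_all
      have "fst (pmap c) = G.awlast (fst (pmap a)) (snd (pmap a)) \<longleftrightarrow> fst c = H.awlast (fst a) (snd a)"
        unfolding pmap_path(2) [OF a]
        using inj_on_eq_iff [OF b_inj path_ends_verts(1) [OF c] path_ends_verts(2) [OF a]] by (simp add: pmap_def)
      moreover have "(fst (pmap a), snd (pmap a) @ snd (pmap c)) = pmap (J (a, c))"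
        by (simp add: pmap_def J_def)
      ultimately show "g a * h c * (single (pmap a) \<otimes>\<^bsub>G.PA\<^esub> single (pmap c)) r =
        g a * h c * (if fst c = H.awlast (fst a) (snd a) then single (pmap (J (a, c))) r else 0)"
        using G.single_mult_single [of "fst (pmap a)" "snd (pmap a)" "fst (pmap c)" "snd (pmap c)"] by simp
    qed
    also have "\<dots> = (\<Sum>ac\<in>U. k ac * single (pmap (J ac)) r)" by (rule U_sum)
    finally show "lin_comb U k (\<lambda>a. pmap (J a)) r = (push g \<otimes>\<^bsub>G.PA\<^esub> push h) r" by (simp add: lin_comb_def)
  qed
  finally show ?thesis .
qed

section \<open>The corner of the quotient at the images of the vertices\<close>

definition corner_unit :: "('v, 'a) qpath \<Rightarrow> complex" where
  "corner_unit = (\<Oplus>\<^bsub>G.PA\<^esub>v\<in>b ` verts H. single (v, []))"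

lemma trivial_path: "v \<in> b ` verts H \<Longrightarrow> (v, []) \<in> paths G"
  using b_verts by (auto simp: G.mem_paths_iff G.awalk_Nil_iff)

lemma corner_unit_eq: "corner_unit = lin_comb (verts H) (\<lambda>_. 1) (\<lambda>i. (b i, []))"
proof
  fix p
  have "corner_unit p = (\<Sum>v\<in>b ` verts H. single (v, []) p)"
    unfolding corner_unit_def by (rule G.finsum_apply) (simp_all add: trivial_path)
  also have "\<dots> = (\<Sum>i\<in>verts H. single (b i, []) p)"
    by (rule sum.reindex_cong [OF b_inj refl]) simp
  finally show "corner_unit p = lin_comb (verts H) (\<lambda>_. 1) (\<lambda>i. (b i, [])) p"
    by (simp add: lin_comb_def)
qed

lemma corner_unit_closed: "corner_unit \<in> carrier G.PA"
  unfolding corner_unit_def by (rule G.PA.finsum_closed) (use trivial_path in auto)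

lemma push_one: "push \<one>\<^bsub>H.PA\<^esub> = corner_unit"
proof -
  have "\<one>\<^bsub>H.PA\<^esub> = lin_comb (verts H) (\<lambda>_. 1) (\<lambda>i. (i, []))"
  proof
    fix p :: "('w, 'c) qpath"
    have "lin_comb (verts H) (\<lambda>_. 1) (\<lambda>i. (i, [])) p = (\<Sum>i\<in>verts H. if i = fst p then (if snd p = [] then 1 else 0) else 0)"
      unfolding lin_comb_def by (rule sum.cong [OF refl]) (auto simp: single_def prod_eq_iff)
    also have "\<dots> = (if fst p \<in> verts H then (if snd p = [] then 1 else 0) else 0)"
      by (rule sum.delta) simp
    finally show "\<one>\<^bsub>H.PA\<^esub> p = lin_comb (verts H) (\<lambda>_. 1) (\<lambda>i. (i, [])) p"
      by (simp add: path_algebra_simps(2))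
  qed
  then show ?thesis
    using push_lin_comb [of "verts H" "\<lambda>_. 1" "\<lambda>i. (i, [])"] by (simp add: corner_unit_eq pmap_def)
qed

abbreviation "IG \<equiv> G.label_ideal"
abbreviation "IH \<equiv> H.label_ideal"
abbreviation "cls z \<equiv> IG +>\<^bsub>G.PA\<^esub> z"
abbreviation "corner \<equiv> corner_algebra (quot_algebra G.PA IG) (cls corner_unit)"

sublocale IG: ideal IG G.PA by (rule G.label_ideal_ideal)
sublocale IH: ideal IH H.PA by (rule H.label_ideal_ideal)

lemma cls_eq_iff: "y \<in> carrier G.PA \<Longrightarrow> z \<in> carrier G.PA \<Longrightarrow> cls y = cls z \<longleftrightarrow> y \<ominus>\<^bsub>G.PA\<^esub> z \<in> IG"
  using G.PA.quotient_eq_iff_same_a_r_cos [OF G.label_ideal_ideal] by simp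

lemma cls_hom:
  assumes "y \<in> carrier G.PA" "z \<in> carrier G.PA"
  shows "cls y \<otimes>\<^bsub>G.PA Quot IG\<^esub> cls z = cls (y \<otimes>\<^bsub>G.PA\<^esub> z)" "cls y \<oplus>\<^bsub>G.PA Quot IG\<^esub> cls z = cls (y \<oplus>\<^bsub>G.PA\<^esub> z)"
  using ring_hom_mult [OF IG.rcos_ring_hom assms] ring_hom_add [OF IG.rcos_ring_hom assms] by simp_all

lemma corner_simps:
  "mult corner = mult (G.PA Quot IG)" "add corner = add (G.PA Quot IG)" "zero corner = zero (G.PA Quot IG)"
  "one corner = cls corner_unit" "smult corner = smult (quot_algebra G.PA IG)"
  by (simp_all add: corner_algebra_def quot_algebra_def)

lemma carrier_Quot: "carrier (G.PA Quot IG) = {cls z | z. z \<in> carrier G.PA}"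
  by (auto simp: FactRing_def A_RCOSETS_def')

lemma corner_carrier:
  "carrier corner = {cls (corner_unit \<otimes>\<^bsub>G.PA\<^esub> z \<otimes>\<^bsub>G.PA\<^esub> corner_unit) | z. z \<in> carrier G.PA}"
proof -
  have "carrier corner = {cls corner_unit \<otimes>\<^bsub>G.PA Quot IG\<^esub> x \<otimes>\<^bsub>G.PA Quot IG\<^esub> cls corner_unit | x. x \<in> carrier (G.PA Quot IG)}"
    by (simp add: corner_algebra_def quot_algebra_def)
  also have "\<dots> = {cls (corner_unit \<otimes>\<^bsub>G.PA\<^esub> z \<otimes>\<^bsub>G.PA\<^esub> corner_unit) | z. z \<in> carrier G.PA}"
    unfolding carrier_Quot using cls_hom(1) corner_unit_closed G.PA_mult_closed by (auto, metis+)
  finally show ?thesis .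
qed

definition \<Psi> :: "(('w, 'c) qpath \<Rightarrow> complex) \<Rightarrow> (('v, 'a) qpath \<Rightarrow> complex) set" where
  "\<Psi> g = cls (push g)"

lemma \<Psi>_closed:
  assumes g: "g \<in> carrier H.PA"
  shows "\<Psi> g \<in> carrier corner"
proof -
  have "\<one>\<^bsub>H.PA\<^esub> \<otimes>\<^bsub>H.PA\<^esub> g \<otimes>\<^bsub>H.PA\<^esub> \<one>\<^bsub>H.PA\<^esub> = g" using g by simp
  then have "push g = push (\<one>\<^bsub>H.PA\<^esub> \<otimes>\<^bsub>H.PA\<^esub> g \<otimes>\<^bsub>H.PA\<^esub> \<one>\<^bsub>H.PA\<^esub>)" by (simp only:)
  also have "\<dots> = corner_unit \<otimes>\<^bsub>G.PA\<^esub> push g \<otimes>\<^bsub>G.PA\<^esub> corner_unit"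
    using g by (simp only: push_mult push_one H.PA_mult_closed H.PA.one_closed)
  finally have "\<Psi> g = cls (corner_unit \<otimes>\<^bsub>G.PA\<^esub> push g \<otimes>\<^bsub>G.PA\<^esub> corner_unit)"
    unfolding \<Psi>_def by (rule arg_cong)
  then show ?thesis unfolding corner_carrier using push_closed [OF g] by blast
qed

lemma \<Psi>_ring_hom: "\<Psi> \<in> ring_hom H.PA corner"
proof (rule ring_hom_memI)
  fix g h assume g: "g \<in> carrier H.PA" and h: "h \<in> carrier H.PA"
  show "\<Psi> g \<in> carrier corner" by (rule \<Psi>_closed [OF g])
  show "\<Psi> (g \<otimes>\<^bsub>H.PA\<^esub> h) = \<Psi> g \<otimes>\<^bsub>corner\<^esub> \<Psi> h"
    unfolding \<Psi>_def push_mult [OF g h] corner_simps by (rule cls_hom(1) [symmetric]) (use g h push_closed in simp_all)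
  show "\<Psi> (g \<oplus>\<^bsub>H.PA\<^esub> h) = \<Psi> g \<oplus>\<^bsub>corner\<^esub> \<Psi> h"
    unfolding \<Psi>_def push_add [OF g h] corner_simps by (rule cls_hom(2) [symmetric]) (use g h push_closed in simp_all)
next
  show "\<Psi> \<one>\<^bsub>H.PA\<^esub> = \<one>\<^bsub>corner\<^esub>" unfolding \<Psi>_def push_one corner_simps ..
qed

text \<open>\<open>pmap\<close> makes labels equal only when they were equal already, so the label
  sums of \<open>push g\<close> are those of \<open>g\<close>; at labels that are not hit the sums
  are zero.\<close>

lemma push_label_ideal_iff:
  assumes g: "g \<in> carrier H.PA"
  shows "push g \<in> IG \<longleftrightarrow> g \<in> IH"
proof -
  let ?S = "{p. g p \<noteq> 0}"
  have S: "finite ?S" "\<And>p. p \<in> ?S \<Longrightarrow> p \<in> paths H" using H.carrier_support [OF g] by simp_all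
  have GS: "G.label_sum (push g) l = (\<Sum>p\<in>?S. if G.wlabel (pmap p) = l then g p else 0)" for l
    unfolding push_def by (rule G.label_sum_lin_comb [OF S(1) pmap_path(1) [OF S(2)]])
  have HS: "H.label_sum g l = (\<Sum>p\<in>?S. if H.wlabel p = l then g p else 0)" for l
    by (simp add: H.label_sum_def)
  have eq: "G.label_sum (push g) (G.wlabel (pmap p)) = H.label_sum g (H.wlabel p)" if "p \<in> ?S" for p
    unfolding GS HS by (rule sum.cong [OF refl]) (use pmap_label_iff S(2) that in simp)
  show ?thesis
  proof
    assume "push g \<in> IG"
    then have 0: "G.label_sum (push g) l = 0" for l by (rule G.label_idealD)
    have "H.label_sum g l = 0" for l
    proof (cases "l \<in> H.wlabel ` ?S")
      case True
      then show ?thesis using eq 0 by auto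
    next
      case False
      then show ?thesis unfolding HS by (intro sum.neutral) auto
    qed
    then show "g \<in> IH" by (rule H.label_idealI [OF g])
  next
    assume "g \<in> IH"
    then have 0: "H.label_sum g l = 0" for l by (rule H.label_idealD)
    have "G.label_sum (push g) l = 0" for l
    proof (cases "l \<in> (\<lambda>p. G.wlabel (pmap p)) ` ?S")
      case True
      then show ?thesis using eq 0 by auto
    next
      case False
      then show ?thesis unfolding GS by (intro sum.neutral) auto
    qed
    then show "push g \<in> IG" by (rule G.label_idealI [OF push_closed [OF g]])
  qed
qed

lemma \<Psi>_surj: "\<Psi> ` carrier H.PA = carrier corner"
proof
  show "\<Psi> ` carrier H.PA \<subseteq> carrier corner" using \<Psi>_closed by blast
  show "carrier corner \<subseteq> \<Psi> ` carrier H.PA"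
  proof
    fix X assume "X \<in> carrier corner"
    then obtain z0 where z0: "z0 \<in> carrier G.PA" "X = cls (corner_unit \<otimes>\<^bsub>G.PA\<^esub> z0 \<otimes>\<^bsub>G.PA\<^esub> corner_unit)"
      unfolding corner_carrier by blast
    define z where "z = corner_unit \<otimes>\<^bsub>G.PA\<^esub> z0 \<otimes>\<^bsub>G.PA\<^esub> corner_unit"
    have z: "z \<in> carrier G.PA" unfolding z_def using z0 corner_unit_closed by (simp add: G.PA_mult_closed)
    have unit: "\<exists>i\<in>verts H. p = (b i, [])" if "corner_unit p \<noteq> 0" for p
    proof -
      have "(\<Sum>i\<in>verts H. 1 * single (b i, []) p) \<noteq> 0" using that unfolding corner_unit_eq lin_comb_def .
      then obtain i where "i \<in> verts H" "1 * single (b i, []) p \<noteq> 0" by (rule sum.not_neutral_contains_not_neutral)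
      then show ?thesis by (auto simp: single_def split: if_splits)
    qed
    \<comment> \<open>Multiplication by \<open>corner_unit\<close> on both sides leaves only paths
      that start and end at images of vertices of \<open>H\<close>.\<close>
    have ends: "fst p \<in> b ` verts H \<and> G.awlast (fst p) (snd p) \<in> b ` verts H" if p: "z p \<noteq> 0" for p
    proof -
      obtain u as where ua: "p = (u, as)" by (cases p)
      have "((corner_unit \<otimes>\<^bsub>G.PA\<^esub> z0) \<otimes>\<^bsub>G.PA\<^esub> corner_unit) (u, as) \<noteq> 0" using p ua z_def by simp
      then obtain k where k: "k \<le> length as" "(corner_unit \<otimes>\<^bsub>G.PA\<^esub> z0) (u, take k as) * corner_unit (G.awlast u (take k as), drop k as) \<noteq> 0"
        unfolding path_algebra_simps(5) by (metis (no_types, lifting) atMost_iff sum.not_neutral_contains_not_neutral)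
      then obtain i where i: "i \<in> verts H" "(G.awlast u (take k as), drop k as) = (b i, [])" using unit by fastforce
      then have "take k as = as" by simp
      then have e: "G.awlast u as = b i" using i(2) by simp
      have "(corner_unit \<otimes>\<^bsub>G.PA\<^esub> (z0 \<otimes>\<^bsub>G.PA\<^esub> corner_unit)) (u, as) \<noteq> 0"
        using p ua z_def by (simp add: G.PA_mult_assoc)
      then obtain m where "corner_unit (u, take m as) * (z0 \<otimes>\<^bsub>G.PA\<^esub> corner_unit) (G.awlast u (take m as), drop m as) \<noteq> 0"
        unfolding path_algebra_simps(5) [of _ corner_unit] by (metis (no_types, lifting) sum.not_neutral_contains_not_neutral)
      then obtain j where "j \<in> verts H" "(u, take m as) = (b j, [])" using unit by fastforce
      then show ?thesis using e i(1) ua by simp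
    qed
    let ?S = "{p. z p \<noteq> 0}"
    have S: "finite ?S" "\<And>p. p \<in> ?S \<Longrightarrow> p \<in> paths G" using G.carrier_support [OF z] by simp_all
    have "\<exists>q. q \<in> paths H \<and> G.wlabel (pmap q) = G.wlabel p" if p: "p \<in> ?S" for p
    proof -
      obtain i j where ij: "i \<in> verts H" "fst p = b i" "j \<in> verts H" "G.awlast (fst p) (snd p) = b j"
        using ends p by blast
      have "G.awalk (fst p) (snd p) (G.awlast (fst p) (snd p))"
        using G.mem_paths_iff [of "fst p" "snd p"] S(2) [OF p] by simp
      then have "G.awalk (fst p) (snd p) (b j)" unfolding ij(4) .
      then have "G.awalk (b i) (snd p) (b j)" unfolding ij(2) .
      then obtain q where q: "H.awalk i q j" "H.weight q = G.weight (snd p)" using lift ij by blast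
      have "(i, q) \<in> paths H" by (rule H.mem_pathsI [OF q(1)])
      moreover have "G.wlabel (pmap (i, q)) = G.wlabel p"
        using pmap_path [OF calculation] q ij by (simp add: G.wlabel_def pmap_def)
      ultimately show ?thesis by blast
    qed
    \<comment> \<open>A preimage of each path up to label, not up to equality. This suffices because
      the quotient identifies equally labelled paths.\<close>
    then obtain sec where sec: "\<And>p. p \<in> ?S \<Longrightarrow> sec p \<in> paths H \<and> G.wlabel (pmap (sec p)) = G.wlabel p" by metis
    define g where "g = lin_comb ?S z sec"
    have g: "g \<in> carrier H.PA" unfolding g_def by (rule H.lin_comb_closed [OF S(1)]) (use sec in blast)
    have pg: "push g = lin_comb ?S z (\<lambda>p. pmap (sec p))" unfolding g_def by (rule push_lin_comb [OF S(1)])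
    have "G.label_sum (push g) l = G.label_sum z l" for l
    proof -
      have "G.label_sum (push g) l = (\<Sum>p\<in>?S. if G.wlabel (pmap (sec p)) = l then z p else 0)"
        unfolding pg by (rule G.label_sum_lin_comb [OF S(1)]) (use sec pmap_path(1) in blast)
      also have "\<dots> = (\<Sum>p\<in>?S. if G.wlabel p = l then z p else 0)"
        by (rule sum.cong [OF refl]) (use sec in simp)
      finally show ?thesis by (simp add: G.label_sum_def)
    qed
    then have 0: "G.label_sum (\<lambda>p. 1 * push g p + (-1) * z p) l = 0" for l
      using G.label_sum_add [OF push_closed [OF g] z, of 1 "-1" l] by simp
    have "push g \<ominus>\<^bsub>G.PA\<^esub> z = (\<lambda>p. 1 * push g p + (-1) * z p)"
      unfolding G.PA_minus [OF z] by simp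
    then have "G.label_sum (push g \<ominus>\<^bsub>G.PA\<^esub> z) l = 0" for l using 0 by (simp only:)
    moreover have "push g \<ominus>\<^bsub>G.PA\<^esub> z \<in> carrier G.PA" using push_closed [OF g] z by simp
    ultimately have "push g \<ominus>\<^bsub>G.PA\<^esub> z \<in> IG" by (intro G.label_idealI)
    then have "\<Psi> g = X" unfolding \<Psi>_def z0(2) z_def [symmetric] using cls_eq_iff push_closed [OF g] z by simp
    then show "X \<in> \<Psi> ` carrier H.PA" using g by blast
  qed
qed

lemma cls_zero_iff: "z \<in> carrier G.PA \<Longrightarrow> cls z = \<zero>\<^bsub>G.PA Quot IG\<^esub> \<longleftrightarrow> z \<in> IG"
proof -
  assume z: "z \<in> carrier G.PA"
  have "\<zero>\<^bsub>G.PA Quot IG\<^esub> = IG" by (simp add: FactRing_def)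
  moreover have "cls \<zero>\<^bsub>G.PA\<^esub> = IG" by (rule G.PA.a_coset_add_zero) (rule IG.a_subset)
  moreover have "z \<ominus>\<^bsub>G.PA\<^esub> \<zero>\<^bsub>G.PA\<^esub> = z" using z by (simp add: a_minus_def)
  ultimately show ?thesis using cls_eq_iff [OF z G.PA.zero_closed] by simp
qed

text \<open>The corner is the image of a ring under the homomorphism \<open>\<Psi>\<close>, and so
  inherits the ring axioms without a separate study of the idempotent.\<close>

lemma corner_ring: "ring corner"
proof -
  have "ring (corner \<lparr> carrier := \<Psi> ` carrier H.PA, zero := \<Psi> \<zero>\<^bsub>H.PA\<^esub> \<rparr>)"
    by (rule H.PA.ring_hom_imp_img_ring [OF \<Psi>_ring_hom])
  moreover have "\<Psi> \<zero>\<^bsub>H.PA\<^esub> = zero corner"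
    unfolding \<Psi>_def corner_simps
    using cls_zero_iff [OF push_closed [OF H.PA.zero_closed]] push_label_ideal_iff [OF H.PA.zero_closed] by simp
  ultimately show ?thesis unfolding \<Psi>_surj by simp
qed

text \<open>The first isomorphism theorem for \<open>\<Psi>\<close> gives an isomorphism out of the
  quotient of \<open>H\<close>; its inverse is the one wanted. Every element of the corner is some
  \<open>\<Psi> g\<close>, where the inverse is explicit, and this shows compatibility with
  scalars.\<close>

theorem corner_isomorphic: "algebra_isomorphic corner (quot_algebra H.PA IH)"
proof -
  have hom: "ring_hom_ring H.PA corner \<Psi>"
    by (intro ring_hom_ringI2 H.PA_ring corner_ring \<Psi>_ring_hom)
  have ker: "a_kernel H.PA corner \<Psi> = IH"
  proof -
    have "a_kernel H.PA corner \<Psi> = {g \<in> carrier H.PA. \<Psi> g = \<zero>\<^bsub>corner\<^esub>}" by (simp add: a_kernel_def')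
    also have "\<dots> = {g \<in> carrier H.PA. g \<in> IH}"
      unfolding \<Psi>_def corner_simps by (rule Collect_cong) (use cls_zero_iff push_closed push_label_ideal_iff in blast)
    finally show ?thesis using IH.a_subset by auto
  qed
  define \<theta> where "\<theta> = (\<lambda>X. the_elem (\<Psi> ` X))"
  have \<theta>: "\<theta> \<in> ring_iso (H.PA Quot IH) corner"
    unfolding \<theta>_def ker [symmetric] by (rule ring_hom_ring.FactRing_iso_set [OF hom \<Psi>_surj])
  have \<theta>_cls: "\<theta> (IH +>\<^bsub>H.PA\<^esub> g) = \<Psi> g" if g: "g \<in> carrier H.PA" for g
  proof -
    have "\<Psi> x = \<Psi> g" if xg: "x \<in> IH +>\<^bsub>H.PA\<^esub> g" for x
    proof -
      obtain i where i: "i \<in> IH" "x = i \<oplus>\<^bsub>H.PA\<^esub> g" using xg by (auto simp: a_r_coset_def')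
      have ic: "i \<in> carrier H.PA" using i(1) IH.a_subset by blast
      have "\<Psi> x = \<Psi> i \<oplus>\<^bsub>corner\<^esub> \<Psi> g" unfolding i(2) by (rule ring_hom_add [OF \<Psi>_ring_hom ic g])
      moreover have "\<Psi> i = \<zero>\<^bsub>corner\<^esub>"
        unfolding \<Psi>_def corner_simps using cls_zero_iff [OF push_closed [OF ic]] push_label_ideal_iff [OF ic] i(1) by simp
      ultimately show ?thesis using ring.ring_simprules(8) [OF corner_ring \<Psi>_closed [OF g]] by simp
    qed
    moreover have "g \<in> IH +>\<^bsub>H.PA\<^esub> g" using IH.a_rcos_self g by simp
    ultimately have "\<Psi> ` (IH +>\<^bsub>H.PA\<^esub> g) = {\<Psi> g}" by blast
    then show ?thesis by (simp add: \<theta>_def)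
  qed
  let ?\<phi> = "inv_into (carrier (H.PA Quot IH)) \<theta>"
  have \<phi>: "?\<phi> \<in> ring_iso corner (H.PA Quot IH)"
    by (rule ring_iso_set_sym [OF IH.quotient_is_ring \<theta>])
  have inj: "inj_on \<theta> (carrier (H.PA Quot IH))" using \<theta> by (simp add: ring_iso_def bij_betw_def)
  have carrier: "IH +>\<^bsub>H.PA\<^esub> g \<in> carrier (H.PA Quot IH)" if "g \<in> carrier H.PA" for g
    using that by (auto simp: FactRing_def A_RCOSETS_def')
  have \<phi>_\<Psi>: "?\<phi> (\<Psi> g) = IH +>\<^bsub>H.PA\<^esub> g" if "g \<in> carrier H.PA" for g
    using inv_into_f_f [OF inj carrier [OF that]] \<theta>_cls [OF that] by simp
  have "?\<phi> \<in> ring_iso corner (quot_algebra H.PA IH)"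
    using \<phi> unfolding ring_iso_def ring_hom_def quot_algebra_def by simp
  moreover have "?\<phi> (c \<odot>\<^bsub>corner\<^esub> x) = c \<odot>\<^bsub>quot_algebra H.PA IH\<^esub> ?\<phi> x" if "x \<in> carrier corner" for c x
  proof -
    obtain g where g: "g \<in> carrier H.PA" "x = \<Psi> g" using \<Psi>_surj \<open>x \<in> carrier corner\<close> by blast
    have "c \<odot>\<^bsub>corner\<^esub> x = \<Psi> (c \<odot>\<^bsub>H.PA\<^esub> g)"
      unfolding g(2) \<Psi>_def corner_simps push_smult [OF g(1)]
      by (rule G.quot_smult [OF G.label_ideal_ideal push_closed [OF g(1)]])
    then show ?thesis
      using \<phi>_\<Psi> [OF g(1)] \<phi>_\<Psi> [OF H.PA_smult_closed [OF g(1)]] g(2) H.quot_smult [OF H.label_ideal_ideal g(1)] by simp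
  qed
  ultimately show ?thesis unfolding algebra_isomorphic_def by blast
qed

end

section \<open>Faces and flips\<close>

text \<open>Since the arrows of a face are distinct, only one rotation starts with \<open>a\<close>,
  so the definite description is determined.\<close>

lemma face_return_split:
  assumes c: "c = xs @ a # ys" and "distinct c"
  shows "face_return c a = ys @ xs"
proof -
  have a: "a \<notin> set xs" "a \<notin> set ys" using assms by simp_all
  have "rotate (length xs) c = a # (ys @ xs)"
    using rotate_append [of xs "a # ys"] by (simp add: c)
  moreover have "r = ys @ xs" if "rotate l c = a # r" for l r
  proof -
    define m where "m = l mod length c"
    have "m < length c" by (simp add: m_def c)
    then have ne: "drop m c \<noteq> []" by simp
    have eq: "drop m c @ take m c = a # r"
      using that rotate_drop_take [of l c] by (simp add: m_def)
    obtain zs where zs: "drop m c = a # zs" "zs @ take m c = r"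
      using eq ne by (cases "drop m c") simp_all
    have "xs @ a # ys = take m c @ a # zs"
      using append_take_drop_id [of m c] unfolding zs(1) c [symmetric] by (rule sym)
    then have "xs = take m c \<and> ys = zs"
      using append_Cons_eq_iff [OF a] by blast
    then show ?thesis using zs by simp
  qed
  ultimately show ?thesis
    unfolding face_return_def by (intro the_equality) blast+
qed

context dimer_model_in_disk
begin

abbreviation "tla \<equiv> tail (quiver Q)"
abbreviation "hda \<equiv> head (quiver Q)"

sublocale fin_digraph "quiver Q" by (rule finite_quiver)
sublocale loopfree_digraph "quiver Q" by (rule no_loops)

lemma face_arcs: "c \<in> faces Q \<Longrightarrow> set c \<subseteq> arcs (quiver Q)"
  using face_cycle unfolding awalk_def by blast

lemma finite_faces: "finite (faces Q)"
proof -
  have "faces Q \<subseteq> {c. set c \<subseteq> arcs (quiver Q) \<and> distinct c}"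
    using face_arcs face_distinct by blast
  then show ?thesis
    by (rule finite_subset) (rule finite_subset_distinct, simp)
qed

definition cc_face :: "'a \<Rightarrow> 'a list" where
  "cc_face a = (THE c. c \<in> cc_faces Q \<and> a \<in> set c)"

definition cl_face :: "'a \<Rightarrow> 'a list" where
  "cl_face a = (THE c. c \<in> cl_faces Q \<and> a \<in> set c)"

text \<open>The two colours are disjoint, so the faces supplied by \<open>internal_faces\<close>
  differ and exhaust the two faces counted in \<open>internal_arrows\<close>.\<close>

lemma internal_arrow_faces:
  assumes "a \<in> internal_arrows Q"
  shows "cc_face a \<in> cc_faces Q" "cl_face a \<in> cl_faces Q" "a \<in> set (cc_face a)" "a \<in> set (cl_face a)"
    "{c \<in> faces Q. a \<in> set c} = {cc_face a, cl_face a}" "cc_face a \<noteq> cl_face a"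
proof -
  obtain c d where c: "c \<in> cc_faces Q" "a \<in> set c" and d: "d \<in> cl_faces Q" "a \<in> set d"
    using internal_faces [OF assms] by blast
  have cd: "c \<noteq> d" using c d faces_disjoint by blast
  have "card {c \<in> faces Q. a \<in> set c} = 2"
    using assms by (simp add: internal_arrows_def)
  moreover have "{c, d} \<subseteq> {c \<in> faces Q. a \<in> set c}"
    using c d by (simp add: faces_def)
  moreover have "finite {c \<in> faces Q. a \<in> set c}" using finite_faces by simp
  ultimately have eq: "{c \<in> faces Q. a \<in> set c} = {c, d}"
    using cd by (metis card_2_iff card_subset_eq)
  have "cc_face a = c" unfolding cc_face_def
  proof (rule the_equality)
    fix c' assume c': "c' \<in> cc_faces Q \<and> a \<in> set c'"
    then have "c' \<in> {c, d}" unfolding eq [symmetric] by (simp add: faces_def)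
    then show "c' = c" using c' d faces_disjoint by blast
  qed (use c in simp)
  moreover have "cl_face a = d" unfolding cl_face_def
  proof (rule the_equality)
    fix c' assume c': "c' \<in> cl_faces Q \<and> a \<in> set c'"
    then have "c' \<in> {c, d}" unfolding eq [symmetric] by (simp add: faces_def)
    then show "c' = d" using c' c faces_disjoint by blast
  qed (use d in simp)
  ultimately show "cc_face a \<in> cc_faces Q" "cl_face a \<in> cl_faces Q" "a \<in> set (cc_face a)" "a \<in> set (cl_face a)"
    "{c \<in> faces Q. a \<in> set c} = {cc_face a, cl_face a}" "cc_face a \<noteq> cl_face a"
    using c d eq cd by simp_all
qed

lemma boundary_arrow_faces:
  assumes "a \<in> boundary_arrows Q"
  shows "boundary_face Q a \<in> faces Q" "a \<in> set (boundary_face Q a)"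
    "{c \<in> faces Q. a \<in> set c} = {boundary_face Q a}"
proof -
  have "card {c \<in> faces Q. a \<in> set c} = 1"
    using assms by (simp add: boundary_arrows_def)
  then obtain c where c: "{c \<in> faces Q. a \<in> set c} = {c}"
    by (meson card_1_singletonE)
  have "boundary_face Q a = c" unfolding boundary_face_def
    by (rule the_equality) (use c in blast)+
  then show "boundary_face Q a \<in> faces Q" "a \<in> set (boundary_face Q a)"
    "{c \<in> faces Q. a \<in> set c} = {boundary_face Q a}"
    using c by blast+
qed

lemma boundary_internal_disjoint: "a \<in> boundary_arrows Q \<Longrightarrow> a \<notin> internal_arrows Q"
  by (simp add: boundary_arrows_def internal_arrows_def)

lemma arrow_in_face: "a \<in> arcs (quiver Q) \<Longrightarrow> \<exists>c\<in>faces Q. a \<in> set c"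
  using boundary_or_internal internal_arrow_faces(1,3) boundary_arrow_faces(1,2)
  unfolding faces_def by blast

lemma face_split:
  assumes "c \<in> faces Q" "a \<in> set c"
  obtains xs ys where "c = xs @ a # ys" "face_return c a = ys @ xs" "awalk (hda a) (ys @ xs) (tla a)"
proof -
  obtain xs ys where c: "c = xs @ a # ys" using split_list assms(2) by metis
  obtain v where "awalk v c v" using face_cycle [OF assms(1)] by blast
  then have "awalk (hda a) ys v" "awalk v xs (tla a)"
    unfolding c by (auto simp: awalk_Cons_iff)
  then have "awalk (hda a) (ys @ xs) (tla a)" by (rule awalk_appendI)
  moreover have "face_return c a = ys @ xs"
    using face_return_split [OF c face_distinct [OF assms(1)]] .
  ultimately show ?thesis using that c by blast
qed

lemma face_return_awalk:
  "c \<in> faces Q \<Longrightarrow> a \<in> set c \<Longrightarrow> awalk (hda a) (face_return c a) (tla a)"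
  by (metis face_split)

lemma set_face_return: "c \<in> faces Q \<Longrightarrow> a \<in> set c \<Longrightarrow> set (face_return c a) = set c - {a}"
  by (rule face_split, assumption+) (use face_distinct [of c] in auto)

lemma face_return_nonempty:
  assumes "c \<in> faces Q" "a \<in> set c"
  shows "face_return c a \<noteq> []"
proof
  assume "face_return c a = []"
  then have "awalk (hda a) [] (tla a)" using face_return_awalk [OF assms] by simp
  then have "tla a = hda a" by (simp add: awalk_Nil_iff)
  then show False using no_loops assms face_arcs loopfree_digraph.no_loops by blast
qed

text \<open>The cyclic predecessor of \<open>a\<close> in \<open>c\<close>, read off the return
  path. Strands are traced backwards with it.\<close>

definition pre_arrow :: "'a list \<Rightarrow> 'a \<Rightarrow> 'a" where
  "pre_arrow c a = last (face_return c a)"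

lemma pre_arrow:
  assumes "c \<in> faces Q" "a \<in> set c"
  shows "pre_arrow c a \<in> set c" "pre_arrow c a \<noteq> a" "hda (pre_arrow c a) = tla a"
proof -
  have "pre_arrow c a \<in> set (face_return c a)"
    unfolding pre_arrow_def using face_return_nonempty [OF assms] by simp
  then show "pre_arrow c a \<in> set c" "pre_arrow c a \<noteq> a"
    using set_face_return [OF assms] by auto
  show "hda (pre_arrow c a) = tla a"
    using awlast_of_awalk [OF face_return_awalk [OF assms]] face_return_nonempty [OF assms]
    unfolding pre_arrow_def by (simp add: awalk_verts_conv)
qed

lemma follows_in_face:
  assumes c: "c \<in> faces Q" and "follows_in c a a'"
  shows "a \<in> set c" "a' \<in> set c" "pre_arrow c a' = a" "\<exists>zs. face_return c a' = zs @ [a]"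
proof -
  obtain l where l: "l < length c" "c ! l = a" "c ! (Suc l mod length c) = a'"
    using assms(2) unfolding follows_in_def by blast
  have split: "c = take l c @ a # drop (Suc l) c"
    using id_take_nth_drop [OF l(1)] l(2) by simp
  show a: "a \<in> set c" using l by auto
  show a': "a' \<in> set c" using l c face_cycle by (metis length_greater_0_conv mod_less_divisor nth_mem)
  have ex: "\<exists>zs. face_return c a' = zs @ [a]"
  proof (cases "Suc l < length c")
    case True
    then have "drop (Suc l) c = a' # drop (Suc (Suc l)) c"
      using l(3) by (simp add: Cons_nth_drop_Suc [symmetric])
    then have c2: "c = (take l c @ [a]) @ a' # drop (Suc (Suc l)) c"
      using split by simp
    have "face_return c a' = drop (Suc (Suc l)) c @ take l c @ [a]"
      using face_return_split [OF c2 face_distinct [OF c]] .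
    then show ?thesis by (metis append.assoc)
  next
    case False
    then have last: "Suc l = length c" using l(1) by simp
    then have a0: "c ! 0 = a'" using l(3) by simp
    have "drop (Suc l) c = []" using last by simp
    then have c1: "c = take l c @ [a]" using split by simp
    \<comment> \<open>At the last position the successor is the first arrow. A face of length 1 is
      excluded because its arrow would be a loop.\<close>
    have "l \<noteq> 0"
    proof
      assume "l = 0"
      then have "c = [a]" using c1 by simp
      then have "face_return c a = []" using face_return_split [of c "[]" a "[]"] by simp
      then show False using face_return_nonempty [OF c a] by simp
    qed
    then obtain m where "l = Suc m" using not0_implies_Suc by blast
    then obtain zs where "take l c = a' # zs" using a0 l(1) by (cases c) simp_all
    then have c2: "c = [] @ a' # (zs @ [a])" using c1 by simp
    have "face_return c a' = (zs @ [a]) @ []"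
      using face_return_split [OF c2 face_distinct [OF c]] .
    then show ?thesis by simp
  qed
  then show "\<exists>zs. face_return c a' = zs @ [a]" .
  then show "pre_arrow c a' = a" unfolding pre_arrow_def by auto
qed

lemma face_paths_tail:
  assumes "c \<in> faces Q" "a \<in> set c"
  shows "a # face_return c a \<in> face_paths_at Q (tla a)"
proof -
  obtain xs ys where c: "c = xs @ a # ys" "face_return c a = ys @ xs" "awalk (hda a) (ys @ xs) (tla a)"
    using face_split [OF assms] .
  have "rotate (length xs) c = a # face_return c a"
    using rotate_append [of xs "a # ys"] c by simp
  moreover have "awalk (tla a) (a # face_return c a) (tla a)"
    using c(2,3) assms face_arcs by (auto simp: awalk_Cons_iff)
  ultimately show ?thesis unfolding face_paths_at_def using assms(1) by (metis (mono_tags, lifting) mem_Collect_eq)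
qed

lemma face_paths_head:
  assumes "c \<in> faces Q" "a \<in> set c"
  shows "face_return c a @ [a] \<in> face_paths_at Q (hda a)"
proof -
  obtain xs ys where c: "c = xs @ a # ys" "face_return c a = ys @ xs" "awalk (hda a) (ys @ xs) (tla a)"
    using face_split [OF assms] .
  have "rotate (length (xs @ [a])) ((xs @ [a]) @ ys) = ys @ xs @ [a]"
    by (rule rotate_append)
  then have "rotate (length (xs @ [a])) c = face_return c a @ [a]"
    unfolding c(2) by (simp add: c(1) del: length_append)
  moreover have "awalk (hda a) (face_return c a @ [a]) (hda a)"
    unfolding c(2) by (rule awalk_appendI [OF c(3)]) (use assms face_arcs in \<open>auto intro: arc_implies_awalk\<close>)
  ultimately show ?thesis unfolding face_paths_at_def using assms(1) by (metis (mono_tags, lifting) mem_Collect_eq)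
qed

text \<open>One rotation of a face is read in two ways, from its first arrow and from its last
  arrow. Face paths at a vertex are compared through either of these.\<close>

lemma face_paths_at_cases:
  assumes "p \<in> face_paths_at Q v"
  obtains c a a' where "c \<in> faces Q" "a \<in> set c" "p = a # face_return c a" "tla a = v"
    "a' \<in> set c" "p = face_return c a' @ [a']" "hda a' = v" "awalk v p v"
proof -
  obtain m c where c: "c \<in> faces Q" "p = rotate m c" "awalk v p v"
    using assms unfolding face_paths_at_def by blast
  have ne: "p \<noteq> []" "c \<noteq> []" using c face_cycle by auto
  have pset: "set p = set c" "distinct p" using c face_distinct by auto
  obtain a r where p1: "p = a # r" using ne by (cases p) auto
  obtain a' r' where p2: "p = r' @ [a']" using ne by (metis rev_exhaust)
  have "a \<in> set p" unfolding p1 by simp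
  moreover have "a' \<in> set p" unfolding p2 by simp
  ultimately have a: "a \<in> set c" "a' \<in> set c" using pset(1) by simp_all
  have "r = face_return c a"
  proof -
    obtain xs ys where x: "c = xs @ a # ys" "face_return c a = ys @ xs" using face_split [OF c(1) a(1)] .
    define m' where "m' = m mod length c"
    have "p = drop m' c @ take m' c" unfolding m'_def c(2) by (rule rotate_drop_take)
    moreover have "c = take m' c @ drop m' c" by simp
    moreover have "m' < length c" using ne by (simp add: m'_def)
    ultimately obtain zs where z: "drop m' c = a # zs" "r = zs @ take m' c"
      using p1 by (cases "drop m' c") auto
    then have c2: "c = take m' c @ a # zs" by (metis append_take_drop_id)
    have "face_return c a = zs @ take m' c"
      using face_return_split [OF c2 face_distinct [OF c(1)]] .
    then show ?thesis using z by simp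
  qed
  moreover have "r' = face_return c a'"
  proof -
    define m' where "m' = m mod length c"
    have pp: "p = drop m' c @ take m' c" unfolding m'_def c(2) by (rule rotate_drop_take)
    show ?thesis
    proof (cases "m' = 0")
      case True
      then have c2: "c = r' @ a' # []" using pp p2 by simp
      have "face_return c a' = [] @ r'"
        using face_return_split [OF c2 face_distinct [OF c(1)]] .
      then show ?thesis by simp
    next
      case False
      then have "take m' c \<noteq> []" using ne by simp
      then obtain zs z where z: "take m' c = zs @ [z]" by (metis rev_exhaust)
      then have zz: "z = a'" "r' = drop m' c @ zs" using pp p2 by auto
      have c2: "c = zs @ a' # drop m' c"
        using append_take_drop_id [of m' c] unfolding z zz(1) by simp
      have "face_return c a' = drop m' c @ zs"
        using face_return_split [OF c2 face_distinct [OF c(1)]] .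
      then show ?thesis using zz by simp
    qed
  qed
  moreover have "tla a = v" using c(3) unfolding p1 by (simp add: awalk_Cons_iff)
  moreover have "hda a' = v" using c(3) unfolding p2 by (auto simp: awalk_Cons_iff awalk_Nil_iff)
  ultimately show ?thesis using that [of c a a'] c a p1 p2 by blast
qed

text \<open>One application of a defining relation of the dimer algebra inside a longer list of
  arrows. The equivalence \<open>feq\<close> generated by it lives on bare arrow lists; being a walk
  with given ends is invariant under it, so it stands for equality of classes.\<close>

definition flip :: "'a list \<Rightarrow> 'a list \<Rightarrow> bool" where
  "flip p q \<longleftrightarrow> (\<exists>as bs a. a \<in> internal_arrows Q \<and>
    p = as @ face_return (cc_face a) a @ bs \<and> q = as @ face_return (cl_face a) a @ bs)"

definition feq :: "'a list \<Rightarrow> 'a list \<Rightarrow> bool" where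
  "feq = (symclp flip)\<^sup>*\<^sup>*"

lemma feq_refl [simp, intro]: "feq p p"
  by (simp add: feq_def)

lemma feq_sym: "feq p q \<Longrightarrow> feq q p"
  unfolding feq_def using symp_rtranclp [OF symp_on_symclp] by (rule sympD)

lemma feq_trans [trans]: "feq p q \<Longrightarrow> feq q r \<Longrightarrow> feq p r"
  unfolding feq_def by (rule rtranclp_trans)

lemma feq_induct [consumes 1, case_names refl flip flip']:
  assumes "feq p q" and "P p"
    and "\<And>q r. \<lbrakk>feq p q; P q; flip q r\<rbrakk> \<Longrightarrow> P r"
    and "\<And>q r. \<lbrakk>feq p q; P q; flip r q\<rbrakk> \<Longrightarrow> P r"
  shows "P q"
  using assms(1) unfolding feq_def
proof (induction rule: rtranclp_induct)
  case base then show ?case by (rule assms(2))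
next
  case (step y z)
  then show ?case using assms(3,4) unfolding feq_def symclp_def by blast
qed

lemma flip_feq: "flip p q \<Longrightarrow> feq p q"
  unfolding feq_def symclp_def by blast

lemma flip_append: "flip p q \<Longrightarrow> flip (as @ p @ bs) (as @ q @ bs)"
  unfolding flip_def by (metis append.assoc)

lemma feq_append_both: "feq p q \<Longrightarrow> feq (as @ p @ bs) (as @ q @ bs)"
  by (induction rule: feq_induct)
    (auto intro: feq_trans flip_feq flip_append feq_sym [OF flip_feq])

lemma feq_append:
  assumes "feq p q" "feq p' q'"
  shows "feq (p @ p') (q @ q')"
proof -
  have "feq (p @ p') (q @ p')" using feq_append_both [OF assms(1), of "[]" p'] by simp
  also have "feq (q @ p') (q @ q')" using feq_append_both [OF assms(2), of q "[]"] by simp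
  finally show ?thesis .
qed

lemma flip_awalk: "flip p q \<Longrightarrow> awalk u p v \<longleftrightarrow> awalk u q v"
proof -
  assume "flip p q"
  then obtain as bs a where a: "a \<in> internal_arrows Q"
    and pq: "p = as @ face_return (cc_face a) a @ bs" "q = as @ face_return (cl_face a) a @ bs"
    unfolding flip_def by blast
  define r1 where "r1 = face_return (cc_face a) a"
  define r2 where "r2 = face_return (cl_face a) a"
  have w: "awalk (hda a) r1 (tla a)" "awalk (hda a) r2 (tla a)" and ne: "r1 \<noteq> []" "r2 \<noteq> []"
    unfolding r1_def r2_def
    using internal_arrow_faces [OF a] face_return_awalk face_return_nonempty by (auto simp: faces_def)
  have *: "awalk u (as @ r @ bs) v \<longleftrightarrow> awalk u as (hda a) \<and> awalk (tla a) bs v"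
    if r: "awalk (hda a) r (tla a)" "r \<noteq> []" for r
  proof
    assume "awalk u (as @ r @ bs) v"
    then obtain y z where yz: "awalk u as y" "awalk y r z" "awalk z bs v" by auto
    then have "y = hda a" "z = tla a" using r awalk_ends by blast+
    then show "awalk u as (hda a) \<and> awalk (tla a) bs v" using yz by simp
  next
    assume "awalk u as (hda a) \<and> awalk (tla a) bs v"
    then show "awalk u (as @ r @ bs) v" using r by (blast intro: awalk_appendI)
  qed
  show ?thesis using * [OF w(1) ne(1)] * [OF w(2) ne(2)] pq unfolding r1_def r2_def by simp
qed

lemma feq_awalk: "feq p q \<Longrightarrow> awalk u p v \<longleftrightarrow> awalk u q v"
  by (induction rule: feq_induct) (simp_all add: flip_awalk)

lemma flip_nonempty: "flip p q \<Longrightarrow> p \<noteq> [] \<and> q \<noteq> []"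
  unfolding flip_def using internal_arrow_faces face_return_nonempty
  by (auto simp: faces_def)

lemma feq_Nil: "feq p q \<Longrightarrow> p = [] \<longleftrightarrow> q = []"
  by (induction rule: feq_induct) (use flip_nonempty in blast)+

lemma feq_face_return:
  assumes "c \<in> faces Q" "d \<in> faces Q" "a \<in> set c" "a \<in> set d"
  shows "feq (face_return c a) (face_return d a)"
proof (cases "a \<in> internal_arrows Q")
  case True
  then have "c \<in> {cc_face a, cl_face a}" "d \<in> {cc_face a, cl_face a}"
    using internal_arrow_faces(5) [OF True] assms by blast+
  moreover have "flip (face_return (cc_face a) a) (face_return (cl_face a) a)"
    unfolding flip_def using True by (metis append.left_neutral append.right_neutral)
  ultimately show ?thesis using flip_feq feq_sym by auto
next
  case False
  then have "a \<in> boundary_arrows Q"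
    using boundary_or_internal assms(3) face_arcs [OF assms(1)] by blast
  note eq = boundary_arrow_faces(3) [OF this]
  have "c \<in> {boundary_face Q a}" "d \<in> {boundary_face Q a}"
    unfolding eq [symmetric] using assms by simp_all
  then have "c = d" by simp
  then show ?thesis by simp
qed

definition face_paths_with :: "'v \<Rightarrow> 'a \<Rightarrow> 'a list set" where
  "face_paths_with v a = {p \<in> face_paths_at Q v. hd p = a \<or> last p = a}"

lemma face_paths_with_feq:
  assumes "p \<in> face_paths_with v a" "q \<in> face_paths_with v a"
  shows "feq p q"
proof -
  have p: "p \<in> face_paths_at Q v" "hd p = a \<or> last p = a" and q: "q \<in> face_paths_at Q v" "hd q = a \<or> last q = a"
    using assms by (auto simp: face_paths_with_def)
  obtain c a1 a1' where c: "c \<in> faces Q" "a1 \<in> set c" "p = a1 # face_return c a1" "tla a1 = v"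
    "a1' \<in> set c" "p = face_return c a1' @ [a1']" "hda a1' = v"
    using face_paths_at_cases [OF p(1)] .
  obtain d a2 a2' where d: "d \<in> faces Q" "a2 \<in> set d" "q = a2 # face_return d a2" "tla a2 = v"
    "a2' \<in> set d" "q = face_return d a2' @ [a2']" "hda a2' = v"
    using face_paths_at_cases [OF q(1)] .
  have hp: "hd p = a1" "hd q = a2"
    unfolding c(3) d(3) by simp_all
  have lp: "last p = a1'" "last q = a2'"
    unfolding c(6) d(6) by simp_all
  \<comment> \<open>Without loops the last arrow of a face path at \<open>v\<close> does not leave
    \<open>v\<close>, so the tail of \<open>a\<close> decides whether \<open>a\<close> is the first
    or the last arrow.\<close>
  have nl: "tla b \<noteq> hda b" if "b \<in> set c \<or> b \<in> set d" for b
    using that face_arcs [OF c(1)] face_arcs [OF d(1)] no_loops by blast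
  show ?thesis
  proof (cases "tla a = v")
    case True
    have "a \<noteq> a1'" "a \<noteq> a2'" using True nl [of a1'] nl [of a2'] c(5,7) d(5,7) by auto
    then have "a1 = a" "a2 = a" using p(2) q(2) hp lp by auto
    then show ?thesis
      using feq_append_both [OF feq_face_return [of c d a], of "[a]" "[]"] c d by simp
  next
    case False
    then have "a1 \<noteq> a" "a2 \<noteq> a" using c(4) d(4) by auto
    then have "a1' = a" "a2' = a" using p(2) q(2) hp lp by auto
    then have "p = face_return c a @ [a]" "q = face_return d a @ [a]" "a \<in> set c" "a \<in> set d"
      using c(5,6) d(5,6) by simp_all
    then show ?thesis
      using feq_append_both [OF feq_face_return [of c d a], of "[]" "[a]"] c(1) d(1) by simp
  qed
qed

text \<open>An edge of the incidence graph comes from a face path at \<open>v\<close> that begins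
  with one of its two arrows and ends with the other, so this path belongs to both families. Within
  one family all face paths are equivalent, and a chain of edges carries this from \<open>a\<close>
  to \<open>a'\<close>.\<close>

lemma face_paths_with_connected:
  assumes "(a, a') \<in> (incidence_edges Q v \<union> (incidence_edges Q v)\<inverse>)\<^sup>*"
    and "p \<in> face_paths_with v a" "q \<in> face_paths_with v a'"
  shows "feq p q"
  using assms(1,3)
proof (induction arbitrary: q rule: rtrancl_induct)
  case base
  then show ?case using assms(2) face_paths_with_feq by blast
next
  case (step x y)
  have ex: "\<exists>r. r \<in> face_paths_with v x' \<and> r \<in> face_paths_with v y'"
    if xy: "(x', y') \<in> incidence_edges Q v" for x' y'
  proof -
    obtain c where c: "c \<in> faces Q" "follows_in c x' y'" "tla y' = v"
      using xy unfolding incidence_edges_def by blast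
    note f = follows_in_face [OF c(1,2)]
    obtain zs where zs: "face_return c y' = zs @ [x']" using f(4) by blast
    have "y' # face_return c y' \<in> face_paths_at Q v"
      using face_paths_tail [OF c(1) f(2)] c(3) by simp
    then have "y' # face_return c y' \<in> face_paths_with v x' \<and> y' # face_return c y' \<in> face_paths_with v y'"
      unfolding face_paths_with_def by (simp add: zs)
    then show ?thesis by blast
  qed
  obtain r where r: "r \<in> face_paths_with v x" "r \<in> face_paths_with v y"
    using step.hyps(2) ex by blast
  then show ?case using step.IH [OF r(1)] face_paths_with_feq [OF r(2) step.prems] feq_trans by blast
qed

lemma face_paths_feq:
  assumes "p \<in> face_paths_at Q v" "q \<in> face_paths_at Q v"
  shows "feq p q"
proof -
  obtain c a1 where c: "c \<in> faces Q" "a1 \<in> set c" "p = a1 # face_return c a1" "tla a1 = v"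
    using face_paths_at_cases [OF assms(1)] by metis
  obtain d a2 where d: "d \<in> faces Q" "a2 \<in> set d" "q = a2 # face_return d a2" "tla a2 = v"
    using face_paths_at_cases [OF assms(2)] by metis
  have arcs: "a1 \<in> arcs (quiver Q)" "a2 \<in> arcs (quiver Q)" using c d face_arcs by blast+
  then have "v \<in> verts (quiver Q)" using c(4) by auto
  then have "(a1, a2) \<in> (incidence_edges Q v \<union> (incidence_edges Q v)\<inverse>)\<^sup>*"
    using incidence_connected arcs c(4) d(4) by blast
  moreover have "p \<in> face_paths_with v a1" "q \<in> face_paths_with v a2"
    using assms c(3) d(3) by (simp_all add: face_paths_with_def)
  ultimately show ?thesis by (rule face_paths_with_connected)
qed

definition fp :: "'v \<Rightarrow> 'a list" where
  "fp v = (SOME c. c \<in> face_paths_at Q v)"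

definition pw :: "'v \<Rightarrow> nat \<Rightarrow> 'a list" where
  "pw v m = concat (replicate m (fp v))"

lemma pw_simps: "pw v 0 = []" "pw v (Suc m) = fp v @ pw v m" "pw v (m + k) = pw v m @ pw v k"
  by (simp_all add: pw_def replicate_add)

lemma fp_face_path:
  assumes "p \<in> face_paths_at Q v"
  shows "fp v \<in> face_paths_at Q v" "feq p (fp v)"
proof -
  show "fp v \<in> face_paths_at Q v" unfolding fp_def using assms by (rule someI)
  then show "feq p (fp v)" using assms face_paths_feq by blast
qed

text \<open>For a face containing \<open>a\<close>, the face path at the tail followed by
  \<open>a\<close>, and \<open>a\<close> followed by the face path at the head, are the same
  list.\<close>

lemma fp_arrow:
  assumes "a \<in> arcs (quiver Q)"
  shows "feq (fp (tla a) @ [a]) ([a] @ fp (hda a))"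
proof -
  obtain c where c: "c \<in> faces Q" "a \<in> set c" using arrow_in_face [OF assms] by blast
  have "feq (fp (tla a) @ [a]) ((a # face_return c a) @ [a])"
    by (rule feq_append [OF feq_sym [OF fp_face_path(2) [OF face_paths_tail [OF c]]] feq_refl])
  also have "(a # face_return c a) @ [a] = [a] @ (face_return c a @ [a])" by simp
  also have "feq \<dots> ([a] @ fp (hda a))"
    by (rule feq_append [OF feq_refl fp_face_path(2) [OF face_paths_head [OF c]]])
  finally show ?thesis .
qed

lemma fp_central: "awalk u p v \<Longrightarrow> feq (fp u @ p) (p @ fp v)"
proof (induction p arbitrary: u)
  case Nil then show ?case by (simp add: awalk_Nil_iff)
next
  case (Cons a p)
  then have a: "a \<in> arcs (quiver Q)" "u = tla a" "awalk (hda a) p v" by (simp_all add: awalk_Cons_iff)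
  have "feq ((fp u @ [a]) @ p) (([a] @ fp (hda a)) @ p)"
    unfolding a(2) by (rule feq_append [OF fp_arrow [OF a(1)] feq_refl])
  also have "([a] @ fp (hda a)) @ p = [a] @ (fp (hda a) @ p)" by simp
  also have "feq \<dots> ([a] @ (p @ fp v))"
    by (rule feq_append [OF feq_refl Cons.IH [OF a(3)]])
  finally show ?case by simp
qed

lemma pw_central: "awalk u p v \<Longrightarrow> feq (pw u m @ p) (p @ pw v m)"
proof (induction m)
  case 0 then show ?case by (simp add: pw_simps)
next
  case (Suc m)
  have "feq (fp u @ (pw u m @ p)) (fp u @ (p @ pw v m))"
    by (rule feq_append [OF feq_refl Suc.IH [OF Suc.prems]])
  also have "fp u @ (p @ pw v m) = (fp u @ p) @ pw v m" by simp
  also have "feq \<dots> ((p @ fp v) @ pw v m)"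
    by (rule feq_append [OF fp_central [OF Suc.prems] feq_refl])
  finally show ?case by (simp add: pw_simps)
qed

end

section \<open>Minimal paths and the matchings they define\<close>

text \<open>Thinness rephrased for arrow lists: every walk is equivalent to a fixed one followed by
  a unique power of the face path. A nonempty boundary provides an arrow to start from; the case
  without boundary is settled separately.\<close>

locale thin_dimer = dimer_model_in_disk Q for Q :: "('v, 'a) dimer" +
  assumes thin_feq: "\<lbrakk>u \<in> verts (quiver Q); v \<in> verts (quiver Q)\<rbrakk> \<Longrightarrow>
      \<exists>r. awalk u r v \<and> (\<forall>p. awalk u p v \<longrightarrow> (\<exists>!m. feq p (r @ pw v m)))"
    and boundary_nonempty: "boundary_arrows Q \<noteq> {}"
begin

abbreviation "V \<equiv> verts (quiver Q)"
abbreviation "E \<equiv> arcs (quiver Q)"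

definition mp :: "'v \<Rightarrow> 'v \<Rightarrow> 'a list" where
  "mp u v = (SOME r. awalk u r v \<and> (\<forall>p. awalk u p v \<longrightarrow> (\<exists>!m. feq p (r @ pw v m))))"

definition cval :: "'v \<Rightarrow> 'v \<Rightarrow> 'a list \<Rightarrow> nat" where
  "cval u v p = (THE m. feq p (mp u v @ pw v m))"

lemma mp_props:
  assumes "u \<in> V" "v \<in> V"
  shows "awalk u (mp u v) v" "\<And>p. awalk u p v \<Longrightarrow> \<exists>!m. feq p (mp u v @ pw v m)"
proof -
  have *: "awalk u (mp u v) v \<and> (\<forall>p. awalk u p v \<longrightarrow> (\<exists>!m. feq p (mp u v @ pw v m)))"
    unfolding mp_def by (rule someI_ex [OF thin_feq [OF assms]])
  show "awalk u (mp u v) v" using * by (rule conjunct1)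
  fix p assume "awalk u p v"
  then show "\<exists>!m. feq p (mp u v @ pw v m)"
    using spec [OF conjunct2 [OF *], of p] by (rule rev_mp)
qed

lemma awalk_verts: "awalk u p v \<Longrightarrow> u \<in> V \<and> v \<in> V"
  by (simp add: awalk_hd_in_verts awalk_last_in_verts)

lemma mp_unique:
  assumes "awalk u p v"
  shows "\<exists>!m. feq p (mp u v @ pw v m)"
  using mp_props(2) [OF _ _ assms] awalk_verts [OF assms] by simp

lemma cval_feq: "awalk u p v \<Longrightarrow> feq p (mp u v @ pw v (cval u v p))"
  unfolding cval_def by (rule theI' [OF mp_unique])

lemma cval_unique: "awalk u p v \<Longrightarrow> feq p (mp u v @ pw v m) \<Longrightarrow> cval u v p = m"
  unfolding cval_def by (rule the1_equality [OF mp_unique])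

lemma cval_eq_iff:
  assumes "awalk u p v" "awalk u q v"
  shows "feq p q \<longleftrightarrow> cval u v p = cval u v q"
proof
  assume "feq p q"
  then show "cval u v p = cval u v q"
    by (intro cval_unique [OF assms(1)]) (rule feq_trans [OF _ cval_feq [OF assms(2)]])
next
  assume "cval u v p = cval u v q"
  then show "feq p q"
    using feq_trans [OF cval_feq [OF assms(1)]] feq_sym [OF cval_feq [OF assms(2)]] by simp
qed

lemma cval_mp: "u \<in> V \<Longrightarrow> v \<in> V \<Longrightarrow> cval u v (mp u v) = 0"
  by (rule cval_unique [OF mp_props(1)]) (simp_all add: pw_simps)

text \<open>A face path exists at \<open>v\<close> because some arrow leaves \<open>v\<close>: one
  end of a boundary arrow is a vertex other than \<open>v\<close>, and thinness supplies a walk to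
  it.\<close>

lemma fp_props:
  assumes "v \<in> V"
  shows "fp v \<in> face_paths_at Q v" "awalk v (fp v) v" "fp v \<noteq> []"
proof -
  obtain e where e: "e \<in> E" using boundary_nonempty by (auto simp: boundary_arrows_def)
  have "tla e \<noteq> hda e" by (rule loopfree_digraph.no_loops [OF no_loops e])
  then obtain w where w: "w \<in> V" "w \<noteq> v" using e tail_in_verts head_in_verts by metis
  have aw: "awalk v (mp v w) w" using mp_props assms w by blast
  then have "mp v w \<noteq> []" using w by (auto simp: awalk_Nil_iff)
  then obtain a p where "mp v w = a # p" by (cases "mp v w") simp_all
  then have a: "a \<in> E" "tla a = v" using aw by (auto simp: awalk_Cons_iff)
  obtain c where c: "c \<in> faces Q" "a \<in> set c" using arrow_in_face [OF a(1)] by blast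
  have fp: "fp v \<in> face_paths_at Q v" using fp_face_path(1) [OF face_paths_tail [OF c]] a by simp
  then show "fp v \<in> face_paths_at Q v" .
  show "awalk v (fp v) v" "fp v \<noteq> []" by (rule face_paths_at_cases [OF fp], simp)+
qed

lemma pw_awalk: "v \<in> V \<Longrightarrow> awalk v (pw v m) v"
  by (induction m) (simp add: pw_simps awalk_Nil_iff, unfold pw_simps, rule awalk_appendI [OF fp_props(2)])

lemma cval_pw: "awalk u p v \<Longrightarrow> cval u v (p @ pw v m) = cval u v p + m"
proof -
  assume p: "awalk u p v"
  have v: "v \<in> V" using awalk_verts p by blast
  have "feq (p @ pw v m) ((mp u v @ pw v (cval u v p)) @ pw v m)"
    by (rule feq_append [OF cval_feq [OF p] feq_refl])
  then have "feq (p @ pw v m) (mp u v @ pw v (cval u v p + m))"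
    by (simp add: pw_simps)
  then show ?thesis by (rule cval_unique [OF awalk_appendI [OF p pw_awalk [OF v]]])
qed

text \<open>The face paths split off from \<open>p\<close> are moved past \<open>q\<close> by
  centrality, which leaves the minimal path in front of \<open>q\<close>.\<close>

lemma cval_append_left:
  assumes p: "awalk u p v" and q: "awalk v q w"
  shows "cval u w (p @ q) = cval u v p + cval u w (mp u v @ q)"
proof -
  have mp: "awalk u (mp u v) v" using awalk_verts p mp_props by blast
  have "feq (p @ q) ((mp u v @ pw v (cval u v p)) @ q)"
    by (rule feq_append [OF cval_feq [OF p] feq_refl])
  also have "(mp u v @ pw v (cval u v p)) @ q = mp u v @ (pw v (cval u v p) @ q)" by simp
  also have "feq \<dots> (mp u v @ (q @ pw w (cval u v p)))"
    by (rule feq_append [OF feq_refl pw_central [OF q]])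
  finally have "feq (p @ q) ((mp u v @ q) @ pw w (cval u v p))" by simp
  moreover have "awalk u ((mp u v @ q) @ pw w (cval u v p)) w"
    using mp q awalk_verts [OF q] by (intro awalk_appendI [of _ _ w] awalk_appendI [of _ _ v] pw_awalk) simp_all
  ultimately have "cval u w (p @ q) = cval u w ((mp u v @ q) @ pw w (cval u v p))"
    using cval_eq_iff [OF awalk_appendI [OF p q]] by blast
  then show ?thesis using cval_pw [OF awalk_appendI [OF mp q]] by simp
qed

lemma cval_append_right:
  assumes p: "awalk u p v" and q: "awalk v q w"
  shows "cval u w (p @ q) = cval v w q + cval u w (p @ mp v w)"
proof -
  have mp: "awalk v (mp v w) w" using awalk_verts q mp_props by blast
  have "feq (p @ q) (p @ (mp v w @ pw w (cval v w q)))"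
    by (rule feq_append [OF feq_refl cval_feq [OF q]])
  then have "feq (p @ q) ((p @ mp v w) @ pw w (cval v w q))" by simp
  moreover have "awalk u ((p @ mp v w) @ pw w (cval v w q)) w"
    using mp p awalk_verts [OF q] by (intro awalk_appendI [of _ _ w] awalk_appendI [of _ _ v] pw_awalk) simp_all
  ultimately have "cval u w (p @ q) = cval u w ((p @ mp v w) @ pw w (cval v w q))"
    using cval_eq_iff [OF awalk_appendI [OF p q]] by blast
  then show ?thesis using cval_pw [OF awalk_appendI [OF p mp]] by simp
qed

lemma mp_refl: "v \<in> V \<Longrightarrow> mp v v = []"
proof -
  assume v: "v \<in> V"
  then have "feq [] (mp v v @ pw v (cval v v []))"
    using cval_feq awalk_Nil_iff by blast
  then show ?thesis using feq_Nil by blast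
qed

lemma cval_Nil: "v \<in> V \<Longrightarrow> cval v v [] = 0"
  using cval_mp [of v v] by (simp add: mp_refl)

text \<open>A cycle of c-value 0 would be equivalent to the constant path, and flips never produce
  or destroy an empty list.\<close>

lemma cval_loop: "awalk v p v \<Longrightarrow> p \<noteq> [] \<Longrightarrow> cval v v p \<ge> 1"
proof (rule ccontr)
  assume p: "awalk v p v" "p \<noteq> []" and "\<not> cval v v p \<ge> 1"
  then have "cval v v p = 0" by simp
  then have "feq p []" using cval_feq [OF p(1)] awalk_verts [OF p(1)] by (simp add: mp_refl pw_simps)
  then show False using feq_Nil p(2) by blast
qed

lemma cval_face_path: "p \<in> face_paths_at Q v \<Longrightarrow> cval v v p = 1"
proof -
  assume p: "p \<in> face_paths_at Q v"
  then have aw: "awalk v p v" by (rule face_paths_at_cases)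
  have "pw v 1 = fp v" using pw_simps(2) [of v 0] by (simp add: pw_simps)
  then have "feq p (mp v v @ pw v 1)"
    using fp_face_path(2) [OF p] awalk_verts [OF aw] by (simp add: mp_refl)
  then show ?thesis by (rule cval_unique [OF aw])
qed

definition M :: "'v \<Rightarrow> 'a \<Rightarrow> nat" where
  "M x a = cval x (hda a) (mp x (tla a) @ [a])"

lemma cval_mp_append:
  assumes x: "x \<in> V" and "awalk u p v"
  shows "cval x v (mp x u @ p) = (\<Sum>a\<leftarrow>p. M x a)"
  using assms(2)
proof (induction p arbitrary: v rule: rev_induct)
  case Nil
  then show ?case using x cval_mp by (auto simp: awalk_Nil_iff)
next
  case (snoc a p)
  then have p: "awalk u p (tla a)" "awalk (tla a) [a] (hda a)" "v = hda a"
    by (auto simp: awalk_Cons_iff awalk_Nil_iff)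
  have "awalk x (mp x u) u" using x awalk_verts [OF p(1)] mp_props by blast
  then have "cval x (hda a) ((mp x u @ p) @ [a]) = cval x (tla a) (mp x u @ p) + M x a"
    unfolding M_def using p by (intro cval_append_left awalk_appendI)
  then show ?case using snoc.IH [OF p(1)] p(3) by simp
qed

lemma cval_eq_sum: "awalk u p v \<Longrightarrow> cval u v p = (\<Sum>a\<leftarrow>p. M u a)"
  using cval_mp_append [of u u p v] awalk_verts mp_refl by fastforce

text \<open>The weight of a walk from \<open>u\<close> to \<open>v\<close> exceeds its c-value by
  the c-value of the minimal path from \<open>x\<close> to \<open>u\<close> followed by that from
  \<open>u\<close> to \<open>v\<close>, which does not depend on the walk.\<close>

lemma feq_iff_weight:
  assumes "x \<in> V" "awalk u p v" "awalk u q v"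
  shows "feq p q \<longleftrightarrow> (\<Sum>a\<leftarrow>p. M x a) = (\<Sum>a\<leftarrow>q. M x a)"
proof -
  have "awalk x (mp x u) u" using assms(1) awalk_verts [OF assms(2)] mp_props by blast
  then have "(\<Sum>a\<leftarrow>r. M x a) = cval u v r + cval x v (mp x u @ mp u v)" if "awalk u r v" for r
    using cval_append_right that cval_mp_append [OF assms(1) that] by simp
  then show ?thesis using cval_eq_iff assms by simp
qed

lemma loop_weight:
  assumes "x \<in> V" "awalk u p u"
  shows "cval u u p = (\<Sum>a\<leftarrow>p. M x a)"
proof -
  have u: "u \<in> V" using awalk_verts [OF assms(2)] by blast
  have mp: "awalk x (mp x u) u" using mp_props assms(1) u by blast
  have "cval x u (mp x u @ p) = cval u u p + cval x u (mp x u @ mp u u)"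
    by (rule cval_append_right [OF mp assms(2)])
  then show ?thesis using cval_mp_append [OF assms] assms(1) u by (simp add: mp_refl cval_mp)
qed

text \<open>On closed walks the weight equals the c-value for every base point, and one turn around
  a face has c-value 1.\<close>

lemma M_face:
  assumes x: "x \<in> V" and c: "c \<in> faces Q"
  shows "(\<Sum>a\<in>set c. M x a) = 1"
proof -
  obtain v where v: "awalk v c v" using face_cycle [OF c] by blast
  then have "c \<in> face_paths_at Q v"
    unfolding face_paths_at_def using c by (metis (mono_tags, lifting) id_apply mem_Collect_eq rotate0)
  then have "cval v v c = 1" by (rule cval_face_path)
  then have "(\<Sum>a\<leftarrow>c. M x a) = 1" using loop_weight [OF x v] by simp
  then show ?thesis using face_distinct [OF c] by (simp add: sum_list_distinct_conv_sum_set)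
qed

lemma M_le_1: "x \<in> V \<Longrightarrow> a \<in> E \<Longrightarrow> M x a \<le> 1"
proof -
  assume x: "x \<in> V" and "a \<in> E"
  then obtain c where c: "c \<in> faces Q" "a \<in> set c" using arrow_in_face by blast
  have "M x a \<le> (\<Sum>a\<in>set c. M x a)" using c(2) by (intro member_le_sum) simp_all
  then show ?thesis using M_face [OF x c(1)] by simp
qed

lemma M_unique:
  assumes x: "x \<in> V" and c: "c \<in> faces Q" "a \<in> set c" "b \<in> set c" "M x a = 1" "M x b \<noteq> 0"
  shows "a = b"
proof (rule ccontr)
  assume "a \<noteq> b"
  then have "M x a + M x b = (\<Sum>a\<in>{a, b}. M x a)" by simp
  also have "\<dots> \<le> (\<Sum>a\<in>set c. M x a)" using c by (intro sum_mono2) simp_all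
  finally show False using M_face [OF x c(1)] c by simp
qed

lemma M_exists:
  assumes x: "x \<in> V" and c: "c \<in> faces Q"
  shows "\<exists>a\<in>set c. M x a = 1"
proof (rule ccontr)
  assume no: "\<not> ?thesis"
  have "M x a = 0" if "a \<in> set c" for a
    using M_le_1 [OF x, of a] face_arcs [OF c] that no by fastforce
  then show False using M_face [OF x c] by simp
qed

text \<open>The arrow and its return path together make one turn around a face, of c-value 1.
  Replacing either of them by a minimal path leaves a nonconstant cycle, which already has c-value
  at least 1, so nothing is left for the replaced piece.\<close>

lemma cval_arrow_return:
  assumes c: "c \<in> faces Q" "a \<in> set c"
  shows "cval (tla a) (hda a) [a] = 0" "cval (hda a) (tla a) (face_return c a) = 0"
proof -
  have a: "a \<in> E" using c face_arcs by blast
  then have aw: "awalk (tla a) [a] (hda a)" by (rule arc_implies_awalk)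
  have r: "awalk (hda a) (face_return c a) (tla a)" by (rule face_return_awalk [OF c])
  have ne: "face_return c a \<noteq> []" by (rule face_return_nonempty [OF c])
  have 1: "cval (tla a) (tla a) ([a] @ face_return c a) = 1"
    using cval_face_path [OF face_paths_tail [OF c]] by simp
  have mp: "awalk (tla a) (mp (tla a) (hda a)) (hda a)" "awalk (hda a) (mp (hda a) (tla a)) (tla a)"
    using mp_props a by simp_all
  have "cval (tla a) (tla a) (mp (tla a) (hda a) @ face_return c a) \<ge> 1"
    by (rule cval_loop [OF awalk_appendI [OF mp(1) r]]) (use ne in simp)
  then show "cval (tla a) (hda a) [a] = 0"
    using cval_append_left [OF aw r] 1 by simp
  have "cval (tla a) (tla a) ([a] @ mp (hda a) (tla a)) \<ge> 1"
    by (rule cval_loop [OF awalk_appendI [OF aw mp(2)]]) simp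
  then show "cval (hda a) (tla a) (face_return c a) = 0"
    using cval_append_right [OF aw r] 1 by simp
qed

lemma cval_arrow: "a \<in> E \<Longrightarrow> cval (tla a) (hda a) [a] = 0"
  using arrow_in_face cval_arrow_return(1) by blast

lemma M_tail: "a \<in> E \<Longrightarrow> M (tla a) a = 0"
  using cval_arrow unfolding M_def by (simp add: mp_refl)

lemma M_head:
  assumes a: "a \<in> E"
  shows "M (hda a) a = 1"
proof -
  have "awalk (hda a) (mp (hda a) (tla a)) (tla a)" using mp_props a by simp
  then have "cval (hda a) (hda a) (mp (hda a) (tla a) @ [a]) \<ge> 1"
    by (intro cval_loop awalk_appendI [OF _ arc_implies_awalk]) (use a in simp_all)
  then show ?thesis using M_le_1 [of "hda a" a] a unfolding M_def by simp
qed

text \<open>The mirror image of \<open>M\<close>: what it costs to prefix \<open>b\<close> to a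
  minimal path. \<open>N b\<close> divides the vertices into two sides, and by
  \<open>M_N_exchange\<close> the matchings of the two ends of \<open>b\<close> differ precisely on
  the arrows that pass from one side to the other.\<close>

definition N :: "'a \<Rightarrow> 'v \<Rightarrow> nat" where
  "N b y = cval (tla b) y ([b] @ mp (hda b) y)"

text \<open>One turn around a face beginning with \<open>b\<close>, followed by a minimal path to
  \<open>y\<close>, has c-value 1; it starts with \<open>b\<close> and continues from the head of
  \<open>b\<close> to \<open>y\<close>, so it costs at least \<open>N b y\<close>.\<close>

lemma N_le_1:
  assumes b: "b \<in> E" and y: "y \<in> V"
  shows "N b y \<le> 1"
proof -
  obtain c where c: "c \<in> faces Q" "b \<in> set c" using arrow_in_face b by blast
  have aw: "awalk (tla b) [b] (hda b)" by (rule arc_implies_awalk [OF b])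
  have r: "awalk (hda b) (face_return c b) (tla b)" by (rule face_return_awalk [OF c])
  have mp: "awalk (tla b) (mp (tla b) y) y" using mp_props b y by simp
  have 1: "cval (tla b) (tla b) ([b] @ face_return c b) = 1"
    using cval_face_path [OF face_paths_tail [OF c]] by simp
  have "cval (tla b) y ([b] @ (face_return c b @ mp (tla b) y)) \<ge> N b y"
    unfolding N_def using cval_append_right [OF aw awalk_appendI [OF r mp]] by simp
  moreover have "cval (tla b) y (([b] @ face_return c b) @ mp (tla b) y) = 1"
    using cval_append_left [OF awalk_appendI [OF aw r] mp] 1 b y by (simp add: mp_refl cval_mp)
  ultimately show ?thesis by simp
qed

text \<open>The walk consisting of \<open>b\<close>, a minimal path and \<open>a\<close> has its
  c-value computed by splitting off \<open>a\<close> or by splitting off \<open>b\<close>.\<close>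

lemma M_N_exchange:
  assumes b: "b \<in> E" and a: "a \<in> E"
  shows "M (tla b) a + N b (tla a) = M (hda b) a + N b (hda a)"
proof -
  have b1: "awalk (tla b) [b] (hda b)" by (rule arc_implies_awalk [OF b])
  have a1: "awalk (tla a) [a] (hda a)" by (rule arc_implies_awalk [OF a])
  have mp: "awalk (hda b) (mp (hda b) (tla a)) (tla a)" using mp_props a b by simp
  have "cval (tla b) (hda a) (([b] @ mp (hda b) (tla a)) @ [a]) = N b (tla a) + M (tla b) a"
    unfolding N_def M_def by (rule cval_append_left [OF awalk_appendI [OF b1 mp] a1])
  moreover have "cval (tla b) (hda a) ([b] @ (mp (hda b) (tla a) @ [a])) = M (hda b) a + N b (hda a)"
    unfolding N_def M_def by (rule cval_append_right [OF b1 awalk_appendI [OF mp a1]])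
  ultimately show ?thesis by simp
qed

text \<open>If \<open>b\<close> followed by a minimal path to the intermediate vertex were minimal,
  appending the rest of the given path would produce a walk of c-value 0 through \<open>b\<close> to
  \<open>y\<close>, against \<open>N b y = 1\<close>.\<close>

lemma N_prefix_1:
  assumes b: "b \<in> E" and p: "awalk (tla b) p z" and q: "awalk z q y"
    and 0: "cval (tla b) y (p @ q) = 0" and N: "N b y = 1"
  shows "N b z = 1"
proof (rule ccontr)
  assume "N b z \<noteq> 1"
  moreover have z: "z \<in> V" using awalk_verts p by blast
  ultimately have Nz: "N b z = 0" using N_le_1 [OF b z] by simp
  have aw: "awalk (tla b) [b] (hda b)" by (rule arc_implies_awalk [OF b])
  have mp: "awalk (hda b) (mp (hda b) z) z" using mp_props b z by simp
  have "cval (tla b) y (mp (tla b) z @ q) = 0"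
    using cval_append_left [OF p q] 0 by simp
  then have "cval (tla b) y (([b] @ mp (hda b) z) @ q) = 0"
    using cval_append_left [OF awalk_appendI [OF aw mp] q] Nz by (simp add: N_def)
  moreover have "cval (tla b) y ([b] @ (mp (hda b) z @ q)) \<ge> N b y"
    unfolding N_def using cval_append_right [OF aw awalk_appendI [OF mp q]] by simp
  ultimately show False using N by simp
qed

lemma N_prefix_0:
  assumes b: "b \<in> E" and p: "awalk (hda b) p z" and q: "awalk z q y"
    and 0: "cval (hda b) y (p @ q) = 0" and N: "N b y = 0"
  shows "N b z = 0"
proof -
  have z: "z \<in> V" "y \<in> V" using awalk_verts q by blast+
  have aw: "awalk (tla b) [b] (hda b)" by (rule arc_implies_awalk [OF b])
  have "cval (hda b) z p = 0" using cval_append_left [OF p q] 0 by simp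
  then have "cval (tla b) z ([b] @ p) = N b z"
    unfolding N_def using cval_append_right [OF aw p] by simp
  moreover have "cval (tla b) y ([b] @ (p @ q)) = 0"
    using cval_append_right [OF aw awalk_appendI [OF p q]] 0 N by (simp add: N_def)
  ultimately show ?thesis using cval_append_left [OF awalk_appendI [OF aw p] q] by simp
qed

lemma M_on_minimal:
  assumes "u \<in> V" "y \<in> V" "mp u y = p @ [a] @ q"
  shows "awalk u p (tla a)" "awalk (tla a) [a] (hda a)" "awalk (hda a) q y" "a \<in> E"
    "cval u y (p @ ([a] @ q)) = 0" "cval u y ((p @ [a]) @ q) = 0"
proof -
  have "awalk u (p @ [a] @ q) y" using mp_props(1) [OF assms(1,2)] assms(3) by simp
  then show "awalk u p (tla a)" "awalk (hda a) q y" "a \<in> E"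
    by (auto simp: awalk_Cons_iff)
  then show "awalk (tla a) [a] (hda a)" by (intro arc_implies_awalk) simp_all
  show "cval u y (p @ ([a] @ q)) = 0" "cval u y ((p @ [a]) @ q) = 0"
    using cval_mp [OF assms(1,2)] assms(3) by simp_all
qed

text \<open>\<open>N b\<close> is constantly 1 along this minimal path, so by the exchange no arrow
  on it changes sides. The companion lemma treats minimal paths from the head of \<open>b\<close> to
  the side where \<open>N b\<close> is 0.\<close>

lemma minimal_no_cut_1:
  assumes b: "b \<in> E" and y: "y \<in> V" "N b y = 1" and a: "a \<in> set (mp (tla b) y)"
  shows "M (tla b) a = M (hda b) a"
proof -
  obtain p q where "mp (tla b) y = p @ a # q" using split_list [OF a] by blast
  then have pq: "mp (tla b) y = p @ [a] @ q" by simp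
  note m = M_on_minimal [OF tail_in_verts [OF b] y(1) pq]
  have "N b (tla a) = 1"
    by (rule N_prefix_1 [OF b m(1) awalk_appendI [OF m(2,3)] m(5) y(2)])
  moreover have "N b (hda a) = 1"
    by (rule N_prefix_1 [OF b awalk_appendI [OF m(1,2)] m(3) m(6) y(2)])
  ultimately show ?thesis using M_N_exchange [OF b m(4)] by simp
qed

lemma minimal_no_cut_0:
  assumes b: "b \<in> E" and y: "y \<in> V" "N b y = 0" and a: "a \<in> set (mp (hda b) y)"
  shows "M (tla b) a = M (hda b) a"
proof -
  obtain p q where "mp (hda b) y = p @ a # q" using split_list [OF a] by blast
  then have pq: "mp (hda b) y = p @ [a] @ q" by simp
  note m = M_on_minimal [OF head_in_verts [OF b] y(1) pq]
  have "N b (tla a) = 0"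
    by (rule N_prefix_0 [OF b m(1) awalk_appendI [OF m(2,3)] m(5) y(2)])
  moreover have "N b (hda a) = 0"
    by (rule N_prefix_0 [OF b awalk_appendI [OF m(1,2)] m(3) m(6) y(2)])
  ultimately show ?thesis using M_N_exchange [OF b m(4)] by simp
qed

end

section \<open>Counting vertices, arrows and faces\<close>

text \<open>Gaussian elimination by induction on the equations: an equation with a nonzero
  coefficient determines one unknown, which is substituted into the others.\<close>

lemma homogeneous_system_nontrivial:
  fixes A :: "'j \<Rightarrow> 'i \<Rightarrow> real"
  assumes "finite J" "finite I" "card J < card I"
  shows "\<exists>h. (\<exists>i\<in>I. h i \<noteq> 0) \<and> (\<forall>j\<in>J. (\<Sum>i\<in>I. A j i * h i) = 0)"
  using assms
proof (induction J arbitrary: I A rule: finite_induct)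
  case empty
  then obtain i where "i \<in> I" by (metis all_not_in_conv card.empty less_irrefl)
  then show ?case by (intro exI [of _ "\<lambda>_. 1"]) auto
next
  case (insert j J)
  show ?case
  proof (cases "\<forall>i\<in>I. A j i = 0")
    case True
    have "card J < card I" using insert by simp
    then obtain h where "\<exists>i\<in>I. h i \<noteq> 0" "\<forall>j\<in>J. (\<Sum>i\<in>I. A j i * h i) = 0"
      using insert.IH [OF insert.prems(1), of A] by blast
    then show ?thesis using True by (intro exI [of _ h]) simp
  next
    case False
    then obtain p where p: "p \<in> I" "A j p \<noteq> 0" by blast
    define I' where "I' = I - {p}"
    have I': "finite I'" "card J < card I'" "p \<notin> I'" and II': "I = insert p I'"
      using insert p by (auto simp: I'_def)
    define A' where "A' k i = A k i - A k p * A j i / A j p" for k i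
    obtain h where h: "\<exists>i\<in>I'. h i \<noteq> 0" "\<forall>k\<in>J. (\<Sum>i\<in>I'. A' k i * h i) = 0"
      using insert.IH [OF I'(1,2), of A'] by blast
    define s where "s = (\<Sum>i\<in>I'. A j i * h i)"
    define g where "g = h(p := - s / A j p)"
    have sum: "(\<Sum>i\<in>I. A k i * g i) = A k p * (- s / A j p) + (\<Sum>i\<in>I'. A k i * h i)" for k
    proof -
      have "(\<Sum>i\<in>I'. A k i * g i) = (\<Sum>i\<in>I'. A k i * h i)"
        using I'(3) by (intro sum.cong) (auto simp: g_def)
      then show ?thesis using I' by (simp add: II' g_def)
    qed
    have "(\<Sum>i\<in>I. A j i * g i) = 0"
      unfolding sum using p(2) by (simp add: s_def)
    moreover have "(\<Sum>i\<in>I. A k i * g i) = 0" if "k \<in> J" for k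
    proof -
      have "(\<Sum>i\<in>I'. A' k i * h i) = (\<Sum>i\<in>I'. A k i * h i) - (A k p / A j p) * s"
        unfolding A'_def s_def sum_distrib_left sum_subtractf [symmetric]
        by (intro sum.cong refl) (simp add: algebra_simps)
      then show ?thesis using h(2) that unfolding sum by simp
    qed
    moreover have "\<exists>i\<in>I. g i \<noteq> 0"
      using h(1) I'(3) by (auto simp: II' g_def)
    ultimately show ?thesis by (intro exI [of _ g]) simp
  qed
qed

text \<open>Connectedness in a multigraph whose edge \<open>l\<close> joins \<open>s l\<close> and
  \<open>t l\<close>. Edges are kept as indices, since several may join the same nodes and the count
  has to see each of them.\<close>

definition links :: "('l \<Rightarrow> 'n) \<Rightarrow> ('l \<Rightarrow> 'n) \<Rightarrow> 'l set \<Rightarrow> ('n \<times> 'n) set" where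
  "links s t L = (\<Union>l\<in>L. {(s l, t l), (t l, s l)})\<^sup>*"

lemma links_sym: "(x, y) \<in> links s t L \<Longrightarrow> (y, x) \<in> links s t L"
proof -
  have "sym (\<Union>l\<in>L. {(s l, t l), (t l, s l)})" by (auto simp: sym_def)
  then show "(x, y) \<in> links s t L \<Longrightarrow> (y, x) \<in> links s t L"
    unfolding links_def by (meson sym_rtrancl symD)
qed

lemma links_trans: "(x, y) \<in> links s t L \<Longrightarrow> (y, z) \<in> links s t L \<Longrightarrow> (x, z) \<in> links s t L"
  unfolding links_def by (rule rtrancl_trans)

lemma links_refl: "(x, x) \<in> links s t L"
  unfolding links_def by simp

lemma links_edge: "l \<in> L \<Longrightarrow> (s l, t l) \<in> links s t L"
  unfolding links_def by (intro r_into_rtrancl) blast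

lemma links_mono: "L \<subseteq> L' \<Longrightarrow> links s t L \<subseteq> links s t L'"
  unfolding links_def by (intro rtrancl_mono) blast

lemma links_invariant:
  assumes "(x, y) \<in> links s t L" "\<And>l. l \<in> L \<Longrightarrow> g (s l) = g (t l)"
  shows "g x = g y"
  using assms(1) unfolding links_def
  by (induction rule: rtrancl_induct) (use assms(2) in auto)

lemma links_subset:
  assumes "\<And>l. l \<in> L \<Longrightarrow> (s l, t l) \<in> links s t L'" and "(x, y) \<in> links s t L"
  shows "(x, y) \<in> links s t L'"
  using assms(2) unfolding links_def [of _ _ L]
proof (induction rule: rtrancl_induct)
  case base show ?case by (rule links_refl)
next
  case (step y z)
  have "(y, z) \<in> links s t L'"
    using step.hyps(2) assms(1) links_sym by fastforce
  then show ?case by (rule links_trans [OF step.IH])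
qed

text \<open>With more nodes there would be a nonzero function on \<open>Z\<close> that vanishes at
  \<open>z0\<close> and takes equal values at the ends of every edge, and connectedness makes such a
  function zero.\<close>

lemma connected_card_le:
  assumes fin: "finite Z" "finite L" and z0: "z0 \<in> Z"
    and conn: "\<And>z. z \<in> Z \<Longrightarrow> (z0, z) \<in> links s t L"
  shows "card Z \<le> card L + 1"
proof (rule ccontr)
  assume "\<not> card Z \<le> card L + 1"
  moreover have "card (insert None (Some ` L)) = card L + 1"
    using fin by (simp add: card_image)
  ultimately have "card (insert None (Some ` L)) < card Z" by simp
  moreover define A where "A j i = (case j of None \<Rightarrow> if i = z0 then 1 else 0
    | Some l \<Rightarrow> (if i = s l then 1 else 0) - (if i = t l then 1 else (0 :: real)))" for j i
  ultimately obtain h where h: "\<exists>i\<in>Z. h i \<noteq> 0"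
    "\<forall>j\<in>insert None (Some ` L). (\<Sum>i\<in>Z. A j i * h i) = 0"
    using homogeneous_system_nontrivial [of "insert None (Some ` L)" Z A] fin by blast
  \<comment> \<open>Edges may leave \<open>Z\<close>; extending the function by 0 makes the edge
    equations meaningful there.\<close>
  define g where "g i = (if i \<in> Z then h i else 0)" for i
  have pick: "(\<Sum>i\<in>Z. (if i = z then 1 else 0) * h i) = g z" for z
  proof -
    have "(\<Sum>i\<in>Z. (if i = z then 1 else 0) * h i) = (\<Sum>i\<in>Z. if i = z then h i else 0)"
      by (intro sum.cong) auto
    then show ?thesis using fin by (simp add: g_def)
  qed
  have "g z0 = 0" using h(2) pick [of z0] by (simp add: A_def)
  moreover have "g (s l) = g (t l)" if "l \<in> L" for l
  proof -
    have "(\<Sum>i\<in>Z. A (Some l) i * h i) = g (s l) - g (t l)"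
      unfolding pick [symmetric] A_def by (simp add: sum_subtractf left_diff_distrib)
    then show ?thesis using h(2) that by simp
  qed
  ultimately have "g z = 0" if "z \<in> Z" for z
    using links_invariant [OF conn [OF that], of g] by simp
  then show False using h(1) by (auto simp: g_def)
qed

section \<open>The Euler inequality and the tree of last arrows at a vertex\<close>

context thin_dimer
begin

lemma awalk_telescope:
  fixes f :: "'v \<Rightarrow> real"
  shows "awalk u p v \<Longrightarrow> (\<Sum>e\<leftarrow>p. f (hda e) - f (tla e)) = f v - f u"
  by (induction p arbitrary: u) (auto simp: awalk_Nil_iff awalk_Cons_iff)

text \<open>Half of Euler's formula by linear algebra. The unknowns are a function \<open>f\<close>
  on vertices and a function \<open>k\<close> on faces; there is one equation for each arrow and one
  fixing \<open>f\<close> at \<open>x0\<close>. A nonzero solution would exist if the bound failed,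
  but its gradient is orthogonal to itself and so 0. Hence \<open>f\<close> vanishes, and
  \<open>k\<close> vanishes by spreading from the boundary.\<close>

lemma face_arrow_bound: "card V + card (faces Q) \<le> card E + 1"
proof (rule ccontr)
  assume less: "\<not> card V + card (faces Q) \<le> card E + 1"
  obtain b0 where b0: "b0 \<in> boundary_arrows Q" using boundary_nonempty by blast
  then have b0E: "b0 \<in> E" by (simp add: boundary_arrows_def)
  define x0 where "x0 = tla b0"
  have x0: "x0 \<in> V" using b0E by (simp add: x0_def)
  let ?J = "insert None (Some ` E)" and ?I = "V <+> faces Q"
  define A where "A j i = (case j of
      None \<Rightarrow> (case i of Inl v \<Rightarrow> if v = x0 then 1 else 0 | Inr c \<Rightarrow> 0)
    | Some e \<Rightarrow> (case i of Inl v \<Rightarrow> (if v = hda e then 1 else 0) - (if v = tla e then 1 else 0)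
        | Inr c \<Rightarrow> if e \<in> set c then 1 else (0 :: real)))" for j i
  have "card ?J = card E + 1" by (simp add: card_image)
  moreover have "card ?I = card V + card (faces Q)" using finite_faces by (simp add: card_Plus)
  ultimately have "card ?J < card ?I" using less by simp
  then obtain h where h: "\<exists>i\<in>?I. h i \<noteq> 0" "\<forall>j\<in>?J. (\<Sum>i\<in>?I. A j i * h i) = 0"
    using homogeneous_system_nontrivial [of ?J ?I A] finite_faces by auto
  define f where "f v = h (Inl v)" for v
  define k where "k c = h (Inr c)" for c
  have pick: "(\<Sum>v\<in>V. (if v = w then 1 else 0) * f v) = f w" if "w \<in> V" for w
  proof -
    have "(\<Sum>v\<in>V. (if v = w then 1 else 0) * f v) = (\<Sum>v\<in>V. if v = w then f v else 0)"
      by (intro sum.cong) auto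
    then show ?thesis using that by simp
  qed
  have split: "(\<Sum>i\<in>?I. A j i * h i) = (\<Sum>v\<in>V. A j (Inl v) * f v) + (\<Sum>c\<in>faces Q. A j (Inr c) * k c)" for j
    unfolding f_def k_def using finite_faces by (simp add: sum.Plus)
  have f0: "f x0 = 0"
    using h(2) split [of None] pick [OF x0] by (simp add: A_def)
  have eq: "f (hda e) - f (tla e) + (\<Sum>c\<in>faces Q. if e \<in> set c then k c else 0) = 0" if e: "e \<in> E" for e
  proof -
    have "(\<Sum>v\<in>V. A (Some e) (Inl v) * f v) = f (hda e) - f (tla e)"
      using pick e by (simp add: A_def left_diff_distrib sum_subtractf)
    moreover have "(\<Sum>c\<in>faces Q. A (Some e) (Inr c) * k c) = (\<Sum>c\<in>faces Q. if e \<in> set c then k c else 0)"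
      by (intro sum.cong) (auto simp: A_def)
    ultimately show ?thesis using h(2) split [of "Some e"] e by simp
  qed
  define d where "d e = f (hda e) - f (tla e)" for e
  have closed: "(\<Sum>e\<in>set c. d e) = 0" if c: "c \<in> faces Q" for c
  proof -
    obtain v where "awalk v c v" using face_cycle [OF c] by blast
    then have "(\<Sum>e\<leftarrow>c. d e) = 0" using awalk_telescope [of v c v f] by (simp add: d_def)
    then show ?thesis using face_distinct [OF c] by (simp add: sum_list_distinct_conv_sum_set)
  qed
  \<comment> \<open>The arrow equations write the gradient \<open>d\<close> as minus a combination
    of faces, while \<open>d\<close> sums to 0 around each face; so its squared norm is 0.\<close>
  have "(\<Sum>e\<in>E. d e * d e) = (\<Sum>e\<in>E. - (\<Sum>c\<in>faces Q. if e \<in> set c then k c * d e else 0))"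
  proof (rule sum.cong [OF refl])
    fix e assume "e \<in> E"
    then have "d e = - (\<Sum>c\<in>faces Q. if e \<in> set c then k c else 0)" using eq [of e] unfolding d_def by linarith
    then have "d e * d e = - (\<Sum>c\<in>faces Q. if e \<in> set c then k c else 0) * d e" by simp
    also have "\<dots> = - (\<Sum>c\<in>faces Q. (if e \<in> set c then k c else 0) * d e)"
      by (simp add: sum_distrib_right)
    also have "(\<Sum>c\<in>faces Q. (if e \<in> set c then k c else 0) * d e) = (\<Sum>c\<in>faces Q. if e \<in> set c then k c * d e else 0)"
      by (intro sum.cong) auto
    finally show "d e * d e = - (\<Sum>c\<in>faces Q. if e \<in> set c then k c * d e else 0)" .
  qed
  also have "\<dots> = - (\<Sum>c\<in>faces Q. \<Sum>e\<in>E. if e \<in> set c then k c * d e else 0)"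
    unfolding sum_negf by (subst sum.swap) simp
  also have "(\<Sum>c\<in>faces Q. \<Sum>e\<in>E. if e \<in> set c then k c * d e else 0) = (\<Sum>c\<in>faces Q. k c * (\<Sum>e\<in>set c. d e))"
  proof (rule sum.cong [OF refl])
    fix c assume c: "c \<in> faces Q"
    have "(\<Sum>e\<in>E. if e \<in> set c then k c * d e else 0) = (\<Sum>e\<in>{e \<in> E. e \<in> set c}. k c * d e)"
      by (rule sum.inter_filter [symmetric]) simp
    also have "{e \<in> E. e \<in> set c} = set c" using face_arcs [OF c] by blast
    finally show "(\<Sum>e\<in>E. if e \<in> set c then k c * d e else 0) = k c * (\<Sum>e\<in>set c. d e)"
      by (simp add: sum_distrib_left)
  qed
  also have "\<dots> = 0" using closed by simp
  finally have "(\<Sum>e\<in>E. d e * d e) = 0" by simp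
  then have d0: "d e = 0" if "e \<in> E" for e
    using sum_nonneg_eq_0_iff [of E "\<lambda>e. d e * d e"] that by simp
  have fv: "f v = 0" if "v \<in> V" for v
  proof -
    have aw: "awalk x0 (mp x0 v) v" using mp_props x0 that by blast
    then have "set (mp x0 v) \<subseteq> E" by (rule awalkE')
    then have "map d (mp x0 v) = map (\<lambda>_. 0) (mp x0 v)" using d0 by (intro map_cong refl) blast
    then have "(\<Sum>e\<leftarrow>mp x0 v. d e) = 0" by (simp only: sum_list_0)
    then show ?thesis using awalk_telescope [OF aw, of f] f0 by (simp add: d_def)
  qed
  have k_sum: "(\<Sum>c\<in>{c \<in> faces Q. e \<in> set c}. k c) = 0" if e: "e \<in> E" for e
    using eq [OF e] d0 [OF e] sum.inter_filter [OF finite_faces, of k "\<lambda>c. e \<in> set c"] by (simp add: d_def)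
  \<comment> \<open>With the gradient gone, the two faces at an internal arrow have opposite values
    and the face at a boundary arrow has value 0. Being \<open>good\<close> therefore spreads from
    \<open>b0\<close> within faces, around vertices through the incidence graph, and along
    walks.\<close>
  define good where "good e \<longleftrightarrow> (\<forall>c\<in>faces Q. e \<in> set c \<longrightarrow> k c = 0)" for e
  have good_boundary: "good e" if "e \<in> boundary_arrows Q" for e
  proof -
    have "k (boundary_face Q e) = 0"
      using k_sum [of e] boundary_arrow_faces(3) [OF that] that by (simp add: boundary_arrows_def)
    moreover have "c = boundary_face Q e" if "c \<in> faces Q" "e \<in> set c" for c
      using boundary_arrow_faces(3) [OF \<open>e \<in> boundary_arrows Q\<close>] that by blast
    ultimately show ?thesis unfolding good_def by blast
  qed
  have good_face: "good e'" if "c \<in> faces Q" "e \<in> set c" "e' \<in> set c" "good e" for c e e'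
  proof (cases "e' \<in> internal_arrows Q")
    case True
    have kc: "k c = 0" using that good_def by blast
    have "e' \<in> E" using face_arcs that by blast
    then have "k (cc_face e') + k (cl_face e') = 0"
      using k_sum [of e'] internal_arrow_faces(5,6) [OF True] by simp
    moreover have "c \<in> {cc_face e', cl_face e'}"
      unfolding internal_arrow_faces(5) [OF True, symmetric] using that by simp
    ultimately have "k (cc_face e') = 0" "k (cl_face e') = 0" using kc by auto
    moreover have "c' \<in> {cc_face e', cl_face e'}" if "c' \<in> faces Q" "e' \<in> set c'" for c'
      unfolding internal_arrow_faces(5) [OF True, symmetric] using that by simp
    ultimately show ?thesis unfolding good_def by blast
  next
    case False
    then have "e' \<in> boundary_arrows Q" using boundary_or_internal face_arcs [OF that(1)] that(3) by blast
    then show ?thesis by (rule good_boundary)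
  qed
  have good_inc: "good a'" if "(a, a') \<in> (incidence_edges Q v \<union> (incidence_edges Q v)\<inverse>)\<^sup>*" "good a" for a a' v
    using that(1)
  proof (induction rule: rtrancl_induct)
    case base show ?case by (rule that(2))
  next
    case (step y z)
    then obtain c where "c \<in> faces Q" "follows_in c y z \<or> follows_in c z y"
      unfolding incidence_edges_def by blast
    then have "c \<in> faces Q" "y \<in> set c" "z \<in> set c" using follows_in_face by blast+
    then show ?case using good_face step.IH by blast
  qed
  have good_vert: "good a'" if "good a" "a \<in> E" "a' \<in> E" "tla a = v \<or> hda a = v" "tla a' = v \<or> hda a' = v" for a a' v
  proof -
    have "v \<in> V" using that by auto
    then show ?thesis using incidence_connected [OF _ that(2,3,4,5)] good_inc that(1) by blast
  qed
  have walk: "awalk u p v \<Longrightarrow> (\<And>e. e \<in> E \<Longrightarrow> tla e = u \<or> hda e = u \<Longrightarrow> good e) \<Longrightarrow>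
      e \<in> E \<Longrightarrow> tla e = v \<or> hda e = v \<Longrightarrow> good e" for u p v e
  proof (induction p arbitrary: u)
    case Nil then show ?case by (simp add: awalk_Nil_iff)
  next
    case (Cons a p)
    then have a: "a \<in> E" "u = tla a" "awalk (hda a) p v" by (simp_all add: awalk_Cons_iff)
    have "good a" using Cons.prems(2) [OF a(1)] a(2) by simp
    then have "good e'" if "e' \<in> E" "tla e' = hda a \<or> hda e' = hda a" for e'
      using good_vert [of a e' "hda a"] a(1) that by simp
    then show ?case using Cons.IH [OF a(3)] Cons.prems by simp
  qed
  have "good e" if e: "e \<in> E" for e
  proof -
    have "good e'" if "e' \<in> E" "tla e' = x0 \<or> hda e' = x0" for e'
      using good_vert [OF good_boundary [OF b0] b0E that(1), of x0] that(2) by (simp add: x0_def)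
    moreover have "awalk x0 (mp x0 (tla e)) (tla e)" using mp_props x0 e by simp
    ultimately show ?thesis using walk [of x0 "mp x0 (tla e)" "tla e" e] e by simp
  qed
  then have "k c = 0" if c: "c \<in> faces Q" for c
  proof -
    have "c \<noteq> []" using face_cycle [OF c] by simp
    then have "hd c \<in> set c" by simp
    moreover have "hd c \<in> E" using face_arcs [OF c] calculation by (rule subsetD)
    ultimately show ?thesis using \<open>\<And>e. e \<in> E \<Longrightarrow> good e\<close> c unfolding good_def by simp
  qed
  then show False using h(1) fv unfolding f_def k_def by auto
qed

text \<open>These are the last arrows of the minimal paths from \<open>x\<close> to
  \<open>y\<close>. The internal arrows \<open>a\<close> in \<open>one_out x y\<close> are those at
  which such a path can be flipped at its very end, which exchanges the last arrows
  \<open>cc_pre a\<close> and \<open>cl_pre a\<close>.\<close>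

definition zero_in :: "'v \<Rightarrow> 'v \<Rightarrow> 'a set" where
  "zero_in x y = {a \<in> E. hda a = y \<and> M x a = 0}"

definition one_out :: "'v \<Rightarrow> 'v \<Rightarrow> 'a set" where
  "one_out x y = {a \<in> internal_arrows Q. tla a = y \<and> M x a = 1}"

abbreviation "cc_pre a \<equiv> pre_arrow (cc_face a) a"
abbreviation "cl_pre a \<equiv> pre_arrow (cl_face a) a"

lemma internal_arcs: "a \<in> internal_arrows Q \<Longrightarrow> a \<in> E"
  by (simp add: internal_arrows_def)

lemma zero_in_finite: "finite (zero_in x y)" "finite (one_out x y)"
proof -
  show "finite (zero_in x y)" unfolding zero_in_def by simp
  show "finite (one_out x y)" unfolding one_out_def
    by (rule finite_subset [of _ E]) (auto simp: internal_arcs)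
qed

text \<open>Two minimal paths from \<open>x\<close> to \<open>y\<close> are joined by flips. A flip
  changes the last arrow only if it happens at the end of the path, at an arrow \<open>a\<close>
  leaving \<open>y\<close>. The return path of \<open>a\<close> then has weight 0, so
  \<open>a\<close> is the arrow of weight 1 in its face and hence an edge.\<close>

lemma zero_in_connected:
  assumes x: "x \<in> V" and g: "g \<in> zero_in x y" "g' \<in> zero_in x y"
  shows "(g, g') \<in> links cc_pre cl_pre (one_out x y)"
proof -
  have path: "awalk x (mp x (tla a) @ [a]) y \<and> cval x y (mp x (tla a) @ [a]) = 0" if "a \<in> zero_in x y" for a
  proof -
    have a: "a \<in> E" "hda a = y" "M x a = 0" using that by (auto simp: zero_in_def)
    have "awalk x (mp x (tla a)) (tla a)" using mp_props x a by simp
    then show ?thesis using awalk_appendI [OF _ arc_implies_awalk [OF a(1)]] a unfolding M_def by blast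
  qed
  define p where "p = mp x (tla g) @ [g]"
  define p' where "p' = mp x (tla g') @ [g']"
  have p: "awalk x p y" "cval x y p = 0" "awalk x p' y" "cval x y p' = 0"
    using path g unfolding p_def p'_def by blast+
  then have "feq p p'" using cval_eq_iff by simp
  then have "awalk x p' y \<and> (last p, last p') \<in> links cc_pre cl_pre (one_out x y)"
  proof (induction rule: feq_induct)
    case refl
    show ?case using p by (simp add: links_refl)
  next
    case (flip q r)
    then have q: "feq p q" "awalk x q y" "awalk x r y" using flip_awalk by blast+
    have "feq p r" using q flip(2) flip_feq feq_trans by blast
    then have "cval x y q = 0" using cval_eq_iff [OF p(1) q(2)] q(1) p(2) by simp
    then have qz: "(\<Sum>a\<leftarrow>q. M x a) = 0" using cval_eq_sum q(2) by simp
    obtain as bs a where a: "a \<in> internal_arrows Q"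
      and qr: "q = as @ face_return (cc_face a) a @ bs" "r = as @ face_return (cl_face a) a @ bs"
      using flip(2) unfolding flip_def by blast
    note f = internal_arrow_faces [OF a]
    have F: "cc_face a \<in> faces Q" "cl_face a \<in> faces Q" using f by (simp_all add: faces_def)
    have ne: "face_return (cc_face a) a \<noteq> []" "face_return (cl_face a) a \<noteq> []"
      using face_return_nonempty F f by blast+
    show ?case
    proof (cases "bs = []")
      case True
      have "last q = cc_pre a" "last r = cl_pre a" using qr True ne by (simp_all add: pre_arrow_def)
      moreover have "tla a = y"
        using q(2) face_return_awalk [OF F(1) f(3)] ne(1) unfolding qr(1) True by (metis append_Nil2 awalk_append_iff awalk_ends)
      moreover have "M x a = 1"
      proof -
        obtain a' where a': "a' \<in> set (cc_face a)" "M x a' = 1" using M_exists [OF x F(1)] by blast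
        have "M x e = 0" if "e \<in> set (cc_face a) - {a}" for e
          using qz that unfolding set_face_return [OF F(1) f(3), symmetric] qr(1) by (auto simp: sum_list_eq_0_iff)
        then show ?thesis using a' by (cases "a' = a") auto
      qed
      ultimately have "(last q, last r) \<in> links cc_pre cl_pre (one_out x y)"
        using links_edge [of a "one_out x y" cc_pre cl_pre] a by (simp add: one_out_def)
      from links_trans [OF conjunct2 [OF flip(3)] this] show ?thesis using q(3) by simp
    next
      case False
      then have "last r = last q" unfolding qr by simp
      then show ?thesis using conjunct2 [OF flip(3)] q(3) by simp
    qed
  next
    case (flip' q r)
    then have q: "feq p q" "awalk x q y" "awalk x r y" using flip_awalk by blast+
    have "cval x y q = 0" using cval_eq_iff [OF p(1) q(2)] q(1) p(2) by simp
    then have qz: "(\<Sum>a\<leftarrow>q. M x a) = 0" using cval_eq_sum q(2) by simp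
    obtain as bs a where a: "a \<in> internal_arrows Q"
      and qr: "r = as @ face_return (cc_face a) a @ bs" "q = as @ face_return (cl_face a) a @ bs"
      using flip'(2) unfolding flip_def by blast
    note f = internal_arrow_faces [OF a]
    have F: "cc_face a \<in> faces Q" "cl_face a \<in> faces Q" using f by (simp_all add: faces_def)
    have ne: "face_return (cc_face a) a \<noteq> []" "face_return (cl_face a) a \<noteq> []"
      using face_return_nonempty F f by blast+
    show ?case
    proof (cases "bs = []")
      case True
      have "last r = cc_pre a" "last q = cl_pre a" using qr True ne by (simp_all add: pre_arrow_def)
      moreover have "tla a = y"
        using q(2) face_return_awalk [OF F(2) f(4)] ne(2) unfolding qr(2) True by (metis append_Nil2 awalk_append_iff awalk_ends)
      moreover have "M x a = 1"
      proof -
        obtain a' where a': "a' \<in> set (cl_face a)" "M x a' = 1" using M_exists [OF x F(2)] by blast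
        have "M x e = 0" if "e \<in> set (cl_face a) - {a}" for e
          using qz that unfolding set_face_return [OF F(2) f(4), symmetric] qr(2) by (auto simp: sum_list_eq_0_iff)
        then show ?thesis using a' by (cases "a' = a") auto
      qed
      ultimately have "(last r, last q) \<in> links cc_pre cl_pre (one_out x y)"
        using links_edge [of a "one_out x y" cc_pre cl_pre] a by (simp add: one_out_def)
      from links_trans [OF conjunct2 [OF flip'(3)] links_sym [OF this]] show ?thesis using q(3) by simp
    next
      case False
      then have "last r = last q" unfolding qr by simp
      then show ?thesis using conjunct2 [OF flip'(3)] q(3) by simp
    qed
  qed
  then show ?thesis by (simp add: p_def p'_def)
qed

lemma zero_in_nonempty:
  assumes x: "x \<in> V" and y: "y \<in> V" "y \<noteq> x"
  shows "zero_in x y \<noteq> {}"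
proof -
  have aw: "awalk x (mp x y) y" using mp_props x y by blast
  then have "mp x y \<noteq> []" using y by (auto simp: awalk_Nil_iff)
  then obtain p a where pa: "mp x y = p @ [a]" by (metis rev_exhaust)
  have "(\<Sum>a\<leftarrow>mp x y. M x a) = 0" using cval_eq_sum [OF aw] cval_mp x y by simp
  then have "M x a = 0" by (simp add: pa)
  moreover have "a \<in> E" "hda a = y" using aw unfolding pa by (auto simp: awalk_Cons_iff awalk_Nil_iff)
  ultimately show ?thesis by (auto simp: zero_in_def)
qed

lemma zero_in_le:
  assumes "x \<in> V" "y \<in> V" "y \<noteq> x"
  shows "card (zero_in x y) \<le> card (one_out x y) + 1"
proof -
  obtain g where "g \<in> zero_in x y" using zero_in_nonempty [OF assms] by blast
  then show ?thesis
    using connected_card_le [OF zero_in_finite] zero_in_connected [OF assms(1)] by blast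
qed

lemma card_face_incidence:
  assumes "a \<in> E"
  shows "card {c \<in> faces Q. a \<in> set c} = (if a \<in> internal_arrows Q then 2 else 1)"
proof (cases "a \<in> internal_arrows Q")
  case True
  then show ?thesis by (simp add: internal_arrows_def)
next
  case False
  then have "a \<in> boundary_arrows Q" using boundary_or_internal assms by blast
  then show ?thesis using False by (simp add: boundary_arrows_def)
qed

text \<open>Summing \<open>zero_in_le\<close> over all \<open>y\<close> different from
  \<open>x\<close> compares the number of arrows of weight 0 with vertices and internal arrows of
  weight 1. Counting faces through their unique arrow of weight 1, boundary arrows once and internal
  ones twice, turns \<open>face_arrow_bound\<close> into the opposite inequality of the sums. So
  each single bound is sharp.\<close>

lemma zero_in_card:
  assumes x: "x \<in> V" and y: "y \<in> V" "y \<noteq> x"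
  shows "card (zero_in x y) = card (one_out x y) + 1"
proof -
  define m0 where "m0 = card {a \<in> E. M x a = 0}"
  define m1 where "m1 = card {a \<in> E. M x a = 1}"
  define mi where "mi = card {a \<in> internal_arrows Q. M x a = 1}"
  have fin_int: "finite (internal_arrows Q)" by (rule finite_subset [of _ E]) (auto simp: internal_arcs)
  have "E = {a \<in> E. M x a = 0} \<union> {a \<in> E. M x a = 1}" using M_le_1 [OF x] by fastforce
  then have cE: "card E = m0 + m1"
    unfolding m0_def m1_def by (subst card_Un_disjoint [symmetric]) auto
  have "card (faces Q) = (\<Sum>c\<in>faces Q. \<Sum>a\<in>set c. M x a)" using M_face [OF x] by simp
  also have "\<dots> = (\<Sum>c\<in>faces Q. \<Sum>a\<in>E. if a \<in> set c then M x a else 0)"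
  proof (rule sum.cong [OF refl])
    fix c assume c: "c \<in> faces Q"
    have "{a \<in> E. a \<in> set c} = set c" using face_arcs [OF c] by blast
    then show "(\<Sum>a\<in>set c. M x a) = (\<Sum>a\<in>E. if a \<in> set c then M x a else 0)"
      using sum.inter_filter [of E "M x" "\<lambda>a. a \<in> set c"] by simp
  qed
  also have "\<dots> = (\<Sum>a\<in>E. \<Sum>c\<in>faces Q. if a \<in> set c then M x a else 0)" by (rule sum.swap)
  also have "\<dots> = (\<Sum>a\<in>E. (if M x a = 1 then 1 else 0) + (if a \<in> internal_arrows Q \<and> M x a = 1 then 1 else 0))"
  proof (rule sum.cong [OF refl])
    fix a assume a: "a \<in> E"
    have "(\<Sum>c\<in>faces Q. if a \<in> set c then M x a else 0) = (\<Sum>c\<in>{c \<in> faces Q. a \<in> set c}. M x a)"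
      by (rule sum.inter_filter [OF finite_faces, symmetric])
    also have "\<dots> = (if a \<in> internal_arrows Q then 2 else 1) * M x a"
      using card_face_incidence [OF a] by simp
    also have "\<dots> = (if M x a = 1 then 1 else 0) + (if a \<in> internal_arrows Q \<and> M x a = 1 then 1 else 0)"
      using M_le_1 [OF x a] by (cases "M x a = 0") auto
    finally show "(\<Sum>c\<in>faces Q. if a \<in> set c then M x a else 0) =
      (if M x a = 1 then 1 else 0) + (if a \<in> internal_arrows Q \<and> M x a = 1 then 1 else 0)" .
  qed
  also have "\<dots> = m1 + card {a \<in> E. a \<in> internal_arrows Q \<and> M x a = 1}"
    unfolding m1_def by (simp add: sum.distrib sum.inter_filter [symmetric] flip: card_eq_sum)
  also have "{a \<in> E. a \<in> internal_arrows Q \<and> M x a = 1} = {a \<in> internal_arrows Q. M x a = 1}"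
    using internal_arcs by blast
  finally have cF: "card (faces Q) = m1 + mi" by (simp add: mi_def)
  have "{a \<in> E. M x a = 0} = (\<Union>y\<in>V. zero_in x y)" by (auto simp: zero_in_def)
  moreover have "card (\<Union>y\<in>V. zero_in x y) = (\<Sum>y\<in>V. card (zero_in x y))"
    by (rule card_UN_disjoint) (use zero_in_finite in \<open>auto simp: zero_in_def\<close>)
  moreover have "zero_in x x = {}" using M_head by (fastforce simp: zero_in_def)
  moreover have "(\<Sum>y\<in>V. card (zero_in x y)) = card (zero_in x x) + (\<Sum>y\<in>V - {x}. card (zero_in x y))"
    using x by (simp add: sum.remove)
  ultimately have s0: "(\<Sum>y\<in>V - {x}. card (zero_in x y)) = m0" by (simp add: m0_def)
  have "{a \<in> internal_arrows Q. M x a = 1} = (\<Union>y\<in>V. one_out x y)"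
    using internal_arcs by (auto simp: one_out_def)
  moreover have "card (\<Union>y\<in>V. one_out x y) = (\<Sum>y\<in>V. card (one_out x y))"
    by (rule card_UN_disjoint) (use zero_in_finite in \<open>auto simp: one_out_def\<close>)
  moreover have "one_out x x = {}" using M_tail internal_arcs by (fastforce simp: one_out_def)
  moreover have "(\<Sum>y\<in>V. card (one_out x y)) = card (one_out x x) + (\<Sum>y\<in>V - {x}. card (one_out x y))"
    using x by (simp add: sum.remove)
  ultimately have s1: "(\<Sum>y\<in>V - {x}. card (one_out x y)) = mi" by (simp add: mi_def)
  have "(\<Sum>y\<in>V - {x}. card (one_out x y) + 1) = mi + (card V - 1)"
    unfolding sum.distrib s1 using x by simp
  moreover have "card V \<ge> 1" using x by (metis One_nat_def Suc_leI card_gt_0_iff empty_iff finite_verts)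
  ultimately have "(\<Sum>y\<in>V - {x}. card (one_out x y) + 1) \<le> (\<Sum>y\<in>V - {x}. card (zero_in x y))"
    unfolding s0 using face_arrow_bound cE cF by linarith
  moreover have le: "card (zero_in x y) \<le> card (one_out x y) + 1" if "y \<in> V - {x}" for y
    using zero_in_le [OF x] that by simp
  then have "(\<Sum>y\<in>V - {x}. card (zero_in x y)) \<le> (\<Sum>y\<in>V - {x}. card (one_out x y) + 1)"
    by (rule sum_mono)
  ultimately have "(\<Sum>y\<in>V - {x}. card (zero_in x y)) = (\<Sum>y\<in>V - {x}. card (one_out x y) + 1)" by simp
  then show ?thesis by (rule sum_mono_inv) (use le y in auto)
qed

text \<open>By the count, the incoming arrows in \<open>zero_in x y\<close> form a tree with edges \<open>one_out x y\<close>.\<close>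

lemma one_out_bridge:
  assumes x: "x \<in> V" and y: "y \<in> V" "y \<noteq> x" and a: "a \<in> one_out x y"
  shows "(cc_pre a, cl_pre a) \<notin> links cc_pre cl_pre (one_out x y - {a})"
proof
  assume in': "(cc_pre a, cl_pre a) \<in> links cc_pre cl_pre (one_out x y - {a})"
  obtain g where g: "g \<in> zero_in x y" using zero_in_nonempty [OF x y] by blast
  \<comment> \<open>If the ends of \<open>a\<close> stay linked without \<open>a\<close>, then
    \<open>a\<close> can be avoided in every connection, and the remaining edges are one too few for
    the number of nodes.\<close>
  have "(cc_pre l, cl_pre l) \<in> links cc_pre cl_pre (one_out x y - {a})" if "l \<in> one_out x y" for l
    using in' links_edge [of l "one_out x y - {a}"] that by (cases "l = a") auto
  then have "(g, g') \<in> links cc_pre cl_pre (one_out x y - {a})" if "g' \<in> zero_in x y" for g'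
    by (rule links_subset) (use zero_in_connected [OF x g that] in auto)
  then have "card (zero_in x y) \<le> card (one_out x y - {a}) + 1"
    by (intro connected_card_le [OF _ _ g]) (use zero_in_finite in auto)
  moreover have "card (one_out x y - {a}) + 1 = card (one_out x y)"
    using a zero_in_finite(2) by (metis Suc_eq_plus1 card.remove)
  ultimately show False using zero_in_card [OF x y] by simp
qed

end

section \<open>Strands\<close>

context thin_dimer
begin

lemma internal_if_two_faces:
  assumes "c \<in> faces Q" "d \<in> faces Q" "c \<noteq> d" "a \<in> set c" "a \<in> set d"
  shows "a \<in> internal_arrows Q" "{c, d} = {cc_face a, cl_face a}" "c \<in> cc_faces Q \<longleftrightarrow> d \<notin> cc_faces Q"
proof -
  have "a \<notin> boundary_arrows Q"
  proof
    assume "a \<in> boundary_arrows Q"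
    note eq = boundary_arrow_faces(3) [OF this]
    have "c \<in> {boundary_face Q a}" "d \<in> {boundary_face Q a}"
      unfolding eq [symmetric] using assms by simp_all
    then show False using assms(3) by simp
  qed
  then show a: "a \<in> internal_arrows Q"
    using boundary_or_internal face_arcs [OF assms(1)] assms(4) by blast
  note f = internal_arrow_faces [OF a]
  have cd: "c \<in> {cc_face a, cl_face a}" "d \<in> {cc_face a, cl_face a}"
    unfolding f(5) [symmetric] using assms by simp_all
  then show eq: "{c, d} = {cc_face a, cl_face a}" using assms(3) by auto
  have "cl_face a \<notin> cc_faces Q" using f(2) faces_disjoint by blast
  then show "c \<in> cc_faces Q \<longleftrightarrow> d \<notin> cc_faces Q"
    using cd assms(3) f(1) by auto
qed

lemma same_colour_face:
  assumes "c \<in> faces Q" "d \<in> faces Q" "a \<in> set c" "a \<in> set d" "c \<in> cc_faces Q \<longleftrightarrow> d \<in> cc_faces Q"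
  shows "c = d"
  using internal_if_two_faces(3) [OF assms(1,2) _ assms(3,4)] assms(5) by blast

end

text \<open>A strand read backwards from its final arrow, with arrows \<open>a l\<close> and faces \<open>G l\<close>.\<close>

locale backward_strand = thin_dimer Q for Q :: "('v, 'a) dimer" +
  fixes b :: 'a and a :: "nat \<Rightarrow> 'a" and G :: "nat \<Rightarrow> 'a list" and N0 :: nat
  assumes b_boundary: "b \<in> boundary_arrows Q"
    and a_0: "a 0 = b"
    and G_face: "l < N0 \<Longrightarrow> G l \<in> faces Q"
    and a_in: "l < N0 \<Longrightarrow> a l \<in> set (G l)"
    and a_Suc: "l < N0 \<Longrightarrow> a (Suc l) = pre_arrow (G l) (a l)"
    and G_Suc: "Suc l < N0 \<Longrightarrow> G (Suc l) \<noteq> G l"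
begin

lemma b_E: "b \<in> E"
  using b_boundary by (simp add: boundary_arrows_def)

lemma b_verts: "tla b \<in> V" "hda b \<in> V"
  using b_E by simp_all

lemma a_Suc_in: "l < N0 \<Longrightarrow> a (Suc l) \<in> set (G l)"
  using pre_arrow(1) [OF G_face a_in] a_Suc by simp

lemma a_Suc_neq: "l < N0 \<Longrightarrow> a (Suc l) \<noteq> a l"
  using pre_arrow(2) [OF G_face a_in] a_Suc by simp

lemma a_Suc_head: "l < N0 \<Longrightarrow> hda (a (Suc l)) = tla (a l)"
  using pre_arrow(3) [OF G_face a_in] a_Suc by simp

lemma a_E: "l \<le> N0 \<Longrightarrow> a l \<in> E"
proof (cases l)
  case 0 then show ?thesis using a_0 b_E by simp
next
  case (Suc m)
  assume "l \<le> N0"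
  then have "a l \<in> set (G m)" "G m \<in> faces Q" using Suc a_Suc_in G_face by simp_all
  then show ?thesis using face_arcs by blast
qed

lemma a_two_faces:
  assumes "Suc l < N0"
  shows "a (Suc l) \<in> internal_arrows Q" "{G (Suc l), G l} = {cc_face (a (Suc l)), cl_face (a (Suc l))}"
    "G (Suc l) \<in> cc_faces Q \<longleftrightarrow> G l \<notin> cc_faces Q"
proof -
  have l: "l < N0" using assms by simp
  note t = internal_if_two_faces [OF G_face [OF assms] G_face [OF l] G_Suc [OF assms] a_in [OF assms] a_Suc_in [OF l]]
  show "a (Suc l) \<in> internal_arrows Q" "{G (Suc l), G l} = {cc_face (a (Suc l)), cl_face (a (Suc l))}"
    "G (Suc l) \<in> cc_faces Q \<longleftrightarrow> G l \<notin> cc_faces Q" by (rule t)+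
qed

text \<open>Consecutive faces share an internal arrow, whose two faces have different
  colours.\<close>

lemma G_colour: "l < N0 \<Longrightarrow> G l \<in> cc_faces Q \<longleftrightarrow> (even l \<longleftrightarrow> G 0 \<in> cc_faces Q)"
  by (induction l) (auto simp: a_two_faces(3))

lemma links_pre:
  assumes "Suc l < N0" "a (Suc l) \<in> L"
  shows "(pre_arrow (G (Suc l)) (a (Suc l)), pre_arrow (G l) (a (Suc l))) \<in> links cc_pre cl_pre L"
proof -
  have "(cc_pre (a (Suc l)), cl_pre (a (Suc l))) \<in> links cc_pre cl_pre L"
    by (rule links_edge [OF assms(2)])
  then show ?thesis
    using a_two_faces(2) [OF assms(1)] links_sym by (auto simp: doubleton_eq_iff)
qed

text \<open>The one of the two end points of \<open>b\<close> whose matching contains \<open>a l\<close>, and the other one.\<close>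

definition X :: "nat \<Rightarrow> 'v" where "X l = (if even l then hda b else tla b)"
definition Y :: "nat \<Rightarrow> 'v" where "Y l = (if even l then tla b else hda b)"

lemma XY_Suc: "X (Suc l) = Y l" "Y (Suc l) = X l"
  by (simp_all add: X_def Y_def)

lemma XY_V: "X l \<in> V" "Y l \<in> V"
  using b_verts by (simp_all add: X_def Y_def)

text \<open>The strand is to be an alternating path for the two matchings: each arrow lies in
  exactly one of them, in turn, beginning with \<open>b\<close> in the matching of its own
  head.\<close>

definition alternates :: "nat \<Rightarrow> bool" where
  "alternates l \<longleftrightarrow> M (X l) (a l) = 1 \<and> M (Y l) (a l) = 0"

text \<open>The arrow \<open>e\<close> crosses the cut, so by the exchange formula it fixes the side
  on which \<open>v\<close> lies. Every other arrow at \<open>v\<close> can then cross the cut in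
  one direction only, which makes the two matchings comparable at \<open>v\<close>.\<close>

lemma matchings_nested:
  assumes a: "e \<in> E" "M (X l) e = 1" "M (Y l) e = 0" "tla e = v"
  shows "zero_in (Y l) v \<subseteq> zero_in (X l) v" "one_out (Y l) v \<subseteq> one_out (X l) v"
proof -
  have ve: "v \<in> V" using a by auto
  have ex: "M (tla b) g + N b (tla g) = M (hda b) g + N b (hda g)" if "g \<in> E" for g
    using M_N_exchange [OF b_E that] .
  have le: "M (tla b) g \<le> 1" "M (hda b) g \<le> 1" "N b (tla g) \<le> 1" "N b (hda g) \<le> 1" if "g \<in> E" for g
    using M_le_1 N_le_1 [OF b_E] b_verts that by simp_all
  show "zero_in (Y l) v \<subseteq> zero_in (X l) v"
  proof
    fix g assume "g \<in> zero_in (Y l) v"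
    then have g: "g \<in> E" "hda g = v" "M (Y l) g = 0" by (simp_all add: zero_in_def)
    have "M (X l) g = 0"
      using ex [OF a(1)] ex [OF g(1)] le [OF g(1)] le [OF a(1)] a(2-4) g(2,3)
      by (cases "even l") (simp_all add: X_def Y_def)
    then show "g \<in> zero_in (X l) v" using g by (simp add: zero_in_def)
  qed
  show "one_out (Y l) v \<subseteq> one_out (X l) v"
  proof
    fix g assume "g \<in> one_out (Y l) v"
    then have g: "g \<in> internal_arrows Q" "tla g = v" "M (Y l) g = 1" by (simp_all add: one_out_def)
    have gE: "g \<in> E" using internal_arcs [OF g(1)] .
    have "M (X l) g = 1"
      using ex [OF a(1)] ex [OF gE] le [OF gE] le [OF a(1)] a(2-4) g(2,3)
      by (cases "even l") (simp_all add: X_def Y_def)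
    then show "g \<in> one_out (X l) v" using g by (simp add: one_out_def)
  qed
qed

lemma other_zero:
  assumes "x \<in> V" "c \<in> faces Q" "e \<in> set c" "f \<in> set c" "M x e = 1" "f \<noteq> e"
  shows "M x f = 0"
  using M_unique [OF assms(1,2,3,4,5)] assms(6) by blast

lemma alternates_0: "alternates 0"
  using M_head [OF b_E] M_tail [OF b_E] by (simp add: alternates_def X_def Y_def a_0)

lemma alternates_1:
  assumes "0 < N0"
  shows "alternates (Suc 0)"
proof -
  have h: "hda (a (Suc 0)) = tla b" using a_Suc_head [OF assms] a_0 by simp
  have "M (tla b) (a (Suc 0)) = 1"
    using M_head [of "a (Suc 0)"] a_E [of "Suc 0"] assms unfolding h by simp
  moreover have "M (hda b) (a (Suc 0)) = 0"
    by (rule other_zero [OF b_verts(2) G_face [OF assms] a_in [OF assms] a_Suc_in [OF assms]])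
      (use M_head [OF b_E] a_0 a_Suc_neq [OF assms] in auto)
  ultimately show ?thesis by (simp add: alternates_def X_def Y_def)
qed

text \<open>
  If the strand did not continue the alternating curve at \<open>a l\<close>, the tree of \<open>X l\<close> at
  \<open>v = tail (a l)\<close> minus the edge \<open>a l\<close> would contain the component of the other neighbour of
  \<open>a l\<close>, and following the strand back to \<open>b\<close> inside this component (through faces of length 2)
  never leaves it.
\<close>

lemma alternates_Suc:
  assumes l: "0 < l" "l < N0" and alt: "\<And>i. i \<le> l \<Longrightarrow> alternates i"
  shows "alternates (Suc l)"
proof -
  define P where "P = X l"
  define P' where "P' = Y l"
  define v where "v = tla (a l)"
  define p where "p = a (Suc l)"
  have V: "P \<in> V" "P' \<in> V" using XY_V by (simp_all add: P_def P'_def)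
  have al: "M P (a l) = 1" "M P' (a l) = 0" using alt [of l] by (simp_all add: alternates_def P_def P'_def)
  have aE: "a l \<in> E" using a_E l by simp
  have vV: "v \<in> V" using aE by (simp add: v_def)
  have pE: "p \<in> E" using a_E l by (simp add: p_def)
  have p: "p \<in> set (G l)" "hda p = v" "p \<noteq> a l" "p = pre_arrow (G l) (a l)"
    using a_Suc_in a_Suc_head a_Suc_neq a_Suc l by (simp_all add: p_def v_def)
  have Pp: "M P p = 0"
    by (rule other_zero [OF V(1) G_face [OF l(2)] a_in [OF l(2)] p(1) al(1) p(3)])
  have "M P' p = 1"
  proof (rule ccontr)
    assume "M P' p \<noteq> 1"
    then have P'p: "M P' p = 0" using M_le_1 [OF V(2) pE] by simp
    \<comment> \<open>An arrow has weight 0 seen from its tail and 1 seen from its head. This rules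
      out \<open>v = P\<close>, so the tree at \<open>v\<close> is available, and
      \<open>v = P'\<close>, which the strand followed back to \<open>b\<close> will
      contradict.\<close>
    have vP: "v \<noteq> P" using M_tail [OF aE] al(1) by (auto simp: v_def)
    have vP': "v \<noteq> P'" using M_head [OF pE] P'p p(2) by auto
    note nested = matchings_nested [OF aE al [unfolded P_def P'_def] v_def [symmetric], folded P_def P'_def]
    obtain k where k: "l = Suc k" using l(1) by (cases l) simp_all
    have kN: "Suc k < N0" "k < N0" using l k by simp_all
    have aint: "a l \<in> internal_arrows Q" using a_two_faces(1) [OF kN(1)] k by simp
    define L where "L = one_out P v - {a l}"
    define conn where "conn = links cc_pre cl_pre L"
    have a_out: "a l \<in> one_out P v" using aint al by (simp add: one_out_def v_def)
    have bridge: "(cc_pre (a l), cl_pre (a l)) \<notin> conn"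
      unfolding conn_def L_def by (rule one_out_bridge [OF V(1) vV vP a_out])
    define p' where "p' = pre_arrow (G k) (a l)"
    \<comment> \<open>\<open>p\<close> and \<open>p'\<close> are the two ends of the edge
      \<open>a l\<close>, and removing this edge separates them.\<close>
    have pp': "(p, p') \<notin> conn"
    proof
      assume "(p, p') \<in> conn"
      moreover from this have "(p', p) \<in> conn" unfolding conn_def by (rule links_sym)
      ultimately show False
        using bridge a_two_faces(2) [OF kN(1)] unfolding p(4) p'_def k by (auto simp: doubleton_eq_iff)
    qed
    \<comment> \<open>For \<open>P'\<close> the arrow \<open>a l\<close> has weight 0 and is not an
      edge, so all nodes of the tree of \<open>P'\<close> at \<open>v\<close> lie in the component
      of \<open>p\<close>.\<close>
    have p_conn: "(p, q) \<in> conn" if "q \<in> zero_in P' v" for q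
    proof -
      have "p \<in> zero_in P' v" using pE p(2) P'p by (simp add: zero_in_def)
      then have "(p, q) \<in> links cc_pre cl_pre (one_out P' v)"
        by (rule zero_in_connected [OF V(2) _ that])
      moreover have "one_out P' v \<subseteq> L" using nested(2) al(2) by (auto simp: L_def one_out_def)
      ultimately show ?thesis unfolding conn_def using links_mono by blast
    qed
    \<comment> \<open>Consequently every arrow into \<open>v\<close> in the component of
      \<open>p'\<close> has weight 1 for \<open>P'\<close>.\<close>
    have node: "M P' e = 1" if e: "(p', e) \<in> conn" "e \<in> E" "hda e = v" for e
    proof (rule ccontr)
      assume "M P' e \<noteq> 1"
      then have "M P' e = 0" using M_le_1 [OF V(2) e(2)] by simp
      then have "(p, e) \<in> conn" using p_conn e by (simp add: zero_in_def)
      moreover have "(e, p') \<in> conn" using e(1) unfolding conn_def by (rule links_sym)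
      ultimately have "(p, p') \<in> conn" unfolding conn_def by (rule links_trans)
      then show False using pp' by blast
    qed
    \<comment> \<open>Two steps at a time towards \<open>b\<close>, a strand arrow entering
      \<open>v\<close> is found in the component of \<open>p'\<close>: the predecessor of the
      outgoing strand arrow in the face and the strand arrow itself both have weight 1 for
      \<open>P'\<close>, hence coincide.\<close>
    have desc: "2 * j + 1 \<le> l \<Longrightarrow> hda (a (l - 2 * j - 1)) = v \<and> (p', a (l - 2 * j - 1)) \<in> conn" for j
    proof (induction j)
      case 0
      have ak: "a l \<in> set (G k)" using a_Suc_in [OF kN(2)] k by simp
      note pre = pre_arrow [OF G_face [OF kN(2)] ak, folded p'_def]
      have p'E: "p' \<in> E" using pre(1) face_arcs [OF G_face [OF kN(2)]] by blast
      have "hda p' = v" using pre(3) by (simp add: v_def)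
      moreover have refl: "(p', p') \<in> conn" unfolding conn_def by (rule links_refl)
      ultimately have "M P' p' = 1" using node p'E by blast
      moreover have "M P' (a k) = 1" using alt [of k] XY_Suc(2) [of k] by (simp add: alternates_def P'_def k)
      ultimately have "p' = a k"
        using M_unique [OF V(2) G_face [OF kN(2)] pre(1) a_in [OF kN(2)]] by simp
      then show ?case using refl \<open>hda p' = v\<close> by (simp add: k)
    next
      case (Suc j)
      define i where "i = l - 2 * j - 3"
      have i: "l - 2 * j - 1 = Suc (Suc i)" "l - 2 * Suc j - 1 = i" "Suc i < N0" "i < N0" "Suc i < l"
        "even (Suc i) \<longleftrightarrow> even l"
        using Suc.prems l(2) by (auto simp: i_def)
      have IH: "hda (a (Suc (Suc i))) = v" "(p', a (Suc (Suc i))) \<in> conn"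
        using Suc.IH Suc.prems unfolding i(1) by simp_all
      have tv: "tla (a (Suc i)) = v" using IH(1) a_Suc_head [OF i(3)] by simp
      have XP: "X (Suc i) = P" "Y (Suc i) = P'" using i(6) by (simp_all add: X_def Y_def P_def P'_def)
      have al': "M P (a (Suc i)) = 1" using alt [of "Suc i"] i(5) XP by (simp add: alternates_def)
      have int: "a (Suc i) \<in> internal_arrows Q" using a_two_faces(1) [OF i(3)] .
      \<comment> \<open>By parity both passages through this arrow use faces of the same colour,
        hence the same face; the next arrow in the backward reading would then be \<open>p\<close>,
        on the other side of the removed edge.\<close>
      have "a (Suc i) \<noteq> a l"
      proof
        assume eq: "a (Suc i) = a l"
        have "G (Suc i) = G l"
          by (rule same_colour_face [OF G_face [OF i(3)] G_face [OF l(2)] a_in [OF i(3)]])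
            (use a_in [OF l(2)] eq G_colour [OF i(3)] G_colour [OF l(2)] i(6) in auto)
        then have "a (Suc (Suc i)) = p" using a_Suc [OF i(3)] p(4) eq by simp
        then have "(p', p) \<in> conn" using IH(2) by simp
        then have "(p, p') \<in> conn" unfolding conn_def by (rule links_sym)
        then show False using pp' by simp
      qed
      then have "a (Suc i) \<in> L" using int tv al' by (simp add: L_def one_out_def)
      then have "(a (Suc (Suc i)), pre_arrow (G i) (a (Suc i))) \<in> conn"
        using links_pre [OF i(3)] a_Suc [OF i(3)] unfolding conn_def by simp
      then have c: "(p', pre_arrow (G i) (a (Suc i))) \<in> conn"
        using IH(2) unfolding conn_def by (rule links_trans [rotated])
      have ai: "a (Suc i) \<in> set (G i)" using a_Suc_in [OF i(4)] .
      note pre = pre_arrow [OF G_face [OF i(4)] ai]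
      have "M P' (pre_arrow (G i) (a (Suc i))) = 1"
        by (rule node [OF c]) (use pre tv face_arcs [OF G_face [OF i(4)]] in auto)
      moreover have "M P' (a i) = 1" using alt [of i] XY_Suc(2) [of i] XP(2) i(5) by (simp add: alternates_def)
      ultimately have "pre_arrow (G i) (a (Suc i)) = a i"
        using M_unique [OF V(2) G_face [OF i(4)] pre(1) a_in [OF i(4)]] by simp
      then show ?case using c pre(3) tv unfolding i(2) by simp
    qed
    \<comment> \<open>Depending on the parity of \<open>l\<close>, the descent stops at
      \<open>a 1\<close>, whose head is the tail of \<open>b\<close>, or at \<open>b\<close> itself.
      In both cases \<open>v\<close> would be \<open>P'\<close>.\<close>
    show False
    proof (cases "even l")
      case True
      then obtain m where m: "l = 2 * m" by blast
      then have "2 * (m - 1) + 1 \<le> l" "l - 2 * (m - 1) - 1 = Suc 0" using l(1) by simp_all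
      then have "hda (a (Suc 0)) = v" using desc [of "m - 1"] by simp
      moreover have "hda (a (Suc 0)) = tla b" using a_Suc_head [of 0] a_0 l by simp
      ultimately show False using vP' True by (simp add: P'_def Y_def)
    next
      case False
      then obtain m where m: "l = 2 * m + 1" by (metis oddE)
      then have "hda (a 0) = v" using desc [of m] by simp
      then show False using vP' False a_0 by (simp add: P'_def Y_def)
    qed
  qed
  then show ?thesis using Pp by (simp add: alternates_def XY_Suc P_def P'_def p_def)
qed

lemma alternates_all: "l \<le> N0 \<Longrightarrow> alternates l"
proof (induction l rule: less_induct)
  case (less l)
  consider "l = 0" | "l = 1" | k where "l = Suc k" "0 < k" by (cases l) auto
  then show ?case
  proof cases
    case 1 then show ?thesis by (simp add: alternates_0)
  next
    case 2 then show ?thesis using less.prems alternates_1 by simp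
  next
    case 3
    then show ?thesis using less alternates_Suc [of k] by simp
  qed
qed

lemma cut_iff:
  assumes "e \<in> E" "alternates l" "a l = e"
  shows "M (tla b) e \<noteq> M (hda b) e"
  using assms by (cases "even l") (auto simp: alternates_def X_def Y_def)

section \<open>The arrows at which the matchings of the two ends differ\<close>

definition curve :: "'a \<Rightarrow> int" where
  "curve e = (if e \<in> a ` {..N0} then int (M (tla b) e) - int (M (hda b) e) else 0)"

text \<open>
  \<open>curve\<close> has sum 0 around every face, hence the same sum along parallel paths. An arrow at which
  the matchings of the end points of \<open>b\<close> differ leads from one side of the curve to the other,
  so it lies on the strand.
\<close>

lemma curve_face:
  assumes pos: "0 < N0" and fin: "a N0 \<in> boundary_arrows Q" and c: "c \<in> faces Q"
  shows "(\<Sum>e\<in>set c. curve e) = 0"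
proof (cases "\<exists>l\<le>N0. a l \<in> set c")
  case False
  then have "curve e = 0" if "e \<in> set c" for e
    using that unfolding curve_def by auto
  then show ?thesis by simp
next
  case True
  then obtain l where l: "l \<le> N0" "a l \<in> set c" by blast
  \<comment> \<open>A face meeting the strand is one of the faces the strand runs through: there is
    only one face at either end, and at an inner arrow the strand uses both.\<close>
  have "\<exists>m<N0. c = G m"
  proof -
    consider "l = 0" | "l = N0" | k where "l = Suc k" "Suc k < N0"
      using l(1) by (metis le_neq_implies_less not0_implies_Suc)
    then show ?thesis
    proof cases
      case 1
      then have "c \<in> {boundary_face Q b}" "G 0 \<in> {boundary_face Q b}"
        unfolding boundary_arrow_faces(3) [OF b_boundary, symmetric]
        using l c a_0 pos G_face a_in [of 0] 1 by auto
      then show ?thesis using pos by auto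
    next
      case 2
      define m where "m = N0 - 1"
      have m: "m < N0" "Suc m = N0" using pos by (simp_all add: m_def)
      have "c \<in> {boundary_face Q (a N0)}" "G m \<in> {boundary_face Q (a N0)}"
        unfolding boundary_arrow_faces(3) [OF fin, symmetric]
        using l c 2 G_face [OF m(1)] a_Suc_in [OF m(1)] m(2) by auto
      then show ?thesis using m(1) by auto
    next
      case 3
      note t = a_two_faces [OF 3(2)]
      have "c \<in> {cc_face (a l), cl_face (a l)}"
        using internal_arrow_faces(5) [of "a l"] t(1) 3(1) l c by blast
      then have "c \<in> {G (Suc k), G k}" using t(2) 3(1) by simp
      then show ?thesis using 3(2) by (metis Suc_lessD empty_iff insert_iff)
    qed
  qed
  then obtain m where m: "m < N0" "c = G m" by blast
  have am: "a m \<in> set c" "a (Suc m) \<in> set c" using a_in a_Suc_in m by simp_all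
  have alt: "M (X m) (a m) = 1" "M (Y m) (a (Suc m)) = 1"
    using alternates_all [of m] alternates_all [of "Suc m"] m by (simp_all add: alternates_def XY_Suc)
  \<comment> \<open>In \<open>G m\<close> the arrows of weight 1 for the two ends of
    \<open>b\<close> are \<open>a m\<close> and \<open>a (Suc m)\<close>, both on the strand. Both
    matchings vanish on the arrows of this face off the strand, so cutting \<open>curve\<close> down
    to the strand loses nothing here.\<close>
  have "curve e = int (M (tla b) e) - int (M (hda b) e)" if e: "e \<in> set c" for e
  proof (cases "e \<in> a ` {..N0}")
    case False
    then have ne: "e \<noteq> a m" "e \<noteq> a (Suc m)" using m by auto
    have "M (X m) e = 0" using other_zero [OF XY_V(1) c am(1) e alt(1) ne(1)] .
    moreover have "M (Y m) e = 0" using other_zero [OF XY_V(2) c am(2) e alt(2) ne(2)] .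
    ultimately show ?thesis using False by (cases "even m") (simp_all add: curve_def X_def Y_def)
  qed (simp add: curve_def)
  then have "(\<Sum>e\<in>set c. curve e) = int (\<Sum>e\<in>set c. M (tla b) e) - int (\<Sum>e\<in>set c. M (hda b) e)"
    by (simp add: sum_subtractf)
  then show ?thesis using M_face b_verts c by simp
qed

lemma curve_face_return:
  assumes pos: "0 < N0" and fin: "a N0 \<in> boundary_arrows Q" and c: "c \<in> faces Q" "e \<in> set c"
  shows "(\<Sum>f\<leftarrow>face_return c e. curve f) = - curve e"
proof -
  obtain xs ys where x: "c = xs @ e # ys" "face_return c e = ys @ xs" using face_split [OF c] .
  have "distinct (face_return c e)" using face_distinct [OF c(1)] x by auto
  then have "(\<Sum>f\<leftarrow>face_return c e. curve f) = (\<Sum>f\<in>set c - {e}. curve f)"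
    using set_face_return [OF c] by (simp add: sum_list_distinct_conv_sum_set)
  moreover have "(\<Sum>f\<in>set c. curve f) = curve e + (\<Sum>f\<in>set c - {e}. curve f)"
    using c(2) by (intro sum.remove) simp_all
  ultimately show ?thesis using curve_face [OF pos fin c(1)] by simp
qed

text \<open>The sum is unchanged by flips and vanishes around face paths, so each walk has the same
  sum as the minimal path with its ends.\<close>

lemma curve_parallel:
  assumes pos: "0 < N0" and fin: "a N0 \<in> boundary_arrows Q" and "awalk u p v" "awalk u q v"
  shows "(\<Sum>f\<leftarrow>p. curve f) = (\<Sum>f\<leftarrow>q. curve f)"
proof -
  have flip: "(\<Sum>f\<leftarrow>p. curve f) = (\<Sum>f\<leftarrow>q. curve f)" if pq': "flip p q" for p q
  proof -
    obtain as bs e where e: "e \<in> internal_arrows Q"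
      and pq: "p = as @ face_return (cc_face e) e @ bs" "q = as @ face_return (cl_face e) e @ bs"
      using pq' unfolding flip_def by blast
    note f = internal_arrow_faces [OF e]
    have "cc_face e \<in> faces Q" "cl_face e \<in> faces Q" using f by (simp_all add: faces_def)
    then show ?thesis using curve_face_return [OF pos fin] f(3,4) unfolding pq by simp
  qed
  have feq: "(\<Sum>f\<leftarrow>p. curve f) = (\<Sum>f\<leftarrow>q. curve f)" if "feq p q" for p q
    using that by (induction rule: feq_induct) (simp_all add: flip)
  have red: "(\<Sum>f\<leftarrow>p. curve f) = (\<Sum>f\<leftarrow>mp u v. curve f)" if p: "awalk u p v" for p
  proof -
    have "v \<in> V" using awalk_verts [OF p] by blast
    then obtain c e where c: "c \<in> faces Q" "e \<in> set c" "fp v = e # face_return c e"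
      using face_paths_at_cases [OF fp_props(1)] by metis
    have "(\<Sum>f\<leftarrow>fp v. curve f) = 0" unfolding c(3) using curve_face_return [OF pos fin c(1,2)] by simp
    then have "(\<Sum>f\<leftarrow>pw v m. curve f) = 0" for m by (induction m) (simp_all add: pw_simps)
    then show ?thesis using feq [OF cval_feq [OF p]] by simp
  qed
  show ?thesis using red assms(3,4) by simp
qed

lemma curve_outside:
  assumes "M (tla b) e = M (hda b) e"
  shows "curve e = 0"
  using assms by (simp add: curve_def)

lemma curve_outside_list:
  assumes "\<And>e. e \<in> set p \<Longrightarrow> M (tla b) e = M (hda b) e"
  shows "(\<Sum>f\<leftarrow>p. curve f) = 0"
  using assms by (induction p) (simp_all add: curve_outside)

text \<open>\<open>e\<close> joins the two sides of the cut. Take two parallel walks from the tail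
  of \<open>b\<close>, of which one begins with \<open>b\<close> and one uses \<open>e\<close>, all
  other pieces being minimal paths that do not cross the cut. These pieces contribute 0 to
  \<open>curve\<close> and \<open>b\<close> contributes -1, so \<open>e\<close> cannot contribute
  0.\<close>

lemma cut_on_strand:
  assumes pos: "0 < N0" and fin: "a N0 \<in> boundary_arrows Q"
    and e: "e \<in> E" "M (tla b) e \<noteq> M (hda b) e"
  shows "e \<in> a ` {..N0}"
proof (rule ccontr)
  assume "e \<notin> a ` {..N0}"
  then have ce: "curve e = 0" by (simp add: curve_def)
  have "b \<in> a ` {..N0}" using a_0 by (metis atMost_iff image_eqI le0)
  then have cb: "curve b = -1" using M_head [OF b_E] M_tail [OF b_E] by (simp add: curve_def)
  have V: "tla e \<in> V" "hda e \<in> V" using e by simp_all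
  have aw: "awalk (tla b) [b] (hda b)" "awalk (tla e) [e] (hda e)"
    using arc_implies_awalk b_E e by blast+
  have mp1: "awalk (tla b) (mp (tla b) y) y" and mp2: "awalk (hda b) (mp (hda b) y) y" if "y \<in> V" for y
    using mp_props b_verts that by blast+
  have N01: "N b (tla e) \<le> 1" "N b (hda e) \<le> 1" using N_le_1 [OF b_E] V by simp_all
  have "N b (tla e) \<noteq> N b (hda e)" using M_N_exchange [OF b_E e(1)] e(2) by auto
  then consider "N b (tla e) = 1" "N b (hda e) = 0" | "N b (tla e) = 0" "N b (hda e) = 1"
    using N01 by linarith
  then show False
  proof cases
    case 1
    have "(\<Sum>f\<leftarrow>mp (tla b) (tla e) @ [e]. curve f) = (\<Sum>f\<leftarrow>[b] @ mp (hda b) (hda e). curve f)"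
      by (rule curve_parallel [OF pos fin awalk_appendI [OF mp1 [OF V(1)] aw(2)]
          awalk_appendI [OF aw(1) mp2 [OF V(2)]]])
    moreover have "(\<Sum>f\<leftarrow>mp (tla b) (tla e). curve f) = 0"
      by (rule curve_outside_list) (rule minimal_no_cut_1 [OF b_E V(1) 1(1)])
    moreover have "(\<Sum>f\<leftarrow>mp (hda b) (hda e). curve f) = 0"
      by (rule curve_outside_list) (rule minimal_no_cut_0 [OF b_E V(2) 1(2)])
    ultimately show False using ce cb by simp
  next
    case 2
    have "(\<Sum>f\<leftarrow>mp (tla b) (hda e). curve f) = (\<Sum>f\<leftarrow>[b] @ (mp (hda b) (tla e) @ [e]). curve f)"
      by (rule curve_parallel [OF pos fin mp1 [OF V(2)]
          awalk_appendI [OF aw(1) awalk_appendI [OF mp2 [OF V(1)] aw(2)]]])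
    moreover have "(\<Sum>f\<leftarrow>mp (tla b) (hda e). curve f) = 0"
      by (rule curve_outside_list) (rule minimal_no_cut_1 [OF b_E V(2) 2(2)])
    moreover have "(\<Sum>f\<leftarrow>mp (hda b) (tla e). curve f) = 0"
      by (rule curve_outside_list) (rule minimal_no_cut_0 [OF b_E V(1) 2(1)])
    ultimately show False using ce cb by simp
  qed
qed

lemma boundary_cut_iff:
  assumes pos: "0 < N0" and fin: "a N0 \<in> boundary_arrows Q" and e: "e \<in> boundary_arrows Q"
  shows "M (tla b) e \<noteq> M (hda b) e \<longleftrightarrow> e = b \<or> e = a N0"
proof
  assume cut: "M (tla b) e \<noteq> M (hda b) e"
  have "e \<in> E" using e by (simp add: boundary_arrows_def)
  then obtain l where l: "l \<le> N0" "e = a l" using cut_on_strand [OF pos fin _ cut] by blast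
  show "e = b \<or> e = a N0"
  proof (rule ccontr)
    assume "\<not> ?thesis"
    then have ne: "a l \<noteq> a 0" "a l \<noteq> a N0" using l(2) a_0 by simp_all
    have "l \<noteq> 0" using ne(1) by (rule contrapos_nn) simp
    moreover have "l \<noteq> N0" using ne(2) by (rule contrapos_nn) simp
    ultimately obtain k where "l = Suc k" "Suc k < N0" using l(1) by (cases l) simp_all
    then have "e \<in> internal_arrows Q" using a_two_faces(1) l(2) by simp
    then show False using boundary_internal_disjoint [OF e] by simp
  qed
next
  assume "e = b \<or> e = a N0"
  moreover have "e \<in> E" using e by (simp add: boundary_arrows_def)
  ultimately show "M (tla b) e \<noteq> M (hda b) e"
    using cut_iff [OF _ alternates_all [of 0]] cut_iff [OF _ alternates_all [of N0]] a_0 by auto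
qed

text \<open>If the strand returned to \<open>b\<close>, its first and last faces would both be the
  unique face at \<open>b\<close>. As colours alternate, the number of its faces would be odd, and
  alternation would give \<open>b\<close> weight 1 seen from its own tail.\<close>

lemma start_neq_end:
  assumes pos: "0 < N0"
  shows "a N0 \<noteq> b"
proof
  assume eq: "a N0 = b"
  define m where "m = N0 - 1"
  have m: "m < N0" "Suc m = N0" using pos by (simp_all add: m_def)
  have "G m \<in> {boundary_face Q b}" "G 0 \<in> {boundary_face Q b}"
    unfolding boundary_arrow_faces(3) [OF b_boundary, symmetric]
    using G_face pos m a_0 a_in [of 0] a_Suc_in [OF m(1)] eq by auto
  then have "even m" using G_colour [OF m(1)] by auto
  then have "odd N0" using m(2) by auto
  then have "M (tla b) b = 1" using alternates_all [of N0] eq by (simp add: alternates_def X_def)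
  then show False using M_tail [OF b_E] by simp
qed

end

context thin_dimer
begin

text \<open>Only a reversal of indices: there is one more arrow than faces, so the face between the
  backward arrows \<open>l\<close> and \<open>Suc l\<close> has forward index
  \<open>length fs - 1 - l\<close>.\<close>

lemma strand_backward:
  assumes "is_strand Q as fs"
  shows "backward_strand Q (last as) (\<lambda>l. as ! (length fs - l)) (\<lambda>l. fs ! (length fs - 1 - l)) (length fs)"
    "as ! 0 = hd as" "0 < length fs" "hd as \<in> boundary_arrows Q" "last as \<in> boundary_arrows Q"
proof -
  have s: "fs \<noteq> []" "length as = Suc (length fs)"
    "\<And>l. l < length fs \<Longrightarrow> fs ! l \<in> faces Q \<and> follows_in (fs ! l) (as ! l) (as ! Suc l)"
    "\<And>l. Suc l < length fs \<Longrightarrow> fs ! Suc l \<noteq> fs ! l"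
    "hd as \<in> boundary_arrows Q" "last as \<in> boundary_arrows Q"
    using assms unfolding is_strand_def by blast+
  have ne: "as \<noteq> []" using s(2) by auto
  show "backward_strand Q (last as) (\<lambda>l. as ! (length fs - l)) (\<lambda>l. fs ! (length fs - 1 - l)) (length fs)"
  proof
    show "last as \<in> boundary_arrows Q" by (rule s(6))
    show "as ! (length fs - 0) = last as" using ne s(2) by (simp add: last_conv_nth)
    fix l assume l: "l < length fs"
    define m where "m = length fs - 1 - l"
    have m: "m < length fs" "length fs - l = Suc m" "length fs - Suc l = m" using l by (simp_all add: m_def)
    note f = follows_in_face [of "fs ! m" "as ! m" "as ! Suc m"]
    show "fs ! (length fs - 1 - l) \<in> faces Q" using s(3) [OF m(1)] by (simp add: m_def)
    show "as ! (length fs - l) \<in> set (fs ! (length fs - 1 - l))"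
      using f(2) s(3) [OF m(1)] unfolding m(2) m_def [symmetric] by simp
    show "as ! (length fs - Suc l) = pre_arrow (fs ! (length fs - 1 - l)) (as ! (length fs - l))"
      using f(3) s(3) [OF m(1)] unfolding m(2,3) m_def [symmetric] by simp
  next
    fix l assume l: "Suc l < length fs"
    define m where "m = length fs - 1 - Suc l"
    have "Suc m < length fs" "length fs - 1 - l = Suc m" using l by (simp_all add: m_def)
    then show "fs ! (length fs - 1 - Suc l) \<noteq> fs ! (length fs - 1 - l)"
      using s(4) [of m] unfolding m_def [symmetric] by auto
  qed
  show "as ! 0 = hd as" using ne by (simp add: hd_conv_nth)
  show "0 < length fs" "hd as \<in> boundary_arrows Q" "last as \<in> boundary_arrows Q" using s by simp_all
qed

lemma strand_cut:
  assumes st: "is_strand Q as fs"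
  shows "hd as \<noteq> last as"
    "e \<in> boundary_arrows Q \<Longrightarrow>
      M (tla (last as)) e \<noteq> M (hda (last as)) e \<longleftrightarrow> e = last as \<or> e = hd as"
proof -
  note b = strand_backward [OF st]
  interpret backward_strand Q "last as" "\<lambda>l. as ! (length fs - l)" "\<lambda>l. fs ! (length fs - 1 - l)" "length fs"
    by (rule b(1))
  show "hd as \<noteq> last as" using start_neq_end [OF b(3)] b(2) by simp
  show "e \<in> boundary_arrows Q \<Longrightarrow>
      M (tla (last as)) e \<noteq> M (hda (last as)) e \<longleftrightarrow> e = last as \<or> e = hd as"
    using boundary_cut_iff [OF b(3)] b(2,4) by simp
qed

section \<open>Uniqueness and existence of strands\<close>

lemma face_return_pre_arrow:
  assumes c: "c \<in> faces Q" "a \<in> set c"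
  shows "hd (face_return c (pre_arrow c a)) = a" "follows_in c (pre_arrow c a) a"
proof -
  obtain xs ys where x: "c = xs @ a # ys" "face_return c a = ys @ xs" using face_split [OF c] .
  have d: "distinct c" by (rule face_distinct [OF c(1)])
  have ne: "ys @ xs \<noteq> []" using face_return_nonempty [OF c] x by simp
  define p where "p = pre_arrow c a"
  have p: "p = last (ys @ xs)" by (simp only: p_def pre_arrow_def x(2))
  show "hd (face_return c (pre_arrow c a)) = a"
  proof (cases "xs = []")
    case True
    then have "ys = butlast ys @ [p]" using ne p by simp
    then have c2: "c = (a # butlast ys) @ p # []" using x(1) True by simp
    show ?thesis using face_return_split [OF c2 d] by (simp add: p_def)
  next
    case False
    then have "xs = butlast xs @ [p]" using p by simp
    then have c2: "c = butlast xs @ p # (a # ys)" using x(1) by simp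
    show ?thesis using face_return_split [OF c2 d] by (simp add: p_def)
  qed
  show "follows_in c (pre_arrow c a) a"
  proof (cases "xs = []")
    case True
    then have y: "ys \<noteq> []" "p = last ys" using ne p by simp_all
    have "c ! (length c - 1) = p" using y x(1) True by (simp add: last_conv_nth nth_Cons')
    moreover have "c ! 0 = a" "length c - 1 < length c" "Suc (length c - 1) mod length c = 0" using x(1) True by simp_all
    ultimately show ?thesis unfolding follows_in_def p_def [symmetric] by metis
  next
    case False
    define l where "l = length xs - 1"
    have l: "l < length c" "Suc l = length xs" "Suc l < length c" using False x(1) by (simp_all add: l_def)
    have "p = last xs" using False p by simp
    then have "c ! l = p" using False x(1) by (simp add: l_def last_conv_nth nth_append)
    moreover have "c ! (Suc l mod length c) = a" using l x(1) by simp
    ultimately show ?thesis unfolding follows_in_def p_def [symmetric] using l(1) by blast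
  qed
qed

lemma follows_in_unique:
  assumes "c \<in> faces Q" "follows_in c a a'" "follows_in c a a''"
  shows "a' = a''"
  using face_return_pre_arrow(1) [OF assms(1)] follows_in_face [OF assms(1,2)] follows_in_face [OF assms(1,3)] by metis

lemma other_face_unique:
  assumes "c \<in> faces Q" "d \<in> faces Q" "d' \<in> faces Q" "c \<noteq> d" "c \<noteq> d'" "a \<in> set c" "a \<in> set d" "a \<in> set d'"
  shows "d = d'"
  using internal_if_two_faces(2) [OF assms(1,2,4,6,7)] internal_if_two_faces(2) [OF assms(1,3,5,6,8)] assms(4,5)
  by (metis doubleton_eq_iff)

text \<open>The starting face is the only face at a boundary arrow. From then on face and arrow
  determine the next arrow, and the next face is the other face at that arrow.\<close>

lemma strand_deterministic_prefix:
  assumes st: "is_strand Q as fs" "is_strand Q as' fs'" and hd: "hd as = hd as'"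
  shows "l \<le> length fs \<Longrightarrow> l \<le> length fs' \<Longrightarrow> as ! l = as' ! l"
    "l < length fs \<Longrightarrow> l < length fs' \<Longrightarrow> fs ! l = fs' ! l"
proof -
  have s: "fs ! l \<in> faces Q" "follows_in (fs ! l) (as ! l) (as ! Suc l)" if "l < length fs" for l
    using st(1) that unfolding is_strand_def by blast+
  have s': "fs' ! l \<in> faces Q" "follows_in (fs' ! l) (as' ! l) (as' ! Suc l)" if "l < length fs'" for l
    using st(2) that unfolding is_strand_def by blast+
  have n: "fs ! Suc l \<noteq> fs ! l" if "Suc l < length fs" for l
    using st(1) that unfolding is_strand_def by blast
  have n': "fs' ! Suc l \<noteq> fs' ! l" if "Suc l < length fs'" for l
    using st(2) that unfolding is_strand_def by blast
  have z0: "as ! 0 = as' ! 0" using strand_backward(2) [OF st(1)] strand_backward(2) [OF st(2)] hd by simp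
  have f0: "fs ! 0 = fs' ! 0"
  proof -
    have p: "0 < length fs" "0 < length fs'" using strand_backward(3) st by blast+
    have bd: "as ! 0 \<in> boundary_arrows Q" using strand_backward(2,4) [OF st(1)] by simp
    have "fs ! 0 \<in> {boundary_face Q (as ! 0)}" "fs' ! 0 \<in> {boundary_face Q (as ! 0)}"
      unfolding boundary_arrow_faces(3) [OF bd, symmetric]
      using s [OF p(1)] s' [OF p(2)] follows_in_face(1) z0 by auto
    then show ?thesis by simp
  qed
  have "(l \<le> length fs \<longrightarrow> l \<le> length fs' \<longrightarrow> as ! l = as' ! l) \<and>
    (l < length fs \<longrightarrow> l < length fs' \<longrightarrow> fs ! l = fs' ! l)" for l
  proof (induction l)
    case 0 show ?case using z0 f0 by simp
  next
    case (Suc l)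
    have a: "as ! Suc l = as' ! Suc l" if "Suc l \<le> length fs" "Suc l \<le> length fs'"
    proof -
      have l: "l < length fs" "l < length fs'" using that by simp_all
      have "as ! l = as' ! l" "fs ! l = fs' ! l" using Suc l by simp_all
      then show ?thesis using follows_in_unique [OF s(1) [OF l(1)] s(2) [OF l(1)]] s'(2) [OF l(2)] by simp
    qed
    moreover have "fs ! Suc l = fs' ! Suc l" if l: "Suc l < length fs" "Suc l < length fs'"
    proof -
      have l': "l < length fs" "l < length fs'" using that by simp_all
      have eq: "fs ! l = fs' ! l" "as ! Suc l = as' ! Suc l" using Suc l' l a by simp_all
      show ?thesis
        by (rule other_face_unique [OF s(1) [OF l'(1)] s(1) [OF l(1)] s'(1) [OF l(2)] _ _
            follows_in_face(2) [OF s(1) [OF l'(1)] s(2) [OF l'(1)]]])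
          (use n [OF l(1)] n' [OF l(2)] eq follows_in_face(1) [OF s(1) [OF l(1)] s(2) [OF l(1)]]
            follows_in_face(1) [OF s'(1) [OF l(2)] s'(2) [OF l(2)]] in simp_all)
    qed
    ultimately show ?case by simp
  qed
  then show "l \<le> length fs \<Longrightarrow> l \<le> length fs' \<Longrightarrow> as ! l = as' ! l"
    "l < length fs \<Longrightarrow> l < length fs' \<Longrightarrow> fs ! l = fs' ! l" by simp_all
qed

text \<open>The shorter strand ends at a boundary arrow, whereas an arrow in the middle of the
  longer one lies in two faces.\<close>

lemma strand_length_le:
  assumes st: "is_strand Q as fs" "is_strand Q as' fs'" and hd: "hd as = hd as'"
  shows "length fs' \<le> length fs"
proof (rule ccontr)
  assume "\<not> length fs' \<le> length fs"
  then have less: "length fs < length fs'" by simp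
  have s': "fs' ! l \<in> faces Q \<and> follows_in (fs' ! l) (as' ! l) (as' ! Suc l)" if "l < length fs'" for l
    using st(2) that unfolding is_strand_def by blast
  obtain m where m: "length fs = Suc m" using strand_backward(3) [OF st(1)] by (cases "length fs") simp_all
  have ne: "fs' ! Suc m \<noteq> fs' ! m" using st(2) less m unfolding is_strand_def by auto
  have "length as = Suc (length fs)" using st(1) unfolding is_strand_def by blast
  then have "last as = as ! length fs" by (metis diff_Suc_1 last_conv_nth list.size(3) nat.simps(3))
  also have "\<dots> = as' ! Suc m" using strand_deterministic_prefix(1) [OF st hd, of "length fs"] less m by simp
  finally have l: "as' ! Suc m \<in> boundary_arrows Q" using strand_backward(5) [OF st(1)] by simp
  have "as' ! Suc m \<in> internal_arrows Q"
    by (rule internal_if_two_faces(1) [OF _ _ ne])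
      (use s' [of m] s' [of "Suc m"] less m follows_in_face in auto)
  then show False using boundary_internal_disjoint [OF l] by simp
qed

lemma strand_deterministic:
  assumes st: "is_strand Q as fs" "is_strand Q as' fs'" and hd: "hd as = hd as'"
  shows "last as = last as'"
proof -
  have len: "length fs = length fs'"
    using strand_length_le [OF st hd] strand_length_le [OF st(2,1) hd [symmetric]] by simp
  have l: "length as = Suc (length fs)" "length as' = Suc (length fs')"
    using st unfolding is_strand_def by blast+
  then have "last as = as ! length fs" "last as' = as' ! length fs'"
    by (metis diff_Suc_1 last_conv_nth list.size(3) nat.simps(3))+
  then show ?thesis using strand_deterministic_prefix(1) [OF st hd, of "length fs"] len by simp
qed

definition other_face :: "'a list \<Rightarrow> 'a \<Rightarrow> 'a list" where
  "other_face c a = (if a \<in> internal_arrows Q then (if c = cc_face a then cl_face a else cc_face a) else c)"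

lemma other_face:
  assumes c: "c \<in> faces Q" "a \<in> set c"
  shows "other_face c a \<in> faces Q" "a \<in> set (other_face c a)" "a \<in> internal_arrows Q \<Longrightarrow> other_face c a \<noteq> c"
proof -
  show "other_face c a \<in> faces Q" "a \<in> set (other_face c a)"
    using c internal_arrow_faces [of a] by (auto simp: other_face_def faces_def)
  show "other_face c a \<noteq> c" if "a \<in> internal_arrows Q"
    using internal_arrow_faces(6) [OF that] that by (auto simp: other_face_def)
qed

lemma other_face_inj:
  assumes "c \<in> faces Q" "d \<in> faces Q" "a \<in> set c" "a \<in> set d" "other_face c a = other_face d a"
  shows "c = d"
proof (cases "a \<in> internal_arrows Q")
  case True
  have "c \<in> {cc_face a, cl_face a}" "d \<in> {cc_face a, cl_face a}"
    unfolding internal_arrow_faces(5) [OF True, symmetric] using assms by simp_all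
  then show ?thesis using assms(5) True internal_arrow_faces(6) [OF True]
    by (auto simp: other_face_def split: if_splits)
next
  case False then show ?thesis using assms(5) by (simp add: other_face_def)
qed

text \<open>One step backwards along a strand, on pairs of a face and an arrow in it. At a boundary
  arrow the face is kept, and off such pairs the map is the identity; so it is injective on the
  whole type, and elements with finite orbits return to themselves.\<close>

definition flag_step :: "'a list \<times> 'a \<Rightarrow> 'a list \<times> 'a" where
  "flag_step f = (if fst f \<in> faces Q \<and> snd f \<in> set (fst f)
    then (other_face (fst f) (pre_arrow (fst f) (snd f)), pre_arrow (fst f) (snd f)) else f)"

lemma flag_step_flag:
  "fst f \<in> faces Q \<Longrightarrow> snd f \<in> set (fst f) \<Longrightarrow>
    fst (flag_step f) \<in> faces Q \<and> snd (flag_step f) \<in> set (fst (flag_step f))"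
  using other_face pre_arrow(1) by (simp add: flag_step_def)

lemma flag_step_inj: "inj flag_step"
proof (rule injI)
  fix f g assume eq: "flag_step f = flag_step g"
  show "f = g"
  proof (cases "fst f \<in> faces Q \<and> snd f \<in> set (fst f)")
    case True
    then have F: "fst (flag_step g) \<in> faces Q \<and> snd (flag_step g) \<in> set (fst (flag_step g))"
      using flag_step_flag [of f] eq by simp
    have G: "fst g \<in> faces Q \<and> snd g \<in> set (fst g)"
    proof (rule ccontr)
      assume "\<not> ?thesis"
      then show False using F unfolding flag_step_def by (simp only: if_False)
    qed
    have po: "other_face (fst f) (pre_arrow (fst f) (snd f)) = other_face (fst g) (pre_arrow (fst g) (snd g)) \<and>
        pre_arrow (fst f) (snd f) = pre_arrow (fst g) (snd g)"
      using eq unfolding flag_step_def if_P [OF True] if_P [OF G] prod.inject .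
    note p = conjunct2 [OF po]
    have "fst f = fst g"
    proof (rule other_face_inj)
      show "fst f \<in> faces Q" "fst g \<in> faces Q" using True G by simp_all
      show "pre_arrow (fst f) (snd f) \<in> set (fst f)" using True pre_arrow(1) by simp
      show "pre_arrow (fst f) (snd f) \<in> set (fst g)" using G pre_arrow(1) unfolding p by simp
      show "other_face (fst f) (pre_arrow (fst f) (snd f)) = other_face (fst g) (pre_arrow (fst f) (snd f))"
        using conjunct1 [OF po] unfolding p .
    qed
    moreover have "snd f = snd g"
    proof -
      have "snd f = hd (face_return (fst f) (pre_arrow (fst f) (snd f)))"
        using face_return_pre_arrow(1) [of "fst f" "snd f"] True by simp
      also have "\<dots> = hd (face_return (fst g) (pre_arrow (fst g) (snd g)))"
        unfolding p by (simp only: \<open>fst f = fst g\<close>)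
      also have "\<dots> = snd g"
        using face_return_pre_arrow(1) [of "fst g" "snd g"] G by simp
      finally show ?thesis .
    qed
    ultimately show ?thesis by (rule prod_eqI)
  next
    case False
    then have f: "flag_step f = f" unfolding flag_step_def by (simp only: if_False)
    have "\<not> (fst g \<in> faces Q \<and> snd g \<in> set (fst g))"
      using flag_step_flag [of g] False eq f by auto
    then have "flag_step g = g" unfolding flag_step_def by (simp only: if_False)
    then show ?thesis using eq f by simp
  qed
qed

text \<open>The orbit of the pair at \<open>b\<close> is finite and the step is injective, so the
  orbit returns to \<open>b\<close>. The first boundary arrow met after leaving \<open>b\<close> is
  the start of the strand.\<close>

lemma strand_to_exists:
  assumes b: "b \<in> boundary_arrows Q"
  shows "\<exists>as fs. is_strand Q as fs \<and> last as = b"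
proof -
  define s where "s l = (flag_step ^^ l) (boundary_face Q b, b)" for l
  define G where "G l = fst (s l)" for l
  define a where "a l = snd (s l)" for l
  have flag: "G l \<in> faces Q \<and> a l \<in> set (G l)" for l
  proof (induction l)
    case 0 show ?case using boundary_arrow_faces [OF b] by (simp add: s_def G_def a_def)
  next
    case (Suc l)
    then show ?case using flag_step_flag [of "s l"] by (simp add: s_def G_def a_def)
  qed
  have step: "a (Suc l) = pre_arrow (G l) (a l)" "G (Suc l) = other_face (G l) (a (Suc l))" for l
    using flag [of l] by (simp_all add: s_def G_def a_def flag_step_def)
  have a0: "a 0 = b" by (simp add: a_def s_def)
  have "finite {y. \<exists>m. y = (flag_step ^^ m) (boundary_face Q b, b)}"
  proof (rule finite_subset)
    show "{y. \<exists>m. y = (flag_step ^^ m) (boundary_face Q b, b)} \<subseteq> faces Q \<times> E"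
    proof
      fix y assume "y \<in> {y. \<exists>m. y = (flag_step ^^ m) (boundary_face Q b, b)}"
      then obtain m where "y = s m" by (auto simp: s_def)
      then have "y = (G m, a m)" by (simp add: G_def a_def)
      then show "y \<in> faces Q \<times> E" using flag [of m] face_arcs by blast
    qed
    show "finite (faces Q \<times> E)" using finite_faces by simp
  qed
  then obtain m where m: "0 < m" "(flag_step ^^ m) (boundary_face Q b, b) = (boundary_face Q b, b)"
    using funpow_inj_finite [OF flag_step_inj] by blast
  define P where "P l \<longleftrightarrow> 0 < l \<and> a l \<in> boundary_arrows Q" for l
  have "P m" using m b by (simp add: P_def a_def s_def)
  define K where "K = (LEAST l. P l)"
  have K: "P K" unfolding K_def using \<open>P m\<close> by (rule LeastI)
  have small: "a l \<in> internal_arrows Q" if "0 < l" "l < K" for l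
  proof -
    have "\<not> P l" using that(2) unfolding K_def by (rule not_less_Least)
    then have "a l \<notin> boundary_arrows Q" using that by (simp add: P_def)
    then show ?thesis using boundary_or_internal flag [of l] face_arcs by blast
  qed
  define as where "as = map (\<lambda>i. a (K - i)) [0..<Suc K]"
  define fs where "fs = map (\<lambda>i. G (K - 1 - i)) [0..<K]"
  have len: "length as = Suc K" "length fs = K" by (simp_all add: as_def fs_def)
  have as: "as ! i = a (K - i)" if "i \<le> K" for i using that by (simp add: as_def del: upt_Suc)
  have fs: "fs ! i = G (K - 1 - i)" if "i < K" for i using that by (simp add: fs_def)
  have ne: "as \<noteq> []" using len by auto
  have hd: "hd as = a K" using ne as [of 0] by (simp add: hd_conv_nth)
  have last: "last as = b" using ne as [of K] a0 len by (simp add: last_conv_nth)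
  have "is_strand Q as fs"
    unfolding is_strand_def
  proof (intro conjI allI impI)
    show "fs \<noteq> []" using K len(2) by (auto simp: P_def)
    show "length as = Suc (length fs)" using len by simp
    show "hd as \<in> boundary_arrows Q" using K hd by (simp add: P_def)
    show "last as \<in> boundary_arrows Q" using last b by simp
  next
    fix i assume "i < length fs"
    then have i: "i < K" using len by simp
    define l where "l = K - 1 - i"
    have l: "K - i = Suc l" "K - Suc i = l" using i by (simp_all add: l_def)
    show "fs ! i \<in> faces Q" using fs [OF i] flag by simp
    show "follows_in (fs ! i) (as ! i) (as ! Suc i)"
      using fs [OF i] as [of i] as [of "Suc i"] i l step(1) face_return_pre_arrow(2) flag
      unfolding l_def [symmetric] by simp
  next
    fix i assume "Suc i < length fs"
    then have i: "i < K" "Suc i < K" using len by simp_all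
    define l where "l = K - 1 - Suc i"
    have l: "K - 1 - i = Suc l" "Suc l < K" using i by (simp_all add: l_def)
    have "G (Suc l) \<noteq> G l"
      using other_face(3) [of "G l" "a (Suc l)"] pre_arrow(1) [of "G l" "a l"] flag [of l] step small [OF _ l(2)] by simp
    then show "fs ! Suc i \<noteq> fs ! i" using fs [OF i(1)] fs [OF i(2)] l(1) unfolding l_def [symmetric] by auto
  qed
  then show ?thesis using last by blast
qed

end

section \<open>The boundary\<close>

lemma cyc_range: "n \<ge> 1 \<Longrightarrow> cyc n j \<in> {1..n}"
proof -
  assume n: "n \<ge> 1"
  then have "0 \<le> (j - 1) mod int n" "(j - 1) mod int n < int n" by simp_all
  then show ?thesis unfolding cyc_def by auto
qed

lemma cyc_id: "i \<in> {1..n} \<Longrightarrow> cyc n (int i) = i"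
proof -
  assume i: "i \<in> {1..n}"
  then have "(int i - 1) mod int n = int i - 1" by (intro mod_pos_pos_trivial) simp_all
  moreover have "nat (int i - 1) + 1 = i" using i by (simp add: Suc_nat_eq_nat_zadd1)
  ultimately show ?thesis unfolding cyc_def by simp
qed

lemma cyc_eq_iff: "n \<ge> 1 \<Longrightarrow> cyc n j = cyc n j' \<longleftrightarrow> int n dvd (j - j')"
proof -
  assume n: "n \<ge> 1"
  have "cyc n j = cyc n j' \<longleftrightarrow> (j - 1) mod int n = (j' - 1) mod int n"
    unfolding cyc_def using n by (simp add: nat_eq_iff)
  also have "\<dots> \<longleftrightarrow> int n dvd ((j - 1) - (j' - 1))" by (rule mod_eq_dvd_iff)
  finally show ?thesis by simp
qed

lemma int_cyc: "n \<ge> 1 \<Longrightarrow> int n dvd (int (cyc n j) - j)"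
proof -
  assume n: "n \<ge> 1"
  have "int (cyc n j) - j = ((j - 1) mod int n) - (j - 1)" unfolding cyc_def using n by simp
  also have "\<dots> = - (int n * ((j - 1) div int n))" using mult_div_mod_eq [of "int n" "j - 1"] by linarith
  finally show ?thesis by simp
qed

lemma cyc_cyc: "n \<ge> 1 \<Longrightarrow> cyc n (int (cyc n j) + k) = cyc n (j + k)"
  using int_cyc [of n j] by (simp add: cyc_eq_iff)

lemma cyc_cyc_minus: "n \<ge> 1 \<Longrightarrow> cyc n (int (cyc n j) - k) = cyc n (j - k)"
  using int_cyc [of n j] by (simp add: cyc_eq_iff)

lemma cyc_Suc: "i < n \<Longrightarrow> cyc n (int i + 1) = Suc i"
  using cyc_id [of "Suc i" n] by (simp add: add.commute)

text \<open>Going around the circle from \<open>j\<close>, where the value is 1, the function drops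
  to 0 just after \<open>j\<close> and rises again just after \<open>k\<close>. The stretch from
  \<open>j + 1\<close> to \<open>k\<close> where it is 0 contains position 1 iff it wraps around,
  that is, iff \<open>k < j\<close>.\<close>

lemma two_changes:
  fixes q :: "nat \<Rightarrow> nat"
  assumes j: "j \<in> {1..n}" and k: "k \<in> {1..n}" "k \<noteq> j" and q01: "\<And>i. i \<in> {1..n} \<Longrightarrow> q i \<le> 1"
    and qj: "q j = 1"
    and change: "\<And>i. i \<in> {1..n} \<Longrightarrow> q i \<noteq> q (cyc n (int i + 1)) \<longleftrightarrow> i = j \<or> i = k"
  shows "q 1 = (if k \<ge> j then 1 else 0)"
proof -
  have const: "q i = q i'" if "1 \<le> i" "i \<le> i'" "i' \<le> n" "\<And>l. i \<le> l \<Longrightarrow> l < i' \<Longrightarrow> l \<noteq> j \<and> l \<noteq> k" for i i'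
    using that(2,3,4)
  proof (induction i' rule: dec_induct)
    case base show ?case by simp
  next
    case (step m)
    have "m \<in> {1..n}" using step that(1) by simp
    then have "q m = q (Suc m)" using change [of m] step.prems(2) [of m] step cyc_Suc [of m n] by auto
    moreover have "q i = q m" by (rule step.IH) (use step.prems in auto)
    ultimately show ?case by simp
  qed
  show ?thesis
  proof (cases "k \<ge> j")
    case True
    then have "q 1 = q j" using j k by (intro const) auto
    then show ?thesis using True qj by simp
  next
    case False
    then have "q (Suc k) = q j" using j k by (intro const) auto
    then have "q (Suc k) = 1" using qj by simp
    moreover have "q k \<noteq> q (Suc k)" using change [OF k(1)] cyc_Suc [of k n] False j by auto
    ultimately have "q k = 0" using q01 [OF k(1)] by simp
    moreover have "q 1 = q k" using False k by (intro const) auto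
    ultimately show ?thesis using False by simp
  qed
qed

locale numbered_dimer = thin_dimer Q for Q :: "('v, 'a) dimer" +
  fixes n :: nat and b :: "nat \<Rightarrow> 'v" and \<alpha> :: "nat \<Rightarrow> 'a"
  assumes numbering: "clockwise_numbering Q n b \<alpha>"
begin

lemma b_bij: "bij_betw b {1..n} (boundary_verts Q)"
  and \<alpha>_bij: "bij_betw \<alpha> {1..n} (boundary_arrows Q)"
  using numbering by (simp_all add: clockwise_numbering_def)

lemma n_pos: "n \<ge> 1"
proof (rule ccontr)
  assume "\<not> n \<ge> 1"
  then have "boundary_arrows Q = {}" using \<alpha>_bij by (simp add: bij_betw_def)
  then show False using boundary_nonempty by simp
qed

lemma \<alpha>_boundary: "i \<in> {1..n} \<Longrightarrow> \<alpha> i \<in> boundary_arrows Q"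
  using bij_betwE [OF \<alpha>_bij] by blast

lemma \<alpha>_inj: "i \<in> {1..n} \<Longrightarrow> j \<in> {1..n} \<Longrightarrow> \<alpha> i = \<alpha> j \<longleftrightarrow> i = j"
  by (rule inj_on_eq_iff [OF bij_betw_imp_inj_on [OF \<alpha>_bij]])

lemma b_inj: "i \<in> {1..n} \<Longrightarrow> j \<in> {1..n} \<Longrightarrow> b i = b j \<longleftrightarrow> i = j"
  by (rule inj_on_eq_iff [OF bij_betw_imp_inj_on [OF b_bij]])

lemma \<alpha>_E: "i \<in> {1..n} \<Longrightarrow> \<alpha> i \<in> E"
  using \<alpha>_boundary by (simp add: boundary_arrows_def)

abbreviation "nx i \<equiv> cyc n (int i + 1)"

lemma nx_range: "nx i \<in> {1..n}"
  using cyc_range n_pos by blast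

lemma \<alpha>_ends:
  assumes i: "i \<in> {1..n}"
  shows "boundary_face Q (\<alpha> i) \<in> cl_faces Q \<Longrightarrow> tla (\<alpha> i) = b i \<and> hda (\<alpha> i) = b (nx i)"
    "boundary_face Q (\<alpha> i) \<notin> cl_faces Q \<Longrightarrow> tla (\<alpha> i) = b (nx i) \<and> hda (\<alpha> i) = b i"
proof -
  note f = boundary_arrow_faces(1,2) [OF \<alpha>_boundary [OF i]]
  have c: "(boundary_face Q (\<alpha> i) \<in> cl_faces Q \<longrightarrow> tla (\<alpha> i) = b i \<and> hda (\<alpha> i) = b (nx i)) \<and>
    (boundary_face Q (\<alpha> i) \<in> cc_faces Q \<longrightarrow> tla (\<alpha> i) = b (nx i) \<and> hda (\<alpha> i) = b i)"
    using numbering i f unfolding clockwise_numbering_def by simp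
  show "boundary_face Q (\<alpha> i) \<in> cl_faces Q \<Longrightarrow> tla (\<alpha> i) = b i \<and> hda (\<alpha> i) = b (nx i)"
    using c by simp
  show "boundary_face Q (\<alpha> i) \<notin> cl_faces Q \<Longrightarrow> tla (\<alpha> i) = b (nx i) \<and> hda (\<alpha> i) = b i"
    using c f(1) unfolding faces_def by simp
qed

lemma b_V: "i \<in> {1..n} \<Longrightarrow> b i \<in> V"
  using \<alpha>_ends [of i] \<alpha>_E [of i] tail_in_verts head_in_verts by metis

lemma b_boundary: "i \<in> {1..n} \<Longrightarrow> b i \<in> boundary_verts Q"
  using bij_betwE [OF b_bij] by blast

lemma xy_walks:
  assumes i: "i \<in> {1..n}"
  shows "awalk (b i) (x_arrows Q \<alpha> i) (b (nx i))" "awalk (b (nx i)) (y_arrows Q \<alpha> i) (b i)"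
    "x_arrows Q \<alpha> i \<noteq> []" "y_arrows Q \<alpha> i \<noteq> []"
    "x_arrows Q \<alpha> i @ y_arrows Q \<alpha> i \<in> face_paths_at Q (b i)"
    "y_arrows Q \<alpha> i @ x_arrows Q \<alpha> i \<in> face_paths_at Q (b (nx i))"
    "cval (b i) (b (nx i)) (x_arrows Q \<alpha> i) = 0" "cval (b (nx i)) (b i) (y_arrows Q \<alpha> i) = 0"
proof -
  note f = boundary_arrow_faces(1,2) [OF \<alpha>_boundary [OF i]]
  have a: "awalk (tla (\<alpha> i)) [\<alpha> i] (hda (\<alpha> i))" by (rule arc_implies_awalk [OF \<alpha>_E [OF i]])
  note facts = a face_return_awalk [OF f] face_return_nonempty [OF f] face_paths_tail [OF f] face_paths_head [OF f]
    cval_arrow_return [OF f]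
  show "awalk (b i) (x_arrows Q \<alpha> i) (b (nx i))" "awalk (b (nx i)) (y_arrows Q \<alpha> i) (b i)"
    "x_arrows Q \<alpha> i \<noteq> []" "y_arrows Q \<alpha> i \<noteq> []"
    "x_arrows Q \<alpha> i @ y_arrows Q \<alpha> i \<in> face_paths_at Q (b i)"
    "y_arrows Q \<alpha> i @ x_arrows Q \<alpha> i \<in> face_paths_at Q (b (nx i))"
    "cval (b i) (b (nx i)) (x_arrows Q \<alpha> i) = 0" "cval (b (nx i)) (b i) (y_arrows Q \<alpha> i) = 0"
    using facts \<alpha>_ends [OF i]
    by (cases "boundary_face Q (\<alpha> i) \<in> cl_faces Q"; simp add: x_arrows_def y_arrows_def)+
qed

definition W :: "'v \<Rightarrow> 'a list \<Rightarrow> nat" where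
  "W x p = (\<Sum>a\<leftarrow>p. M x a)"

lemma W_append: "W x (p @ q) = W x p + W x q" and W_Nil: "W x [] = 0"
  by (simp_all add: W_def)

lemma W_xy:
  assumes x: "x \<in> V" and i: "i \<in> {1..n}"
  shows "W x (x_arrows Q \<alpha> i) + W x (y_arrows Q \<alpha> i) = 1"
proof -
  have "awalk (b i) (x_arrows Q \<alpha> i @ y_arrows Q \<alpha> i) (b i)"
    using xy_walks(1,2) [OF i] by (rule awalk_appendI)
  then have "W x (x_arrows Q \<alpha> i @ y_arrows Q \<alpha> i) = 1"
    using loop_weight [OF x] cval_face_path [OF xy_walks(5) [OF i]] by (simp add: W_def)
  then show ?thesis by (simp add: W_append)
qed

lemma W_y:
  assumes x: "x \<in> V" and i: "i \<in> {1..n}"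
  shows "W x (y_arrows Q \<alpha> i) = (if boundary_face Q (\<alpha> i) \<in> cl_faces Q then 1 - M x (\<alpha> i) else M x (\<alpha> i))"
  using W_xy [OF x i] by (auto simp: x_arrows_def y_arrows_def W_def)

definition \<pi> :: "nat \<Rightarrow> nat" where "\<pi> = strand_perm Q n \<alpha>"

lemma strand_start:
  assumes "is_strand Q as fs"
  obtains i where "i \<in> {1..n}" "hd as = \<alpha> i"
proof -
  have "hd as \<in> \<alpha> ` {1..n}" using strand_backward(4) [OF assms] \<alpha>_bij by (simp add: bij_betw_def)
  then show ?thesis using that by blast
qed

text \<open>Existence was shown from the end of a strand. Sending an end to a start is injective by
  determinism, hence a permutation of the boundary labels, so every boundary arrow is also a
  start.\<close>

lemma strand_from:
  assumes j: "j \<in> {1..n}"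
  shows "\<exists>as fs k. k \<in> {1..n} \<and> is_strand Q as fs \<and> hd as = \<alpha> j \<and> last as = \<alpha> k"
proof -
  define \<sigma> where "\<sigma> k = (SOME i. i \<in> {1..n} \<and> (\<exists>as fs. is_strand Q as fs \<and> last as = \<alpha> k \<and> hd as = \<alpha> i))" for k
  have \<sigma>: "\<sigma> k \<in> {1..n} \<and> (\<exists>as fs. is_strand Q as fs \<and> last as = \<alpha> k \<and> hd as = \<alpha> (\<sigma> k))" if k: "k \<in> {1..n}" for k
  proof -
    obtain as fs where s: "is_strand Q as fs" "last as = \<alpha> k" using strand_to_exists [OF \<alpha>_boundary [OF k]] by blast
    obtain i where "i \<in> {1..n}" "hd as = \<alpha> i" using strand_start [OF s(1)] .
    then have "\<exists>i. i \<in> {1..n} \<and> (\<exists>as fs. is_strand Q as fs \<and> last as = \<alpha> k \<and> hd as = \<alpha> i)" using s by blast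
    then show ?thesis unfolding \<sigma>_def by (rule someI_ex)
  qed
  have "inj_on \<sigma> {1..n}"
  proof (rule inj_onI)
    fix k k' assume k: "k \<in> {1..n}" "k' \<in> {1..n}" "\<sigma> k = \<sigma> k'"
    obtain as fs where s: "is_strand Q as fs" "last as = \<alpha> k" "hd as = \<alpha> (\<sigma> k)" using \<sigma> [OF k(1)] by blast
    obtain as' fs' where s': "is_strand Q as' fs'" "last as' = \<alpha> k'" "hd as' = \<alpha> (\<sigma> k')" using \<sigma> [OF k(2)] by blast
    have "\<alpha> k = \<alpha> k'" using strand_deterministic [OF s(1) s'(1)] s s' k(3) by simp
    then show "k = k'" using \<alpha>_inj k by simp
  qed
  moreover have "\<sigma> ` {1..n} \<subseteq> {1..n}" using \<sigma> by blast
  ultimately have "\<sigma> ` {1..n} = {1..n}" by (intro endo_inj_surj) simp_all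
  then obtain k where k: "k \<in> {1..n}" "j = \<sigma> k" using j by blast
  then show ?thesis using \<sigma> [OF k(1)] by blast
qed

lemma \<pi>_strand:
  assumes j: "j \<in> {1..n}"
  shows "\<pi> j \<in> {1..n}" "\<exists>as fs. is_strand Q as fs \<and> hd as = \<alpha> j \<and> last as = \<alpha> (\<pi> j)"
proof -
  obtain as fs k where s: "k \<in> {1..n}" "is_strand Q as fs" "hd as = \<alpha> j" "last as = \<alpha> k"
    using strand_from [OF j] by blast
  have "\<pi> j = k" unfolding \<pi>_def strand_perm_def
  proof (rule the_equality)
    show "k \<in> {1..n} \<and> (\<exists>as fs. is_strand Q as fs \<and> hd as = \<alpha> j \<and> last as = \<alpha> k)" using s by blast
  next
    fix k' assume "k' \<in> {1..n} \<and> (\<exists>as fs. is_strand Q as fs \<and> hd as = \<alpha> j \<and> last as = \<alpha> k')"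
    then obtain as' fs' where s': "k' \<in> {1..n}" "is_strand Q as' fs'" "hd as' = \<alpha> j" "last as' = \<alpha> k'" by blast
    have "\<alpha> k' = \<alpha> k" using strand_deterministic [OF s'(2) s(2)] s s' by simp
    then show "k' = k" using \<alpha>_inj s(1) s'(1) by simp
  qed
  then show "\<pi> j \<in> {1..n}" "\<exists>as fs. is_strand Q as fs \<and> hd as = \<alpha> j \<and> last as = \<alpha> (\<pi> j)"
    using s by blast+
qed

lemma \<pi>_no_fixed_point:
  assumes j: "j \<in> {1..n}"
  shows "\<pi> j \<noteq> j"
proof
  assume eq: "\<pi> j = j"
  obtain as fs where "is_strand Q as fs" "hd as = \<alpha> j" "last as = \<alpha> (\<pi> j)"
    using \<pi>_strand(2) [OF j] by blast
  then show False using strand_cut(1) eq by metis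
qed

lemma M_change_iff:
  assumes i: "i \<in> {1..n}" and j: "j \<in> {1..n}"
  shows "M (tla (\<alpha> i)) (\<alpha> j) \<noteq> M (hda (\<alpha> i)) (\<alpha> j) \<longleftrightarrow> j = i \<or> \<pi> j = i"
proof -
  obtain as fs where s: "is_strand Q as fs" "last as = \<alpha> i" using strand_to_exists [OF \<alpha>_boundary [OF i]] by blast
  obtain m where m: "m \<in> {1..n}" "hd as = \<alpha> m" using strand_start [OF s(1)] .
  have iff: "M (tla (\<alpha> i)) (\<alpha> j) \<noteq> M (hda (\<alpha> i)) (\<alpha> j) \<longleftrightarrow> j = i \<or> j = m"
    if "j \<in> {1..n}" for j
    using strand_cut(2) [OF s(1) \<alpha>_boundary [OF that]] s(2) m \<alpha>_inj that i by simp
  obtain as' fs' where s': "is_strand Q as' fs'" "hd as' = \<alpha> m" "last as' = \<alpha> (\<pi> m)" using \<pi>_strand(2) [OF m(1)] by blast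
  have "\<alpha> (\<pi> m) = \<alpha> i" using strand_deterministic [OF s(1) s'(1)] s m(2) s' by simp
  then have pm: "\<pi> m = i" using \<alpha>_inj i \<pi>_strand(1) [OF m(1)] by simp
  have "j = m" if pj: "\<pi> j = i"
  proof -
    obtain bs gs where t: "is_strand Q bs gs" "hd bs = \<alpha> j" "last bs = \<alpha> i" using \<pi>_strand(2) [OF j] pj by metis
    have "M (tla (\<alpha> i)) (\<alpha> j) \<noteq> M (hda (\<alpha> i)) (\<alpha> j)"
      using strand_cut(2) [OF t(1) \<alpha>_boundary [OF j]] t by simp
    then have "j = i \<or> j = m" using iff [OF j] by simp
    moreover have "j \<noteq> i" using \<pi>_no_fixed_point [OF j] pj by auto
    ultimately show ?thesis by simp
  qed
  then show ?thesis using iff [OF j] pm by auto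
qed

lemma b_1: "b 1 \<in> V"
  using b_V n_pos by simp

text \<open>Here \<open>j\<close> is fixed and the base point moves around the circle. By
  \<open>M_change_iff\<close> the weight changes just when the base point passes \<open>j\<close> or
  \<open>\<pi> j\<close>. At \<open>b j\<close> it is 1, because \<open>\<alpha> j\<close> has
  weight 1 seen from its head and 0 seen from its tail.\<close>

lemma W_y_value:
  assumes j: "j \<in> {1..n}"
  shows "W (b 1) (y_arrows Q \<alpha> j) = (if \<pi> j \<ge> j then 1 else 0)"
proof (rule two_changes [OF j \<pi>_strand(1) [OF j] \<pi>_no_fixed_point [OF j]])
  fix i assume i: "i \<in> {1..n}"
  show "W (b i) (y_arrows Q \<alpha> j) \<le> 1" using W_xy [OF b_V [OF i] j] by simp
  have M1: "M (b i) (\<alpha> j) \<le> 1" "M (b (nx i)) (\<alpha> j) \<le> 1" using M_le_1 b_V i nx_range \<alpha>_E j by simp_all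
  have "M (b i) (\<alpha> j) \<noteq> M (b (nx i)) (\<alpha> j) \<longleftrightarrow> i = j \<or> i = \<pi> j"
    using M_change_iff [OF i j] \<alpha>_ends [OF i] by (cases "boundary_face Q (\<alpha> i) \<in> cl_faces Q") auto
  then show "W (b i) (y_arrows Q \<alpha> j) \<noteq> W (b (nx i)) (y_arrows Q \<alpha> j) \<longleftrightarrow> i = j \<or> i = \<pi> j"
    using M1 W_y [OF b_V [OF i] j] W_y [OF b_V [OF nx_range] j] by (auto split: if_splits)
next
  show "W (b j) (y_arrows Q \<alpha> j) = 1"
    using W_y [OF b_V [OF j] j] \<alpha>_ends [OF j] M_head [OF \<alpha>_E [OF j]] M_tail [OF \<alpha>_E [OF j]]
    by (cases "boundary_face Q (\<alpha> j) \<in> cl_faces Q") simp_all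
qed

lemma sum_W_y: "(\<Sum>j\<in>{1..n}. W (b 1) (y_arrows Q \<alpha> j)) = card (noninversions n \<pi>)"
proof -
  have "(\<Sum>j\<in>{1..n}. W (b 1) (y_arrows Q \<alpha> j)) = (\<Sum>j\<in>{1..n}. if \<pi> j \<ge> j then 1 else 0)"
    by (rule sum.cong [OF refl W_y_value])
  also have "\<dots> = card {j \<in> {1..n}. \<pi> j \<ge> j}"
    by (simp add: sum.inter_filter [symmetric])
  finally show ?thesis by (simp add: noninversions_def)
qed

end

section \<open>The dimer algebra\<close>

context fin_digraph
begin

lemma PA_mult_minus:
  assumes "f \<in> carrier PA" "g \<in> carrier PA" "h \<in> carrier PA"
  shows "f \<otimes>\<^bsub>PA\<^esub> (g \<ominus>\<^bsub>PA\<^esub> h) = f \<otimes>\<^bsub>PA\<^esub> g \<ominus>\<^bsub>PA\<^esub> f \<otimes>\<^bsub>PA\<^esub> h"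
    "(g \<ominus>\<^bsub>PA\<^esub> h) \<otimes>\<^bsub>PA\<^esub> f = g \<otimes>\<^bsub>PA\<^esub> f \<ominus>\<^bsub>PA\<^esub> h \<otimes>\<^bsub>PA\<^esub> f"
  using assms by (simp_all add: a_minus_def PA.r_distr PA.l_distr PA.r_minus PA.l_minus)

definition cong_mod :: "(('a, 'b) qpath \<Rightarrow> complex) set \<Rightarrow> ('a, 'b) qpath \<Rightarrow> ('a, 'b) qpath \<Rightarrow> bool" where
  "cong_mod J p q \<longleftrightarrow> single p \<ominus>\<^bsub>PA\<^esub> single q \<in> J"

lemma cong_mod_refl: "ideal J PA \<Longrightarrow> p \<in> paths G \<Longrightarrow> cong_mod J p p"
proof -
  assume J: "ideal J PA" and p: "p \<in> paths G"
  interpret J: ideal J PA by (rule J)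
  have "single p \<ominus>\<^bsub>PA\<^esub> single p = \<zero>\<^bsub>PA\<^esub>" using p by (simp add: PA.r_neg a_minus_def)
  then show ?thesis unfolding cong_mod_def by simp
qed

lemma cong_mod_sym:
  assumes J: "ideal J PA" and p: "p \<in> paths G" "q \<in> paths G" and c: "cong_mod J p q"
  shows "cong_mod J q p"
proof -
  interpret J: ideal J PA by (rule J)
  have "\<ominus>\<^bsub>PA\<^esub> (single p \<ominus>\<^bsub>PA\<^esub> single q) \<in> J" using c unfolding cong_mod_def by (rule J.a_inv_closed)
  moreover have "\<ominus>\<^bsub>PA\<^esub> (single p \<ominus>\<^bsub>PA\<^esub> single q) = single q \<ominus>\<^bsub>PA\<^esub> single p"
    using p by (simp add: a_minus_def PA.minus_add PA.a_comm)
  ultimately show ?thesis unfolding cong_mod_def by simp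
qed

lemma cong_mod_trans:
  assumes J: "ideal J PA" and p: "p \<in> paths G" "q \<in> paths G" "r \<in> paths G"
    and c: "cong_mod J p q" "cong_mod J q r"
  shows "cong_mod J p r"
proof -
  interpret J: ideal J PA by (rule J)
  have "(single p \<ominus>\<^bsub>PA\<^esub> single q) \<oplus>\<^bsub>PA\<^esub> (single q \<ominus>\<^bsub>PA\<^esub> single r) \<in> J"
    using c unfolding cong_mod_def by (rule J.a_closed)
  moreover have "(single p \<ominus>\<^bsub>PA\<^esub> single q) \<oplus>\<^bsub>PA\<^esub> (single q \<ominus>\<^bsub>PA\<^esub> single r) = single p \<ominus>\<^bsub>PA\<^esub> single r"
    unfolding PA_minus [OF single_closed [OF p(2)]] PA_minus [OF single_closed [OF p(3)]] path_algebra_simps(3)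
    by simp
  ultimately show ?thesis unfolding cong_mod_def by simp
qed

lemma cong_mod_context:
  assumes J: "ideal J PA" and w: "awalk u as v" "awalk u bs v" "awalk w cs u" "awalk v ds x"
    and c: "cong_mod J (u, as) (u, bs)"
  shows "cong_mod J (w, cs @ as @ ds) (w, cs @ bs @ ds)"
proof -
  interpret J: ideal J PA by (rule J)
  have P: "(u, as) \<in> paths G" "(u, bs) \<in> paths G" "(w, cs) \<in> paths G" "(v, ds) \<in> paths G"
    using w mem_pathsI by blast+
  have e: "awlast u as = v" "awlast u bs = v" "awlast w cs = u" using w by simp_all
  have el: "awlast w (cs @ as) = v" "awlast w (cs @ bs) = v" by (simp_all only: awlast_append' e)
  have "single (w, cs) \<otimes>\<^bsub>PA\<^esub> (single (u, as) \<ominus>\<^bsub>PA\<^esub> single (u, bs)) \<otimes>\<^bsub>PA\<^esub> single (v, ds) \<in> J"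
    using c P unfolding cong_mod_def by (intro J.I_r_closed J.I_l_closed single_closed)
  also have "single (w, cs) \<otimes>\<^bsub>PA\<^esub> (single (u, as) \<ominus>\<^bsub>PA\<^esub> single (u, bs)) \<otimes>\<^bsub>PA\<^esub> single (v, ds) =
      single (w, cs) \<otimes>\<^bsub>PA\<^esub> single (u, as) \<otimes>\<^bsub>PA\<^esub> single (v, ds) \<ominus>\<^bsub>PA\<^esub>
      single (w, cs) \<otimes>\<^bsub>PA\<^esub> single (u, bs) \<otimes>\<^bsub>PA\<^esub> single (v, ds)"
    using P by (simp only: PA_mult_minus PA_mult_closed single_closed)
  also have "\<dots> = single (w, cs @ as @ ds) \<ominus>\<^bsub>PA\<^esub> single (w, cs @ bs @ ds)"
    by (simp only: single_mult_single e el if_True append_assoc simp_thms)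
  finally show ?thesis unfolding cong_mod_def .
qed

end

context dimer_model_in_disk
begin

lemma feq_Collect: "Collect (feq as) = Collect (feq bs) \<longleftrightarrow> feq as bs"
proof
  assume "Collect (feq as) = Collect (feq bs)"
  then have "bs \<in> Collect (feq as)" by simp
  then show "feq as bs" by simp
next
  assume "feq as bs"
  then show "Collect (feq as) = Collect (feq bs)"
    using feq_trans feq_sym by (intro Collect_cong iffI) blast+
qed

text \<open>The start vertex is recorded because \<open>feq\<close> compares arrow lists only, and
  the empty list is a path at every vertex.\<close>

definition flip_label :: "('v, 'a) qpath \<Rightarrow> 'v \<times> 'a list set" where
  "flip_label p = (fst p, Collect (feq (snd p)))"

lemma flip_label_eq: "flip_label (u, as) = flip_label (v, bs) \<longleftrightarrow> u = v \<and> feq as bs"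
  by (simp add: flip_label_def feq_Collect)

sublocale flips: path_labelling "quiver Q" flip_label
proof
  fix u as v bs
  assume "(u, as) \<in> paths (quiver Q)" "(v, bs) \<in> paths (quiver Q)" and l: "flip_label (u, as) = flip_label (v, bs)"
  then have w: "awalk u as (awlast u as)" "u = v" "feq as bs" by (simp_all add: flip_label_eq mem_paths_iff)
  then have "awalk v bs (awlast u as)" using feq_awalk by blast
  then have "awlast v bs = awlast u as" by simp
  then show "u = v \<and> awlast u as = awlast v bs" using w(2) by simp
next
  fix u as bs w cs
  assume "flip_label (u, as) = flip_label (u, bs)"
  then show "flip_label (w, cs @ as) = flip_label (w, cs @ bs)"
    using feq_append [OF feq_refl, of as bs cs] by (simp add: flip_label_eq)
next
  fix u as bs cs
  assume "flip_label (u, as) = flip_label (u, bs)"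
  then show "flip_label (u, as @ cs) = flip_label (u, bs @ cs)"
    using feq_append [OF _ feq_refl, of as bs cs] by (simp add: flip_label_eq)
qed

lemma R_paths: "R_cc Q a = (hda a, face_return (cc_face a) a)" "R_cl Q a = (hda a, face_return (cl_face a) a)"
  by (simp_all add: R_cc_def R_cl_def cc_face_def cl_face_def)

lemma R_walks:
  assumes "a \<in> internal_arrows Q"
  shows "awalk (hda a) (face_return (cc_face a) a) (tla a)" "awalk (hda a) (face_return (cl_face a) a) (tla a)"
  using face_return_awalk internal_arrow_faces [OF assms] by (simp_all add: faces_def)

lemma R_mem_paths: "a \<in> internal_arrows Q \<Longrightarrow> R_cc Q a \<in> paths (quiver Q)" "a \<in> internal_arrows Q \<Longrightarrow> R_cl Q a \<in> paths (quiver Q)"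
  unfolding R_paths using R_walks mem_pathsI by blast+

lemma dimer_generators: "{single (R_cc Q a) \<ominus>\<^bsub>PA\<^esub> single (R_cl Q a) | a. a \<in> internal_arrows Q} \<subseteq> carrier PA"
  using R_mem_paths by auto

lemma dimer_ideal_ideal: "ideal (dimer_ideal Q) PA"
  unfolding dimer_ideal_def by (rule PA.genideal_ideal [OF dimer_generators])

lemma dimer_cong:
  assumes p: "awalk u p v" and pq: "feq p q"
  shows "cong_mod (dimer_ideal Q) (u, p) (u, q)"
proof -
  have step: "cong_mod (dimer_ideal Q) (u, q) (u, r)" if "awalk u q v" "flip q r" for q r
  proof -
    obtain as bs a where a: "a \<in> internal_arrows Q"
      and qr: "q = as @ face_return (cc_face a) a @ bs" "r = as @ face_return (cl_face a) a @ bs"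
      using \<open>flip q r\<close> unfolding flip_def by blast
    have w: "awalk (hda a) (face_return (cc_face a) a) (tla a)" "awalk (hda a) (face_return (cl_face a) a) (tla a)"
      by (rule R_walks [OF a])+
    have F: "face_return (cc_face a) a \<noteq> []"
      using face_return_nonempty internal_arrow_faces [OF a] by (simp add: faces_def)
    obtain y z where yz: "awalk u as y" "awalk y (face_return (cc_face a) a) z" "awalk z bs v"
      using \<open>awalk u q v\<close> unfolding qr(1) by auto
    have "y = hda a" "z = tla a" using awalk_ends [OF yz(2) w(1)] F by auto
    moreover have "cong_mod (dimer_ideal Q) (hda a, face_return (cc_face a) a) (hda a, face_return (cl_face a) a)"
      unfolding cong_mod_def R_paths [symmetric] dimer_ideal_def
      by (rule subsetD [OF PA.genideal_self [OF dimer_generators]]) (use a in blast)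
    ultimately show ?thesis
      unfolding qr using yz by (intro cong_mod_context [OF dimer_ideal_ideal w]) simp_all
  qed
  have "awalk u q v \<and> cong_mod (dimer_ideal Q) (u, p) (u, q)"
    using pq
  proof (induction rule: feq_induct)
    case refl
    show ?case using p cong_mod_refl [OF dimer_ideal_ideal mem_pathsI [OF p]] by simp
  next
    case (flip q r)
    then have w: "awalk u q v" "awalk u r v" "cong_mod (dimer_ideal Q) (u, p) (u, q)" using flip_awalk by simp_all
    show ?case
      using cong_mod_trans [OF dimer_ideal_ideal mem_pathsI [OF p] mem_pathsI [OF w(1)] mem_pathsI [OF w(2)] w(3) step [OF w(1) flip(2)]] w(2)
      by simp
  next
    case (flip' q r)
    then have w: "awalk u q v" "awalk u r v" "cong_mod (dimer_ideal Q) (u, p) (u, q)" using flip_awalk by simp_all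
    have "cong_mod (dimer_ideal Q) (u, q) (u, r)"
      by (rule cong_mod_sym [OF dimer_ideal_ideal mem_pathsI [OF w(2)] mem_pathsI [OF w(1)] step [OF w(2) flip'(2)]])
    then show ?case
      using cong_mod_trans [OF dimer_ideal_ideal mem_pathsI [OF p] mem_pathsI [OF w(1)] mem_pathsI [OF w(2)] w(3)] w(2)
      by simp
  qed
  then show ?thesis by simp
qed

text \<open>Each generator is a difference of two paths one flip apart and so lies in the label
  ideal. Conversely, differences along a chain of flips add up to elements of the dimer ideal, and
  differences of equally labelled paths span the label ideal.\<close>

lemma dimer_ideal_eq: "dimer_ideal Q = flips.label_ideal"
proof
  show "dimer_ideal Q \<subseteq> flips.label_ideal"
    unfolding dimer_ideal_def
  proof (rule PA.genideal_minimal [OF flips.label_ideal_ideal], rule subsetI)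
    fix z assume "z \<in> {single (R_cc Q a) \<ominus>\<^bsub>PA\<^esub> single (R_cl Q a) | a. a \<in> internal_arrows Q}"
    then obtain a where a: "a \<in> internal_arrows Q" "z = single (R_cc Q a) \<ominus>\<^bsub>PA\<^esub> single (R_cl Q a)" by blast
    have "flip (face_return (cc_face a) a) (face_return (cl_face a) a)"
      unfolding flip_def using a(1) by (metis append.left_neutral append.right_neutral)
    then have "flip_label (R_cc Q a) = flip_label (R_cl Q a)"
      unfolding R_paths flip_label_eq using flip_feq by simp
    then show "z \<in> flips.label_ideal"
      unfolding a(2) using flips.single_diff_label_ideal [OF R_mem_paths [OF a(1)]] by simp
  qed
  show "flips.label_ideal \<subseteq> dimer_ideal Q"
  proof (rule flips.label_ideal_subset [OF dimer_ideal_ideal])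
    fix p q assume pq: "p \<in> paths (quiver Q)" "q \<in> paths (quiver Q)" "flip_label p = flip_label q"
    have l: "fst q = fst p" "feq (snd p) (snd q)" using pq(3) by (simp_all add: flip_label_def feq_Collect)
    have "awalk (fst p) (snd p) (awlast (fst p) (snd p))" using pq(1) mem_paths_iff [of "fst p" "snd p"] by simp
    from dimer_cong [OF this l(2)]
    have "cong_mod (dimer_ideal Q) (fst p, snd p) (fst q, snd q)" unfolding l(1) .
    then show "single p \<ominus>\<^bsub>PA\<^esub> single q \<in> dimer_ideal Q" unfolding cong_mod_def prod.collapse .
  qed
qed

lemma dimer_class_eq_iff:
  assumes "(u, p) \<in> paths (quiver Q)" "(v, q) \<in> paths (quiver Q)"
  shows "dimer_class Q (single (u, p)) = dimer_class Q (single (v, q)) \<longleftrightarrow> u = v \<and> feq p q"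
  unfolding dimer_class_def
  using PA.quotient_eq_iff_same_a_r_cos [OF dimer_ideal_ideal single_closed [OF assms(1)] single_closed [OF assms(2)]]
    flips.single_diff_label_ideal [OF assms] by (simp add: dimer_ideal_eq flip_label_eq)

lemma fp_walk:
  assumes conn: "\<And>u v. u \<in> verts (quiver Q) \<Longrightarrow> v \<in> verts (quiver Q) \<Longrightarrow> \<exists>p. awalk u p v"
    and e: "e \<in> arcs (quiver Q)" and v: "v \<in> verts (quiver Q)"
  shows "awalk v (fp v) v"
proof -
  have "tla e \<noteq> hda e" by (rule loopfree_digraph.no_loops [OF no_loops e])
  then obtain w where w: "w \<in> verts (quiver Q)" "w \<noteq> v" using e tail_in_verts head_in_verts by metis
  obtain q where aw: "awalk v q w" using conn v w by blast
  then have "q \<noteq> []" using w by (auto simp: awalk_Nil_iff)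
  then obtain a p where "q = a # p" by (cases q) simp_all
  then have a: "a \<in> arcs (quiver Q)" "tla a = v" using aw by (auto simp: awalk_Cons_iff)
  obtain c where c: "c \<in> faces Q" "a \<in> set c" using arrow_in_face [OF a(1)] by blast
  have "fp v \<in> face_paths_at Q v" using fp_face_path(1) [OF face_paths_tail [OF c]] a by simp
  then show ?thesis by (rule face_paths_at_cases)
qed

lemma pw_Suc_right: "pw v (Suc m) = pw v m @ fp v"
  using pw_simps(3) [of v m 1] pw_simps(2) [of v 0] by (simp add: pw_simps)

text \<open>\<open>fp\<close> and \<open>face_element\<close> choose the same face path at each
  vertex. In a product with a single path only the summand at its end survives, so each factor
  appends one face path.\<close>

lemma class_times_f_eq:
  assumes fp: "\<And>v. v \<in> verts (quiver Q) \<Longrightarrow> awalk v (fp v) v" and q: "awalk u q v"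
  shows "class_times_f Q (u, q) m = dimer_class Q (single (u, q @ pw v m))"
proof -
  have f: "face_element Q = (\<Oplus>\<^bsub>PA\<^esub>v \<in> verts (quiver Q). single (v, fp v))"
    by (simp add: face_element_def fp_def)
  have fpP: "(v, fp v) \<in> paths (quiver Q)" if "v \<in> verts (quiver Q)" for v by (rule mem_pathsI [OF fp [OF that]])
  have fc: "face_element Q \<in> carrier PA"
    unfolding f by (rule PA.finsum_closed) (use fpP in auto)
  have v: "v \<in> verts (quiver Q)" using q by (simp add: awalk_last_in_verts)
  have pw: "awalk v (pw v m) v" for m
  proof (induction m)
    case 0 show ?case using v by (simp add: pw_simps awalk_Nil_iff)
  next
    case (Suc m) then show ?case unfolding pw_simps(2) by (rule awalk_appendI [OF fp [OF v]])
  qed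
  have one: "single (u, r) \<otimes>\<^bsub>PA\<^esub> face_element Q = single (u, r @ fp v)" if r: "awalk u r v" for r
  proof
    fix p
    have "single (u, r) \<otimes>\<^bsub>PA\<^esub> face_element Q = (\<Oplus>\<^bsub>PA\<^esub>w \<in> verts (quiver Q). single (u, r) \<otimes>\<^bsub>PA\<^esub> single (w, fp w))"
      unfolding f by (rule PA.finsum_rdistr) (use fpP mem_pathsI [OF r] in auto)
    then have "(single (u, r) \<otimes>\<^bsub>PA\<^esub> face_element Q) p = (\<Sum>w \<in> verts (quiver Q). (single (u, r) \<otimes>\<^bsub>PA\<^esub> single (w, fp w)) p)"
      using finsum_apply [of "verts (quiver Q)" "\<lambda>w. single (u, r) \<otimes>\<^bsub>PA\<^esub> single (w, fp w)" p]
        PA_mult_closed [OF single_closed [OF mem_pathsI [OF r]] single_closed [OF fpP]] by simp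
    also have "\<dots> = (\<Sum>w \<in> verts (quiver Q). if w = v then single (u, r @ fp v) p else 0)"
      by (rule sum.cong [OF refl]) (use r in \<open>simp add: single_mult_single\<close>)
    also have "\<dots> = single (u, r @ fp v) p" using v by simp
    finally show "(single (u, r) \<otimes>\<^bsub>PA\<^esub> face_element Q) p = single (u, r @ fp v) p" .
  qed
  have "single (u, q) \<otimes>\<^bsub>PA\<^esub> (face_element Q [^]\<^bsub>PA\<^esub> m) = single (u, q @ pw v m)"
  proof (induction m)
    case 0
    show ?case using PA_one_mult(2) [OF single_closed [OF mem_pathsI [OF q]]] by (simp add: pw_simps)
  next
    case (Suc m)
    have "single (u, q) \<otimes>\<^bsub>PA\<^esub> (face_element Q [^]\<^bsub>PA\<^esub> Suc m) = (single (u, q) \<otimes>\<^bsub>PA\<^esub> (face_element Q [^]\<^bsub>PA\<^esub> m)) \<otimes>\<^bsub>PA\<^esub> face_element Q"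
      by (simp add: PA_mult_assoc)
    also have "\<dots> = single (u, (q @ pw v m) @ fp v)"
      unfolding Suc.IH by (rule one [OF awalk_appendI [OF q pw]])
    finally show ?case by (simp add: pw_Suc_right)
  qed
  then show ?thesis by (simp add: class_times_f_def)
qed

lemma thin_dimerI:
  assumes thin: "thin Q" and bd: "boundary_arrows Q \<noteq> {}"
  shows "thin_dimer Q"
proof unfold_locales
  show "boundary_arrows Q \<noteq> {}" by (rule bd)
  obtain e where e: "e \<in> arcs (quiver Q)" using bd by (auto simp: boundary_arrows_def)
  \<comment> \<open>Face paths must be known to exist before \<open>class_times_f\<close> can be
    evaluated; for this it is enough that any two vertices are joined by a walk.\<close>
  have walk: "\<exists>p. awalk u p v" if "u \<in> verts (quiver Q)" "v \<in> verts (quiver Q)" for u v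
  proof -
    have "\<exists>r. r \<in> paths_between (quiver Q) u v"
      using bspec [OF bspec [OF thin [unfolded thin_def] that(1)] that(2)] by (elim bexE) (rule exI)
    then obtain r where "r \<in> paths_between (quiver Q) u v" by (elim exE)
    then have "awalk u (snd r) v" using paths_between_iff [of "fst r" "snd r" u v] by simp
    then show ?thesis by blast
  qed
  have fp: "awalk v (fp v) v" if "v \<in> verts (quiver Q)" for v
    by (rule fp_walk [OF walk e that])
  fix u v assume uv: "u \<in> verts (quiver Q)" "v \<in> verts (quiver Q)"
  obtain r0 where r0: "r0 \<in> paths_between (quiver Q) u v"
    "\<forall>p \<in> paths_between (quiver Q) u v. \<exists>!m. dimer_class Q (single p) = class_times_f Q r0 m"
    using thin uv unfolding thin_def by blast
  obtain r where r: "r0 = (u, r)" "awalk u r v"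
    using r0(1) paths_between_iff [of "fst r0" "snd r0" u v] by (metis prod.collapse)
  have pw: "awalk v (pw v m) v" for m
  proof (induction m)
    case 0 show ?case using uv by (simp add: pw_simps awalk_Nil_iff)
  next
    case (Suc m) then show ?case unfolding pw_simps(2) by (rule awalk_appendI [OF fp [OF uv(2)]])
  qed
  have "\<exists>!m. feq p (r @ pw v m)" if p: "awalk u p v" for p
  proof -
    have ct: "class_times_f Q r0 m = dimer_class Q (single (u, r @ pw v m))" for m
      unfolding r(1) by (rule class_times_f_eq [OF _ r(2)]) (rule fp)
    have iff: "dimer_class Q (single (u, p)) = class_times_f Q r0 m \<longleftrightarrow> feq p (r @ pw v m)" for m
      unfolding ct
      using dimer_class_eq_iff [OF mem_pathsI [OF p] mem_pathsI [OF awalk_appendI [OF r(2) pw]]] by simp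
    have "(u, p) \<in> paths_between (quiver Q) u v" using p by (simp add: paths_between_iff)
    with r0(2) have "\<exists>!m. dimer_class Q (single (u, p)) = class_times_f Q r0 m" by (rule bspec)
    then show ?thesis unfolding iff .
  qed
  then show "\<exists>r. awalk u r v \<and> (\<forall>p. awalk u p v \<longrightarrow> (\<exists>!m. feq p (r @ pw v m)))"
    using r(2) by blast
qed

lemma path_equivalent_iff:
  assumes "awalk u p v" "(w, q) \<in> paths (quiver Q)"
  shows "path_equivalent Q (u, p) (w, q) \<longleftrightarrow> w = u \<and> feq p q"
  unfolding path_equivalent_def using dimer_class_eq_iff [OF mem_pathsI [OF assms(1)] assms(2)] by auto

end

context thin_dimer
begin

lemma class_times_f: "awalk u q v \<Longrightarrow> class_times_f Q (u, q) m = dimer_class Q (single (u, q @ pw v m))"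
  by (rule class_times_f_eq [OF fp_props(2)])

text \<open>A positive c-value splits off a power of the face path; conversely, a factorisation
  through \<open>m\<close> face paths adds \<open>m\<close> to a c-value.\<close>

lemma minimal_path_iff:
  assumes r: "awalk u r v"
  shows "minimal_path Q (u, r) \<longleftrightarrow> cval u v r = 0"
proof
  assume min: "minimal_path Q (u, r)"
  have uv: "u \<in> V" "v \<in> V" using awalk_verts [OF r] by simp_all
  have mp: "awalk u (mp u v) v" using mp_props uv by blast
  have P: "(u, mp u v @ pw v m) \<in> paths (quiver Q)" for m
    by (rule mem_pathsI [OF awalk_appendI [OF mp pw_awalk [OF uv(2)]]])
  have "dimer_class Q (single (u, r)) = class_times_f Q (u, mp u v) (cval u v r)"
    unfolding class_times_f [OF mp] using dimer_class_eq_iff [OF mem_pathsI [OF r] P] cval_feq [OF r] by simp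
  then have "\<not> 1 \<le> cval u v r"
    using min mem_pathsI [OF mp] unfolding minimal_path_def by metis
  then show "cval u v r = 0" by simp
next
  assume 0: "cval u v r = 0"
  have "dimer_class Q (single (u, r)) \<noteq> class_times_f Q q m" if q: "q \<in> paths (quiver Q)" and m: "m \<ge> 1" for q m
  proof
    assume eq: "dimer_class Q (single (u, r)) = class_times_f Q q m"
    obtain w s where ws: "q = (w, s)" by (cases q)
    define y where "y = awlast w s"
    have s: "awalk w s y" using q ws by (simp add: mem_paths_iff y_def)
    have yV: "y \<in> V" using awalk_verts [OF s] by simp
    have sp: "awalk w (s @ pw y m) y" by (rule awalk_appendI [OF s pw_awalk [OF yV]])
    have "u = w \<and> feq r (s @ pw y m)"
      using eq dimer_class_eq_iff [OF mem_pathsI [OF r] mem_pathsI [OF sp]] unfolding ws class_times_f [OF s] by simp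
    then have f: "u = w" "feq r (s @ pw y m)" by simp_all
    have "awalk w (s @ pw y m) v" using feq_awalk [OF f(2)] r f(1) by simp
    then have yv: "v = y" using awalk_ends [OF sp] by metis
    have s': "awalk u s v" using s f(1) yv by simp
    have "cval u v r = cval u v (s @ pw v m)"
      using cval_eq_iff [OF r] f(2) sp unfolding f(1) yv by blast
    then show False using cval_pw [OF s'] 0 m by simp
  qed
  then show "minimal_path Q (u, r)" unfolding minimal_path_def using mem_pathsI [OF r] by blast
qed

lemma c_value_eq:
  assumes p: "awalk u p v"
  shows "c_value Q (u, p) = cval u v p"
proof -
  have uv: "u \<in> V" "v \<in> V" using awalk_verts [OF p] by simp_all
  have mp: "awalk u (mp u v) v" using mp_props uv by blast
  have iff: "dimer_class Q (single (u, p)) = class_times_f Q (u, r) m \<longleftrightarrow> cval u v p = cval u v r + m"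
    if r: "awalk u r v" for r m
    unfolding class_times_f [OF r]
    using dimer_class_eq_iff [OF mem_pathsI [OF p] mem_pathsI [OF awalk_appendI [OF r pw_awalk [OF uv(2)]]]]
      cval_eq_iff [OF p awalk_appendI [OF r pw_awalk [OF uv(2)]]] cval_pw [OF r] by simp
  have e: "path_start (u, p) = u" "path_end (quiver Q) (u, p) = v"
    using p by (simp_all add: path_start_def path_end_conv)
  show ?thesis unfolding c_value_def e
  proof (rule the_equality)
    have "(u, mp u v) \<in> paths_between (quiver Q) u v" using mp by (simp add: paths_between_iff)
    moreover have "minimal_path Q (u, mp u v)" using minimal_path_iff [OF mp] cval_mp [OF uv] by simp
    moreover have "dimer_class Q (single (u, p)) = class_times_f Q (u, mp u v) (cval u v p)"
      using iff [OF mp] cval_mp [OF uv] by simp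
    ultimately show "\<exists>r\<in>paths_between (quiver Q) u v. minimal_path Q r \<and>
        dimer_class Q (single (u, p)) = class_times_f Q r (cval u v p)" by blast
  next
    fix m assume "\<exists>r\<in>paths_between (quiver Q) u v. minimal_path Q r \<and> dimer_class Q (single (u, p)) = class_times_f Q r m"
    then obtain r0 where r0: "r0 \<in> paths_between (quiver Q) u v" "minimal_path Q r0"
      "dimer_class Q (single (u, p)) = class_times_f Q r0 m" by blast
    obtain r where r: "r0 = (u, r)" "awalk u r v"
      using r0(1) paths_between_iff [of "fst r0" "snd r0" u v] by (metis prod.collapse)
    have "cval u v r = 0" using r0(2) minimal_path_iff [OF r(2)] r(1) by simp
    then show "m = cval u v p" using iff [OF r(2), THEN iffD1, OF r0(3) [unfolded r(1)]] by linarith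
  qed
qed

text \<open>Flip labels and weights from \<open>x\<close> separate the same paths, so each of the
  two label ideals contains the differences that span the other.\<close>

lemma dimer_ideal_weight:
  assumes x: "x \<in> V"
  shows "dimer_ideal Q = path_labelling.label_ideal (quiver Q) (weighted_quiver.wlabel (quiver Q) (M x))"
proof -
  interpret W: weighted_quiver "quiver Q" "M x" ..
  have iff: "W.wlabel p = W.wlabel q \<longleftrightarrow> flip_label p = flip_label q"
    if pq: "p \<in> paths (quiver Q)" "q \<in> paths (quiver Q)" for p q
  proof -
    have w: "awalk (fst p) (snd p) (awlast (fst p) (snd p))" "awalk (fst q) (snd q) (awlast (fst q) (snd q))"
      using pq mem_paths_iff [of "fst p" "snd p"] mem_paths_iff [of "fst q" "snd q"] by simp_all
    show ?thesis
    proof (cases "fst p = fst q \<and> awlast (fst p) (snd p) = awlast (fst q) (snd q)")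
      case True
      then have q: "fst q = fst p" "awlast (fst p) (snd q) = awlast (fst p) (snd p)" by (metis, metis)
      have "awalk (fst p) (snd q) (awlast (fst p) (snd p))" using w(2) unfolding q by simp
      then have "feq (snd p) (snd q) \<longleftrightarrow> W.weight (snd p) = W.weight (snd q)"
        using feq_iff_weight [OF x w(1)] by (simp add: W.weight_def)
      then show ?thesis unfolding W.wlabel_def flip_label_def feq_Collect q prod.inject by blast
    next
      case False
      then have "flip_label p \<noteq> flip_label q"
        using flips.label_ends [of "fst p" "snd p" "fst q" "snd q"] pq by auto
      moreover have "W.wlabel p \<noteq> W.wlabel q" using False by (auto simp: W.wlabel_def)
      ultimately show ?thesis by simp
    qed
  qed
  have "flips.label_ideal = W.label_ideal"
  proof
    show "flips.label_ideal \<subseteq> W.label_ideal"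
      by (rule flips.label_ideal_subset [OF W.label_ideal_ideal]) (simp add: W.single_diff_label_ideal iff)
    show "W.label_ideal \<subseteq> flips.label_ideal"
      by (rule W.label_ideal_subset [OF flips.label_ideal_ideal]) (simp add: flips.single_diff_label_ideal iff)
  qed
  then show ?thesis by (simp add: dimer_ideal_eq)
qed

end

section \<open>Arrow-defining paths and the circle quiver\<close>

context dimer_model_in_disk
begin

lemma path_class_conv:
  assumes p: "awalk u p v"
  shows "path_class Q (u, p) = Pair u ` Collect (feq p)"
proof (intro equalityI subsetI)
  fix r assume r: "r \<in> path_class Q (u, p)"
  obtain w q where wq: "r = (w, q)" by (cases r)
  have "w = u \<and> feq p q"
    using r path_equivalent_iff [OF p, of w q] unfolding wq path_class_def by simp
  then show "r \<in> Pair u ` Collect (feq p)" unfolding wq by simp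
next
  fix r assume "r \<in> Pair u ` Collect (feq p)"
  then obtain q where q: "r = (u, q)" "feq p q" by (elim imageE) simp
  have "(u, q) \<in> paths (quiver Q)" using feq_awalk [OF q(2)] p mem_pathsI by blast
  then show "r \<in> path_class Q (u, p)"
    using path_equivalent_iff [OF p, of u q] q unfolding path_class_def by simp
qed

lemma path_class_eq:
  assumes "awalk u p v" "feq p q"
  shows "path_class Q (u, p) = path_class Q (u, q)"
proof -
  have "Collect (feq p) = Collect (feq q)" using assms(2) by (simp add: feq_Collect)
  then show ?thesis
    using path_class_conv [OF assms(1)] path_class_conv [of u q v] feq_awalk [OF assms(2)] assms(1) by simp
qed

end

context thin_dimer
begin

text \<open>The weight seen from \<open>u\<close> is a sum of nonnegative terms, and a cycle inside
  \<open>p\<close> would contribute at least 1 to it.\<close>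

lemma minimal_cycleless:
  assumes p: "awalk u p v" and 0: "cval u v p = 0"
  shows "cycleless Q (u, p)"
proof -
  have False if eq: "p = as @ bs @ cs" and bs: "bs \<noteq> []" "awalk w bs w" for as bs cs w
  proof -
    have u: "u \<in> V" using awalk_verts [OF p] by simp
    have "(\<Sum>a\<leftarrow>bs. M u a) \<ge> 1" using loop_weight [OF u bs(2)] cval_loop [OF bs(2,1)] by simp
    moreover have "(\<Sum>a\<leftarrow>p. M u a) = 0" using 0 cval_eq_sum [OF p] by simp
    moreover have "(\<Sum>a\<leftarrow>bs. M u a) \<le> (\<Sum>a\<leftarrow>p. M u a)" unfolding eq by simp
    ultimately show False by linarith
  qed
  then show ?thesis unfolding cycleless_def by auto
qed

text \<open>A path of positive c-value is equivalent to one that runs around a face, which is not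
  cycleless and hence not direct.\<close>

lemma arrow_defining_minimal:
  assumes p: "awalk u p v" and ad: "arrow_defining Q (u, p)"
  shows "cval u v p = 0"
proof (rule ccontr)
  assume "cval u v p \<noteq> 0"
  then obtain m where m: "cval u v p = Suc m" by (cases "cval u v p") simp_all
  have v: "v \<in> V" using awalk_verts [OF p] by simp
  let ?q = "mp u v @ fp v @ pw v m"
  have "feq p ?q" using cval_feq [OF p] unfolding m pw_simps by simp
  then have "(u, ?q) \<in> path_class Q (u, p)" unfolding path_class_conv [OF p] by simp
  then have "direct_path Q (u, ?q)" using ad unfolding arrow_defining_def by (elim conjE) (rule bspec)
  then have "cycleless Q (u, ?q)" unfolding direct_path_def by simp
  moreover have "fp v \<noteq> []" "awalk v (fp v) v" using fp_props [OF v] by simp_all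
  ultimately show False unfolding cycleless_def snd_conv by blast
qed

text \<open>All paths in the class have c-value 0 and are cycleless. A member that is not direct
  must therefore visit a further boundary vertex, and it is cut there.\<close>

lemma arrow_defining_or_split:
  assumes p: "awalk u p v" and 0: "cval u v p = 0" and uv: "u \<in> boundary_verts Q" "v \<in> boundary_verts Q"
    and nad: "\<not> arrow_defining Q (u, p)"
  obtains q r w where "feq p (q @ r)" "awalk u q w" "awalk w r v" "w \<in> boundary_verts Q" "w \<noteq> u" "w \<noteq> v"
proof -
  have "\<exists>s. feq p s \<and> \<not> direct_path Q (u, s)"
  proof (cases "direct_path Q (u, p)")
    case True
    then obtain s where "s \<in> path_class Q (u, p)" "\<not> direct_path Q s"
      using nad unfolding arrow_defining_def by blast
    then show ?thesis unfolding path_class_conv [OF p] by auto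
  next
    case False
    then show ?thesis using feq_refl by blast
  qed
  then obtain s where s: "feq p s" "\<not> direct_path Q (u, s)" by blast
  have w: "awalk u s v" using feq_awalk [OF s(1)] p by simp
  have "cval u v s = 0" using cval_eq_iff [OF p w] s(1) 0 by simp
  then have "cycleless Q (u, s)" by (rule minimal_cycleless [OF w])
  moreover have "path_start (u, s) = u" "path_end (quiver Q) (u, s) = v"
    using w by (simp_all add: path_start_def path_end_conv)
  ultimately have "\<not> set (pre_digraph.awalk_verts (quiver Q) u s) \<inter> boundary_verts Q \<subseteq> {u, v}"
    using s(2) uv mem_pathsI [OF w] unfolding direct_path_def by simp
  then obtain x where x: "x \<in> set (pre_digraph.awalk_verts (quiver Q) u s)" "x \<in> boundary_verts Q" "x \<noteq> u" "x \<noteq> v"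
    by blast
  obtain q r where "s = q @ r" "awalk u q x" "awalk x r v" using awalk_decomp [OF w x(1)] by blast
  then show thesis using that [of q r x] s(1) x by simp
qed

text \<open>Summed over all base points so that every nonconstant path has positive weight.\<close>

definition total_weight :: "'a list \<Rightarrow> nat" where
  "total_weight p = (\<Sum>x\<in>V. \<Sum>a\<leftarrow>p. M x a)"

lemma total_weight_append: "total_weight (p @ q) = total_weight p + total_weight q"
  by (simp add: total_weight_def sum.distrib)

lemma total_weight_feq:
  assumes "awalk u p v" "feq p q"
  shows "total_weight p = total_weight q"
  unfolding total_weight_def
proof (rule sum.cong [OF refl])
  fix x assume "x \<in> V"
  moreover have "awalk u q v" using feq_awalk [OF assms(2)] assms(1) by simp
  ultimately show "(\<Sum>a\<leftarrow>p. M x a) = (\<Sum>a\<leftarrow>q. M x a)" using feq_iff_weight assms by blast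
qed

lemma total_weight_pos:
  assumes p: "awalk u p v" and ne: "p \<noteq> []"
  shows "total_weight p > 0"
proof -
  obtain a q where aq: "p = a # q" using ne by (cases p) simp_all
  have a: "a \<in> E" using p unfolding aq by (simp add: awalk_Cons_iff)
  have "1 \<le> (\<Sum>b\<leftarrow>p. M (hda a) b)" unfolding aq using M_head [OF a] by simp
  also have "\<dots> \<le> total_weight p" unfolding total_weight_def
    by (rule member_le_sum) (use head_in_verts [OF a] in simp_all)
  finally show ?thesis by simp
qed

end

section \<open>Lifting boundary paths to the circle quiver\<close>

context numbered_dimer
begin

abbreviation "src P \<equiv> t_label n b (representative P)"
abbreviation "tgt P \<equiv> h_label Q n b (representative P)"
abbreviation "word P \<equiv> snd (representative P)"

lemma vertex_label_b: "i \<in> {1..n} \<Longrightarrow> vertex_label n b (b i) = i"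
  unfolding vertex_label_def by (rule inv_into_f_f [OF bij_betw_imp_inj_on [OF b_bij]])

lemma boundary_label:
  assumes "v \<in> boundary_verts Q"
  obtains i where "i \<in> {1..n}" "v = b i"
proof -
  have "v \<in> b ` {1..n}" using assms b_bij by (simp add: bij_betw_def)
  then show thesis using that by blast
qed

lemma labels:
  assumes "i \<in> {1..n}" "j \<in> {1..n}" "awalk (b i) p (b j)"
  shows "t_label n b (b i, p) = i" "h_label Q n b (b i, p) = j"
  using assms vertex_label_b
  by (simp_all add: t_label_def h_label_def path_start_def path_end_conv)

text \<open>The representative is an arbitrary member of the class. Equivalent paths share ends and
  c-value, so what is read off from it describes the class.\<close>

lemma NBP_props:
  assumes P: "P \<in> NBP Q n b"
  shows "src P \<in> {1..n}" "tgt P \<in> {1..n}" "awalk (b (src P)) (word P) (b (tgt P))"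
    "cval (b (src P)) (b (tgt P)) (word P) = 0" "representative P = (b (src P), word P)"
    "path_class Q (b (src P), word P) = P"
proof -
  obtain p0 where p0: "P = path_class Q p0" "arrow_defining Q p0" using P unfolding NBP_def by blast
  obtain u p where up: "p0 = (u, p)" by (cases p0)
  define v where "v = awlast u p"
  have d: "direct_path Q (u, p)" using p0(2) unfolding up arrow_defining_def by simp
  then have p: "awalk u p v" unfolding direct_path_def v_def mem_paths_iff by simp
  have uv: "u \<in> boundary_verts Q" "v \<in> boundary_verts Q"
    using d unfolding direct_path_def by (simp_all add: path_start_def path_end_conv v_def)
  obtain i where i: "i \<in> {1..n}" "u = b i" by (rule boundary_label [OF uv(1)])
  obtain j where j: "j \<in> {1..n}" "v = b j" by (rule boundary_label [OF uv(2)])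
  have Pc: "P = Pair u ` Collect (feq p)" using p0(1) path_class_conv [OF p] unfolding up by simp
  have "(u, p) \<in> P" unfolding Pc by simp
  then have "representative P \<in> P" unfolding representative_def by (rule someI)
  then obtain q where q: "representative P = (u, q)" "feq p q" unfolding Pc by (elim imageE) simp
  have qw: "awalk u q v" using feq_awalk [OF q(2)] p by simp
  have l: "src P = i" "tgt P = j" using labels [OF i(1) j(1), of q] qw unfolding q(1) i(2) j(2) by simp_all
  show "src P \<in> {1..n}" "tgt P \<in> {1..n}" unfolding l using i j by simp_all
  show "awalk (b (src P)) (word P) (b (tgt P))" unfolding l unfolding q(1) using qw i j by simp
  have "cval u v q = 0"
    using arrow_defining_minimal [OF p] p0(2) cval_eq_iff [OF p qw] q(2) unfolding up by simp
  then show "cval (b (src P)) (b (tgt P)) (word P) = 0" unfolding l unfolding q(1) using i j by simp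
  show "representative P = (b (src P), word P)" unfolding l unfolding q(1) using i by simp
  show "path_class Q (b (src P), word P) = P"
    unfolding l unfolding q(1) using path_class_eq [OF p q(2)] p0(1) up i by simp
qed

text \<open>Arrow-defining paths are minimal, and minimal paths with common ends are equivalent.
  Because of this the one relation summed over all classes can be separated into a relation for each
  class.\<close>

lemma NBP_inj: "inj_on (\<lambda>P. (src P, tgt P)) (NBP Q n b)"
proof (rule inj_onI)
  fix P P' assume P: "P \<in> NBP Q n b" "P' \<in> NBP Q n b" "(src P, tgt P) = (src P', tgt P')"
  then have l: "src P' = src P" "tgt P' = tgt P" by simp_all
  note p = NBP_props [OF P(1)] and p' = NBP_props [OF P(2), unfolded l]
  have "feq (word P) (word P')" using cval_eq_iff [OF p(3) p'(3)] p(4) p'(4) by simp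
  then show "P = P'" using path_class_eq [OF p(3)] p(6) p'(6) by simp
qed

lemma NBP_finite: "finite (NBP Q n b)"
proof (rule inj_on_finite [OF NBP_inj])
  show "(\<lambda>P. (src P, tgt P)) ` NBP Q n b \<subseteq> {1..n} \<times> {1..n}"
    using NBP_props(1,2) by (intro image_subsetI SigmaI)
qed simp

lemma circ_simps [simp]:
  "verts (circ_quiver Q n b) = {1..n}"
  "arcs (circ_quiver Q n b) = X_arrow ` {1..n} \<union> Y_arrow ` {1..n} \<union> P_arrow ` NBP Q n b"
  "tail (circ_quiver Q n b) (X_arrow i) = i" "head (circ_quiver Q n b) (X_arrow i) = nx i"
  "tail (circ_quiver Q n b) (Y_arrow i) = nx i" "head (circ_quiver Q n b) (Y_arrow i) = i"
  "tail (circ_quiver Q n b) (P_arrow P) = src P" "head (circ_quiver Q n b) (P_arrow P) = tgt P"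
  by (simp_all add: circ_quiver_def)

lemma circ_arc_cases:
  assumes "e \<in> arcs (circ_quiver Q n b)"
  obtains i where "i \<in> {1..n}" "e = X_arrow i" | i where "i \<in> {1..n}" "e = Y_arrow i"
    | P where "P \<in> NBP Q n b" "e = P_arrow P"
  using assms unfolding circ_simps by blast

sublocale circ: fin_digraph "circ_quiver Q n b"
proof
  fix e assume "e \<in> arcs (circ_quiver Q n b)"
  then show "tail (circ_quiver Q n b) e \<in> verts (circ_quiver Q n b)"
    "head (circ_quiver Q n b) e \<in> verts (circ_quiver Q n b)"
    by (cases rule: circ_arc_cases; use nx_range NBP_props(1,2) in simp)+
qed (simp_all add: NBP_finite)

fun arr :: "('v, 'a) qpath set circ_arrow \<Rightarrow> 'a list" where
  "arr (X_arrow i) = x_arrows Q \<alpha> i"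
| "arr (Y_arrow i) = y_arrows Q \<alpha> i"
| "arr (P_arrow P) = word P"

abbreviation "expand q \<equiv> concat (map arr q)"

lemma arr_walk:
  assumes "e \<in> arcs (circ_quiver Q n b)"
  shows "awalk (b (tail (circ_quiver Q n b) e)) (arr e) (b (head (circ_quiver Q n b) e))"
  using assms by (cases rule: circ_arc_cases) (use xy_walks NBP_props(3) in simp_all)

lemma circ_arrow_walks:
  "i \<in> {1..n} \<Longrightarrow> circ.awalk i [X_arrow i] (nx i)"
  "i \<in> {1..n} \<Longrightarrow> circ.awalk (nx i) [Y_arrow i] i"
  "P \<in> NBP Q n b \<Longrightarrow> circ.awalk (src P) [P_arrow P] (tgt P)"
  using circ.arc_implies_awalk [of "X_arrow i"] circ.arc_implies_awalk [of "Y_arrow i"]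
    circ.arc_implies_awalk [of "P_arrow P"] by simp_all

text \<open>Induction on the total weight. Between equal or neighbouring vertices the constant path,
  \<open>x\<^sub>i\<close> or \<open>y\<^sub>j\<close> has c-value 0 and so is equivalent to
  \<open>p\<close>. Otherwise \<open>p\<close> is arrow-defining and has an arrow of its own, or it
  splits at a boundary vertex into two minimal paths of smaller total weight.\<close>

lemma minimal_lift:
  "\<lbrakk>i \<in> {1..n}; j \<in> {1..n}; awalk (b i) p (b j); cval (b i) (b j) p = 0\<rbrakk> \<Longrightarrow>
    \<exists>q. circ.awalk i q j \<and> feq p (expand q)"
proof (induction "total_weight p" arbitrary: i j p rule: less_induct)
  case less
  note i = less.prems(1) and j = less.prems(2) and p = less.prems(3) and 0 = less.prems(4)
  note eqI = cval_eq_iff [OF p, unfolded 0, THEN iffD2, OF _ sym]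
  consider "j = i" | "j = nx i" | "i = nx j" | "j \<noteq> i" "j \<noteq> nx i" "i \<noteq> nx j" by blast
  then show ?case
  proof cases
    case 1
    have "feq p (expand [])"
      using eqI [of "[]"] cval_Nil [OF b_V [OF i]] b_V [OF i] by (simp add: 1 awalk_Nil_iff)
    moreover have "circ.awalk i [] j" using i 1 by (simp add: circ.awalk_Nil_iff)
    ultimately show ?thesis by blast
  next
    case 2
    have "feq p (expand [X_arrow i])" using eqI [of "x_arrows Q \<alpha> i"] xy_walks(1,7) [OF i] by (simp add: 2)
    then show ?thesis using circ_arrow_walks(1) [OF i] unfolding 2 by blast
  next
    case 3
    have "feq p (expand [Y_arrow j])" using eqI [of "y_arrows Q \<alpha> j"] xy_walks(2,8) [OF j] by (simp add: 3)
    then show ?thesis using circ_arrow_walks(2) [OF j] unfolding 3 by blast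
  next
    case 4
    show ?thesis
    proof (cases "arrow_defining Q (b i, p)")
      case True
      let ?P = "path_class Q (b i, p)"
      have "j \<noteq> cyc n (int i - 1)"
      proof
        assume "j = cyc n (int i - 1)"
        then have "nx j = i" using cyc_cyc [OF n_pos, of "int i - 1" 1] cyc_id [OF i] by simp
        then show False using 4 by simp
      qed
      then have "nonadjacent Q n b (b i, p)" unfolding nonadjacent_def labels [OF i j p] using 4 by simp
      then have P: "?P \<in> NBP Q n b" using True unfolding NBP_def by blast
      \<comment> \<open>The representative of the class may be a path other than \<open>p\<close>;
        being equivalent to \<open>p\<close>, it has the same ends, so the new arrow runs from
        \<open>i\<close> to \<open>j\<close>.\<close>
      have "(b (src ?P), word ?P) \<in> path_class Q (b (src ?P), word ?P)"
        unfolding path_class_conv [OF NBP_props(3) [OF P]] by simp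
      then have r: "(b (src ?P), word ?P) \<in> Pair (b i) ` Collect (feq p)"
        unfolding NBP_props(6) [OF P] unfolding path_class_conv [OF p] .
      then have f: "feq p (word ?P)" and bi: "b (src ?P) = b i" by auto
      have "src ?P = i" using bi b_inj [OF NBP_props(1) [OF P] i] by simp
      moreover have "awalk (b i) (word ?P) (b j)" using feq_awalk [OF f] p by simp
      then have "h_label Q n b (b (src ?P), word ?P) = j" unfolding bi by (rule labels(2) [OF i j])
      then have "tgt ?P = j" using NBP_props(5) [OF P] by simp
      ultimately have "circ.awalk i [P_arrow ?P] j" using circ_arrow_walks(3) [OF P] by simp
      moreover have "feq p (expand [P_arrow ?P])" using f by simp
      ultimately show ?thesis by blast
    next
      case False
      obtain q r w where s: "feq p (q @ r)" "awalk (b i) q w" "awalk w r (b j)" "w \<in> boundary_verts Q" "w \<noteq> b i" "w \<noteq> b j"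
        by (rule arrow_defining_or_split [OF p 0 b_boundary [OF i] b_boundary [OF j] False])
      obtain l where l: "l \<in> {1..n}" "w = b l" by (rule boundary_label [OF s(4)])
      have q: "awalk (b i) q (b l)" and r: "awalk (b l) r (b j)" using s l by simp_all
      have ne: "q \<noteq> []" "r \<noteq> []" using s by (auto simp: awalk_Nil_iff)
      have tw: "total_weight p = total_weight q + total_weight r"
        using total_weight_feq [OF p s(1)] total_weight_append by simp
      have qr: "awalk (b i) (q @ r) (b j)" by (rule awalk_appendI [OF q r])
      have c: "cval (b i) (b j) (q @ r) = 0" using cval_eq_iff [OF p qr] s(1) 0 by simp
      have cq: "cval (b i) (b l) q = 0" "cval (b l) (b j) r = 0"
        using c cval_append_left [OF q r] cval_append_right [OF q r] by simp_all
      obtain q' where q': "circ.awalk i q' l" "feq q (expand q')"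
        using less.hyps [OF _ i l(1) q cq(1)] tw total_weight_pos [OF r ne(2)] by auto
      obtain r' where r': "circ.awalk l r' j" "feq r (expand r')"
        using less.hyps [OF _ l(1) j r cq(2)] tw total_weight_pos [OF q ne(1)] by auto
      have "circ.awalk i (q' @ r') j" by (rule circ.awalk_appendI [OF q'(1) r'(1)])
      moreover have "feq p (expand (q' @ r'))" using feq_trans [OF s(1) feq_append [OF q'(2) r'(2)]] by simp
      ultimately show ?thesis by blast
    qed
  qed
qed

lemma fp_lift:
  assumes j: "j \<in> {1..n}"
  shows "\<exists>q. circ.awalk j q j \<and> feq (pw (b j) m) (expand q)"
proof (induction m)
  case 0
  have "circ.awalk j [] j" using j by (simp add: circ.awalk_Nil_iff)
  moreover have "feq (pw (b j) 0) (expand [])" by (simp add: pw_simps)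
  ultimately show ?case by blast
next
  case (Suc m)
  then obtain q where q: "circ.awalk j q j" "feq (pw (b j) m) (expand q)" by blast
  have "circ.awalk j ([X_arrow j] @ [Y_arrow j] @ q) j"
    by (intro circ.awalk_appendI [OF circ_arrow_walks(1) [OF j]] circ.awalk_appendI [OF circ_arrow_walks(2) [OF j]] q(1))
  moreover have "feq (fp (b j)) (x_arrows Q \<alpha> j @ y_arrows Q \<alpha> j)"
    by (rule feq_sym [OF fp_face_path(2) [OF xy_walks(5) [OF j]]])
  then have "feq (pw (b j) (Suc m)) (expand ([X_arrow j] @ [Y_arrow j] @ q))"
    using feq_append [OF _ q(2), of "fp (b j)" "x_arrows Q \<alpha> j @ y_arrows Q \<alpha> j"] by (simp add: pw_simps)
  ultimately show ?case by blast
qed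

lemma boundary_path_lift:
  assumes i: "i \<in> {1..n}" and j: "j \<in> {1..n}" and p: "awalk (b i) p (b j)"
  shows "\<exists>q. circ.awalk i q j \<and> feq p (expand q)"
proof -
  obtain q where q: "circ.awalk i q j" "feq (mp (b i) (b j)) (expand q)"
    using minimal_lift [OF i j mp_props(1) cval_mp] b_V i j by blast
  obtain r where r: "circ.awalk j r j" "feq (pw (b j) (cval (b i) (b j) p)) (expand r)"
    using fp_lift [OF j] by blast
  have "feq p (expand (q @ r))"
    using feq_trans [OF cval_feq [OF p] feq_append [OF q(2) r(2)]] by simp
  then show ?thesis using circ.awalk_appendI [OF q(1) r(1)] by blast
qed

definition circ_weight :: "('v, 'a) qpath set circ_arrow \<Rightarrow> nat" where
  "circ_weight e = W (b 1) (arr e)"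

lemma circ_weight_expand: "weighted_quiver.weight circ_weight q = W (b 1) (expand q)"
proof -
  interpret H: weighted_quiver "circ_quiver Q n b" circ_weight ..
  show ?thesis unfolding H.weight_def by (induction q) (simp_all add: circ_weight_def W_append W_Nil)
qed

text \<open>By \<open>dimer_ideal_weight\<close> every base point describes the same dimer ideal.
  \<open>b 1\<close> is taken because noninversions compare labels in the order that begins at
  1.\<close>

sublocale circ_map: quiver_map "quiver Q" "M (b 1)" "circ_quiver Q n b" circ_weight b arr
proof unfold_locales
  show "inj_on b (verts (circ_quiver Q n b))" using bij_betw_imp_inj_on [OF b_bij] by simp
  show "b ` verts (circ_quiver Q n b) \<subseteq> V" using b_V by auto
  fix e assume "e \<in> arcs (circ_quiver Q n b)"
  then show "awalk (b (tail (circ_quiver Q n b) e)) (arr e) (b (head (circ_quiver Q n b) e))" by (rule arr_walk)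
next
  interpret G: weighted_quiver "quiver Q" "M (b 1)" ..
  fix e show "weighted_quiver.weight (M (b 1)) (arr e) = circ_weight e"
    unfolding G.weight_def circ_weight_def W_def ..
next
  fix i j p assume a: "i \<in> verts (circ_quiver Q n b)" "j \<in> verts (circ_quiver Q n b)" "awalk (b i) p (b j)"
  interpret G: weighted_quiver "quiver Q" "M (b 1)" ..
  obtain q where q: "circ.awalk i q j" "feq p (expand q)"
    using boundary_path_lift [of i j p] a unfolding circ_simps by blast
  have "awalk (b i) (expand q) (b j)" using feq_awalk [OF q(2)] a(3) by simp
  then have "weighted_quiver.weight circ_weight q = G.weight p"
    unfolding circ_weight_expand unfolding W_def G.weight_def using feq_iff_weight [OF b_1 a(3)] q(2) by metis
  then show "\<exists>q. circ.awalk i q j \<and> weighted_quiver.weight circ_weight q = G.weight p" using q(1) by blast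
qed

end

section \<open>Cancellative ideals\<close>

context fin_digraph
begin

lemma ideal_finsum_closed:
  assumes J: "ideal J PA" and S: "finite S" "\<And>i. i \<in> S \<Longrightarrow> g i \<in> J"
  shows "(\<Oplus>\<^bsub>PA\<^esub>i\<in>S. g i) \<in> J"
proof -
  interpret J: ideal J PA by (rule J)
  show ?thesis using S
  proof (induction S rule: finite_induct)
    case empty then show ?case by simp
  next
    case (insert i S)
    have "(\<Oplus>\<^bsub>PA\<^esub>i\<in>insert i S. g i) = g i \<oplus>\<^bsub>PA\<^esub> (\<Oplus>\<^bsub>PA\<^esub>i\<in>S. g i)"
      using insert J.a_subset by (intro PA.finsum_insert) auto
    then show ?case using insert by (simp add: J.a_closed)
  qed
qed

lemma single_mult_walks:
  assumes "awalk u p v"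
  shows "single (u, p) \<otimes>\<^bsub>PA\<^esub> single (v, q) = single (u, p @ q)"
  using single_mult_single [of u p v q] assms by simp

lemma cancellative_ideal_ideal: "cancellative_ideal G J \<Longrightarrow> ideal J PA"
  by (simp add: cancellative_ideal_def)

text \<open>Cancellativity is applied to the two-term combination with coefficients 1 and -1, with a
  constant path on the left.\<close>

lemma cancellative_right:
  assumes J: "cancellative_ideal G J" and p: "awalk u p v" and q: "awalk u q v" and d: "awalk v d w"
    and c: "cong_mod J (u, p @ d) (u, q @ d)"
  shows "cong_mod J (u, p) (u, q)"
proof -
  define P where "P l = (if l = 1 then (u, p) else (u, q))" for l :: nat
  define s where "s l = (if l = 1 then 1 else -1 :: complex)" for l :: nat
  define z where "z = (\<Oplus>\<^bsub>PA\<^esub>l\<in>{1..2}. s l \<odot>\<^bsub>PA\<^esub> single (P l))"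
  have u: "awalk u [] u" using awalk_hd_in_verts [OF p] by (simp add: awalk_Nil_iff)
  have paths: "(u, p) \<in> paths G" "(u, q) \<in> paths G" "(u, []) \<in> paths G" "(v, d) \<in> paths G"
    using p q u d mem_pathsI by blast+
  have P: "P l \<in> paths G" for l using paths by (simp add: P_def)
  have z: "z = single (u, p) \<ominus>\<^bsub>PA\<^esub> single (u, q)"
  proof
    fix r
    have "z r = (\<Sum>l\<in>{1, 2 :: nat}. (s l \<odot>\<^bsub>PA\<^esub> single (P l)) r)"
    proof -
      have "{1..2} = {1, 2 :: nat}" by auto
      then show ?thesis unfolding z_def by (subst finsum_apply) (simp_all add: P PA_smult_closed del: One_nat_def)
    qed
    then show "z r = (single (u, p) \<ominus>\<^bsub>PA\<^esub> single (u, q)) r"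
      unfolding PA_minus [OF single_closed [OF paths(2)]] by (simp add: path_algebra_simps(4) s_def P_def)
  qed
  have ends: "path_end G (u, []) = u" "path_start (v, d) = v" by (simp_all add: path_end_conv path_start_def)
  have "\<forall>l\<in>{1..2}. P l \<in> paths_between G u v" using p q by (simp add: P_def paths_between_iff)
  then have "single (u, []) \<otimes>\<^bsub>PA\<^esub> z \<otimes>\<^bsub>PA\<^esub> single (v, d) \<in> J \<longleftrightarrow> z \<in> J"
    using J paths(3,4) unfolding cancellative_ideal_def Let_def z_def
    by (elim conjE allE [where x = 2] ballE [where x = "(u, [])"] ballE [where x = "(v, d)"] allE [where x = P] allE [where x = s] impE)
      (simp_all add: ends)
  moreover have "single (u, []) \<otimes>\<^bsub>PA\<^esub> z \<otimes>\<^bsub>PA\<^esub> single (v, d) = single (u, p @ d) \<ominus>\<^bsub>PA\<^esub> single (u, q @ d)"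
    unfolding z using paths
    by (simp add: PA_mult_minus PA_mult_closed single_mult_walks [OF u] single_mult_walks [OF p] single_mult_walks [OF q])
  ultimately show ?thesis using c unfolding cong_mod_def z by simp
qed

text \<open>The cancellation equivalence holds in each of the intersected ideals and passes to the
  intersection. The ideal \<open>I\<close> makes the family nonempty, as an empty intersection would
  contain all functions.\<close>

lemma cancellative_closure_cancellative:
  assumes I: "cancellative_ideal G I" "S \<subseteq> I"
  shows "cancellative_ideal G (cancellative_closure G S)"
proof -
  have "ideal (cancellative_closure G S) PA"
    unfolding cancellative_closure_def
    by (rule PA.i_Intersect) (use I in \<open>auto intro: cancellative_ideal_ideal\<close>)
  then show ?thesis
    unfolding cancellative_ideal_def cancellative_closure_def Let_def by (intro conjI) (assumption, blast)
qed

definition diff_sum :: "'i set \<Rightarrow> ('i \<Rightarrow> ('a, 'b) qpath) \<Rightarrow> ('i \<Rightarrow> ('a, 'b) qpath) \<Rightarrow> ('a, 'b) qpath \<Rightarrow> complex" where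
  "diff_sum S F F' = (\<Oplus>\<^bsub>PA\<^esub>i\<in>S. single (F i) \<ominus>\<^bsub>PA\<^esub> single (F' i))"

lemma diff_sum_mem:
  assumes "ideal J PA" "finite S" "\<And>i. i \<in> S \<Longrightarrow> cong_mod J (F i) (F' i)"
  shows "diff_sum S F F' \<in> J"
  unfolding diff_sum_def
  by (rule ideal_finsum_closed [OF assms(1,2)]) (rule assms(3) [unfolded cong_mod_def])

text \<open>The defining relations are sums over all vertices or all classes. Multiplying by the
  constant paths at the ends of one summand kills the others, since no other summand has both of
  these ends.\<close>

lemma diff_sum_memD:
  assumes J: "ideal J PA" and S: "finite S" and s: "\<And>i. i \<in> S \<Longrightarrow> awalk (s i) (p i) (t i) \<and> awalk (s i) (q i) (t i)"
    and inj: "inj_on (\<lambda>i. (s i, t i)) S"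
    and mem: "diff_sum S (\<lambda>i. (s i, p i)) (\<lambda>i. (s i, q i)) \<in> J" and i: "i \<in> S"
  shows "cong_mod J (s i, p i) (s i, q i)"
proof -
  interpret J: ideal J PA by (rule J)
  let ?d = "\<lambda>j. single (s j, p j) \<ominus>\<^bsub>PA\<^esub> single (s j, q j)"
  have P: "(s j, p j) \<in> paths G" "(s j, q j) \<in> paths G" if "j \<in> S" for j using s [OF that] mem_pathsI by blast+
  have d: "?d j \<in> carrier PA" if "j \<in> S" for j using P [OF that] by simp
  have T: "(s i, []) \<in> paths G" "(t i, []) \<in> paths G"
    using s [OF i] awalk_hd_in_verts awalk_last_in_verts by (auto simp: mem_paths_iff awalk_Nil_iff)
  have step: "single (s i, []) \<otimes>\<^bsub>PA\<^esub> ?d j \<otimes>\<^bsub>PA\<^esub> single (t i, []) = (if i = j then ?d j else \<zero>\<^bsub>PA\<^esub>)" if j: "j \<in> S" for j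
  proof -
    have e: "awlast (s j) (p j) = t j" "awlast (s j) (q j) = t j" using s [OF j] by simp_all
    have one: "single (s i, []) \<otimes>\<^bsub>PA\<^esub> single (s j, r) \<otimes>\<^bsub>PA\<^esub> single (t i, []) = (if i = j then single (s j, r) else \<zero>\<^bsub>PA\<^esub>)"
      if r: "awlast (s j) r = t j" for r
    proof (cases "s j = s i")
      case True
      have "single (s i, []) \<otimes>\<^bsub>PA\<^esub> single (s j, r) = single (s j, r)"
        using True by (simp add: single_mult_single)
      moreover have "single (s j, r) \<otimes>\<^bsub>PA\<^esub> single (t i, []) = (if t i = t j then single (s j, r) else \<zero>\<^bsub>PA\<^esub>)"
        using r by (simp add: single_mult_single path_algebra_simps(1))
      moreover have "t i = t j \<longleftrightarrow> i = j" using inj_onD [OF inj _ i j] True by auto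
      ultimately show ?thesis by simp
    next
      case False
      have "single (s i, []) \<otimes>\<^bsub>PA\<^esub> single (s j, r) = \<zero>\<^bsub>PA\<^esub>"
        using False by (simp add: single_mult_single path_algebra_simps(1))
      then show ?thesis using False T by auto
    qed
    show ?thesis
      using P [OF j] T one [OF e(1)] one [OF e(2)]
      by (simp add: PA_mult_minus PA_mult_closed) (simp add: a_minus_def)
  qed
  have "single (s i, []) \<otimes>\<^bsub>PA\<^esub> (\<Oplus>\<^bsub>PA\<^esub>j\<in>S. ?d j) \<otimes>\<^bsub>PA\<^esub> single (t i, []) =
      (\<Oplus>\<^bsub>PA\<^esub>j\<in>S. single (s i, []) \<otimes>\<^bsub>PA\<^esub> ?d j) \<otimes>\<^bsub>PA\<^esub> single (t i, [])"
    by (subst PA.finsum_rdistr [OF S]) (use d T in auto)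
  also have "\<dots> = (\<Oplus>\<^bsub>PA\<^esub>j\<in>S. single (s i, []) \<otimes>\<^bsub>PA\<^esub> ?d j \<otimes>\<^bsub>PA\<^esub> single (t i, []))"
    by (rule PA.finsum_ldistr [OF S]) (use d T in \<open>auto intro: PA_mult_closed\<close>)
  also have "\<dots> = (\<Oplus>\<^bsub>PA\<^esub>j\<in>S. if i = j then ?d j else \<zero>\<^bsub>PA\<^esub>)"
    by (rule PA.finsum_cong' [OF refl]) (use d step in auto)
  also have "\<dots> = ?d i"
    by (rule PA.finsum_singleton [OF i S]) (use d in auto)
  finally show ?thesis
    using J.I_r_closed [OF J.I_l_closed [OF mem single_closed [OF T(1)]] single_closed [OF T(2)]]
    unfolding cong_mod_def diff_sum_def by simp
qed

end

text \<open>Only the partition of \<open>S\<close> into fibres matters, and \<open>f\<close> and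
  \<open>g\<close> have the same fibres.\<close>

lemma sum_fibres_zero:
  fixes c :: "'i \<Rightarrow> 'b :: comm_monoid_add"
  assumes fg: "\<And>i j. i \<in> S \<Longrightarrow> j \<in> S \<Longrightarrow> g i = g j \<longleftrightarrow> f i = f j"
    and 0: "\<And>l. (\<Sum>i\<in>S. if f i = l then c i else 0) = 0"
  shows "(\<Sum>i\<in>S. if g i = l then c i else 0) = 0"
proof (cases "l \<in> g ` S")
  case True
  then obtain j where j: "j \<in> S" "l = g j" by blast
  have "(\<Sum>i\<in>S. if g i = l then c i else 0) = (\<Sum>i\<in>S. if f i = f j then c i else 0)"
    by (rule sum.cong [OF refl]) (simp add: j fg)
  then show ?thesis using 0 by simp
next
  case False
  then show ?thesis by (intro sum.neutral) auto
qed

context weighted_quiver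
begin

text \<open>Composition with fixed paths on both sides adds a constant to all weights, so it neither
  merges nor splits the classes of equal weight among the parallel paths \<open>p l\<close>.\<close>

lemma label_ideal_cancellative: "cancellative_ideal G label_ideal"
  unfolding cancellative_ideal_def Let_def
proof (intro conjI allI impI ballI)
  show "ideal label_ideal PA" by (rule label_ideal_ideal)
  fix m :: nat and a b :: "('v, 'a) qpath" and p :: "nat \<Rightarrow> ('v, 'a) qpath" and c :: "nat \<Rightarrow> complex"
  assume a: "a \<in> paths G" and b: "b \<in> paths G"
    and p: "\<forall>l\<in>{1..m}. p l \<in> paths_between G (path_end G a) (path_start b)"
  obtain u as where ua: "a = (u, as)" by (cases a)
  obtain w bs where wb: "b = (w, bs)" by (cases b)
  define v where "v = awlast u as"
  have A: "awalk u as v" using a by (simp add: ua mem_paths_iff v_def)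
  have B: "awalk w bs (awlast w bs)" using b by (simp add: wb mem_paths_iff)
  have P: "fst (p l) = v \<and> awalk v (snd (p l)) w" if "l \<in> {1..m}" for l
    using bspec [OF p that] paths_between_iff [of "fst (p l)" "snd (p l)" v w]
    by (simp add: ua wb path_end_conv path_start_def v_def)
  define F where "F l = (u, as @ snd (p l) @ bs)" for l
  have path: "p l \<in> paths G" if "l \<in> {1..m}" for l
    using mem_pathsI [OF conjunct2 [OF P [OF that]]] P [OF that] prod.collapse [of "p l"] by simp
  have F: "F l \<in> paths G" if "l \<in> {1..m}" for l
    unfolding F_def
    by (rule mem_pathsI [OF awalk_appendI [OF A awalk_appendI [OF conjunct2 [OF P [OF that]] B]]])
  let ?z = "\<Oplus>\<^bsub>PA\<^esub>l\<in>{1..m}. c l \<odot>\<^bsub>PA\<^esub> single (p l)"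
  have z: "?z = lin_comb {1..m} c p"
    by (rule ext) (subst finsum_apply; (rule PA_smult_closed)?; simp add: path lin_comb_def path_algebra_simps(4))
  have step: "single a \<otimes>\<^bsub>PA\<^esub> (c l \<odot>\<^bsub>PA\<^esub> single (p l)) \<otimes>\<^bsub>PA\<^esub> single b = c l \<odot>\<^bsub>PA\<^esub> single (F l)" if l: "l \<in> {1..m}" for l
  proof -
    have "single a \<otimes>\<^bsub>PA\<^esub> single (p l) = single (u, as @ snd (p l))"
      using single_mult_walks [OF A, of "snd (p l)"] P [OF l] prod.collapse [of "p l"] unfolding ua by simp
    moreover have "single (u, as @ snd (p l)) \<otimes>\<^bsub>PA\<^esub> single b = single (F l)"
      using single_mult_walks [OF awalk_appendI [OF A conjunct2 [OF P [OF l]]], of bs] by (simp add: wb F_def)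
    ultimately show ?thesis by (simp add: PA_smult_mult)
  qed
  have "single a \<otimes>\<^bsub>PA\<^esub> ?z \<otimes>\<^bsub>PA\<^esub> single b = (\<Oplus>\<^bsub>PA\<^esub>l\<in>{1..m}. single a \<otimes>\<^bsub>PA\<^esub> (c l \<odot>\<^bsub>PA\<^esub> single (p l))) \<otimes>\<^bsub>PA\<^esub> single b"
    by (subst PA.finsum_rdistr) (use a path in \<open>auto intro: PA_smult_closed\<close>)
  also have "\<dots> = (\<Oplus>\<^bsub>PA\<^esub>l\<in>{1..m}. single a \<otimes>\<^bsub>PA\<^esub> (c l \<odot>\<^bsub>PA\<^esub> single (p l)) \<otimes>\<^bsub>PA\<^esub> single b)"
    by (rule PA.finsum_ldistr) (use a b path in \<open>auto intro!: PA_mult_closed PA_smult_closed\<close>)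
  also have "\<dots> = (\<Oplus>\<^bsub>PA\<^esub>l\<in>{1..m}. c l \<odot>\<^bsub>PA\<^esub> single (F l))"
    by (rule PA.finsum_cong' [OF refl]) (use step F in \<open>auto intro: PA_smult_closed\<close>)
  also have "\<dots> = lin_comb {1..m} c F"
    by (rule ext) (subst finsum_apply; (rule PA_smult_closed)?; simp add: F lin_comb_def path_algebra_simps(4))
  finally have azb: "single a \<otimes>\<^bsub>PA\<^esub> ?z \<otimes>\<^bsub>PA\<^esub> single b = lin_comb {1..m} c F" .
  have mem: "lin_comb {1..m} c K \<in> label_ideal \<longleftrightarrow> (\<forall>l. (\<Sum>i\<in>{1..m}. if wlabel (K i) = l then c i else 0) = 0)"
    if "\<And>i. i \<in> {1..m} \<Longrightarrow> K i \<in> paths G" for K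
  proof -
    have sum: "label_sum (lin_comb {1..m} c K) l = (\<Sum>i\<in>{1..m}. if wlabel (K i) = l then c i else 0)" for l
      by (rule label_sum_lin_comb [OF finite_atLeastAtMost that])
    have "lin_comb {1..m} c K \<in> carrier PA" by (rule lin_comb_closed [OF finite_atLeastAtMost that])
    then show ?thesis unfolding sum [symmetric] using label_idealI label_idealD by blast
  qed
  have label: "wlabel (F i) = wlabel (F j) \<longleftrightarrow> wlabel (p i) = wlabel (p j)" if i: "i \<in> {1..m}" and j: "j \<in> {1..m}" for i j
  proof -
    have e: "awlast u (as @ snd (p l) @ bs) = awlast w bs" "awlast v (snd (p l)) = w" if "l \<in> {1..m}" for l
      using awalk_appendI [OF A awalk_appendI [OF conjunct2 [OF P [OF that]] B]] P [OF that] by simp_all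
    show ?thesis
      unfolding wlabel_def F_def fst_conv snd_conv e(1) [OF i] e(1) [OF j] conjunct1 [OF P [OF i]] conjunct1 [OF P [OF j]]
        e(2) [OF i] e(2) [OF j]
      by simp
  qed
  show "single a \<otimes>\<^bsub>PA\<^esub> ?z \<otimes>\<^bsub>PA\<^esub> single b \<in> label_ideal \<longleftrightarrow> ?z \<in> label_ideal"
  proof -
    have "(\<forall>l. (\<Sum>i\<in>{1..m}. if wlabel (F i) = l then c i else 0) = 0) \<longleftrightarrow>
        (\<forall>l. (\<Sum>i\<in>{1..m}. if wlabel (p i) = l then c i else 0) = 0)"
    proof (intro iffI allI)
      fix l assume 0: "\<forall>l. (\<Sum>i\<in>{1..m}. if wlabel (F i) = l then c i else 0) = 0"
      show "(\<Sum>i\<in>{1..m}. if wlabel (p i) = l then c i else 0) = 0"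
        by (rule sum_fibres_zero [where f = "\<lambda>i. wlabel (F i)"]) (simp only: label, rule spec [OF 0])
    next
      fix l assume 0: "\<forall>l. (\<Sum>i\<in>{1..m}. if wlabel (p i) = l then c i else 0) = 0"
      show "(\<Sum>i\<in>{1..m}. if wlabel (F i) = l then c i else 0) = 0"
        by (rule sum_fibres_zero [where f = "\<lambda>i. wlabel (p i)"]) (simp only: label, rule spec [OF 0])
    qed
    moreover have "lin_comb {1..m} c F \<in> label_ideal \<longleftrightarrow> (\<forall>l. (\<Sum>i\<in>{1..m}. if wlabel (F i) = l then c i else 0) = 0)"
      by (rule mem) (rule F)
    moreover have "lin_comb {1..m} c p \<in> label_ideal \<longleftrightarrow> (\<forall>l. (\<Sum>i\<in>{1..m}. if wlabel (p i) = l then c i else 0) = 0)"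
      by (rule mem) (rule path)
    ultimately show ?thesis unfolding azb unfolding z by simp
  qed
qed

end

section \<open>The relations of the circle quiver\<close>

lemma descending_Suc: "descending n f i (Suc m) = f (cyc n i) @ descending n f (i - 1) m"
proof -
  have "[0..<Suc m] = 0 # map Suc [0..<m]" by (simp only: map_Suc_upt upt_conv_Cons zero_less_Suc)
  then show ?thesis unfolding descending_def by (simp add: comp_def algebra_simps)
qed

context numbered_dimer
begin

abbreviation "pv i \<equiv> cyc n (int i - 1)"
abbreviation "R \<equiv> {1..n}"

lemma nx_pv: "i \<in> R \<Longrightarrow> nx (pv i) = i" and pv_nx: "i \<in> R \<Longrightarrow> pv (nx i) = i"
  using cyc_cyc [OF n_pos, of "int i - 1" 1] cyc_cyc_minus [OF n_pos, of "int i + 1" 1] cyc_id [of i n] by simp_all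

lemma pv_range: "pv i \<in> R"
  using cyc_range n_pos by blast

text \<open>\<open>x_run\<close>, \<open>y_run\<close> and \<open>e_run\<close> are the words at
  vertex \<open>i\<close> occurring in the powers of \<open>x\<close>, \<open>y\<close> and
  \<open>xy\<close>. \<open>Y_arrow\<close> is indexed by its head, so the one leaving
  \<open>i\<close> is \<open>Y_arrow (pv i)\<close>.\<close>

primrec x_run :: "nat \<Rightarrow> nat \<Rightarrow> ('v, 'a) qpath set circ_arrow list" where
  "x_run 0 i = []"
| "x_run (Suc m) i = X_arrow i # x_run m (nx i)"

primrec y_run :: "nat \<Rightarrow> nat \<Rightarrow> ('v, 'a) qpath set circ_arrow list" where
  "y_run 0 i = []"
| "y_run (Suc m) i = Y_arrow (pv i) # y_run m (pv i)"

primrec e_run :: "nat \<Rightarrow> nat \<Rightarrow> ('v, 'a) qpath set circ_arrow list" where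
  "e_run 0 i = []"
| "e_run (Suc m) i = [X_arrow i, Y_arrow i] @ e_run m i"

lemma circ_Nil_walk: "i \<in> R \<Longrightarrow> circ.awalk i [] i"
  by (simp add: circ.awalk_Nil_iff)

lemma Y_walk: "i \<in> R \<Longrightarrow> circ.awalk i [Y_arrow (pv i)] (pv i)"
  using circ_arrow_walks(2) [OF pv_range, of i] by (simp add: nx_pv)

lemma x_run_walk: "i \<in> R \<Longrightarrow> circ.awalk i (x_run m i) (cyc n (int i + int m))"
proof (induction m arbitrary: i)
  case 0 then show ?case using circ_Nil_walk cyc_id by simp
next
  case (Suc m)
  have "circ.awalk i ([X_arrow i] @ x_run m (nx i)) (cyc n (int (nx i) + int m))"
    by (rule circ.awalk_appendI [OF circ_arrow_walks(1) [OF Suc.prems] Suc.IH [OF nx_range]])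
  then show ?case unfolding cyc_cyc [OF n_pos] by (simp add: algebra_simps)
qed

lemma y_run_walk: "i \<in> R \<Longrightarrow> circ.awalk i (y_run m i) (cyc n (int i - int m))"
proof (induction m arbitrary: i)
  case 0 then show ?case using circ_Nil_walk cyc_id by simp
next
  case (Suc m)
  have "circ.awalk i ([Y_arrow (pv i)] @ y_run m (pv i)) (cyc n (int (pv i) - int m))"
    by (rule circ.awalk_appendI [OF Y_walk [OF Suc.prems] Suc.IH [OF pv_range]])
  then show ?case unfolding cyc_cyc_minus [OF n_pos] by (simp add: algebra_simps)
qed

lemma XY_walk: "i \<in> R \<Longrightarrow> circ.awalk i [X_arrow i, Y_arrow i] i"
  using circ.awalk_appendI [OF circ_arrow_walks(1,2)] by fastforce

lemma e_run_walk: "i \<in> R \<Longrightarrow> circ.awalk i (e_run m i) i"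
proof (induction m)
  case 0 then show ?case using circ_Nil_walk by simp
next
  case (Suc m)
  show ?case unfolding e_run.simps by (rule circ.awalk_appendI [OF XY_walk [OF Suc.prems] Suc.IH [OF Suc.prems]])
qed

lemma x_run_add: "i \<in> R \<Longrightarrow> x_run (m + l) i = x_run m i @ x_run l (cyc n (int i + int m))"
proof (induction m arbitrary: i)
  case 0 then show ?case using cyc_id by simp
next
  case (Suc m)
  have "cyc n (int (nx i) + int m) = cyc n (int i + int (Suc m))"
    using cyc_cyc [OF n_pos, of "int i + 1" "int m"] by (simp add: algebra_simps)
  then show ?case using Suc.IH [OF nx_range] by (simp only: add_Suc x_run.simps append_Cons)
qed

lemma y_run_add: "i \<in> R \<Longrightarrow> y_run (m + l) i = y_run m i @ y_run l (cyc n (int i - int m))"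
proof (induction m arbitrary: i)
  case 0 then show ?case using cyc_id by simp
next
  case (Suc m)
  have "cyc n (int (pv i) - int m) = cyc n (int i - int (Suc m))"
    using cyc_cyc_minus [OF n_pos, of "int i - 1" "int m"] by (simp add: algebra_simps)
  then show ?case using Suc.IH [OF pv_range] by (simp only: add_Suc y_run.simps append_Cons)
qed

lemma e_run_add: "e_run (m + l) i = e_run m i @ e_run l i"
  by (induction m) simp_all

text \<open>Stated for a general \<open>g\<close> because it is needed in the circle quiver itself
  and, with \<open>arr\<close>, for the paths \<open>y\<^sub>i\<close> in \<open>Q\<close>.\<close>

lemma descending_y_run:
  assumes g: "\<And>j. g (Y_arrow j) = f j"
  shows "i \<in> R \<Longrightarrow> descending n f (int i - 1) m = concat (map g (y_run m i))"
proof (induction m arbitrary: i)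
  case 0 then show ?case by (simp add: descending_def)
next
  case (Suc m)
  have "cyc n (int i - 1 - 1 - int l) = cyc n (int (pv i) - 1 - int l)" for l
    using cyc_cyc_minus [OF n_pos, of "int i - 1" "1 + int l"] by (simp add: algebra_simps)
  then have "descending n f (int i - 1 - 1) m = descending n f (int (pv i) - 1) m"
    unfolding descending_def by simp
  then show ?case using Suc.IH [OF pv_range] unfolding descending_Suc by (simp add: g)
qed

text \<open>Sums of one path per vertex, the shape shared by \<open>x\<close>, \<open>y\<close>,
  their products and powers. Multiplication becomes concatenation of the words at matching
  vertices.\<close>

definition el :: "(nat \<Rightarrow> ('v, 'a) qpath set circ_arrow list) \<Rightarrow> (nat, ('v, 'a) qpath set circ_arrow) qpath \<Rightarrow> complex" where
  "el w = (\<Oplus>\<^bsub>circ.PA\<^esub>i\<in>R. single (i, w i))"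

lemma el_closed: "(\<And>i. i \<in> R \<Longrightarrow> circ.awalk i (w i) (s i)) \<Longrightarrow> el w \<in> carrier circ.PA"
  unfolding el_def by (rule circ.PA.finsum_closed) (use circ.mem_pathsI in fast)

lemma el_cong: "(\<And>i. i \<in> R \<Longrightarrow> circ.awalk i (w i) (s i)) \<Longrightarrow> (\<And>i. i \<in> R \<Longrightarrow> w i = w' i) \<Longrightarrow> el w = el w'"
proof -
  assume w: "\<And>i. i \<in> R \<Longrightarrow> circ.awalk i (w i) (s i)" and eq: "\<And>i. i \<in> R \<Longrightarrow> w i = w' i"
  show ?thesis unfolding el_def
  proof (rule circ.PA.finsum_cong' [OF refl])
    show "(\<lambda>i. single (i, w' i)) \<in> R \<rightarrow> carrier circ.PA"
      using circ.mem_pathsI [OF w] eq by (intro funcsetI circ.single_closed) simp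
  qed (simp add: eq)
qed

lemma single_mult_el:
  assumes w: "\<And>i. i \<in> R \<Longrightarrow> circ.awalk i (w i) (s i)" and p: "circ.awalk u p j"
  shows "single (u, p) \<otimes>\<^bsub>circ.PA\<^esub> el w = single (u, p @ w j)"
proof -
  have j: "j \<in> R" using circ.awalk_last_in_verts [OF p] by simp
  have P: "(i, w i) \<in> paths (circ_quiver Q n b)" if "i \<in> R" for i by (rule circ.mem_pathsI [OF w [OF that]])
  have U: "(u, p) \<in> paths (circ_quiver Q n b)" "(u, p @ w j) \<in> paths (circ_quiver Q n b)"
    using circ.mem_pathsI [OF p] circ.mem_pathsI [OF circ.awalk_appendI [OF p w [OF j]]] by simp_all
  have "single (u, p) \<otimes>\<^bsub>circ.PA\<^esub> el w = (\<Oplus>\<^bsub>circ.PA\<^esub>i\<in>R. single (u, p) \<otimes>\<^bsub>circ.PA\<^esub> single (i, w i))"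
    unfolding el_def by (rule circ.PA.finsum_rdistr) (use P U in auto)
  also have "\<dots> = (\<Oplus>\<^bsub>circ.PA\<^esub>i\<in>R. if j = i then single (u, p @ w j) else \<zero>\<^bsub>circ.PA\<^esub>)"
  proof (rule circ.PA.finsum_cong' [OF refl])
    show "(\<lambda>i. if j = i then single (u, p @ w j) else \<zero>\<^bsub>circ.PA\<^esub>) \<in> R \<rightarrow> carrier circ.PA" using circ.single_closed [OF U(2)] circ.PA.zero_closed by (intro funcsetI) metis
    fix i
    have "circ.awlast u p = j" using p by simp
    then show "single (u, p) \<otimes>\<^bsub>circ.PA\<^esub> single (i, w i) = (if j = i then single (u, p @ w j) else \<zero>\<^bsub>circ.PA\<^esub>)"
      unfolding circ.single_mult_single path_algebra_simps(1) by auto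
  qed
  also have "\<dots> = single (u, p @ w j)" by (rule circ.PA.finsum_singleton [OF j]) (use U in auto)
  finally show ?thesis .
qed

lemma el_mult:
  assumes w: "\<And>i. i \<in> R \<Longrightarrow> circ.awalk i (w i) (s i)" and w': "\<And>i. i \<in> R \<Longrightarrow> circ.awalk i (w' i) (s' i)"
  shows "el w \<otimes>\<^bsub>circ.PA\<^esub> el w' = el (\<lambda>i. w i @ w' (s i))"
proof -
  have P: "(i, w i) \<in> paths (circ_quiver Q n b)" if "i \<in> R" for i by (rule circ.mem_pathsI [OF w [OF that]])
  have "el w \<otimes>\<^bsub>circ.PA\<^esub> el w' = (\<Oplus>\<^bsub>circ.PA\<^esub>i\<in>R. single (i, w i) \<otimes>\<^bsub>circ.PA\<^esub> el w')"
    unfolding el_def [of w] by (rule circ.PA.finsum_ldistr) (use P el_closed [OF w'] in auto)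
  also have "\<dots> = el (\<lambda>i. w i @ w' (s i))" unfolding el_def [of "\<lambda>i. w i @ w' (s i)"]
  proof (rule circ.PA.finsum_cong' [OF refl])
    fix i assume i: "i \<in> R"
    show "single (i, w i) \<otimes>\<^bsub>circ.PA\<^esub> el w' = single (i, w i @ w' (s i))"
      by (rule single_mult_el [OF w' w [OF i]])
  next
    have "single (i, w i @ w' (s i)) \<in> carrier circ.PA" if i: "i \<in> R" for i
    proof (rule circ.single_closed, rule circ.mem_pathsI, rule circ.awalk_appendI [OF w [OF i]])
      show "circ.awalk (s i) (w' (s i)) (s' (s i))" using w' circ.awalk_last_in_verts [OF w [OF i]] by simp
    qed
    then show "(\<lambda>i. single (i, w i @ w' (s i))) \<in> R \<rightarrow> carrier circ.PA" by simp
  qed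
  finally show ?thesis .
qed

lemma el_one: "\<one>\<^bsub>circ.PA\<^esub> = el (\<lambda>_. [])"
proof
  fix p :: "(nat, ('v, 'a) qpath set circ_arrow) qpath"
  have "el (\<lambda>_. []) p = (\<Sum>i\<in>R. single (i, []) p)"
    unfolding el_def using circ.mem_pathsI [OF circ_Nil_walk] by (intro circ.finsum_apply) auto
  also have "\<dots> = (\<Sum>i\<in>R. if i = fst p then (if snd p = [] then 1 else 0) else 0)"
    by (rule sum.cong [OF refl]) (auto simp: single_def prod_eq_iff)
  also have "\<dots> = (if fst p \<in> R then (if snd p = [] then 1 else 0) else 0)"
    by (rule sum.delta) simp
  finally show "\<one>\<^bsub>circ.PA\<^esub> p = el (\<lambda>_. []) p" by (simp add: path_algebra_simps(2))
qed

lemma el_minus: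
  assumes w: "\<And>i. i \<in> R \<Longrightarrow> circ.awalk i (w i) (s i)" and w': "\<And>i. i \<in> R \<Longrightarrow> circ.awalk i (w' i) (s' i)"
  shows "el w \<ominus>\<^bsub>circ.PA\<^esub> el w' = circ.diff_sum R (\<lambda>i. (i, w i)) (\<lambda>i. (i, w' i))"
proof
  fix r
  have P: "(i, w i) \<in> paths (circ_quiver Q n b)" "(i, w' i) \<in> paths (circ_quiver Q n b)" if "i \<in> R" for i
    using circ.mem_pathsI [OF w [OF that]] circ.mem_pathsI [OF w' [OF that]] by simp_all
  have "(el w \<ominus>\<^bsub>circ.PA\<^esub> el w') r = (\<Sum>i\<in>R. single (i, w i) r) - (\<Sum>i\<in>R. single (i, w' i) r)"
  proof -
    have "el w r = (\<Sum>i\<in>R. single (i, w i) r)" "el w' r = (\<Sum>i\<in>R. single (i, w' i) r)"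
      unfolding el_def by (rule circ.finsum_apply; simp add: P)+
    moreover have "el w' \<in> carrier circ.PA" by (rule el_closed) (rule w')
    ultimately show ?thesis by (simp add: circ.PA_minus)
  qed
  also have "\<dots> = (\<Sum>i\<in>R. (single (i, w i) \<ominus>\<^bsub>circ.PA\<^esub> single (i, w' i)) r)"
    unfolding sum_subtractf [symmetric] by (rule sum.cong [OF refl]) (simp add: P circ.PA_minus)
  also have "\<dots> = circ.diff_sum R (\<lambda>i. (i, w i)) (\<lambda>i. (i, w' i)) r"
    unfolding circ.diff_sum_def by (rule circ.finsum_apply [symmetric]) (simp_all add: P)
  finally show "(el w \<ominus>\<^bsub>circ.PA\<^esub> el w') r = circ.diff_sum R (\<lambda>i. (i, w i)) (\<lambda>i. (i, w' i)) r" .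
qed

lemma circ_x_eq: "circ_x Q n b = el (x_run 1)"
  by (simp add: circ_x_def el_def)

lemma circ_y_eq: "circ_y Q n b = el (y_run 1)"
proof -
  have inj: "inj_on (\<lambda>i. nx i) R" by (rule inj_on_inverseI [where g = "\<lambda>i. pv i"]) (rule pv_nx)
  have img: "(\<lambda>i. nx i) ` R = R"
  proof
    show "(\<lambda>i. nx i) ` R \<subseteq> R" using nx_range by blast
    show "R \<subseteq> (\<lambda>i. nx i) ` R"
    proof
      fix i assume "i \<in> R"
      then show "i \<in> (\<lambda>i. nx i) ` R" using nx_pv pv_range by (intro image_eqI [where x = "pv i"]) simp_all
    qed
  qed
  have P: "(i, [Y_arrow (pv i)]) \<in> paths (circ_quiver Q n b)" if "i \<in> R" for i
    by (rule circ.mem_pathsI [OF Y_walk [OF that]])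
  have "el (y_run 1) = (\<Oplus>\<^bsub>circ.PA\<^esub>i\<in>(\<lambda>i. nx i) ` R. single (i, [Y_arrow (pv i)]))"
    unfolding img el_def by simp
  also have "\<dots> = (\<Oplus>\<^bsub>circ.PA\<^esub>i\<in>R. single (nx i, [Y_arrow (pv (nx i))]))"
    by (rule circ.PA.finsum_reindex [OF _ inj]) (unfold img, use P in simp)
  also have "\<dots> = circ_y Q n b" unfolding circ_y_def
  proof (rule circ.PA.finsum_cong' [OF refl])
    show "(\<lambda>i. single (nx i, [Y_arrow i])) \<in> R \<rightarrow> carrier circ.PA"
      using circ.mem_pathsI [OF circ_arrow_walks(2)] by simp
  qed (simp add: pv_nx)
  finally show ?thesis by simp
qed

lemma x_power: "circ_x Q n b [^]\<^bsub>circ.PA\<^esub> (m :: nat) = el (x_run m)"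
proof (induction m)
  case 0 show ?case using el_one by simp
next
  case (Suc m)
  have "circ_x Q n b [^]\<^bsub>circ.PA\<^esub> Suc m = el (x_run m) \<otimes>\<^bsub>circ.PA\<^esub> el (x_run 1)" using Suc.IH by (simp add: circ_x_eq)
  also have "\<dots> = el (\<lambda>i. x_run m i @ x_run 1 (cyc n (int i + int m)))"
    by (rule el_mult [OF x_run_walk x_run_walk])
  also have "\<dots> = el (x_run (Suc m))" using x_run_add [of _ m 1] x_run_walk [of _ "Suc m"]
    by (intro el_cong [symmetric, where s = "\<lambda>i. cyc n (int i + int (Suc m))"]) simp_all
  finally show ?case .
qed

lemma y_power: "circ_y Q n b [^]\<^bsub>circ.PA\<^esub> (m :: nat) = el (y_run m)"
proof (induction m)
  case 0 show ?case using el_one by simp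
next
  case (Suc m)
  have "circ_y Q n b [^]\<^bsub>circ.PA\<^esub> Suc m = el (y_run m) \<otimes>\<^bsub>circ.PA\<^esub> el (y_run 1)" using Suc.IH by (simp add: circ_y_eq)
  also have "\<dots> = el (\<lambda>i. y_run m i @ y_run 1 (cyc n (int i - int m)))"
    by (rule el_mult [OF y_run_walk y_run_walk])
  also have "\<dots> = el (y_run (Suc m))" using y_run_add [of _ m 1] y_run_walk [of _ "Suc m"]
    by (intro el_cong [symmetric, where s = "\<lambda>i. cyc n (int i - int (Suc m))"]) simp_all
  finally show ?case .
qed

lemma xy_eq: "circ_x Q n b \<otimes>\<^bsub>circ.PA\<^esub> circ_y Q n b = el (e_run 1)"
proof -
  have "circ_x Q n b \<otimes>\<^bsub>circ.PA\<^esub> circ_y Q n b = el (\<lambda>i. x_run 1 i @ y_run 1 (cyc n (int i + int 1)))"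
    unfolding circ_x_eq circ_y_eq by (rule el_mult [OF x_run_walk y_run_walk])
  also have "\<dots> = el (e_run 1)"
    by (rule el_cong [symmetric, where s = "\<lambda>i. i", OF e_run_walk]) (simp_all add: pv_nx)
  finally show ?thesis .
qed

lemma yx_eq: "circ_y Q n b \<otimes>\<^bsub>circ.PA\<^esub> circ_x Q n b = el (\<lambda>i. [Y_arrow (pv i), X_arrow (pv i)])"
proof -
  have "circ_y Q n b \<otimes>\<^bsub>circ.PA\<^esub> circ_x Q n b = el (\<lambda>i. y_run 1 i @ x_run 1 (cyc n (int i - int 1)))"
    unfolding circ_x_eq circ_y_eq by (rule el_mult [OF y_run_walk x_run_walk])
  then show ?thesis by simp
qed

lemma xy_power: "(circ_x Q n b \<otimes>\<^bsub>circ.PA\<^esub> circ_y Q n b) [^]\<^bsub>circ.PA\<^esub> (m :: nat) = el (e_run m)"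
proof (induction m)
  case 0 show ?case using el_one by simp
next
  case (Suc m)
  have "(circ_x Q n b \<otimes>\<^bsub>circ.PA\<^esub> circ_y Q n b) [^]\<^bsub>circ.PA\<^esub> Suc m = el (e_run m) \<otimes>\<^bsub>circ.PA\<^esub> el (e_run 1)"
    using Suc.IH by (simp only: xy_eq circ.PA.nat_pow_Suc)
  also have "\<dots> = el (\<lambda>i. e_run m i @ e_run 1 i)" by (rule el_mult [OF e_run_walk e_run_walk])
  also have "(\<lambda>i. e_run m i @ e_run 1 i) = e_run (Suc m)" using e_run_add [of m 1] by (simp add: fun_eq_iff)
  finally show ?case .
qed

abbreviation "reach P \<equiv> reach_y Q n b (representative P)"
abbreviation "rel P \<equiv> nat (Y_number Q n b \<alpha> (representative P))"
abbreviation "k \<equiv> card (noninversions n \<pi>)"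

lemma reach_end:
  assumes P: "P \<in> NBP Q n b"
  shows "cyc n (int (src P) - int (reach P)) = tgt P"
proof -
  have "int (reach P) = (int (src P) - int (tgt P)) mod int n" unfolding reach_y_def using n_pos by simp
  then have "int (src P) - int (reach P) - int (tgt P) = (int (src P) - int (tgt P)) - (int (src P) - int (tgt P)) mod int n"
    by simp
  then have "int n dvd int (src P) - int (reach P) - int (tgt P)" using dvd_minus_mod [of "int n" "int (src P) - int (tgt P)"] by (simp only:)
  then have "cyc n (int (src P) - int (reach P)) = cyc n (int (tgt P))" using cyc_eq_iff [OF n_pos] by simp
  then show ?thesis using cyc_id NBP_props(2) [OF P] by simp
qed

lemma reach_walk: "P \<in> NBP Q n b \<Longrightarrow> circ.awalk (src P) (y_run (reach P) (src P)) (tgt P)"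
  using y_run_walk [OF NBP_props(1), of P "reach P"] reach_end by simp

lemma P_e_walk: "P \<in> NBP Q n b \<Longrightarrow> circ.awalk (src P) ([P_arrow P] @ e_run m (tgt P)) (tgt P)"
  by (rule circ.awalk_appendI [OF circ_arrow_walks(3) e_run_walk [OF NBP_props(2)]])

abbreviation "rel_xy \<equiv> circ.diff_sum R (\<lambda>i. (i, e_run 1 i)) (\<lambda>i. (i, [Y_arrow (pv i), X_arrow (pv i)]))"
abbreviation "rel_k \<equiv> circ.diff_sum R (\<lambda>i. (i, x_run k i)) (\<lambda>i. (i, y_run (n - k) i))"
abbreviation "rel_P \<equiv> circ.diff_sum (NBP Q n b) (\<lambda>P. (src P, y_run (reach P) (src P)))
  (\<lambda>P. (src P, [P_arrow P] @ e_run (rel P) (tgt P)))"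

lemma YX_walk: "i \<in> R \<Longrightarrow> circ.awalk i [Y_arrow (pv i), X_arrow (pv i)] i"
  using circ.awalk_appendI [OF Y_walk circ_arrow_walks(1) [OF pv_range]] nx_pv by fastforce

text \<open>The three generators are brought into the form of sums of differences of parallel paths,
  from which the individual relations can be extracted.\<close>

lemma circ_ideal_eq:
  "circ_ideal Q n b \<alpha> k = cancellative_closure (circ_quiver Q n b) (Idl\<^bsub>circ.PA\<^esub> {rel_xy, rel_k, rel_P})"
proof -
  have 1: "circ_x Q n b \<otimes>\<^bsub>circ.PA\<^esub> circ_y Q n b \<ominus>\<^bsub>circ.PA\<^esub> circ_y Q n b \<otimes>\<^bsub>circ.PA\<^esub> circ_x Q n b = rel_xy"
    unfolding xy_eq yx_eq by (rule el_minus [OF e_run_walk YX_walk])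
  have 2: "circ_x Q n b [^]\<^bsub>circ.PA\<^esub> k \<ominus>\<^bsub>circ.PA\<^esub> circ_y Q n b [^]\<^bsub>circ.PA\<^esub> (n - k) = rel_k"
    unfolding x_power y_power by (rule el_minus [OF x_run_walk y_run_walk])
  have 3: "(\<Oplus>\<^bsub>circ.PA\<^esub>P\<in>NBP Q n b. (let p = representative P in single (circ_y_reach Q n b p) \<ominus>\<^bsub>circ.PA\<^esub>
      single (t_label n b p, [P_arrow P]) \<otimes>\<^bsub>circ.PA\<^esub> ((circ_x Q n b \<otimes>\<^bsub>circ.PA\<^esub> circ_y Q n b) [^]\<^bsub>circ.PA\<^esub> rel P))) = rel_P"
    unfolding circ.diff_sum_def Let_def
  proof (rule circ.PA.finsum_cong' [OF refl])
    fix P assume P: "P \<in> NBP Q n b"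
    have "single (src P, [P_arrow P]) \<otimes>\<^bsub>circ.PA\<^esub> el (e_run (rel P)) = single (src P, [P_arrow P] @ e_run (rel P) (tgt P))"
      by (rule single_mult_el [OF e_run_walk circ_arrow_walks(3) [OF P]])
    moreover have "circ_y_reach Q n b (representative P) = (src P, y_run (reach P) (src P))"
      unfolding circ_y_reach_def
      using descending_y_run [of "\<lambda>a. [a]" "\<lambda>i. [Y_arrow i]", OF refl NBP_props(1) [OF P]] by simp
    ultimately show "single (circ_y_reach Q n b (representative P)) \<ominus>\<^bsub>circ.PA\<^esub> single (src P, [P_arrow P]) \<otimes>\<^bsub>circ.PA\<^esub>
        ((circ_x Q n b \<otimes>\<^bsub>circ.PA\<^esub> circ_y Q n b) [^]\<^bsub>circ.PA\<^esub> rel P) =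
      single (src P, y_run (reach P) (src P)) \<ominus>\<^bsub>circ.PA\<^esub> single (src P, [P_arrow P] @ e_run (rel P) (tgt P))"
      unfolding xy_power by simp
  next
    show "(\<lambda>P. single (src P, y_run (reach P) (src P)) \<ominus>\<^bsub>circ.PA\<^esub> single (src P, [P_arrow P] @ e_run (rel P) (tgt P)))
      \<in> NBP Q n b \<rightarrow> carrier circ.PA"
      by (intro funcsetI circ.PA.minus_closed circ.single_closed circ.mem_pathsI [OF reach_walk] circ.mem_pathsI [OF P_e_walk])
  qed
  show ?thesis unfolding circ_ideal_def Let_def 1 2 unfolding 3 [unfolded Let_def] ..
qed

section \<open>The weights satisfy the relations\<close>

abbreviation "wt q \<equiv> circ_map.H.weight q"

lemmas wt_expand = circ_weight_expand

lemma IH_cong_iff: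
  assumes "circ.awalk i p j" "circ.awalk i q j"
  shows "circ.cong_mod circ_map.IH (i, p) (i, q) \<longleftrightarrow> wt p = wt q"
proof -
  have "circ.awlast i p = j" "circ.awlast i q = j" using assms by simp_all
  then show ?thesis
    unfolding circ.cong_mod_def
    using circ_map.H.single_diff_label_ideal [OF circ.mem_pathsI [OF assms(1)] circ.mem_pathsI [OF assms(2)]]
    by (simp add: circ_map.H.wlabel_def)
qed

lemma wt_XY: "i \<in> R \<Longrightarrow> wt [X_arrow i] + wt [Y_arrow i] = 1"
  using W_xy [OF b_1] by (simp add: wt_expand)

lemma wt_e_run: "i \<in> R \<Longrightarrow> wt (e_run m i) = m"
proof (induction m)
  case (Suc m)
  have "wt (e_run (Suc m) i) = wt [X_arrow i] + wt [Y_arrow i] + wt (e_run m i)"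
    by (simp add: add.assoc)
  then show ?case using Suc wt_XY [OF Suc.prems] by simp
qed simp

lemma yx_run_Suc:
  assumes i: "i \<in> R"
  shows "y_run (Suc m) i @ x_run (Suc m) (cyc n (int i - int (Suc m))) =
    [Y_arrow (pv i)] @ (y_run m (pv i) @ x_run m (cyc n (int (pv i) - int m))) @ [X_arrow (pv i)]"
proof -
  define c where "c = cyc n (int i - int (Suc m))"
  have c: "c \<in> R" unfolding c_def using cyc_range n_pos by blast
  have "cyc n (int (pv i) - int m) = c"
    unfolding c_def using cyc_cyc_minus [OF n_pos, of "int i - 1" "int m"] by (simp add: algebra_simps)
  moreover have "cyc n (int c + int m) = pv i"
    unfolding c_def using cyc_cyc [OF n_pos, of "int i - int (Suc m)" "int m"] by (simp add: algebra_simps)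
  ultimately show ?thesis
    unfolding c_def [symmetric] using x_run_add [OF c, of m 1] by simp
qed

lemma wt_yx_run: "i \<in> R \<Longrightarrow> wt (y_run m i @ x_run m (cyc n (int i - int m))) = m"
proof (induction m arbitrary: i)
  case 0 show ?case by simp
next
  case (Suc m)
  have "wt [Y_arrow (pv i)] + wt (y_run m (pv i) @ x_run m (cyc n (int (pv i) - int m))) + wt [X_arrow (pv i)] = Suc m"
    using Suc.IH [OF pv_range [of i]] wt_XY [OF pv_range [of i]] by linarith
  then show ?case unfolding yx_run_Suc [OF Suc.prems] circ_map.H.weight_simps(3) by simp
qed

lemma k_le: "k \<le> n"
proof -
  have "noninversions n \<pi> \<subseteq> R" by (auto simp: noninversions_def)
  then show ?thesis using card_mono [of R "noninversions n \<pi>"] by simp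
qed

lemma cyc_add_n: "cyc n (j + int n) = cyc n j"
  using cyc_eq_iff [OF n_pos] by simp

lemma wt_x_run_from_1: "m \<le> n \<Longrightarrow> wt (x_run m 1) = (\<Sum>j\<in>{1..m}. wt [X_arrow j])"
proof (induction m)
  case 0 show ?case by simp
next
  case (Suc m)
  have "cyc n (int 1 + int m) = Suc m" using cyc_id [of "Suc m" n] Suc.prems by (simp add: algebra_simps)
  then have "x_run (Suc m) 1 = x_run m 1 @ [X_arrow (Suc m)]"
    using x_run_add [of 1 m 1] n_pos by simp
  then have "wt (x_run (Suc m) 1) = wt (x_run m 1) + wt [X_arrow (Suc m)]" by (simp only: circ_map.H.weight_simps(3))
  then show ?case using Suc by simp
qed

text \<open>A full turn from 1 uses each \<open>X_arrow\<close> once; the weights of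
  \<open>x\<^sub>j\<close> and \<open>y\<^sub>j\<close> add up to 1, so \<open>sum_W_y\<close>
  leaves \<open>n - k\<close>. Moving the start by one step moves the first arrow to the end of the
  word.\<close>

lemma wt_x_run_full: "i \<in> R \<Longrightarrow> wt (x_run n i) = n - k"
proof (induction i rule: nat_induct)
  case 0 then show ?case by simp
next
  case (Suc i)
  show ?case
  proof (cases "i = 0")
    case True
    have "(\<Sum>j\<in>R. wt [X_arrow j]) + (\<Sum>j\<in>R. wt [Y_arrow j]) = (\<Sum>j\<in>R. 1)"
      unfolding sum.distrib [symmetric] by (rule sum.cong [OF refl wt_XY])
    moreover have "(\<Sum>j\<in>R. wt [Y_arrow j]) = k" using sum_W_y by (simp add: wt_expand)
    ultimately show ?thesis using wt_x_run_from_1 [OF order_refl] True by simp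
  next
    case False
    then have i: "i \<in> R" and nx: "nx i = Suc i" using Suc.prems cyc_Suc by simp_all
    have "x_run (Suc n) i = x_run n i @ [X_arrow i]"
      using x_run_add [OF i, of n 1] cyc_add_n [of "int i"] cyc_id [OF i] by simp
    then have "wt ([X_arrow i] @ x_run n (nx i)) = wt (x_run n i @ [X_arrow i])" by simp
    then show ?thesis using Suc.IH [OF i] unfolding circ_map.H.weight_simps(3) nx by simp
  qed
qed

lemma k_end: "cyc n (int i - int (n - k)) = cyc n (int i + int k)"
  using cyc_eq_iff [OF n_pos] k_le by (simp add: of_nat_diff)

text \<open>Both sides are completed by the same \<open>n - k\<close> steps of \<open>x\<close>: the
  left one to a full turn, the right one to a run there and back. Both results have weight
  \<open>n - k\<close>.\<close>

lemma wt_rel_k: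
  assumes i: "i \<in> R"
  shows "wt (x_run k i) = wt (y_run (n - k) i)"
proof -
  have "x_run n i = x_run k i @ x_run (n - k) (cyc n (int i + int k))"
    using x_run_add [OF i, of k "n - k"] k_le by simp
  then have "wt (x_run k i) + wt (x_run (n - k) (cyc n (int i + int k))) = n - k"
    using wt_x_run_full [OF i] by simp
  then show ?thesis using wt_yx_run [OF i, of "n - k"] unfolding k_end by simp
qed

lemma W_pw: "v \<in> V \<Longrightarrow> W (b 1) (pw v m) = m"
  using loop_weight [OF b_1 pw_awalk] cval_pw [of v "[]" v m] cval_Nil by (simp add: W_def awalk_Nil_iff)

text \<open>The \<open>y\<close>-path is equivalent to the minimal path \<open>word P\<close>
  followed by as many face paths as its c-value. This c-value is the relation number, because the
  arrow-defining path itself has c-value 0.\<close>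

lemma wt_rel_P:
  assumes P: "P \<in> NBP Q n b"
  shows "wt (y_run (reach P) (src P)) = wt ([P_arrow P] @ e_run (rel P) (tgt P))"
proof -
  note p = NBP_props [OF P]
  let ?u = "b (src P)" and ?v = "b (tgt P)"
  define q where "q = expand (y_run (reach P) (src P))"
  have q: "awalk ?u q ?v" unfolding q_def by (rule circ_map.pmap_walk [OF reach_walk [OF P]])
  have v: "?v \<in> V" using b_V p(2) by simp
  have "descending n (y_arrows Q \<alpha>) (int (src P) - 1) (reach P) = q"
    unfolding q_def by (rule descending_y_run [OF _ p(1)]) simp
  moreover have "path_start (representative P) = ?u" unfolding path_start_def by (subst p(5)) simp
  moreover have "c_value Q (representative P) = 0" using c_value_eq [OF p(3)] p(4,5) by simp
  ultimately have r: "rel P = cval ?u ?v q" using c_value_eq [OF q] by (simp add: Y_number_def)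
  have pe: "awalk ?u (word P @ pw ?v (rel P)) ?v" by (rule awalk_appendI [OF p(3) pw_awalk [OF v]])
  have "cval ?u ?v (word P @ pw ?v (rel P)) = rel P" using cval_pw [OF p(3)] p(4) by simp
  then have "feq q (word P @ pw ?v (rel P))" using cval_eq_iff [OF q pe] r by simp
  then have "W (b 1) q = W (b 1) (word P @ pw ?v (rel P))" using feq_iff_weight [OF b_1 q pe] by (simp add: W_def)
  then have "wt (y_run (reach P) (src P)) = W (b 1) (word P) + rel P"
    unfolding wt_expand q_def W_append W_pw [OF v] .
  then show ?thesis using wt_e_run [OF p(2)] by (simp add: circ_weight_def)
qed

abbreviation "CI \<equiv> circ_ideal Q n b \<alpha> k"

lemma generators_IH: "{rel_xy, rel_k, rel_P} \<subseteq> circ_map.IH"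
proof -
  note mem = circ.diff_sum_mem [OF circ_map.H.label_ideal_ideal]
  have "rel_xy \<in> circ_map.IH"
  proof (rule mem)
    fix i assume i: "i \<in> R"
    show "circ.cong_mod circ_map.IH (i, e_run 1 i) (i, [Y_arrow (pv i), X_arrow (pv i)])"
      unfolding IH_cong_iff [OF e_run_walk [OF i] YX_walk [OF i]] wt_e_run [OF i]
      using wt_XY [OF pv_range [of i]] by simp
  qed simp
  moreover have "rel_k \<in> circ_map.IH"
  proof (rule mem)
    fix i assume i: "i \<in> R"
    have "circ.awalk i (y_run (n - k) i) (cyc n (int i + int k))" using y_run_walk [OF i, of "n - k"] unfolding k_end .
    then show "circ.cong_mod circ_map.IH (i, x_run k i) (i, y_run (n - k) i)"
      using IH_cong_iff [OF x_run_walk [OF i]] wt_rel_k [OF i] by blast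
  qed simp
  moreover have "rel_P \<in> circ_map.IH"
  proof (rule mem [OF NBP_finite])
    fix P assume P: "P \<in> NBP Q n b"
    show "circ.cong_mod circ_map.IH (src P, y_run (reach P) (src P)) (src P, [P_arrow P] @ e_run (rel P) (tgt P))"
      unfolding IH_cong_iff [OF reach_walk [OF P] P_e_walk [OF P]] by (rule wt_rel_P [OF P])
  qed
  ultimately show ?thesis by simp
qed

text \<open>The weight ideal is cancellative and contains the generators, so it is one of the ideals
  intersected. This gives the upper bound for \<open>CI\<close> and also that \<open>CI\<close> is a
  cancellative ideal.\<close>

lemma CI_props:
  "cancellative_ideal (circ_quiver Q n b) CI" "CI \<subseteq> circ_map.IH" "{rel_xy, rel_k, rel_P} \<subseteq> CI"
proof -
  have sub: "Idl\<^bsub>circ.PA\<^esub> {rel_xy, rel_k, rel_P} \<subseteq> circ_map.IH"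
    by (rule circ.PA.genideal_minimal [OF circ_map.H.label_ideal_ideal generators_IH])
  show "cancellative_ideal (circ_quiver Q n b) CI"
    unfolding circ_ideal_eq
    by (rule circ.cancellative_closure_cancellative [OF circ_map.H.label_ideal_cancellative sub])
  show "CI \<subseteq> circ_map.IH"
    unfolding circ_ideal_eq cancellative_closure_def using circ_map.H.label_ideal_cancellative sub by blast
  have "{rel_xy, rel_k, rel_P} \<subseteq> carrier circ.PA"
    using generators_IH circ_map.IH.a_subset by blast
  then have "{rel_xy, rel_k, rel_P} \<subseteq> Idl\<^bsub>circ.PA\<^esub> {rel_xy, rel_k, rel_P}" by (rule circ.PA.genideal_self)
  then show "{rel_xy, rel_k, rel_P} \<subseteq> CI" unfolding circ_ideal_eq cancellative_closure_def by blast
qed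

lemmas CI_ideal = circ.cancellative_ideal_ideal [OF CI_props(1)]

text \<open>Congruence modulo \<open>CI\<close> with both walks and their common ends carried along,
  so that calculations chain without side conditions.\<close>

definition cg :: "nat \<Rightarrow> nat \<Rightarrow> ('v, 'a) qpath set circ_arrow list \<Rightarrow> ('v, 'a) qpath set circ_arrow list \<Rightarrow> bool" where
  "cg i j p q \<longleftrightarrow> circ.awalk i p j \<and> circ.awalk i q j \<and> circ.cong_mod CI (i, p) (i, q)"

lemma cgI: "circ.awalk i p j \<Longrightarrow> circ.awalk i q j \<Longrightarrow> circ.cong_mod CI (i, p) (i, q) \<Longrightarrow> cg i j p q"
  by (simp add: cg_def)

lemma cg_walks: "cg i j p q \<Longrightarrow> circ.awalk i p j" "cg i j p q \<Longrightarrow> circ.awalk i q j"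
  by (simp_all add: cg_def)

lemma cg_refl: "circ.awalk i p j \<Longrightarrow> cg i j p p"
  unfolding cg_def using circ.cong_mod_refl [OF CI_ideal circ.mem_pathsI] by simp

lemma cg_sym: "cg i j p q \<Longrightarrow> cg i j q p"
  unfolding cg_def using circ.cong_mod_sym [OF CI_ideal circ.mem_pathsI circ.mem_pathsI] by blast

lemma cg_trans [trans]: "cg i j p q \<Longrightarrow> cg i j q r \<Longrightarrow> cg i j p r"
  unfolding cg_def using circ.cong_mod_trans [OF CI_ideal circ.mem_pathsI circ.mem_pathsI circ.mem_pathsI] by blast

lemma cg_append:
  assumes pq: "cg i j p p'" "cg j l q q'"
  shows "cg i l (p @ q) (p' @ q')"
proof -
  note w = cg_walks [OF pq(1)] cg_walks [OF pq(2)]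
  have ij: "circ.awalk i [] i" "circ.awalk l [] l"
    using circ.awalk_hd_in_verts [OF w(1)] circ.awalk_last_in_verts [OF w(3)] by (simp_all add: circ.awalk_Nil_iff)
  have "circ.cong_mod CI (i, [] @ p @ q) (i, [] @ p' @ q)"
    by (rule circ.cong_mod_context [OF CI_ideal w(1,2) ij(1) w(3)]) (use pq(1) in \<open>simp add: cg_def\<close>)
  then have 1: "cg i l (p @ q) (p' @ q)"
    using circ.awalk_appendI [OF w(1,3)] circ.awalk_appendI [OF w(2,3)] by (simp add: cg_def)
  have "circ.cong_mod CI (i, p' @ q @ []) (i, p' @ q' @ [])"
    by (rule circ.cong_mod_context [OF CI_ideal w(3,4) w(2) ij(2)]) (use pq(2) in \<open>simp add: cg_def\<close>)
  then have 2: "cg i l (p' @ q) (p' @ q')"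
    using circ.awalk_appendI [OF w(2,3)] circ.awalk_appendI [OF w(2,4)] by (simp add: cg_def)
  show ?thesis by (rule cg_trans [OF 1 2])
qed

lemma cg_cancel:
  assumes "cg i l (p @ d) (q @ d)" "circ.awalk i p j" "circ.awalk i q j" "circ.awalk j d l"
  shows "cg i j p q"
  using circ.cancellative_right [OF CI_props(1) assms(2-4)] assms unfolding cg_def by blast

lemma cg_wt: "cg i j p q \<Longrightarrow> wt p = wt q"
  using CI_props(2) IH_cong_iff [of i p j q] unfolding cg_def circ.cong_mod_def by blast

end

section \<open>Normal forms modulo the relations\<close>

context numbered_dimer
begin

lemma cg_xy:
  assumes i: "i \<in> R"
  shows "cg i i (e_run 1 i) [Y_arrow (pv i), X_arrow (pv i)]"
proof (rule cgI [OF e_run_walk [OF i] YX_walk [OF i]])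
  show "circ.cong_mod CI (i, e_run 1 i) (i, [Y_arrow (pv i), X_arrow (pv i)])"
  proof (rule circ.diff_sum_memD [OF CI_ideal finite_atLeastAtMost, where s = "\<lambda>i. i" and t = "\<lambda>i. i"])
    show "circ.awalk i (e_run 1 i) i \<and> circ.awalk i [Y_arrow (pv i), X_arrow (pv i)] i" if "i \<in> R" for i
      by (intro conjI e_run_walk YX_walk that)
    show "rel_xy \<in> CI" using CI_props(3) by simp
  qed (simp add: inj_on_def, rule i)
qed

lemma cg_k:
  assumes i: "i \<in> R"
  shows "cg i (cyc n (int i + int k)) (x_run k i) (y_run (n - k) i)"
proof (rule cgI [OF x_run_walk [OF i] y_run_walk [OF i, of "n - k", unfolded k_end]])
  show "circ.cong_mod CI (i, x_run k i) (i, y_run (n - k) i)"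
  proof (rule circ.diff_sum_memD [OF CI_ideal finite_atLeastAtMost, where s = "\<lambda>i. i" and t = "\<lambda>i. cyc n (int i + int k)"])
    show "circ.awalk i (x_run k i) (cyc n (int i + int k)) \<and> circ.awalk i (y_run (n - k) i) (cyc n (int i + int k))" if "i \<in> R" for i
      using x_run_walk [OF that, of k] y_run_walk [OF that, of "n - k"] unfolding k_end by simp
    show "rel_k \<in> CI" using CI_props(3) by simp
  qed (simp add: inj_on_def, rule i)
qed

lemma cg_P:
  assumes P: "P \<in> NBP Q n b"
  shows "cg (src P) (tgt P) (y_run (reach P) (src P)) ([P_arrow P] @ e_run (rel P) (tgt P))"
proof (rule cgI [OF reach_walk [OF P] P_e_walk [OF P]])
  show "circ.cong_mod CI (src P, y_run (reach P) (src P)) (src P, [P_arrow P] @ e_run (rel P) (tgt P))"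
  proof (rule circ.diff_sum_memD [OF CI_ideal NBP_finite, where s = "\<lambda>P. src P" and t = "\<lambda>P. tgt P"])
    show "circ.awalk (src P) (y_run (reach P) (src P)) (tgt P) \<and> circ.awalk (src P) ([P_arrow P] @ e_run (rel P) (tgt P)) (tgt P)"
      if "P \<in> NBP Q n b" for P by (intro conjI reach_walk P_e_walk that)
    show "rel_P \<in> CI" using CI_props(3) by simp
  qed (rule NBP_inj, rule P)
qed

lemma e_comm_append:
  assumes p: "cg i j (e_run 1 i @ p) (p @ e_run 1 j)" "circ.awalk i p j"
    and q: "cg j l (e_run 1 j @ q) (q @ e_run 1 l)" "circ.awalk j q l"
  shows "cg i l (e_run 1 i @ p @ q) ((p @ q) @ e_run 1 l)"
proof -
  have "cg i l (e_run 1 i @ p @ q) (p @ e_run 1 j @ q)"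
    using cg_append [OF p(1) cg_refl [OF q(2)]] by simp
  also have "cg i l \<dots> ((p @ q) @ e_run 1 l)"
    using cg_append [OF cg_refl [OF p(2)] q(1)] by simp
  finally show ?thesis .
qed

lemma e_comm_power:
  assumes p: "cg i j (e_run 1 i @ p) (p @ e_run 1 j)" "circ.awalk i p j"
  shows "cg i j (e_run m i @ p) (p @ e_run m j)"
proof (induction m)
  case 0 show ?case using cg_refl [OF p(2)] by simp
next
  case (Suc m)
  have ij: "i \<in> R" "j \<in> R" using circ.awalk_hd_in_verts [OF p(2)] circ.awalk_last_in_verts [OF p(2)] by simp_all
  have e: "e_run (Suc m) h = e_run 1 h @ e_run m h" for h by simp
  have "cg i j (e_run (Suc m) i @ p) (e_run 1 i @ p @ e_run m j)"
    using cg_append [OF cg_refl [OF e_run_walk [OF ij(1), of 1]] Suc.IH] unfolding e by (simp only: append_assoc)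
  also have "cg i j \<dots> (p @ e_run (Suc m) j)"
    using cg_append [OF p(1) cg_refl [OF e_run_walk [OF ij(2), of m]]] unfolding e by (simp only: append_assoc)
  finally show ?case .
qed

lemma e_comm_X:
  assumes i: "i \<in> R"
  shows "cg i (nx i) (e_run 1 i @ [X_arrow i]) ([X_arrow i] @ e_run 1 (nx i))"
proof -
  have "cg (nx i) (nx i) [Y_arrow i, X_arrow i] (e_run 1 (nx i))"
    using cg_sym [OF cg_xy [OF nx_range, of i]] pv_nx [OF i] by simp
  then show ?thesis using cg_append [OF cg_refl [OF circ_arrow_walks(1) [OF i]]] by fastforce
qed

lemma e_comm_Y:
  assumes i: "i \<in> R"
  shows "cg i (pv i) (e_run 1 i @ [Y_arrow (pv i)]) ([Y_arrow (pv i)] @ e_run 1 (pv i))"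
  using cg_append [OF cg_xy [OF i] cg_refl [OF Y_walk [OF i]]] by simp

lemma e_comm_Nil: "i \<in> R \<Longrightarrow> cg i i (e_run 1 i @ []) ([] @ e_run 1 i)"
  using cg_refl [OF e_run_walk [of i 1]] by simp

lemma e_comm_y_run:
  "i \<in> R \<Longrightarrow> cg i (cyc n (int i - int m)) (e_run 1 i @ y_run m i) (y_run m i @ e_run 1 (cyc n (int i - int m)))"
proof (induction m arbitrary: i)
  case 0 then show ?case using e_comm_Nil cyc_id by simp
next
  case (Suc m)
  have c: "cyc n (int (pv i) - int m) = cyc n (int i - int (Suc m))"
    using cyc_cyc_minus [OF n_pos, of "int i - 1" "int m"] by (simp add: algebra_simps)
  show ?case
    using e_comm_append [OF e_comm_Y [OF Suc.prems] Y_walk [OF Suc.prems] Suc.IH [OF pv_range] y_run_walk [OF pv_range]]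
    unfolding c by simp
qed

text \<open>Commutation with \<open>xy\<close> is known for runs of \<open>y\<close>, hence by the
  relation of \<open>P\<close> for \<open>P_arrow P\<close> followed by a power of
  \<open>xy\<close>. This power commutes with \<open>xy\<close> and is cancelled on the
  right.\<close>

lemma e_comm_P:
  assumes P: "P \<in> NBP Q n b"
  shows "cg (src P) (tgt P) (e_run 1 (src P) @ [P_arrow P]) ([P_arrow P] @ e_run 1 (tgt P))"
proof (rule cg_cancel)
  note s = NBP_props(1) [OF P] and t = NBP_props(2) [OF P]
  note e = e_run_walk [OF s, of 1] e_run_walk [OF t, of 1]
  have e_comm: "e_run 1 j @ e_run m j = e_run m j @ e_run 1 j" for m j
    using e_run_add [of 1 m j] e_run_add [of m 1 j] by (simp only: add.commute)
  have "cg (src P) (tgt P) (e_run 1 (src P) @ ([P_arrow P] @ e_run (rel P) (tgt P))) (e_run 1 (src P) @ y_run (reach P) (src P))"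
    by (rule cg_append [OF cg_refl [OF e(1)] cg_sym [OF cg_P [OF P]]])
  also have "cg (src P) (tgt P) \<dots> (y_run (reach P) (src P) @ e_run 1 (tgt P))"
    using e_comm_y_run [OF s, of "reach P"] unfolding reach_end [OF P] .
  also have "cg (src P) (tgt P) \<dots> (([P_arrow P] @ e_run (rel P) (tgt P)) @ e_run 1 (tgt P))"
    by (rule cg_append [OF cg_P [OF P] cg_refl [OF e(2)]])
  finally show "cg (src P) (tgt P) ((e_run 1 (src P) @ [P_arrow P]) @ e_run (rel P) (tgt P))
      (([P_arrow P] @ e_run 1 (tgt P)) @ e_run (rel P) (tgt P))"
    by (simp only: append_assoc e_comm)
  show "circ.awalk (src P) (e_run 1 (src P) @ [P_arrow P]) (tgt P)"
    by (rule circ.awalk_appendI [OF e(1) circ_arrow_walks(3) [OF P]])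
  show "circ.awalk (src P) ([P_arrow P] @ e_run 1 (tgt P)) (tgt P)" by (rule P_e_walk [OF P])
  show "circ.awalk (tgt P) (e_run (rel P) (tgt P)) (tgt P)" by (rule e_run_walk [OF t])
qed

lemma walk_induct [consumes 1, case_names Nil X Y P append]:
  assumes "circ.awalk i p j"
    and "\<And>i. i \<in> R \<Longrightarrow> K i [] i"
    and "\<And>i. i \<in> R \<Longrightarrow> K i [X_arrow i] (nx i)"
    and "\<And>i. i \<in> R \<Longrightarrow> K i [Y_arrow (pv i)] (pv i)"
    and "\<And>P. P \<in> NBP Q n b \<Longrightarrow> K (src P) [P_arrow P] (tgt P)"
    and app: "\<And>i p j q l. circ.awalk i p j \<Longrightarrow> circ.awalk j q l \<Longrightarrow> K i p j \<Longrightarrow> K j q l \<Longrightarrow> K i (p @ q) l"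
  shows "K i p j"
  using assms(1)
proof (induction p arbitrary: i)
  case Nil then show ?case using assms(2) by (simp add: circ.awalk_Nil_iff)
next
  case (Cons e p)
  let ?h = "head (circ_quiver Q n b) e"
  have e: "e \<in> arcs (circ_quiver Q n b)" "i = tail (circ_quiver Q n b) e" and p: "circ.awalk ?h p j"
    using Cons.prems by (simp_all add: circ.awalk_Cons_iff)
  have "K i [e] ?h" using e(1)
  proof (cases rule: circ_arc_cases)
    case (2 m)
    then show ?thesis using assms(4) [OF nx_range, of m] pv_nx [of m] e(2) by simp
  qed (use assms(3,5) e(2) in simp_all)
  moreover have "circ.awalk i [e] ?h" using circ.arc_implies_awalk [OF e(1)] e(2) by simp
  ultimately show ?case using app [of i "[e]" ?h p j] p Cons.IH [OF p] by simp
qed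

lemma e_comm: "circ.awalk i p j \<Longrightarrow> cg i j (e_run m i @ p) (p @ e_run m j)"
proof (rule e_comm_power)
  show "cg i j (e_run 1 i @ p) (p @ e_run 1 j)" if "circ.awalk i p j"
    using that
    by (induction rule: walk_induct)
      (use e_comm_Nil e_comm_X e_comm_Y e_comm_P e_comm_append in blast)+
qed

text \<open>By induction the inner word is a power of \<open>xy\<close>, which commutes with the
  outer arrow \<open>y\<close>; what remains is one more \<open>yx = xy\<close>.\<close>

lemma cg_yx_run: "i \<in> R \<Longrightarrow> cg i i (y_run m i @ x_run m (cyc n (int i - int m))) (e_run m i)"
proof (induction m arbitrary: i)
  case 0 then show ?case using cg_refl [OF circ_Nil_walk] by simp
next
  case (Suc m)
  note X = circ_arrow_walks(1) [OF pv_range [of i], unfolded nx_pv [OF Suc.prems]]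
  note Y = Y_walk [OF Suc.prems]
  have "cg i i (y_run (Suc m) i @ x_run (Suc m) (cyc n (int i - int (Suc m)))) ([Y_arrow (pv i)] @ e_run m (pv i) @ [X_arrow (pv i)])"
    unfolding yx_run_Suc [OF Suc.prems]
    by (rule cg_append [OF cg_refl [OF Y] cg_append [OF Suc.IH [OF pv_range] cg_refl [OF X]]])
  also have "cg i i \<dots> (e_run m i @ [Y_arrow (pv i), X_arrow (pv i)])"
    using cg_append [OF cg_sym [OF e_comm [OF Y, of m]] cg_refl [OF X]] by simp
  also have "cg i i \<dots> (e_run m i @ e_run 1 i)"
    by (rule cg_append [OF cg_refl [OF e_run_walk [OF Suc.prems]] cg_sym [OF cg_xy [OF Suc.prems]]])
  also have "e_run m i @ e_run 1 i = e_run (Suc m) i" using e_run_add [of m 1 i] by simp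
  finally show ?case .
qed

text \<open>\<open>x^n = x^k x^(n-k) = y^(n-k) x^(n-k) = (xy)^(n-k)\<close>, by \<open>cg_k\<close>
  and \<open>cg_yx_run\<close>.\<close>

lemma cg_x_full:
  assumes i: "i \<in> R"
  shows "cg i i (x_run n i) (e_run (n - k) i)"
proof -
  define c where "c = cyc n (int i + int k)"
  have c: "c \<in> R" unfolding c_def using cyc_range n_pos by blast
  have "cyc n (int c + int (n - k)) = i"
    unfolding c_def using cyc_cyc [OF n_pos, of "int i + int k" "int (n - k)"] cyc_add_n [of "int i"] cyc_id [OF i] k_le
    by (simp add: of_nat_diff)
  then have x: "circ.awalk c (x_run (n - k) c) i" using x_run_walk [OF c, of "n - k"] by simp
  have "x_run n i = x_run k i @ x_run (n - k) c"
    using x_run_add [OF i, of k "n - k"] k_le unfolding c_def by simp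
  also have "cg i i \<dots> (y_run (n - k) i @ x_run (n - k) c)"
    by (rule cg_append [OF cg_k [OF i, folded c_def] cg_refl [OF x]])
  also have "cg i i \<dots> (e_run (n - k) i)"
    using cg_yx_run [OF i, of "n - k"] unfolding k_end c_def .
  finally show ?thesis .
qed

lemma cg_x_run_add:
  assumes i: "i \<in> R" and j: "cyc n (int i + int a) = j"
  shows "cg i j (x_run (a + n * t) i) (x_run a i @ e_run ((n - k) * t) j)"
proof (induction t)
  case 0 show ?case using cg_refl [OF x_run_walk [OF i, of a]] j by simp
next
  case (Suc t)
  have jR: "j \<in> R" using j cyc_range n_pos by blast
  have "cyc n (int i + int (a + n * t)) = j"
    using cyc_eq_iff [OF n_pos, of "int i + int (a + n * t)" "int i + int a"] j by simp
  then have "x_run (a + n * Suc t) i = x_run (a + n * t) i @ x_run n j"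
    using x_run_add [OF i, of "a + n * t" n] by (simp add: algebra_simps)
  also have "cg i j \<dots> ((x_run a i @ e_run ((n - k) * t) j) @ e_run (n - k) j)"
    by (rule cg_append [OF Suc.IH cg_x_full [OF jR]])
  also have "\<dots> = x_run a i @ e_run ((n - k) * Suc t) j"
    using e_run_add [of "(n - k) * t" "n - k" j] by (simp add: add.commute)
  finally show ?case .
qed

text \<open>The arrows \<open>y\<close> and the new arrows need not be products of \<open>x\<close>
  and \<open>xy\<close>, but become so after multiplication by a power of \<open>xy\<close>. The
  property is closed under composition because \<open>xy\<close> is central, and the extra power is
  cancelled at the end.\<close>

definition normalises :: "nat \<Rightarrow> ('v, 'a) qpath set circ_arrow list \<Rightarrow> nat \<Rightarrow> bool" where
  "normalises i p j \<longleftrightarrow> (\<exists>a r s. cyc n (int i + int a) = j \<and> cg i j (p @ e_run r j) (x_run a i @ e_run s j))"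

lemma normalisesI:
  "cyc n (int i + int a) = j \<Longrightarrow> cg i j (p @ e_run r j) (x_run a i @ e_run s j) \<Longrightarrow> normalises i p j"
  unfolding normalises_def by blast

lemma e_run_commute: "e_run m j @ e_run l j = e_run l j @ e_run m j"
  using e_run_add [of m l j] e_run_add [of l m j] by (simp only: add.commute)

lemma normalises_append:
  assumes p: "circ.awalk i p j" "normalises i p j" and q: "circ.awalk j q l" "normalises j q l"
  shows "normalises i (p @ q) l"
proof -
  obtain a r s where a: "cyc n (int i + int a) = j" "cg i j (p @ e_run r j) (x_run a i @ e_run s j)"
    using p(2) unfolding normalises_def by blast
  obtain a' r' s' where a': "cyc n (int j + int a') = l" "cg j l (q @ e_run r' l) (x_run a' j @ e_run s' l)"
    using q(2) unfolding normalises_def by blast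
  have R: "i \<in> R" "j \<in> R" "l \<in> R"
    using circ.awalk_hd_in_verts [OF p(1)] circ.awalk_last_in_verts [OF p(1)] circ.awalk_last_in_verts [OF q(1)] by simp_all
  have x: "circ.awalk i (x_run a i) j" "circ.awalk j (x_run a' j) l"
    using x_run_walk [OF R(1), of a] x_run_walk [OF R(2), of a'] a(1) a'(1) by simp_all
  show ?thesis
  proof (rule normalisesI)
    show "cyc n (int i + int (a + a')) = l" using a(1) a'(1) cyc_cyc [OF n_pos, of "int i + int a" "int a'"] by (simp add: algebra_simps)
    have "cg i l (p @ (q @ e_run r l) @ e_run r' l) (p @ (e_run r j @ q) @ e_run r' l)"
      by (rule cg_append [OF cg_refl [OF p(1)] cg_append [OF cg_sym [OF e_comm [OF q(1)]] cg_refl [OF e_run_walk [OF R(3)]]]])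
    also have "p @ (e_run r j @ q) @ e_run r' l = (p @ e_run r j) @ (q @ e_run r' l)" by simp
    also have "cg i l \<dots> ((x_run a i @ e_run s j) @ (x_run a' j @ e_run s' l))"
      by (rule cg_append [OF a(2) a'(2)])
    also have "(x_run a i @ e_run s j) @ (x_run a' j @ e_run s' l) = x_run a i @ (e_run s j @ x_run a' j) @ e_run s' l" by simp
    also have "cg i l \<dots> (x_run a i @ (x_run a' j @ e_run s l) @ e_run s' l)"
      by (rule cg_append [OF cg_refl [OF x(1)] cg_append [OF e_comm [OF x(2)] cg_refl [OF e_run_walk [OF R(3)]]]])
    also have "\<dots> = x_run (a + a') i @ e_run (s + s') l"
      using x_run_add [OF R(1), of a a'] a(1) by (simp add: e_run_add)
    also have "p @ (q @ e_run r l) @ e_run r' l = (p @ q) @ e_run (r + r') l" by (simp add: e_run_add)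
    finally show "cg i l ((p @ q) @ e_run (r + r') l) (x_run (a + a') i @ e_run (s + s') l)" .
  qed
qed

lemma normalises_Nil: "i \<in> R \<Longrightarrow> normalises i [] i"
  by (rule normalisesI [where a = 0 and r = 0 and s = 0]) (simp_all add: cyc_id cg_refl circ_Nil_walk)

lemma normalises_X: "i \<in> R \<Longrightarrow> normalises i [X_arrow i] (nx i)"
  by (rule normalisesI [where a = 1 and r = 0 and s = 0]) (simp_all add: cg_refl circ_arrow_walks)

text \<open>\<open>y (xy)^(n-k) = y x^n = (xy) x^(n-1)\<close>, since a full turn of
  \<open>x\<close> is a power of \<open>xy\<close>.\<close>

lemma normalises_Y:
  assumes i: "i \<in> R"
  shows "normalises i [Y_arrow (pv i)] (pv i)"
proof (rule normalisesI)
  have end_eq: "cyc n (int i + int (n - 1)) = pv i"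
    using n_pos cyc_add_n [of "int i - 1"] by (simp add: of_nat_diff algebra_simps)
  show "cyc n (int i + int (n - 1)) = pv i" by (rule end_eq)
  have "circ.awalk i (x_run (n - 1) i) (pv i)" using x_run_walk [OF i, of "n - 1"] unfolding end_eq .
  note x = this
  have "cg i (pv i) ([Y_arrow (pv i)] @ e_run (n - k) (pv i)) ([Y_arrow (pv i)] @ x_run n (pv i))"
    by (rule cg_append [OF cg_refl [OF Y_walk [OF i]] cg_sym [OF cg_x_full [OF pv_range]]])
  also have "x_run n (pv i) = [X_arrow (pv i)] @ x_run (n - 1) i"
    using x_run.simps(2) [of "n - 1" "pv i"] n_pos nx_pv [OF i] by simp
  also have "[Y_arrow (pv i)] @ [X_arrow (pv i)] @ x_run (n - 1) i = [Y_arrow (pv i), X_arrow (pv i)] @ x_run (n - 1) i" by simp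
  also have "cg i (pv i) \<dots> (e_run 1 i @ x_run (n - 1) i)"
    by (rule cg_append [OF cg_sym [OF cg_xy [OF i]] cg_refl [OF x]])
  also have "cg i (pv i) \<dots> (x_run (n - 1) i @ e_run 1 (pv i))" by (rule e_comm [OF x])
  finally show "cg i (pv i) ([Y_arrow (pv i)] @ e_run (n - k) (pv i)) (x_run (n - 1) i @ e_run 1 (pv i))" .
qed

lemma normalises_y_run: "i \<in> R \<Longrightarrow> normalises i (y_run m i) (cyc n (int i - int m))"
proof (induction m arbitrary: i)
  case 0 then show ?case using normalises_Nil cyc_id by simp
next
  case (Suc m)
  have c: "cyc n (int (pv i) - int m) = cyc n (int i - int (Suc m))"
    using cyc_cyc_minus [OF n_pos, of "int i - 1" "int m"] by (simp add: algebra_simps)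
  show ?case
    using normalises_append [OF Y_walk [OF Suc.prems] normalises_Y [OF Suc.prems] y_run_walk [OF pv_range] Suc.IH [OF pv_range]]
    unfolding c by simp
qed

lemma normalises_P:
  assumes P: "P \<in> NBP Q n b"
  shows "normalises (src P) [P_arrow P] (tgt P)"
proof -
  obtain a r s where a: "cyc n (int (src P) + int a) = tgt P"
    "cg (src P) (tgt P) (y_run (reach P) (src P) @ e_run r (tgt P)) (x_run a (src P) @ e_run s (tgt P))"
    using normalises_y_run [OF NBP_props(1) [OF P], of "reach P"] unfolding normalises_def reach_end [OF P] by blast
  have "[P_arrow P] @ e_run (rel P + r) (tgt P) = ([P_arrow P] @ e_run (rel P) (tgt P)) @ e_run r (tgt P)"
    by (simp add: e_run_add)
  also have "cg (src P) (tgt P) \<dots> (y_run (reach P) (src P) @ e_run r (tgt P))"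
    by (rule cg_append [OF cg_sym [OF cg_P [OF P]] cg_refl [OF e_run_walk [OF NBP_props(2) [OF P]]]])
  finally show ?thesis using cg_trans [OF _ a(2)] normalisesI [OF a(1)] by blast
qed

lemma normalises_walk: "circ.awalk i p j \<Longrightarrow> normalises i p j"
  by (induction rule: walk_induct) (use normalises_Nil normalises_X normalises_Y normalises_P normalises_append in blast)+

text \<open>Full turns are traded for powers of \<open>xy\<close> by \<open>cg_x_run_add\<close>, so
  the remaining exponent of \<open>x\<close> depends only on \<open>i\<close> and \<open>j\<close>
  and is shared by parallel walks.\<close>

lemma normal_form:
  assumes p: "circ.awalk i p j"
  obtains r s where "cg i j (p @ e_run r j) (x_run (nat ((int j - int i) mod int n)) i @ e_run s j)"
proof -
  have R: "i \<in> R" "j \<in> R" using circ.awalk_hd_in_verts [OF p] circ.awalk_last_in_verts [OF p] by simp_all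
  obtain a r s where a: "cyc n (int i + int a) = j" "cg i j (p @ e_run r j) (x_run a i @ e_run s j)"
    using normalises_walk [OF p] unfolding normalises_def by blast
  have "cyc n (int i + int a) = cyc n (int j)" using a(1) cyc_id [OF R(2)] by simp
  then have "int n dvd (int a - (int j - int i))" using cyc_eq_iff [OF n_pos] by (simp add: algebra_simps)
  then have m: "int a mod int n = (int j - int i) mod int n" using mod_eq_dvd_iff by blast
  have d: "nat ((int j - int i) mod int n) = a mod n" using m [symmetric] by (simp add: zmod_int [symmetric])
  have "cyc n (int i + int (a mod n)) = j"
    using a(1) cyc_eq_iff [OF n_pos, of "int i + int (a mod n)" "int i + int a"]
    by (simp add: zmod_int mod_eq_dvd_iff [symmetric])
  note red = cg_x_run_add [OF R(1) this, of "a div n"]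
  have "cg i j (x_run a i) (x_run (a mod n) i @ e_run ((n - k) * (a div n)) j)" using red by simp
  then have "cg i j (x_run a i @ e_run s j) ((x_run (a mod n) i @ e_run ((n - k) * (a div n)) j) @ e_run s j)"
    by (rule cg_append [OF _ cg_refl [OF e_run_walk [OF R(2)]]])
  then have "cg i j (p @ e_run r j) (x_run (a mod n) i @ e_run ((n - k) * (a div n) + s) j)"
    using cg_trans [OF a(2)] by (simp add: e_run_add)
  then show thesis using that unfolding d by blast
qed

text \<open>Multiplying each walk by the powers of \<open>xy\<close> from both normal forms,
  crosswise, makes the right sides agree. Equality of weights forces the two multipliers to be
  equal, and they are cancelled.\<close>

lemma equal_weight_cg:
  assumes p: "circ.awalk i p j" and q: "circ.awalk i q j" and w: "wt p = wt q"
  shows "cg i j p q"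
proof -
  define x where "x = x_run (nat ((int j - int i) mod int n)) i"
  have j: "j \<in> R" using circ.awalk_last_in_verts [OF p] by simp
  note e = cg_refl [OF e_run_walk [OF j]]
  obtain r s where 1: "cg i j (p @ e_run r j) (x @ e_run s j)" using normal_form [OF p] unfolding x_def by blast
  obtain r' s' where 2: "cg i j (q @ e_run r' j) (x @ e_run s' j)" using normal_form [OF q] unfolding x_def by blast
  have "cg i j ((p @ e_run r j) @ e_run s' j) ((x @ e_run s j) @ e_run s' j)" by (rule cg_append [OF 1 e])
  also have "(x @ e_run s j) @ e_run s' j = (x @ e_run s' j) @ e_run s j" using e_run_commute [of s j s'] by simp
  also have "cg i j \<dots> ((q @ e_run r' j) @ e_run s j)" by (rule cg_append [OF cg_sym [OF 2] e])
  finally have 3: "cg i j (p @ e_run (r + s') j) (q @ e_run (r' + s) j)" by (simp add: e_run_add)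
  have "r + s' = r' + s" using cg_wt [OF 3] w wt_e_run [OF j] by simp
  then show ?thesis using cg_cancel [OF _ p q e_run_walk [OF j]] 3 by simp
qed

lemma circ_ideal_weight: "CI = circ_map.IH"
proof
  show "CI \<subseteq> circ_map.IH" by (rule CI_props(2))
  show "circ_map.IH \<subseteq> CI"
  proof (rule circ_map.H.label_ideal_subset [OF CI_ideal])
    fix p q assume P: "p \<in> paths (circ_quiver Q n b)" "q \<in> paths (circ_quiver Q n b)"
      and l: "circ_map.H.wlabel p = circ_map.H.wlabel q"
    obtain i as where p: "p = (i, as)" by (cases p)
    obtain i' bs where q: "q = (i', bs)" by (cases q)
    have i: "i' = i" and w: "wt as = wt bs" and e: "circ.awlast i' bs = circ.awlast i as"
      using l unfolding p q circ_map.H.wlabel_def prod.inject fst_conv snd_conv by (elim conjE, simp only:)+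
    have "circ.awalk i as (circ.awlast i as)" using P(1) unfolding p by (simp add: circ.mem_paths_iff)
    moreover have "circ.awalk i bs (circ.awlast i as)" using P(2) unfolding q circ.mem_paths_iff e unfolding i .
    ultimately have "cg i (circ.awlast i as) as bs" using w by (rule equal_weight_cg)
    then show "single p \<ominus>\<^bsub>circ.PA\<^esub> single q \<in> CI" unfolding p q i cg_def circ.cong_mod_def by simp
  qed
qed

theorem boundary_algebra_isomorphic:
  "algebra_isomorphic (boundary_algebra Q) (circ_algebra Q n b \<alpha> (card (noninversions n \<pi>)))"
proof -
  have "circ_map.corner_unit = (\<Oplus>\<^bsub>PA\<^esub>v\<in>boundary_verts Q. single (v, []))"
    unfolding circ_map.corner_unit_def using b_bij by (simp add: bij_betw_def)
  then have "boundary_algebra Q = circ_map.corner"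
    unfolding boundary_algebra_def dimer_algebra_def dimer_class_def dimer_ideal_weight [OF b_1] by simp
  then show ?thesis
    using circ_map.corner_isomorphic unfolding circ_algebra_def circ_ideal_weight by simp
qed

end

section \<open>The case without boundary vertices\<close>

lemma algebra_isomorphic_singletons:
  assumes "carrier M = {u}" "carrier N = {v}" "v \<otimes>\<^bsub>N\<^esub> v = v" "v \<oplus>\<^bsub>N\<^esub> v = v" "\<one>\<^bsub>N\<^esub> = v"
    "\<And>c. c \<odot>\<^bsub>N\<^esub> v = v"
  shows "algebra_isomorphic M N"
  unfolding algebra_isomorphic_def
proof (intro bexI allI ballI)
  show "(\<lambda>_. v) \<in> ring_iso M N"
    using assms(1-5) unfolding ring_iso_def ring_hom_def bij_betw_def by auto
qed (simp add: assms)

context dimer_model_in_disk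
begin

text \<open>The degenerate case \<open>n = 0\<close>: the corner at an empty sum of idempotents is zero, and so is the
  path algebra of a quiver without vertices.\<close>

lemma no_boundary_isomorphic:
  assumes bd: "boundary_arrows Q = {}"
  shows "algebra_isomorphic (boundary_algebra Q) (circ_algebra Q 0 b \<alpha> k)"
proof -
  interpret I: ideal "dimer_ideal Q" PA by (rule dimer_ideal_ideal)
  interpret QI: ring "PA Quot dimer_ideal Q" by (rule I.quotient_is_ring)
  have bv: "boundary_verts Q = {}" using bd by (simp add: boundary_verts_def)
  then have NBP: "NBP Q 0 b = {}" by (auto simp: NBP_def arrow_defining_def direct_path_def)
  let ?H = "circ_quiver Q 0 b"
  have H: "verts ?H = {}" "arcs ?H = {}" by (simp_all add: circ_quiver_def NBP)
  interpret H: fin_digraph ?H by unfold_locales (simp_all add: H)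
  \<comment> \<open>The label ideal of this zero weight provides a cancellative ideal containing the
    generators, so that the closure is an ideal.\<close>
  interpret W: weighted_quiver ?H "\<lambda>_. 0" ..
  have nopath: "paths ?H = {}" using H by (auto simp: paths_def H.awalk_def)
  have zero: "carrier H.PA = {\<zero>\<^bsub>H.PA\<^esub>}"
    using nopath unfolding path_algebra_def by (auto simp: fun_eq_iff)
  define J where "J = circ_ideal Q 0 b \<alpha> k"
  have "ideal J H.PA"
    unfolding J_def circ_ideal_def Let_def
  proof (intro H.cancellative_ideal_ideal H.cancellative_closure_cancellative [OF W.label_ideal_cancellative]
      H.PA.genideal_minimal [OF W.label_ideal_ideal])
    have "circ_x Q 0 b = \<zero>\<^bsub>H.PA\<^esub>" "circ_y Q 0 b = \<zero>\<^bsub>H.PA\<^esub>" by (simp_all add: circ_x_def circ_y_def)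
    moreover have "\<zero>\<^bsub>H.PA\<^esub> \<in> W.label_ideal"
      using additive_subgroup.zero_closed [OF ideal.axioms(1) [OF W.label_ideal_ideal]] .
    ultimately show "{circ_x Q 0 b \<otimes>\<^bsub>H.PA\<^esub> circ_y Q 0 b \<ominus>\<^bsub>H.PA\<^esub> circ_y Q 0 b \<otimes>\<^bsub>H.PA\<^esub> circ_x Q 0 b,
        circ_x Q 0 b [^]\<^bsub>H.PA\<^esub> k \<ominus>\<^bsub>H.PA\<^esub> circ_y Q 0 b [^]\<^bsub>H.PA\<^esub> (0 - k),
        \<Oplus>\<^bsub>H.PA\<^esub>P\<in>NBP Q 0 b. single (circ_y_reach Q 0 b (representative P)) \<ominus>\<^bsub>H.PA\<^esub>
          single (t_label 0 b (representative P), [P_arrow P]) \<otimes>\<^bsub>H.PA\<^esub>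
          ((circ_x Q 0 b \<otimes>\<^bsub>H.PA\<^esub> circ_y Q 0 b) [^]\<^bsub>H.PA\<^esub> nat (Y_number Q 0 b \<alpha> (representative P)))} \<subseteq> W.label_ideal"
    proof -
      have "z \<in> W.label_ideal" if "z \<in> carrier H.PA" for z
        using that \<open>\<zero>\<^bsub>H.PA\<^esub> \<in> W.label_ideal\<close> zero by simp
      then show ?thesis using \<open>circ_x Q 0 b = \<zero>\<^bsub>H.PA\<^esub>\<close> \<open>circ_y Q 0 b = \<zero>\<^bsub>H.PA\<^esub>\<close> by (simp add: NBP)
    qed
  qed
  then interpret J: ideal J H.PA .
  interpret QJ: ring "H.PA Quot J" by (rule J.quotient_is_ring)
  have J0: "\<zero>\<^bsub>H.PA Quot J\<^esub> = J +>\<^bsub>H.PA\<^esub> \<zero>\<^bsub>H.PA\<^esub>"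
    using J.a_rcos_const [OF J.zero_closed] by (simp add: FactRing_def)
  have cJ: "carrier (H.PA Quot J) = {\<zero>\<^bsub>H.PA Quot J\<^esub>}"
    unfolding J0 by (auto simp: FactRing_def A_RCOSETS_def' zero)
  show ?thesis
  proof (rule algebra_isomorphic_singletons)
    have e: "dimer_class Q (\<Oplus>\<^bsub>PA\<^esub>v\<in>boundary_verts Q. single (v, [])) = \<zero>\<^bsub>PA Quot dimer_ideal Q\<^esub>"
      using I.a_rcos_const [OF I.zero_closed] by (simp add: bv dimer_class_def FactRing_def)
    have "{\<zero>\<^bsub>PA Quot dimer_ideal Q\<^esub> \<otimes>\<^bsub>PA Quot dimer_ideal Q\<^esub> x \<otimes>\<^bsub>PA Quot dimer_ideal Q\<^esub> \<zero>\<^bsub>PA Quot dimer_ideal Q\<^esub> | x.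
        x \<in> carrier (PA Quot dimer_ideal Q)} = {\<zero>\<^bsub>PA Quot dimer_ideal Q\<^esub>}"
      using QI.zero_closed QI.l_null QI.r_null by (intro equalityI subsetI) (elim CollectE exE conjE, simp, blast)
    then show "carrier (boundary_algebra Q) = {\<zero>\<^bsub>PA Quot dimer_ideal Q\<^esub>}"
      unfolding boundary_algebra_def e unfolding dimer_algebra_def corner_algebra_def quot_algebra_def by simp
    show "carrier (circ_algebra Q 0 b \<alpha> k) = {\<zero>\<^bsub>H.PA Quot J\<^esub>}"
      using cJ by (simp add: circ_algebra_def quot_algebra_def J_def)
    show "\<one>\<^bsub>circ_algebra Q 0 b \<alpha> k\<^esub> = \<zero>\<^bsub>H.PA Quot J\<^esub>"
      using cJ QJ.one_closed by (simp add: circ_algebra_def quot_algebra_def J_def)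
    show "c \<odot>\<^bsub>circ_algebra Q 0 b \<alpha> k\<^esub> \<zero>\<^bsub>H.PA Quot J\<^esub> = \<zero>\<^bsub>H.PA Quot J\<^esub>" for c
    proof -
      have "c \<odot>\<^bsub>H.PA\<^esub> \<zero>\<^bsub>H.PA\<^esub> = \<zero>\<^bsub>H.PA\<^esub>" by (simp add: path_algebra_simps(1,4))
      then show ?thesis
        using H.quot_smult [OF J.ideal_axioms H.PA.zero_closed, of c] unfolding J0 circ_algebra_def J_def [symmetric] by simp
    qed
  qed (simp_all add: circ_algebra_def quot_algebra_def J_def [symmetric])
qed

end

theorem theorem3:
  fixes Q :: "('v, 'a) dimer" and n k :: nat
    and b :: "nat \<Rightarrow> 'v" and \<alpha> :: "nat \<Rightarrow> 'a" and \<pi> :: "nat \<Rightarrow> nat"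
  assumes "dimer_model_in_disk Q"
    and "thin Q"
    and "clockwise_numbering Q n b \<alpha>"
    and "\<pi> = strand_perm Q n \<alpha>"
    and "k = card (noninversions n \<pi>)"
  shows "algebra_isomorphic (boundary_algebra Q) (circ_algebra Q n b \<alpha> k)"
proof -
  interpret dimer_model_in_disk Q by fact
  show ?thesis
  proof (cases "n = 0")
    case True
    then have "boundary_arrows Q = {}"
      using assms(3) by (simp add: clockwise_numbering_def bij_betw_def)
    then show ?thesis using no_boundary_isomorphic True by simp
  next
    case False
    then have "boundary_arrows Q \<noteq> {}"
      using assms(3) by (auto simp: clockwise_numbering_def bij_betw_def)
    then interpret thin_dimer Q by (rule thin_dimerI [OF assms(2)])
    interpret numbered_dimer Q n b \<alpha> by unfold_locales (rule assms(3))
    show ?thesis using boundary_algebra_isomorphic unfolding assms(4,5) \<pi>_def .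
  qed
qed

end
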